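(* The linear map $\phi:\mathcal{A}^+\to\mathcal{U}(R)$ given on generating functions by $$e(-u)\mapsto L^{33}(u)^{-1}L^{23}(u),\qquad f(-u)\mapsto L^{32}(u)L^{33}(u)^{-1},$$ $$h(-u)\mapsto L^{22}(u)L^{33}(u)^{-1}+L^{32}(u)L^{33}(u)^{-1}L^{23}(u)L^{33}(u)^{-1}$$ is an isomorphism of algebras.
   Context: All algebras are associative unital $\mathbb{Z}_2$-graded algebras over $\mathbb{C}$; $[a]$ is the parity of $a$, $[a,b]=ab-ba$, $\{a,b\}=ab+ba$, and tensor products are graded: $(a\otimes\alpha)(b\otimes\beta)=(-1)^{[b][\alpha]}ab\otimes\alpha\beta$. Put $\kappa=3/2$. The superalgebra $\mathcal{A}^+$ is generated by the unit, odd elements $e_k,f_k$ and even elements $h_k$ ($k\ge0$). With $e(u)=\sum_{k\ge0}e_ku^{-k-1}$, $f(u)=\sum_{k\ge0}f_ku^{-k-1}$, $h(u)=1+\sum_{k\ge0}h_ku^{-k-1}$, its defining relations are $$[h(u),h(v)]=0,\qquad \{e(u),f(v)\}=\frac{h(v)-h(u)}{u-v},$$ $$[h(u),e(v)]=-\frac{(u-v+\kappa-1)[h(u),e(u)-e(v)]}{(u-v)(u-v+\kappa)}+\frac{h(u)(e(v)+e(u)-e_0)-(e(u)-e_0)h(u)}{u-v+\kappa},$$ $$[h(u),f(v)]=\frac{(u-v-\kappa+1)[h(u),f(u)-f(v)]}{(u-v)(u-v-\kappa)}-\frac{h(u)(f(v)+f(u)+f_0)-(f(u)+f_0)h(u)}{u-v-\kappa},$$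 $$\{e(u),e(v)\}=\frac{[e(u),e(v)]}{2(u-v)}-\frac{\{e_0,e(u)-e(v)\}}{u-v}-\frac{(e(u)-e(v))^2}{2(u-v)^2},$$ $$\{f(u),f(v)\}=-\frac{[f(u),f(v)]}{2(u-v)}-\frac{\{f_0,f(u)-f(v)\}}{u-v}-\frac{(f(u)-f(v))^2}{2(u-v)^2},$$ $$e(u)^3=e(u)\{e(u),e_0\}+[e_0^2,e(u)],\qquad f(u)^3=-f(u)\{f(u),f_0\}+[f_0^2,f(u)].$$ The superalgebra $\mathcal{U}(R)$ (the RTT presentation of the super Yangian $Y(osp(1|2))$): indices $1,2,3$ have grades $[1]=[3]=0$, $[2]=1$; $E_{ij}$ is the elementary $3\times3$ matrix, of parity $[i]+[j]$; $\mathbb{I}$ is the $3\times3$ identity. For $A=\sum A^{ij}E_{ij}$ set $A^t=\sum_{i,j,k,l}(-1)^{[i][l]+[i]}J^{ij}A^{kj}J^{lk}E_{il}$ with $J=E_{31}+E_{22}-E_{13}$. Let $P=\sum_{i,j}(-1)^{[j]}E_{ij}\otimes E_{ji}$, let $P^{t_1}$ be obtained by applying $t$ in the first factor, and let $R_{12}(u)=\mathbb{I}\otimes\mathbb{I}+\frac{P}{u}-\frac{P^{t_1}}{u+\kappa}$ (up to a scalar factor, irrelevant in the relations below). $\mathcal{U}(R)$ is generated by the unit and the elements $L^{ij}_{(n)}$ ($1\le i,j\le3$, $n\ge1$) of parity $[i]+[j]$. With $L(u)=\mathbb{I}+\sum_{i,j}\sum_{n\ge1}L^{ij}_{(n)}u^{-n}E_{ij}=\sum_{i,j}L^{ij}(u)E_{ij}$,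 the relations are $R_{12}(u-v)L_1(u)L_2(v)=L_2(v)L_1(u)R_{12}(u-v)$ and $L^t(u-\kappa)L(u)=\mathbb{I}$. Here $L_1(u)=\sum L^{ij}(u)E_{ij}\otimes\mathbb{I}$, $L_2(v)=\sum L^{ij}(v)\,\mathbb{I}\otimes E_{ij}$; the algebra entries $L^{ij}$ are multiplied in the written order and commute (without sign) with the matrices $E_{kl}$, while products in $\mathrm{End}(\mathbb{C}^3)\otimes\mathrm{End}(\mathbb{C}^3)$ use the graded tensor product. *)

theory Defs
  imports
    Complex_Main
    "HOL-Library.Poly_Mapping"
    "HOL-Computational_Algebra.Formal_Laurent_Series"
begin

unbundle fps_syntax

section \<open>Complex associative unital algebras\<close>

class complex_algebra_1 = ring_1 +
  fixes scaleC :: "complex \<Rightarrow> 'a \<Rightarrow> 'a" (infixr \<open>*\<^sub>C\<close> 75)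
  assumes scaleC_add_right: "c *\<^sub>C (x + y) = c *\<^sub>C x + c *\<^sub>C y"
    and scaleC_add_left: "(c + d) *\<^sub>C x = c *\<^sub>C x + d *\<^sub>C x"
    and scaleC_scaleC: "c *\<^sub>C d *\<^sub>C x = (c * d) *\<^sub>C x"
    and scaleC_one: "1 *\<^sub>C x = x"
    and mult_scaleC_left: "(c *\<^sub>C x) * y = c *\<^sub>C (x * y)"
    and mult_scaleC_right: "x * (c *\<^sub>C y) = c *\<^sub>C (x * y)"
begin

lemma scaleC_zero_right [simp]: "c *\<^sub>C 0 = 0"
  using scaleC_add_right[of c 0 0] by simp

lemma scaleC_zero_left [simp]: "0 *\<^sub>C x = 0"
  using scaleC_add_left[of 0 0 x] by simp

end

lemma vector_space_scaleC:
  "vector_space (scaleC :: complex \<Rightarrow> 'a \<Rightarrow> 'a :: complex_algebra_1)"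
  by unfold_locales
    (simp_all add: scaleC_add_right scaleC_add_left scaleC_scaleC scaleC_one)

instantiation complex :: complex_algebra_1
begin
definition scaleC_complex :: "complex \<Rightarrow> complex \<Rightarrow> complex" where
  "scaleC_complex c x = c * x"
instance by standard (simp_all add: scaleC_complex_def algebra_simps)
end

section \<open>Free algebras\<close>

datatype 'g word = Word (letters: "'g list")

instantiation word :: (type) monoid_add
begin
definition zero_word :: "'g word" where "zero_word = Word []"
definition plus_word :: "'g word \<Rightarrow> 'g word \<Rightarrow> 'g word" where
  "plus_word v w = Word (letters v @ letters w)"
instance by standard (simp_all add: zero_word_def plus_word_def)
end

lemma word_plus_eq_0_iff: "0 = v + w \<longleftrightarrow> v = 0 \<and> w = (0 :: 'g word)"
  by (cases v; cases w) (auto simp: zero_word_def plus_word_def)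

text \<open>
  Addition of words is concatenation, so the convolution product of
  \<^typ>\<open>'g word \<Rightarrow>\<^sub>0 complex\<close> is that of the free algebra on \<^typ>\<open>'g\<close>.
\<close>

type_synonym 'g free_algebra = "'g word \<Rightarrow>\<^sub>0 complex"

definition free_gen :: "'g \<Rightarrow> 'g free_algebra" where
  "free_gen g = Poly_Mapping.single (Word [g]) 1"

lemma single_0_central:
  fixes f :: "'w :: monoid_add \<Rightarrow>\<^sub>0 'a :: complex_algebra_1"
  shows "Poly_Mapping.single 0 (c *\<^sub>C 1) * f = f * Poly_Mapping.single 0 (c *\<^sub>C 1)"
proof (induction f rule: update_induct)
  case const
  then show ?case by simp
next
  case (update f a b)
  have "Poly_Mapping.update a b f = Poly_Mapping.single a b + f"
    using update(1)
    by (intro poly_mapping_eqI)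
      (auto simp: lookup_update lookup_add lookup_single in_keys_iff when_def)
  then show ?case
    by (simp add: update.IH distrib_left distrib_right mult_single
        mult_scaleC_left mult_scaleC_right)
qed

instantiation poly_mapping :: (monoid_add, complex_algebra_1) complex_algebra_1
begin
definition scaleC_poly_mapping :: "complex \<Rightarrow> ('a \<Rightarrow>\<^sub>0 'b) \<Rightarrow> ('a \<Rightarrow>\<^sub>0 'b)" where
  "scaleC_poly_mapping c f = Poly_Mapping.single 0 (c *\<^sub>C 1) * f"
instance
proof
  fix c d :: complex and x y :: "'a \<Rightarrow>\<^sub>0 'b"
  show "c *\<^sub>C d *\<^sub>C x = (c * d) *\<^sub>C x"
    by (simp add: scaleC_poly_mapping_def mult.assoc[symmetric] mult_single
        mult_scaleC_left scaleC_scaleC)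
  show "1 *\<^sub>C x = x"
    by (simp add: scaleC_poly_mapping_def scaleC_one)
  show "x * (c *\<^sub>C y) = c *\<^sub>C (x * y)"
    unfolding scaleC_poly_mapping_def by (metis mult.assoc single_0_central)
qed (simp_all add: scaleC_poly_mapping_def distrib_left distrib_right mult.assoc
    scaleC_add_left single_add)
end

section \<open>Superalgebras given by generators and relations\<close>

inductive_set ideal_gen :: "'a :: ring_1 set \<Rightarrow> 'a set" for S where
  zero: "0 \<in> ideal_gen S"
| base: "r \<in> S \<Longrightarrow> a * r * b \<in> ideal_gen S"
| add: "x \<in> ideal_gen S \<Longrightarrow> y \<in> ideal_gen S \<Longrightarrow> x + y \<in> ideal_gen S"

lemma ideal_gen_mult:
  "x \<in> ideal_gen S \<Longrightarrow> a * x * b \<in> ideal_gen S"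
proof (induction rule: ideal_gen.induct)
  case zero
  show ?case by (simp add: ideal_gen.zero)
next
  case (base r a' b')
  then show ?case using ideal_gen.base[of r S "a * a'" "b' * b"] by (simp add: mult.assoc)
next
  case (add x y)
  then show ?case using ideal_gen.add[OF add.IH] by (simp add: distrib_left distrib_right)
qed

lemma ideal_gen_lmult: "x \<in> ideal_gen S \<Longrightarrow> a * x \<in> ideal_gen S"
  using ideal_gen_mult[of x S a 1] by simp

lemma ideal_gen_rmult: "x \<in> ideal_gen S \<Longrightarrow> x * b \<in> ideal_gen S"
  using ideal_gen_mult[of x S 1 b] by simp

lemma ideal_gen_uminus: "x \<in> ideal_gen S \<Longrightarrow> - x \<in> ideal_gen S"
  using ideal_gen_lmult[of x S "- 1"] by simp

text \<open>
  A type \<^typ>\<open>'g\<close> of generators, some of them odd, together with a set of relators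
  in the free algebra that does not present the zero algebra (which is not a \<^class>\<open>ring_1\<close>).
\<close>

class superpresentation =
  fixes odd_gen :: "'a \<Rightarrow> bool"
    and relators :: "'a free_algebra set"
  assumes one_notin_ideal_relators: "1 \<notin> ideal_gen relators"

definition same_class ::
  "'g :: superpresentation free_algebra \<Rightarrow> 'g free_algebra \<Rightarrow> bool" where
  "same_class x y \<longleftrightarrow> x - y \<in> ideal_gen relators"

lemma equivp_same_class: "equivp same_class"
proof (rule equivpI)
  show "reflp same_class" by (simp add: reflp_def same_class_def ideal_gen.zero)
  show "symp same_class"
    unfolding symp_def same_class_def using ideal_gen_uminus by fastforce
  show "transp same_class"
    unfolding transp_def same_class_def using ideal_gen.add by fastforce
qed

quotient_type (overloaded) 'g presented_algebra =
  "'g :: superpresentation free_algebra" / same_class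
  morphisms rep_presented abs_presented
  by (rule equivp_same_class)

instantiation presented_algebra :: (superpresentation) complex_algebra_1
begin

lift_definition zero_presented_algebra :: "'a presented_algebra" is 0 .
lift_definition one_presented_algebra :: "'a presented_algebra" is 1 .
lift_definition plus_presented_algebra ::
  "'a presented_algebra \<Rightarrow> 'a presented_algebra \<Rightarrow> 'a presented_algebra" is "(+)"
  unfolding same_class_def by (metis add_diff_add ideal_gen.add)
lift_definition uminus_presented_algebra ::
  "'a presented_algebra \<Rightarrow> 'a presented_algebra" is uminus
  unfolding same_class_def by (metis ideal_gen_uminus minus_diff_minus)
lift_definition minus_presented_algebra ::
  "'a presented_algebra \<Rightarrow> 'a presented_algebra \<Rightarrow> 'a presented_algebra" is "(-)"
proof -
  fix a b c d :: "'a free_algebra"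
  assume "same_class a b" "same_class c d"
  then have "(a - b) + - (c - d) \<in> ideal_gen relators"
    unfolding same_class_def by (intro ideal_gen.add ideal_gen_uminus)
  then show "same_class (a - c) (b - d)"
    by (simp add: same_class_def algebra_simps)
qed
lift_definition times_presented_algebra ::
  "'a presented_algebra \<Rightarrow> 'a presented_algebra \<Rightarrow> 'a presented_algebra" is "(*)"
proof -
  fix a b c d :: "'a free_algebra"
  assume "same_class a b" "same_class c d"
  then have "(a - b) * c + b * (c - d) \<in> ideal_gen relators"
    unfolding same_class_def by (intro ideal_gen.add ideal_gen_lmult ideal_gen_rmult)
  then show "same_class (a * c) (b * d)"
    by (simp add: same_class_def algebra_simps)
qed
lift_definition scaleC_presented_algebra ::
  "complex \<Rightarrow> 'a presented_algebra \<Rightarrow> 'a presented_algebra" is "scaleC"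
proof -
  fix c and a b :: "'a free_algebra"
  assume "same_class a b"
  then have "Poly_Mapping.single 0 (c *\<^sub>C 1) * (a - b) \<in> ideal_gen relators"
    unfolding same_class_def by (rule ideal_gen_lmult)
  then show "same_class (c *\<^sub>C a) (c *\<^sub>C b)"
    by (simp add: same_class_def scaleC_poly_mapping_def right_diff_distrib)
qed

instance
proof
  show "(0 :: 'a presented_algebra) \<noteq> 1"
  proof (transfer, rule notI)
    assume "same_class (0 :: 'a free_algebra) 1"
    then have "- (0 - 1 :: 'a free_algebra) \<in> ideal_gen relators"
      unfolding same_class_def by (rule ideal_gen_uminus)
    then show False using one_notin_ideal_relators[where 'a = 'a] by simp
  qed
qed (transfer, simp add: same_class_def ideal_gen.zero algebra_simps
    scaleC_add_right scaleC_add_left scaleC_scaleC scaleC_one mult_scaleC_left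
    mult_scaleC_right)+

end

definition alg_gen :: "'g :: superpresentation \<Rightarrow> 'g presented_algebra" where
  "alg_gen g = abs_presented (free_gen g)"

definition odd_word :: "'g :: superpresentation word \<Rightarrow> bool" where
  "odd_word w \<longleftrightarrow> odd (length (filter odd_gen (letters w)))"

definition graded_part :: "bool \<Rightarrow> 'g :: superpresentation presented_algebra set" where
  "graded_part p = abs_presented ` {x. \<forall>w \<in> Poly_Mapping.keys x. odd_word w = p}"

definition superalgebra_hom ::
  "('a :: superpresentation presented_algebra \<Rightarrow> 'b :: superpresentation presented_algebra)
    \<Rightarrow> bool" where
  "superalgebra_hom \<phi> \<longleftrightarrow>
     Vector_Spaces.linear scaleC scaleC \<phi> \<and>
     \<phi> 1 = 1 \<and> (\<forall>x y. \<phi> (x * y) = \<phi> x * \<phi> y) \<and>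
     (\<forall>p. \<phi> ` graded_part p \<subseteq> graded_part p)"

definition superalgebra_iso ::
  "('a :: superpresentation presented_algebra \<Rightarrow> 'b :: superpresentation presented_algebra)
    \<Rightarrow> bool" where
  "superalgebra_iso \<phi> \<longleftrightarrow> superalgebra_hom \<phi> \<and> bij \<phi> \<and> superalgebra_hom (inv \<phi>)"

section \<open>Generating functions\<close>

text \<open>
  A series in \<open>u\<^sup>-\<^sup>1\<close> with coefficients in \<open>A\<close> is an element of \<^typ>\<open>'a fps\<close>.  Identities in two
  spectral parameters live in \<^typ>\<open>'a fls fls\<close>, that is in \<open>A((v\<^sup>-\<^sup>1))((u\<^sup>-\<^sup>1))\<close>: the outer variable
  is \<open>u\<^sup>-\<^sup>1\<close>, the inner one \<open>v\<^sup>-\<^sup>1\<close>.  Over the complex numbers this is a field, so the rational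
  functions of \<open>u\<close> and \<open>v\<close> occurring as coefficients make sense in it (they get expanded for
  \<open>\<bar>u\<bar> > \<bar>v\<bar>\<close>).  Since their denominators are units there, every relation below is equivalent
  to the one obtained by clearing denominators.
\<close>

definition map_fps :: "('a \<Rightarrow> 'b) \<Rightarrow> 'a fps \<Rightarrow> 'b fps" where
  "map_fps g f = Abs_fps (\<lambda>n. g (f $ n))"

definition map_fls :: "('a :: zero \<Rightarrow> 'b :: zero) \<Rightarrow> 'a fls \<Rightarrow> 'b fls" where
  "map_fls g f = Abs_fls (\<lambda>n. g (f $$ n))"

lemma map_fls_nth:
  assumes "g 0 = 0"
  shows "map_fls g f $$ n = g (f $$ n)"
  unfolding map_fls_def
  by (rule nth_Abs_fls_lower_bound[where N = "fls_subdegree f"]) (simp add: assms)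

definition at_u :: "'a :: zero fps \<Rightarrow> 'a fls fls" where
  "at_u f = map_fls fls_const (fps_to_fls f)"

definition at_v :: "'a :: zero fps \<Rightarrow> 'a fls fls" where
  "at_v f = fls_const (fps_to_fls f)"

definition const_uv :: "'a :: zero \<Rightarrow> 'a fls fls" where
  "const_uv a = fls_const (fls_const a)"

definition var_u :: "complex fls fls" where "var_u = fls_X_inv"
definition var_v :: "complex fls fls" where "var_v = fls_const fls_X_inv"

definition smult_uv ::
  "complex fls fls \<Rightarrow> 'a :: complex_algebra_1 fls fls \<Rightarrow> 'a fls fls" (infixr \<open>\<odot>\<close> 75) where
  "c \<odot> f = map_fls (map_fls (\<lambda>z. z *\<^sub>C 1)) c * f"

text \<open>The series \<open>f(-u)\<close> and \<open>f(u - c)\<close>; note that \<open>(u - c)\<^sup>-\<^sup>1 = u\<^sup>-\<^sup>1 / (1 - c u\<^sup>-\<^sup>1)\<close>.\<close>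

definition reflect_series :: "'a :: ring_1 fps \<Rightarrow> 'a fps" where
  "reflect_series f = fps_compose f (- fps_X)"

definition shift_series :: "complex \<Rightarrow> 'a :: complex_algebra_1 fps \<Rightarrow> 'a fps" where
  "shift_series c f =
     fps_compose f (map_fps (\<lambda>z. z *\<^sub>C 1) (fps_X / (1 - fps_const c * fps_X)))"

text \<open>For series with constant term 1 only, where left and right inverse agree.\<close>

abbreviation inverse_series :: "'a :: ring_1 fps \<Rightarrow> 'a fps" where
  "inverse_series f \<equiv> fps_left_inverse f 1"

definition relators_of ::
  "('g free_algebra fls fls \<times> 'g free_algebra fls fls) set \<Rightarrow> 'g free_algebra set" where
  "relators_of E = {(l $$ m) $$ n - (r $$ m) $$ n | l r m n. (l, r) \<in> E}"

definition comm :: "'a :: ring \<Rightarrow> 'a \<Rightarrow> 'a" where "comm a b = a * b - b * a"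
definition acomm :: "'a :: ring \<Rightarrow> 'a \<Rightarrow> 'a" where "acomm a b = a * b + b * a"

definition kappa :: "'a :: field_char_0" where "kappa = 3 / 2"

section \<open>The superalgebra \<open>\<A>\<^sup>+\<close>\<close>

datatype a_gen = E_gen nat | F_gen nat | H_gen nat

definition e_series :: "(a_gen \<Rightarrow> 'a) \<Rightarrow> 'a :: ring_1 fps" where
  "e_series g = Abs_fps (case_nat 0 (\<lambda>k. g (E_gen k)))"

definition f_series :: "(a_gen \<Rightarrow> 'a) \<Rightarrow> 'a :: ring_1 fps" where
  "f_series g = Abs_fps (case_nat 0 (\<lambda>k. g (F_gen k)))"

definition h_series :: "(a_gen \<Rightarrow> 'a) \<Rightarrow> 'a :: ring_1 fps" where
  "h_series g = Abs_fps (case_nat 1 (\<lambda>k. g (H_gen k)))"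

definition a_relations :: "(a_gen free_algebra fls fls \<times> a_gen free_algebra fls fls) set" where
  "a_relations =
    (let u = var_u; v = var_v;
         eu = at_u (e_series free_gen); ev = at_v (e_series free_gen);
         fu = at_u (f_series free_gen); fv = at_v (f_series free_gen);
         hu = at_u (h_series free_gen); hv = at_v (h_series free_gen);
         e0 = const_uv (free_gen (E_gen 0)); f0 = const_uv (free_gen (F_gen 0))
     in {(comm hu hv, 0),
         (acomm eu fv, (1 / (u - v)) \<odot> (hv - hu)),
         (comm hu ev,
            - (((u - v + kappa - 1) / ((u - v) * (u - v + kappa))) \<odot> comm hu (eu - ev))
            + (1 / (u - v + kappa)) \<odot> (hu * (ev + eu - e0) - (eu - e0) * hu)),
         (comm hu fv,
            ((u - v - kappa + 1) / ((u - v) * (u - v - kappa))) \<odot> comm hu (fu - fv)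
            - (1 / (u - v - kappa)) \<odot> (hu * (fv + fu + f0) - (fu + f0) * hu)),
         (acomm eu ev,
            (1 / (2 * (u - v))) \<odot> comm eu ev - (1 / (u - v)) \<odot> acomm e0 (eu - ev)
            - (1 / (2 * (u - v)^2)) \<odot> (eu - ev)^2),
         (acomm fu fv,
            - ((1 / (2 * (u - v))) \<odot> comm fu fv) - (1 / (u - v)) \<odot> acomm f0 (fu - fv)
            - (1 / (2 * (u - v)^2)) \<odot> (fu - fv)^2),
         (eu^3, eu * acomm eu e0 + comm (e0^2) eu),
         (fu^3, - (fu * acomm fu f0) + comm (f0^2) fu)})"

section \<open>The superalgebra \<open>\<U>(R)\<close>\<close>

datatype idx = I1 | I2 | I3

instantiation idx :: enum
begin
definition "enum_idx = [I1, I2, I3]"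
definition "enum_all_idx P \<longleftrightarrow> P I1 \<and> P I2 \<and> P I3"
definition "enum_ex_idx P \<longleftrightarrow> P I1 \<or> P I2 \<or> P I3"
instance
proof
  show univ: "(UNIV :: idx set) = set enum_class.enum"
    unfolding enum_idx_def using idx.exhaust by auto
  show "distinct (enum_class.enum :: idx list)" by (simp add: enum_idx_def)
  show "enum_class.enum_all P \<longleftrightarrow> Ball UNIV P" for P :: "idx \<Rightarrow> bool"
    unfolding univ by (simp add: enum_idx_def enum_all_idx_def)
  show "enum_class.enum_ex P \<longleftrightarrow> Bex UNIV P" for P :: "idx \<Rightarrow> bool"
    unfolding univ by (simp add: enum_idx_def enum_ex_idx_def)
qed
end

lemma UNIV_idx: "UNIV = {I1, I2, I3}"
  using idx.exhaust by auto

fun grade :: "idx \<Rightarrow> nat" where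
  "grade I1 = 0" | "grade I2 = 1" | "grade I3 = 0"

text \<open>
  \<open>M i j\<close> is the coefficient of \<open>E\<^sub>i\<^sub>j\<close>, and \<open>X i j k l\<close> that of \<open>E\<^sub>i\<^sub>j \<otimes> E\<^sub>k\<^sub>l\<close>.
\<close>

type_synonym 'a mat3 = "idx \<Rightarrow> idx \<Rightarrow> 'a"
type_synonym 'a tens = "idx \<Rightarrow> idx \<Rightarrow> idx \<Rightarrow> idx \<Rightarrow> 'a"

definition unit_mat :: "idx \<Rightarrow> idx \<Rightarrow> 'a :: ring_1 mat3" where
  "unit_mat a b i j = (if i = a \<and> j = b then 1 else 0)"

definition id_mat :: "'a :: ring_1 mat3" where
  "id_mat i j = (if i = j then 1 else 0)"

definition mat_mult :: "'a :: ring_1 mat3 \<Rightarrow> 'a mat3 \<Rightarrow> 'a mat3" where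
  "mat_mult A B i j = (\<Sum>k\<in>UNIV. A i k * B k j)"

definition J_mat :: "'a :: ring_1 mat3" where
  "J_mat i j = unit_mat I3 I1 i j + unit_mat I2 I2 i j - unit_mat I1 I3 i j"

definition super_transpose :: "'a :: ring_1 mat3 \<Rightarrow> 'a mat3" where
  "super_transpose A i l =
     (\<Sum>j\<in>UNIV. \<Sum>k\<in>UNIV.
        (-1) ^ (grade i * grade l + grade i) * J_mat i j * A k j * J_mat l k)"

definition tensor :: "'a :: ring_1 mat3 \<Rightarrow> 'a mat3 \<Rightarrow> 'a tens" where
  "tensor A B i j k l = A i j * B k l"

text \<open>
  The sign comes from
  \<open>(E\<^sub>i\<^sub>a \<otimes> E\<^sub>k\<^sub>b)(E\<^sub>a\<^sub>j \<otimes> E\<^sub>b\<^sub>l) = (-1)\<^bsup>([k]+[b])([a]+[j])\<^esup> E\<^sub>i\<^sub>j \<otimes> E\<^sub>k\<^sub>l\<close>; the coefficients are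
  multiplied in the written order and do not contribute a sign.
\<close>

definition tens_mult :: "'a :: ring_1 tens \<Rightarrow> 'a tens \<Rightarrow> 'a tens" (infixl \<open>\<bullet>\<close> 70) where
  "(X \<bullet> Y) i j k l =
     (\<Sum>a\<in>UNIV. \<Sum>b\<in>UNIV.
        (-1) ^ ((grade k + grade b) * (grade a + grade j)) * X i a k b * Y a j b l)"

definition P_tens :: "'a :: ring_1 tens" where
  "P_tens i j k l =
     (\<Sum>a\<in>UNIV. \<Sum>b\<in>UNIV. (-1) ^ grade b * tensor (unit_mat a b) (unit_mat b a) i j k l)"

definition P_t1_tens :: "'a :: ring_1 tens" where
  "P_t1_tens i j k l =
     (\<Sum>a\<in>UNIV. \<Sum>b\<in>UNIV.
        (-1) ^ grade b * tensor (super_transpose (unit_mat a b)) (unit_mat b a) i j k l)"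

text \<open>\<open>R\<^sub>1\<^sub>2(w)\<close> for \<open>w\<close> a rational function of \<open>u\<close> and \<open>v\<close>.\<close>

definition R_tens :: "complex fls fls \<Rightarrow> 'a :: complex_algebra_1 fls fls tens" where
  "R_tens w i j k l =
     tensor id_mat id_mat i j k l + (1 / w) \<odot> P_tens i j k l
     - (1 / (w + kappa)) \<odot> P_t1_tens i j k l"

text \<open>\<open>L_gen i j n\<close> stands for \<open>L\<^sup>i\<^sup>j\<close> with lower index \<open>n + 1\<close>, the coefficient of \<open>u\<close> to the
  power \<open>-n - 1\<close>.\<close>

datatype l_gen = L_gen idx idx nat

definition L_series :: "(l_gen \<Rightarrow> 'a) \<Rightarrow> 'a :: ring_1 fps mat3" where
  "L_series g i j = Abs_fps (case_nat (id_mat i j) (\<lambda>n. g (L_gen i j n)))"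

definition l_relations :: "(l_gen free_algebra fls fls \<times> l_gen free_algebra fls fls) set" where
  "l_relations =
    (let L = L_series free_gen;
         L1 = tensor (\<lambda>i j. at_u (L i j)) id_mat;
         L2 = tensor id_mat (\<lambda>i j. at_v (L i j));
         R = R_tens (var_u - var_v);
         Lt = super_transpose (\<lambda>i j. at_u (shift_series kappa (L i j)))
     in {((R \<bullet> L1 \<bullet> L2) i j k l, (L2 \<bullet> L1 \<bullet> R) i j k l) | i j k l. True} \<union>
        {(mat_mult Lt (\<lambda>i j. at_u (L i j)) i j, id_mat i j) | i j. True})"

section \<open>Both presentations are nontrivial\<close>

text \<open>The algebra map from the free algebra to the complex numbers killing all generators kills
  all relators.\<close>

definition counit :: "'g free_algebra \<Rightarrow> complex" where
  "counit x = Poly_Mapping.lookup x 0"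

lemma counit_0 [simp]: "counit 0 = 0"
  and counit_1 [simp]: "counit 1 = 1"
  and counit_add: "counit (x + y) = counit x + counit y"
  and counit_diff: "counit (x - y) = counit x - counit y"
  by (simp_all add: counit_def lookup_add lookup_minus)

lemma counit_mult: "counit (x * y) = counit x * counit y"
proof -
  have "Sum_any (\<lambda>w. Poly_Mapping.lookup y w when 0 = v + w) =
      (Poly_Mapping.lookup y 0 when v = 0)" for v
    by (cases "v = 0") (simp_all add: word_plus_eq_0_iff)
  then show ?thesis
    by (simp add: counit_def lookup_mult mult_when)
qed

lemma counit_free_gen [simp]: "counit (free_gen g) = 0"
  by (simp add: counit_def free_gen_def lookup_single zero_word_def)

lemma counit_scaleC_1 [simp]: "counit (c *\<^sub>C 1) = c"
  by (simp add: counit_def scaleC_poly_mapping_def scaleC_complex_def lookup_single)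

locale ring_1_hom =
  fixes h :: "'a :: ring_1 \<Rightarrow> 'b :: ring_1"
  assumes h_1: "h 1 = 1" and h_add: "h (x + y) = h x + h y" and h_mult: "h (x * y) = h x * h y"
begin

lemma h_0: "h 0 = 0"
  using h_add[of 0 0] by simp

lemma h_uminus: "h (- x) = - h x"
  using h_add[of x "- x"] by (simp add: h_0 eq_neg_iff_add_eq_0 add.commute)

lemma h_diff: "h (x - y) = h x - h y"
  using h_add[of x "- y"] by (simp add: h_uminus)

lemma h_power: "h (x ^ n) = h x ^ n"
  by (induction n) (simp_all add: h_1 h_mult)

lemma h_sum: "h (sum f A) = (\<Sum>a\<in>A. h (f a))"
  by (induction A rule: infinite_finite_induct) (simp_all add: h_0 h_add)

lemmas hom_simps = h_0 h_1 h_add h_mult h_uminus h_diff h_power h_sum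

end

lemma fls_times_nth_below:
  fixes f g :: "'a :: semiring_0 fls"
  assumes "\<And>i. i < a \<Longrightarrow> f $$ i = 0" "\<And>i. i < b \<Longrightarrow> g $$ i = 0"
  shows "(f * g) $$ n = (\<Sum>i=a..n - b. f $$ i * g $$ (n - i))"
proof -
  have "(f * g) $$ n = (\<Sum>i=fls_subdegree f..n - fls_subdegree g. f $$ i * g $$ (n - i))"
    by (rule fls_times_nth(2))
  also have "\<dots> = (\<Sum>i=min a (fls_subdegree f)..max (n - b) (n - fls_subdegree g).
      f $$ i * g $$ (n - i))"
    by (rule sum.mono_neutral_left) auto
  also have "\<dots> = (\<Sum>i=a..n - b. f $$ i * g $$ (n - i))"
    by (rule sum.mono_neutral_right) (use assms in \<open>auto simp: not_le\<close>)
  finally show ?thesis .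
qed

lemma ring_1_hom_map_fls:
  assumes "ring_1_hom h"
  shows "ring_1_hom (map_fls h)"
proof -
  interpret ring_1_hom h by fact
  note nth = map_fls_nth[of h, OF h_0]
  show ?thesis
  proof
    show "map_fls h 1 = 1"
      by (rule fls_eqI) (simp add: nth h_0 h_1)
    show "map_fls h (x + y) = map_fls h x + map_fls h y" for x y
      by (rule fls_eqI) (simp add: nth h_add)
    show "map_fls h (x * y) = map_fls h x * map_fls h y" for x y
    proof (rule fls_eqI)
      fix n
      have "(map_fls h x * map_fls h y) $$ n =
          (\<Sum>i=fls_subdegree x..n - fls_subdegree y.
            map_fls h x $$ i * map_fls h y $$ (n - i))"
        by (rule fls_times_nth_below) (simp_all add: nth h_0)
      then show "map_fls h (x * y) $$ n = (map_fls h x * map_fls h y) $$ n"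
        by (simp add: nth fls_times_nth(2) h_sum h_mult)
    qed
  qed
qed

definition counit_uv :: "'g free_algebra fls fls \<Rightarrow> complex fls fls" where
  "counit_uv = map_fls (map_fls counit)"

interpretation counit_uv: ring_1_hom counit_uv
  unfolding counit_uv_def
  by (intro ring_1_hom_map_fls) (unfold_locales, simp_all add: counit_add counit_mult)

lemma counit_uv_nth:
  fixes f :: "'g free_algebra fls fls"
  shows "(counit_uv f $$ m) $$ n = counit ((f $$ m) $$ n)"
proof -
  have "map_fls counit (0 :: 'g free_algebra fls) = 0"
    by (rule fls_eqI) (simp add: map_fls_nth)
  then show ?thesis by (simp add: counit_uv_def map_fls_nth)
qed

lemma fls2_eqI: "(\<And>m n. (f $$ m) $$ n = (g $$ m) $$ n) \<Longrightarrow> f = g"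
  by (intro fls_eqI)

lemma counit_uv_at_u: "counit_uv (at_u f) = at_u (map_fps counit f)"
  by (rule fls2_eqI) (simp add: counit_uv_nth at_u_def map_fls_nth map_fps_def)

lemma counit_uv_at_v: "counit_uv (at_v f) = at_v (map_fps counit f)"
  by (rule fls2_eqI) (simp add: counit_uv_nth at_v_def map_fps_def)

lemma counit_uv_const [simp]: "counit_uv (const_uv (free_gen g)) = 0"
  by (rule fls2_eqI) (simp add: counit_uv_nth const_uv_def)

lemma counit_uv_smult: "counit_uv (c \<odot> f) = c * counit_uv f"
proof -
  have 0: "map_fls (\<lambda>z. z *\<^sub>C 1) 0 = (0 :: 'a free_algebra fls)"
    by (rule fls_eqI) (simp add: map_fls_nth)
  have "counit_uv (map_fls (map_fls (\<lambda>z. z *\<^sub>C (1 :: 'a free_algebra))) c) = c"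
    by (rule fls2_eqI) (simp add: counit_uv_nth map_fls_nth 0)
  then show ?thesis by (simp add: smult_uv_def counit_uv.h_mult)
qed

lemma at_u_01 [simp]: "at_u 0 = 0" "at_u 1 = 1"
  by (simp_all add: at_u_def, (rule fls2_eqI, simp add: map_fls_nth)+)

lemma at_v_01 [simp]: "at_v 0 = 0" "at_v 1 = 1"
  by (simp_all add: at_v_def)

lemma counit_a_series [simp]:
  "map_fps counit (e_series free_gen) = 0"
  "map_fps counit (f_series free_gen) = 0"
  "map_fps counit (h_series free_gen) = 1"
  by (auto simp: map_fps_def e_series_def f_series_def h_series_def fps_eq_iff split: nat.split)

lemma a_relations_counit: "(l, r) \<in> a_relations \<Longrightarrow> counit_uv l = counit_uv r"
  by (auto simp: a_relations_def Let_def comm_def acomm_def counit_uv.hom_simps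
      counit_uv_at_u counit_uv_at_v counit_uv_smult)

lemma counit_L_series: "map_fps counit (L_series free_gen i j) = id_mat i j"
  by (auto simp: map_fps_def L_series_def id_mat_def fps_eq_iff split: nat.split)

lemma counit_shift_L_series:
  "map_fps counit (shift_series c (L_series free_gen i j)) = id_mat i j"
proof (rule fps_ext)
  fix n
  interpret ring_1_hom counit
    by unfold_locales (simp_all add: counit_add counit_mult)
  have L: "counit (L_series free_gen i j $ m) = (if m = 0 then id_mat i j else 0)" for m
    by (auto simp: L_series_def id_mat_def split: nat.split)
  show "map_fps counit (shift_series c (L_series free_gen i j)) $ n = id_mat i j $ n"
    by (auto simp: map_fps_def shift_series_def fps_compose_nth h_sum h_mult L id_mat_def
        if_distrib[of "\<lambda>x. x * _"] cong: if_cong)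
qed

lemma counit_uv_id_mat: "counit_uv (id_mat i j) = id_mat i j"
  by (simp add: id_mat_def counit_uv.hom_simps)

lemma counit_uv_tens_mult:
  "counit_uv ((X \<bullet> Y) i j k l) =
     ((\<lambda>i j k l. counit_uv (X i j k l)) \<bullet> (\<lambda>i j k l. counit_uv (Y i j k l))) i j k l"
  by (simp add: tens_mult_def counit_uv.hom_simps)

lemma tens_mult_id:
  "(tensor id_mat id_mat \<bullet> X) = X" "(X \<bullet> tensor id_mat id_mat) = X"
proof -
  show "(tensor id_mat id_mat \<bullet> X) = X"
  proof (intro ext)
    fix i j k l
    show "(tensor id_mat id_mat \<bullet> X) i j k l = X i j k l"
      by (cases i; cases k) (simp_all add: tens_mult_def tensor_def id_mat_def UNIV_idx)
  qed
  show "(X \<bullet> tensor id_mat id_mat) = X"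
  proof (intro ext)
    fix i j k l
    show "(X \<bullet> tensor id_mat id_mat) i j k l = X i j k l"
      by (cases j; cases l) (simp_all add: tens_mult_def tensor_def id_mat_def UNIV_idx)
  qed
qed

lemma l_relations_counit:
  assumes "(l, r) \<in> l_relations"
  shows "counit_uv l = counit_uv r"
proof -
  let ?L = "L_series free_gen"
  have at: "at_u (id_mat i j) = id_mat i j" "at_v (id_mat i j) = id_mat i j" for i j
    by (simp_all add: id_mat_def)
  have L1: "(\<lambda>i j k l. counit_uv (tensor (\<lambda>i j. at_u (?L i j)) id_mat i j k l)) =
      tensor id_mat id_mat"
    by (intro ext) (simp add: tensor_def counit_uv.h_mult counit_uv_at_u counit_L_series
        counit_uv_id_mat at)
  have L2: "(\<lambda>i j k l. counit_uv (tensor id_mat (\<lambda>i j. at_v (?L i j)) i j k l)) =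
      tensor id_mat id_mat"
    by (intro ext) (simp add: tensor_def counit_uv.h_mult counit_uv_at_v counit_L_series
        counit_uv_id_mat at)
  have J: "counit_uv (J_mat i j) = J_mat i j" for i j
    by (simp add: J_mat_def unit_mat_def counit_uv.hom_simps)
  have Lt: "counit_uv (mat_mult (super_transpose (\<lambda>i j. at_u (shift_series kappa (?L i j))))
      (\<lambda>i j. at_u (?L i j)) i j) = mat_mult (super_transpose id_mat) id_mat i j" for i j
    by (simp add: mat_mult_def super_transpose_def counit_uv.hom_simps J counit_uv_at_u
        counit_L_series counit_shift_L_series at)
  have "mat_mult (super_transpose id_mat) id_mat i j = (id_mat i j :: complex fls fls)" for i j
    by (cases i; cases j)
      (simp_all add: mat_mult_def super_transpose_def J_mat_def unit_mat_def id_mat_def UNIV_idx)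
  with assms show ?thesis
    by (auto simp: l_relations_def Let_def counit_uv_tens_mult L1 L2 tens_mult_id Lt
        counit_uv_id_mat)
qed

lemma one_notin_ideal_gen_relators_of:
  assumes "\<And>l r. (l, r) \<in> E \<Longrightarrow> counit_uv l = counit_uv r"
  shows "1 \<notin> ideal_gen (relators_of E)"
proof
  have *: "counit x = 0" if "x \<in> ideal_gen (relators_of E)" for x
    using that
  proof induction
    case (base r a b)
    then have "counit r = 0"
      using assms by (auto simp: relators_of_def counit_diff simp flip: counit_uv_nth)
    then show ?case by (simp add: counit_mult)
  qed (simp_all add: counit_add)
  assume "1 \<in> ideal_gen (relators_of E)"
  from *[OF this] show False by simp
qed

section \<open>The presented superalgebras\<close>

instantiation a_gen :: superpresentation
begin
fun odd_gen_a_gen :: "a_gen \<Rightarrow> bool" where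
  "odd_gen_a_gen (E_gen k) = True"
| "odd_gen_a_gen (F_gen k) = True"
| "odd_gen_a_gen (H_gen k) = False"
definition "relators_a_gen = relators_of a_relations"
instance
  by standard
    (unfold relators_a_gen_def, rule one_notin_ideal_gen_relators_of, rule a_relations_counit)
end

instantiation l_gen :: superpresentation
begin
fun odd_gen_l_gen :: "l_gen \<Rightarrow> bool" where
  "odd_gen_l_gen (L_gen i j n) = odd (grade i + grade j)"
definition "relators_l_gen = relators_of l_relations"
instance
  by standard
    (unfold relators_l_gen_def, rule one_notin_ideal_gen_relators_of, rule l_relations_counit)
end

type_synonym A_plus = "a_gen presented_algebra"
type_synonym U_R = "l_gen presented_algebra"

end

theory Submission imports Defs begin

text \<open>
  Write \<open>T(u) = L(-u)\<close> and \<open>k = T\<^sup>3\<^sup>3\<close>; then \<open>T\<^sup>2\<^sup>3 = k e\<close>, \<open>T\<^sup>3\<^sup>2 = f k\<close> and \<open>T\<^sup>2\<^sup>2 = h k - f k e\<close>.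
  All other entries of \<open>T\<close> arise from \<open>k\<close> by the action of the zero modes \<open>e\<^sub>0\<close> and \<open>f\<^sub>0\<close>, and the
  quadratic relation \<open>T\<^sup>t(u + \<kappa>) T(u) = 1\<close> amounts to \<open>h(u + \<kappa>) k(u + \<kappa>) h(u + 1) k(u) = 1\<close>.  This equation
  determines \<open>k\<close> from \<open>h\<close> order by order, and shows that the commutation relations of \<open>h\<close> and of \<open>k\<close>
  with a given element imply each other.  Hence in \<open>\<A>\<^sup>+\<close> one can solve for \<open>k\<close> and define \<open>T\<close> as the
  orbit of \<open>k\<close>.  It satisfies the RTT relations because the defect \<open>R T\<^sub>1 T\<^sub>2 - T\<^sub>2 T\<^sub>1 R\<close> is intertwined by the
  coproducts of \<open>e\<^sub>0\<close>, \<open>f\<^sub>0\<close> and \<open>h\<^sub>1 - h\<^sub>0\<^sup>2/2\<close>, which forces it to vanish column by column.  Conversely, the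
  entries of the RTT relations with indices 2 and 3 and their zero modes give the relations of \<open>\<A>\<^sup>+\<close>.
\<close>

section \<open>Algebra homomorphisms and presentations\<close>

text \<open>No basis of either algebra is used: bijectivity comes from two homomorphisms that are
  mutually inverse on generators, so both sets of relations have to be derived in full. The RTT
  relations are too many for a direct check of every entry. Symmetry reduces them to [k(u), k(v)] =
  0: the level one operator acts on entries linked by a zero mode with different coefficients in u
  and v, which leaves the factors u - v - 1 and u - v - 3/2, and these are invertible. The equation
  for k is a Schur complement computation: T^t(u + \<kappa>) T(u) factorises through the blocks with
  indices 2 and 3, and k(u) e(u) = e(u + 1) k(u) together with {e(u + 1), f(u)} = h(u) - h(u + 1)
  evaluates the factors. Solving it needs only division by 2, because k occurs twice and has
  constant term 1. In the level one coproduct the term 4 x^2 y^2 is {x, x} {y, y}, the contribution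
  of the even root that is twice the odd one.\<close>

locale complex_algebra_hom = ring_1_hom h
  for h :: "'a :: complex_algebra_1 \<Rightarrow> 'b :: complex_algebra_1" +
  assumes h_scaleC: "h (c *\<^sub>C x) = c *\<^sub>C h x"
begin

lemma h_scaleC_1: "h (c *\<^sub>C 1) = c *\<^sub>C 1"
  by (simp add: h_scaleC h_1)

lemma linear_hom: "Vector_Spaces.linear scaleC scaleC h"
  unfolding Vector_Spaces.linear_def module_hom_iff
  using vector_space_scaleC
  by (auto simp: module_hom_def module_hom_axioms_def h_add h_scaleC vector_space_def module_def
      scaleC_add_right scaleC_add_left scaleC_scaleC scaleC_one)

end

definition word_value :: "('g \<Rightarrow> 'a :: monoid_mult) \<Rightarrow> 'g word \<Rightarrow> 'a" where
  "word_value g w = prod_list (map g (letters w))"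

lemma word_value_0 [simp]: "word_value g 0 = 1"
  and word_value_add: "word_value g (v + w) = word_value g v * word_value g w"
  by (simp_all add: word_value_def zero_word_def plus_word_def)

definition free_ev :: "('g \<Rightarrow> 'a :: complex_algebra_1) \<Rightarrow> 'g free_algebra \<Rightarrow> 'a" where
  "free_ev g x = (\<Sum>w\<in>Poly_Mapping.keys x. Poly_Mapping.lookup x w *\<^sub>C word_value g w)"

lemma free_ev_superset:
  assumes "finite A" "Poly_Mapping.keys x \<subseteq> A"
  shows "free_ev g x = (\<Sum>w\<in>A. Poly_Mapping.lookup x w *\<^sub>C word_value g w)"
  unfolding free_ev_def
  by (rule sum.mono_neutral_left) (use assms in \<open>auto simp: in_keys_iff\<close>)

lemma free_ev_add: "free_ev g (x + y) = free_ev g x + free_ev g y"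
proof -
  let ?A = "Poly_Mapping.keys x \<union> Poly_Mapping.keys y"
  have "Poly_Mapping.keys (x + y) \<subseteq> ?A" by (rule Poly_Mapping.keys_add)
  then show ?thesis
    by (simp add: free_ev_superset[of ?A] lookup_add scaleC_add_left sum.distrib)
qed

lemma free_ev_single: "free_ev g (Poly_Mapping.single w c) = c *\<^sub>C word_value g w"
  by (cases "c = 0") (simp_all add: free_ev_def)

lemma free_algebra_induct [case_names zero add]:
  assumes "P 0" "\<And>w c x. P x \<Longrightarrow> P (Poly_Mapping.single w c + x)"
  shows "P (x :: 'g free_algebra)"
proof (induction x rule: update_induct)
  case const
  show ?case by fact
next
  case (update f a b)
  have "Poly_Mapping.update a b f = Poly_Mapping.single a b + f"
    using update(1)
    by (intro poly_mapping_eqI)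
      (auto simp: lookup_update lookup_add lookup_single in_keys_iff when_def)
  with assms(2) update.IH show ?case by simp
qed

lemma free_ev_mult: "free_ev g (x * y) = free_ev g x * free_ev g y"
proof (induction x rule: free_algebra_induct)
  case zero
  show ?case by (simp add: free_ev_def)
next
  case (add w c x)
  have "free_ev g (Poly_Mapping.single w c * y) = free_ev g (Poly_Mapping.single w c) * free_ev g y"
  proof (induction y rule: free_algebra_induct)
    case zero
    show ?case by (simp add: free_ev_def)
  next
    case (add w' c' x')
    then show ?case
      by (simp add: distrib_left free_ev_add mult_single free_ev_single word_value_add
          mult_scaleC_left mult_scaleC_right scaleC_scaleC mult.commute)
  qed
  with add show ?case by (simp add: distrib_right free_ev_add)
qed

lemma scaleC_free_algebra: "c *\<^sub>C (x :: 'g free_algebra) = Poly_Mapping.single 0 c * x"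
  by (simp add: scaleC_poly_mapping_def scaleC_complex_def)

lemma complex_algebra_hom_free_ev: "complex_algebra_hom (free_ev g)"
proof
  show "free_ev g 1 = 1"
    using free_ev_single[of g 0 1] by (simp add: scaleC_one)
qed (simp_all add: free_ev_add free_ev_mult scaleC_free_algebra free_ev_single mult_scaleC_left)

lemma free_ev_gen [simp]: "free_ev g (free_gen a) = g a"
  by (simp add: free_gen_def free_ev_single word_value_def scaleC_one)

lemma complex_algebra_hom_abs_presented:
  "complex_algebra_hom (abs_presented :: 'g :: superpresentation free_algebra \<Rightarrow> _)"
  by unfold_locales
    (simp_all add: one_presented_algebra_def plus_presented_algebra.abs_eq
      times_presented_algebra.abs_eq scaleC_presented_algebra.abs_eq)

lemma abs_presented_relator: "r \<in> relators \<Longrightarrow> abs_presented r = 0"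
  unfolding zero_presented_algebra_def
  using ideal_gen.base[of r relators 1 1]
  by (simp add: presented_algebra.abs_eq_iff same_class_def)

text \<open>Evaluates the representative chosen by \<open>rep_presented\<close>. The value is
  independent of that choice once \<open>free_ev g\<close> kills the relators, which is why the
  lemmas on \<open>presented_hom\<close> carry this hypothesis.\<close>

definition presented_hom ::
  "('g :: superpresentation \<Rightarrow> 'a :: complex_algebra_1) \<Rightarrow> 'g presented_algebra \<Rightarrow> 'a" where
  "presented_hom g x = free_ev g (rep_presented x)"

lemma presented_hom_abs:
  assumes "\<And>r. r \<in> relators \<Longrightarrow> free_ev g r = 0"
  shows "presented_hom g (abs_presented x) = free_ev g x"
proof -
  interpret complex_algebra_hom "free_ev g" by (rule complex_algebra_hom_free_ev)
  have *: "free_ev g x = 0" if "x \<in> ideal_gen relators" for x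
    using that by induction (simp_all add: hom_simps assms)
  have "same_class (rep_presented (abs_presented x)) x"
    using Quotient_rel_abs[OF Quotient_presented_algebra] Quotient_abs_rep[OF Quotient_presented_algebra]
    by (metis Quotient_rep_abs[OF Quotient_presented_algebra] equivp_same_class equivp_reflp)
  then have "free_ev g (rep_presented (abs_presented x) - x) = 0"
    unfolding same_class_def by (rule *)
  then show ?thesis by (simp add: presented_hom_def h_diff)
qed

lemma presented_cases: obtains y where "x = abs_presented y"
  by (metis Quotient_abs_rep[OF Quotient_presented_algebra])

lemma complex_algebra_hom_presented_hom:
  assumes "\<And>r. r \<in> relators \<Longrightarrow> free_ev g r = 0"
  shows "complex_algebra_hom (presented_hom g)"
proof -
  interpret f: complex_algebra_hom "free_ev g" by (rule complex_algebra_hom_free_ev)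
  interpret a: complex_algebra_hom abs_presented by (rule complex_algebra_hom_abs_presented)
  note ev = presented_hom_abs[OF assms]
  show ?thesis
  proof
    show "presented_hom g 1 = 1"
      using ev[of 1] by (simp add: a.h_1 f.h_1)
    show "presented_hom g (x + y) = presented_hom g x + presented_hom g y" for x y
      by (rule presented_cases[of x], rule presented_cases[of y])
        (simp add: ev f.h_add flip: a.h_add)
    show "presented_hom g (x * y) = presented_hom g x * presented_hom g y" for x y
      by (rule presented_cases[of x], rule presented_cases[of y])
        (simp add: ev f.h_mult flip: a.h_mult)
    show "presented_hom g (c *\<^sub>C x) = c *\<^sub>C presented_hom g x" for c x
      by (rule presented_cases[of x]) (simp add: ev f.h_scaleC flip: a.h_scaleC)
  qed
qed

lemma presented_hom_gen:
  assumes "\<And>r. r \<in> relators \<Longrightarrow> free_ev g r = 0"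
  shows "presented_hom g (alg_gen a) = g a"
  by (simp add: alg_gen_def presented_hom_abs[OF assms])

lemma presented_algebra_induct [case_names gen scale add mult]:
  fixes x :: "'g :: superpresentation presented_algebra"
  assumes gen: "\<And>a. P (alg_gen a)" and scale: "\<And>c. P (c *\<^sub>C 1)"
    and add: "\<And>x y. P x \<Longrightarrow> P y \<Longrightarrow> P (x + y)" and mult: "\<And>x y. P x \<Longrightarrow> P y \<Longrightarrow> P (x * y)"
  shows "P x"
proof -
  interpret a: complex_algebra_hom abs_presented by (rule complex_algebra_hom_abs_presented)
  have word: "P (abs_presented (Poly_Mapping.single (Word gs) 1))" for gs :: "'g list"
  proof (induction gs)
    case Nil
    have "P (1 *\<^sub>C 1)" by (rule scale)
    then show ?case by (simp add: a.h_1 scaleC_one flip: zero_word_def)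
  next
    case (Cons b gs)
    have "Poly_Mapping.single (Word (b # gs)) 1 = free_gen b * Poly_Mapping.single (Word gs) (1 :: complex)"
      by (simp add: free_gen_def mult_single plus_word_def)
    with mult[OF gen[of b] Cons] show ?case by (simp add: a.h_mult alg_gen_def)
  qed
  have single: "P (abs_presented (Poly_Mapping.single w c))" for w :: "'g word" and c
  proof -
    obtain gs where w: "w = Word gs" by (cases w)
    have "Poly_Mapping.single w c = c *\<^sub>C 1 * Poly_Mapping.single w 1"
      by (simp add: scaleC_free_algebra mult_single)
    with mult[OF scale[of c] word[of gs]] show ?thesis
      by (simp add: w a.h_mult a.h_scaleC_1)
  qed
  have "P (abs_presented y)" for y :: "'g free_algebra"
  proof (induction y rule: free_algebra_induct)
    case zero
    show ?case using scale[of 0] by (simp add: a.h_0)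
  next
    case (add w c x)
    with single[of w c] show ?case by (simp add: a.h_add assms(3))
  qed
  then show ?thesis by (metis presented_cases)
qed

lemma presented_hom_unique:
  fixes \<phi> \<psi> :: "'g :: superpresentation presented_algebra \<Rightarrow> 'a :: complex_algebra_1"
  assumes "complex_algebra_hom \<phi>" "complex_algebra_hom \<psi>" "\<And>a. \<phi> (alg_gen a) = \<psi> (alg_gen a)"
  shows "\<phi> = \<psi>"
proof
  interpret p: complex_algebra_hom \<phi> by fact
  interpret q: complex_algebra_hom \<psi> by fact
  fix x show "\<phi> x = \<psi> x"
    by (induction x rule: presented_algebra_induct)
      (simp_all add: assms(3) p.h_scaleC_1 q.h_scaleC_1 p.h_add q.h_add p.h_mult q.h_mult)
qed

section \<open>Substitutions in one-variable series\<close>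

definition cemb :: "complex \<Rightarrow> 'a :: complex_algebra_1" where "cemb c = c *\<^sub>C 1"

lemma ring_1_hom_cemb: "ring_1_hom cemb"
  by unfold_locales (simp_all add: cemb_def scaleC_one scaleC_add_left mult_scaleC_left scaleC_scaleC)

interpretation cemb: ring_1_hom cemb by (rule ring_1_hom_cemb)

lemma cemb_commute: "cemb c * x = x * cemb c"
  by (simp add: cemb_def mult_scaleC_left mult_scaleC_right)

lemma cemb_left_commute: "x * (cemb c * y) = cemb c * (x * y)"
  by (metis cemb_commute mult.assoc)

lemma cemb_mult_mult: "cemb c * cemb d * (a * b) = (cemb c * a) * (cemb d * b)"
  by (simp add: mult.assoc cemb_left_commute[of a])

lemma scaleC_cemb: "c *\<^sub>C x = cemb c * x"
  by (simp add: cemb_def mult_scaleC_left)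

lemma map_fps_nth [simp]: "map_fps g f $ n = g (f $ n)"
  by (simp add: map_fps_def)

lemma ring_1_hom_map_fps:
  assumes "ring_1_hom h"
  shows "ring_1_hom (map_fps h)"
proof -
  interpret ring_1_hom h by fact
  show ?thesis
    by unfold_locales (auto simp: fps_eq_iff hom_simps fps_mult_nth)
qed

text \<open>The substituted series has complex coefficients, which are central in \<open>'a\<close>;
  this makes the substitution multiplicative over a noncommutative ring. If
  \<open>q $ 0 = 0\<close>, the cut at \<open>n\<close> loses nothing, because \<open>q ^ i\<close>
  has order at least \<open>i\<close>.\<close>

definition fps_subst :: "complex fps \<Rightarrow> 'a :: complex_algebra_1 fps \<Rightarrow> 'a fps" where
  "fps_subst q f = Abs_fps (\<lambda>n. \<Sum>i\<le>n. (q ^ i $ n) *\<^sub>C (f $ i))"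

lemma fps_subst_nth: "fps_subst q f $ n = (\<Sum>i\<le>n. cemb (q ^ i $ n) * f $ i)"
  by (simp add: fps_subst_def scaleC_cemb)

lemma fps_compose_map_cemb: "fps_compose f (map_fps (\<lambda>z. z *\<^sub>C 1) q) = fps_subst q f"
proof (rule fps_ext)
  interpret m: ring_1_hom "map_fps cemb"
    by (intro ring_1_hom_map_fps ring_1_hom_cemb)
  have eq: "map_fps (\<lambda>z. z *\<^sub>C 1) q = map_fps cemb q"
    by (simp add: map_fps_def cemb_def)
  fix n show "fps_compose f (map_fps (\<lambda>z. z *\<^sub>C 1) q) $ n = fps_subst q f $ n"
    unfolding eq fps_compose_nth fps_subst_nth
    by (intro sum.cong) (auto simp: cemb_commute simp flip: m.h_power)
qed

lemma power_nth_below: "(q :: complex fps) $ 0 = 0 \<Longrightarrow> n < i \<Longrightarrow> q ^ i $ n = 0"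
  using startsby_zero_power_prefix by blast

lemma fps_subst_nth_above:
  assumes "q $ 0 = 0" "n \<le> m"
  shows "fps_subst q f $ n = (\<Sum>i\<le>m. cemb (q ^ i $ n) * f $ i)"
  unfolding fps_subst_nth
  by (rule sum.mono_neutral_left) (use assms in \<open>auto simp: power_nth_below cemb.h_0\<close>)

lemma ring_1_hom_fps_subst:
  assumes q: "q $ 0 = 0"
  shows "ring_1_hom (fps_subst q)"
proof
  show "fps_subst q 1 = 1"
    by (rule fps_ext) (auto simp: fps_subst_nth if_distrib[of "\<lambda>x. _ * x"] cemb.hom_simps cong: if_cong)
  show "fps_subst q (f + g) = fps_subst q f + fps_subst q g" for f g
    by (rule fps_ext) (simp add: fps_subst_nth distrib_left sum.distrib)
  show "fps_subst q (f * g) = fps_subst q f * fps_subst q g" for f g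
  proof (rule fps_ext)
    fix n :: nat
    let ?A = "{(a, b). a + b \<le> n}"
    have sub: "?A \<subseteq> {..n} \<times> {..n}" by auto
    have fin: "finite ?A" by (rule finite_subset[OF sub]) simp
    have "fps_subst q (f * g) $ n = (\<Sum>i\<le>n. \<Sum>a\<le>i. cemb (q ^ i $ n) * (f $ a * g $ (i - a)))"
      by (simp add: fps_subst_nth fps_mult_nth sum_distrib_left atLeast0AtMost)
    also have "\<dots> = (\<Sum>(i, a)\<in>(SIGMA i:{..n}. {..i}). cemb (q ^ i $ n) * (f $ a * g $ (i - a)))"
      by (simp add: sum.Sigma)
    also have "\<dots> = (\<Sum>(a, b)\<in>?A. cemb (q ^ (a + b) $ n) * (f $ a * g $ b))"
      by (rule sum.reindex_bij_witness[where j = "\<lambda>(i, a). (a, i - a)" and i = "\<lambda>(a, b). (a + b, a)"])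
        auto
    \<comment> \<open>The triangle is enlarged to a square so that the double sum factorises; the
      added pairs have a + b > n and contribute zero.\<close>
    also have "\<dots> = (\<Sum>(a, b)\<in>{..n} \<times> {..n}. cemb (q ^ (a + b) $ n) * (f $ a * g $ b))"
      by (rule sum.mono_neutral_left) (use sub in \<open>auto simp: power_nth_below[OF q] cemb.h_0 not_le\<close>)
    also have "\<dots> = (\<Sum>(a, b)\<in>{..n} \<times> {..n}. \<Sum>m\<le>n. (cemb (q ^ a $ m) * f $ a) * (cemb (q ^ b $ (n - m)) * g $ b))"
    proof (rule sum.cong[OF refl], clarify)
      fix a b
      have "cemb (q ^ (a + b) $ n) * (f $ a * g $ b) =
          (\<Sum>m\<le>n. cemb (q ^ a $ m) * cemb (q ^ b $ (n - m)) * (f $ a * g $ b))"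
        by (simp add: power_add fps_mult_nth cemb.hom_simps sum_distrib_right atLeast0AtMost)
      also have "\<dots> = (\<Sum>m\<le>n. (cemb (q ^ a $ m) * f $ a) * (cemb (q ^ b $ (n - m)) * g $ b))"
        by (simp only: cemb_mult_mult)
      finally show "cemb (q ^ (a + b) $ n) * (f $ a * g $ b) = \<dots>" .
    qed
    also have "\<dots> = (\<Sum>((a, b), m)\<in>({..n} \<times> {..n}) \<times> {..n}.
        (cemb (q ^ a $ m) * f $ a) * (cemb (q ^ b $ (n - m)) * g $ b))"
      by (simp add: sum.cartesian_product split_def)
    also have "\<dots> = (\<Sum>m\<le>n. (\<Sum>a\<le>n. cemb (q ^ a $ m) * f $ a) * (\<Sum>b\<le>n. cemb (q ^ b $ (n - m)) * g $ b))"
      unfolding sum_product sum.cartesian_product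
      by (rule sum.reindex_bij_witness[where i = "\<lambda>(m, a, b). ((a, b), m)" and j = "\<lambda>((a, b), m). (m, a, b)"])
        auto
    also have "\<dots> = (fps_subst q f * fps_subst q g) $ n"
      by (simp add: fps_mult_nth fps_subst_nth_above[OF q, where m = n] atLeast0AtMost)
    finally show "fps_subst q (f * g) $ n = (fps_subst q f * fps_subst q g) $ n" .
  qed
qed

lemma fps_subst_const:
  assumes "q $ 0 = 0"
  shows "fps_subst q (fps_const a) = fps_const a"
  by (rule fps_ext) (auto simp: fps_subst_nth if_distrib[of "\<lambda>x. _ * x"] cemb.hom_simps cong: if_cong)

lemma fps_subst_X:
  assumes "q $ 0 = 0"
  shows "fps_subst q fps_X = map_fps cemb q"
proof (rule fps_ext)
  fix n
  have "fps_subst q fps_X $ n = (\<Sum>i\<le>n. if i = 1 then cemb (q ^ i $ n) else 0)"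
    unfolding fps_subst_nth by (rule sum.cong) (simp_all add: fps_X_def)
  then show "fps_subst q fps_X $ n = map_fps cemb q $ n"
    using assms by (cases "n = 0") (simp_all add: cemb.h_0 sum.delta)
qed

lemma fps_subst_subst:
  assumes q: "q $ 0 = 0" and p: "p $ 0 = 0"
  shows "fps_subst q (fps_subst p f) = fps_subst (fps_compose p q) f"
proof (rule fps_ext)
  fix n
  have "fps_subst q (fps_subst p f) $ n =
      (\<Sum>j\<le>n. \<Sum>i\<le>n. cemb (q ^ j $ n) * (cemb (p ^ i $ j) * f $ i))"
    unfolding fps_subst_nth[of q]
    by (intro sum.cong refl) (simp add: fps_subst_nth_above[OF p, of _ n] sum_distrib_left)
  also have "\<dots> = (\<Sum>i\<le>n. \<Sum>j\<le>n. cemb (q ^ j $ n) * (cemb (p ^ i $ j) * f $ i))"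
    by (rule sum.swap)
  also have "\<dots> = (\<Sum>i\<le>n. cemb (fps_compose p q ^ i $ n) * f $ i)"
  proof (rule sum.cong[OF refl])
    fix i
    have "fps_compose p q ^ i $ n = (\<Sum>j\<le>n. (p ^ i $ j) * (q ^ j $ n))"
      using fps_compose_power[OF q, of p i] by (simp add: fps_compose_nth atLeast0AtMost)
    then show "(\<Sum>j\<le>n. cemb (q ^ j $ n) * (cemb (p ^ i $ j) * f $ i)) = cemb (fps_compose p q ^ i $ n) * f $ i"
      by (simp add: cemb.hom_simps sum_distrib_right)
        (simp add: mult.assoc, intro sum.cong refl, rule cemb_left_commute)
  qed
  finally show "fps_subst q (fps_subst p f) $ n = fps_subst (fps_compose p q) f $ n"
    by (simp add: fps_subst_nth)
qed

lemma fps_subst_id: "fps_subst fps_X f = f"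
  by (rule fps_ext)
    (auto simp: fps_subst_nth fps_X_power_nth if_distrib[of cemb] if_distrib[of "\<lambda>x. x * _"] cemb.hom_simps cong: if_cong)

lemma map_fps_subst:
  assumes "\<And>x y. h (x + y) = h x + h y" "h 0 = 0" "\<And>c x. h (c *\<^sub>C x) = c *\<^sub>C h x"
  shows "map_fps h (fps_subst q f) = fps_subst q (map_fps h f)"
proof (rule fps_ext)
  have "h (sum g A) = (\<Sum>a\<in>A. h (g a))" for g and A :: "nat set"
    by (induction A rule: infinite_finite_induct) (simp_all add: assms)
  then show "map_fps h (fps_subst q f) $ n = fps_subst q (map_fps h f) $ n" for n
    by (simp add: fps_subst_def assms(3))
qed

text \<open>With \<open>fps_X\<close> read as 1/u this is 1/(u + c). Hence \<open>shift c f\<close>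
  is f(u + c), opposite in sign to \<open>shift_series c f\<close>.\<close>

definition translation :: "complex \<Rightarrow> complex fps" where
  "translation c = fps_X / (1 + fps_const c * fps_X)"

lemma one_plus_X_nonzero: "(1 + fps_const c * fps_X :: complex fps) \<noteq> 0"
proof
  assume "(1 + fps_const c * fps_X :: complex fps) = 0"
  then have "(1 + fps_const c * fps_X :: complex fps) $ 0 = 0 $ 0" by (rule arg_cong)
  then show False by simp
qed

lemma translation_eq: "translation c * (1 + fps_const c * fps_X) = fps_X"
  by (simp add: translation_def fps_divide_unit mult.assoc inverse_mult_eq_1)

text \<open>Complex power series form a domain, so a translation is recognised by its product with 1
  + c X; the composition law is checked in this denominator-free form.\<close>

lemma translation_unique: "p * (1 + fps_const c * fps_X) = fps_X \<Longrightarrow> p = translation c"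
  using translation_eq[of c] one_plus_X_nonzero[of c] by (metis mult_right_cancel)

lemma translation_nth_0 [simp]: "translation c $ 0 = 0"
  using arg_cong[OF translation_eq[of c], of "\<lambda>p. p $ 0"] by simp

lemma translation_nth_1: "translation c $ 1 = 1"
  using arg_cong[OF translation_eq[of c], of "\<lambda>p. p $ 1"] by (simp add: fps_mult_nth)

definition shift :: "complex \<Rightarrow> 'a :: complex_algebra_1 fps \<Rightarrow> 'a fps" where
  "shift c f = fps_subst (translation c) f"

interpretation shift: ring_1_hom "shift c"
  unfolding shift_def[abs_def] by (rule ring_1_hom_fps_subst[OF translation_nth_0])

lemma shift_const [simp]: "shift c (fps_const a) = fps_const a"
  by (simp add: shift_def fps_subst_const)

definition cfps :: "complex \<Rightarrow> 'a :: complex_algebra_1 fps" where "cfps c = fps_const (cemb c)"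

lemma cfps_commute: "cfps c * f = f * cfps c"
  by (simp add: cfps_def fps_eq_iff cemb_commute)

lemma ring_1_hom_cfps: "ring_1_hom cfps"
  by unfold_locales (simp_all add: cfps_def cemb.hom_simps)

interpretation cfps: ring_1_hom cfps by (rule ring_1_hom_cfps)

lemma shift_cfps [simp]: "shift c (cfps d) = cfps d"
  by (simp add: cfps_def)

lemma map_fps_cemb_X: "map_fps cemb fps_X = fps_X"
  by (auto simp: fps_eq_iff fps_X_def cemb.hom_simps)

lemma map_fps_cemb_const: "map_fps cemb (fps_const c) = cfps c"
  by (auto simp: fps_eq_iff cfps_def cemb.hom_simps)

lemma shift_X: "(1 + cfps c * fps_X) * shift c fps_X = (fps_X :: 'a :: complex_algebra_1 fps)"
proof -
  interpret m: ring_1_hom "map_fps cemb :: _ \<Rightarrow> 'a fps"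
    by (intro ring_1_hom_map_fps ring_1_hom_cemb)
  have "map_fps cemb ((1 + fps_const c * fps_X) * translation c) = (fps_X :: 'a fps)"
    using translation_eq[of c] by (simp add: mult.commute map_fps_cemb_X)
  then show ?thesis
    by (simp only: shift_def fps_subst_X[OF translation_nth_0] m.hom_simps map_fps_cemb_X map_fps_cemb_const)
qed

lemma translation_compose:
  assumes "q $ 0 = 0"
  shows "fps_compose (translation b) q * (1 + fps_const b * q) = q"
  using arg_cong[OF translation_eq[of b], of "\<lambda>p. fps_compose p q"] assms
  by (simp add: fps_compose_mult_distrib fps_compose_add_distrib)

lemma shift_shift: "shift a (shift b f) = shift (a + b) f"
proof -
  have "1 + fps_const (a + b) * fps_X = (1 + fps_const a * fps_X) + fps_const b * (translation a * (1 + fps_const a * fps_X))"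
    by (simp only: translation_eq) (simp add: algebra_simps flip: fps_const_add)
  also have "\<dots> = (1 + fps_const b * translation a) * (1 + fps_const a * fps_X)"
    by (simp add: algebra_simps)
  finally have "fps_compose (translation b) (translation a) * (1 + fps_const (a + b) * fps_X) =
      fps_compose (translation b) (translation a) * (1 + fps_const b * translation a) * (1 + fps_const a * fps_X)"
    by (simp add: mult.assoc)
  also have "\<dots> = fps_X"
    by (simp only: translation_compose translation_nth_0 translation_eq)
  finally have "fps_compose (translation b) (translation a) = translation (a + b)"
    by (rule translation_unique)
  then show ?thesis
    by (simp add: shift_def fps_subst_subst)
qed

lemma shift_0 [simp]: "shift 0 f = f"
  by (simp add: shift_def translation_def fps_subst_id)

text \<open>A substitution tangent to the identity changes neither the order of a series nor its
  lowest coefficient. This makes shifts invisible in all order-by-order arguments below.\<close>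

lemma fps_subst_nth_lowest:
  assumes q: "q $ 0 = 0" "q $ 1 = 1" and f: "\<And>i. i < n \<Longrightarrow> f $ i = 0"
  shows "fps_subst q f $ n = f $ n" "i < n \<Longrightarrow> fps_subst q f $ i = 0"
proof -
  have "q ^ n $ n = 1"
    using fps_power_zeroth_eq_one[of "q"] q startsby_zero_power_nth_same[OF q(1), of n] by simp
  moreover have "(\<Sum>i\<le>n. cemb (q ^ i $ n) * f $ i) = (\<Sum>i\<in>{n}. cemb (q ^ i $ n) * f $ i)"
    by (rule sum.mono_neutral_right) (use f in auto)
  ultimately show "fps_subst q f $ n = f $ n"
    by (simp add: fps_subst_nth cemb.h_1)
  show "i < n \<Longrightarrow> fps_subst q f $ i = 0"
    by (simp add: fps_subst_nth f)
qed

lemma shift_nth_lowest: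
  assumes "\<And>i. i < n \<Longrightarrow> f $ i = 0"
  shows "shift c f $ n = f $ n" "i < n \<Longrightarrow> shift c f $ i = 0"
  unfolding shift_def
  using fps_subst_nth_lowest[OF translation_nth_0 translation_nth_1, of n f] assms by auto

lemma shift_nth_0 [simp]: "shift c f $ 0 = f $ 0"
  by (simp add: shift_nth_lowest)

definition reflect :: "'a :: complex_algebra_1 fps \<Rightarrow> 'a fps" where
  "reflect f = fps_subst (- fps_X) f"

lemma reflect_series_eq: "reflect_series f = reflect f"
proof -
  have "map_fps (\<lambda>z. z *\<^sub>C 1) (- fps_X) = - (fps_X :: 'a fps)"
    by (auto simp: fps_eq_iff fps_X_def cemb.hom_simps simp flip: cemb_def)
  then show ?thesis
    unfolding reflect_series_def reflect_def fps_compose_map_cemb[symmetric] by simp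
qed

lemma minus_X_power_nth: "(- fps_X :: complex fps) ^ i $ n = (if n = i then (- 1) ^ n else 0)"
proof (induction i arbitrary: n)
  case (Suc i)
  then show ?case by (cases n) (simp_all add: fps_X_mult_nth)
qed (auto simp: fps_one_nth)

lemma reflect_nth: "reflect f $ n = (- 1) ^ n * f $ n"
  by (simp add: reflect_def fps_subst_nth minus_X_power_nth if_distrib[of cemb]
      if_distrib[of "\<lambda>x. x * _"] cemb.hom_simps cong: if_cong)

interpretation reflect: ring_1_hom reflect
  unfolding reflect_def[abs_def] by (rule ring_1_hom_fps_subst) simp

lemma reflect_reflect [simp]: "reflect (reflect f) = f"
proof -
  have "(- 1) ^ n * (- 1) ^ n = (1 :: 'a)" for n :: nat
    by (cases "even n") simp_all
  then show ?thesis
    by (simp add: fps_eq_iff reflect_nth flip: mult.assoc)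
qed

lemma shift_series_eq: "shift_series c f = shift (- c) f"
proof -
  have "translation (- c) = fps_X / (1 - fps_const c * fps_X)"
    unfolding translation_def by (simp flip: fps_const_neg)
  then show ?thesis
    by (simp add: shift_series_def shift_def fps_compose_map_cemb)
qed

lemma reflect_shift: "reflect (shift (- c) f) = shift c (reflect f)"
proof -
  have "- fps_compose (translation (- c)) (- fps_X) * (1 + fps_const c * fps_X) = fps_X"
    using translation_compose[of "- fps_X" "- c"] by (simp flip: fps_const_neg)
  then have "fps_compose (translation (- c)) (- fps_X) = - translation c"
    by (metis translation_unique minus_minus)
  moreover have "fps_compose (- fps_X) (translation c) = - translation c"
    by (simp add: fps_compose_uminus)
  ultimately show ?thesis
    by (simp add: reflect_def shift_def fps_subst_subst)
qed

section \<open>Twisted commutation\<close>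

text \<open>
  A sequence \<open>s\<close> is thought of as \<open>x\<^sup>l s\<close>, so that \<open>lam c\<close> is multiplication by
  \<open>u\<^sup>-\<^sup>1 (u - x + c)\<close>.
\<close>

definition lam :: "complex \<Rightarrow> (nat \<Rightarrow> 'a :: complex_algebra_1 fps) \<Rightarrow> nat \<Rightarrow> 'a fps" where
  "lam c s l = (1 + cfps c * fps_X) * s l - fps_X * s (Suc l)"

definition lams :: "complex list \<Rightarrow> (nat \<Rightarrow> 'a :: complex_algebra_1 fps) \<Rightarrow> nat \<Rightarrow> 'a fps" where
  "lams cs = foldr lam cs"

definition const_seq :: "(nat \<Rightarrow> 'a :: complex_algebra_1) \<Rightarrow> nat \<Rightarrow> 'a fps" where
  "const_seq e l = fps_const (e l)"

lemma lams_Nil [simp]: "lams [] s = s"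
  and lams_Cons [simp]: "lams (c # cs) s = lam c (lams cs s)"
  by (simp_all add: lams_def)

lemma lams_append: "lams (A @ B) s = lams A (lams B s)"
  by (simp add: lams_def)

lemma fps_X_left_commute: "f * (fps_X * g) = fps_X * (f * (g :: 'a :: ring_1 fps))"
  by (metis fps_mult_fps_X_commute mult.assoc)

lemma cfps_left_commute: "f * (cfps c * g) = cfps c * (f * g)"
  by (metis cfps_commute mult.assoc)

lemma lam_mult_left: "lam c (\<lambda>l. p * s l) = (\<lambda>l. p * lam c s l)"
  by (simp add: fun_eq_iff lam_def algebra_simps cfps_left_commute[of p] fps_X_left_commute[of p])

lemma lam_mult_right: "lam c (\<lambda>l. s l * p) = (\<lambda>l. lam c s l * p)"
  by (simp add: fun_eq_iff lam_def algebra_simps)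

lemma lam_add: "lam c (\<lambda>l. s l + t l) = (\<lambda>l. lam c s l + lam c t l)"
  and lam_diff: "lam c (\<lambda>l. s l - t l) = (\<lambda>l. lam c s l - lam c t l)"
  by (simp_all add: fun_eq_iff lam_def algebra_simps)

lemma lams_mult_left: "lams cs (\<lambda>l. p * s l) = (\<lambda>l. p * lams cs s l)"
  by (induction cs) (simp_all add: lam_mult_left)

lemma lams_mult_right: "lams cs (\<lambda>l. s l * p) = (\<lambda>l. lams cs s l * p)"
  by (induction cs) (simp_all add: lam_mult_right)

lemma lams_diff: "lams cs (\<lambda>l. s l - t l) = (\<lambda>l. lams cs s l - lams cs t l)"
  by (induction cs) (simp_all add: lam_diff)

lemma lam_commute: "lam a (lam b s) = lam b (lam a s)"
proof
  have [simp]: "cfps a * (cfps b * f) = cfps b * (cfps a * f)" for f :: "'a fps"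
    by (rule cfps_left_commute)
  fix l show "lam a (lam b s) l = lam b (lam a s) l"
    by (simp add: lam_def algebra_simps fps_X_left_commute[of "cfps _"])
qed

lemma lams_lam: "lams cs (lam c s) = lam c (lams cs s)"
  by (induction cs) (simp_all add: lam_commute[of c])

text \<open>The factors u - x + c are scalars, so only the multiset of shifts matters; compatibility
  of two commutation relations becomes an equality of multisets.\<close>

lemma lams_mset: "mset A = mset B \<Longrightarrow> lams A s = lams B s"
proof (induction A arbitrary: B)
  case (Cons a A)
  then have "a \<in> set B" by (metis list.set_intros(1) set_mset_mset)
  then obtain B1 B2 where B: "B = B1 @ a # B2" by (meson split_list)
  with Cons.prems have "mset A = mset (B1 @ B2)" by simp
  from Cons.IH[OF this] show ?case
    by (simp add: B lams_append lams_lam)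
qed simp

section \<open>Order-by-order arguments for sequences of series\<close>

definition vanishes_below :: "nat \<Rightarrow> (nat \<Rightarrow> 'a :: zero fps) \<Rightarrow> bool" where
  "vanishes_below n s \<longleftrightarrow> (\<forall>l. \<forall>i<n. s l $ i = 0)"

text \<open>The order of vanishing is taken uniformly in \<open>l\<close>, because
  \<open>lam\<close> mixes neighbouring members of the sequence.\<close>

lemma vanishes_below_induct:
  assumes "\<And>n l. vanishes_below n s \<Longrightarrow> s l $ n = 0"
  shows "s l = 0"
proof -
  have "vanishes_below n s" for n
  proof (induction n)
    case (Suc n)
    with assms[OF this] show ?case by (auto simp: vanishes_below_def less_Suc_eq)
  qed (simp add: vanishes_below_def)
  then show ?thesis
    by (auto simp: fps_eq_iff vanishes_below_def)
qed

lemma fps_mult_nth_lowest: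
  fixes f g :: "'a :: ring_1 fps"
  assumes "\<And>i. i < n \<Longrightarrow> g $ i = 0"
  shows "i < n \<Longrightarrow> (f * g) $ i = 0" "(f * g) $ n = f $ 0 * g $ n"
    and "i < n \<Longrightarrow> (g * f) $ i = 0" "(g * f) $ n = g $ n * f $ 0"
proof -
  show "i < n \<Longrightarrow> (f * g) $ i = 0" "i < n \<Longrightarrow> (g * f) $ i = 0"
    by (auto simp: fps_mult_nth assms intro!: sum.neutral)
  have "(\<Sum>i=0..n. f $ i * g $ (n - i)) = (\<Sum>i\<in>{0}. f $ i * g $ (n - i))"
    by (rule sum.mono_neutral_right) (auto intro!: assms simp: assms)
  then show "(f * g) $ n = f $ 0 * g $ n" by (simp add: fps_mult_nth)
  have "(\<Sum>i=0..n. g $ i * f $ (n - i)) = (\<Sum>i\<in>{n}. g $ i * f $ (n - i))"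
    by (rule sum.mono_neutral_right) (auto simp: assms)
  then show "(g * f) $ n = g $ n * f $ 0" by (simp add: fps_mult_nth)
qed

lemma vanishes_below_mult:
  fixes p :: "'a :: ring_1 fps"
  assumes "vanishes_below n s"
  shows "vanishes_below n (\<lambda>l. p * s l)" "vanishes_below n (\<lambda>l. s l * p)"
    and "(p * s l) $ n = p $ 0 * s l $ n" "(s l * p) $ n = s l $ n * p $ 0"
proof -
  have s: "\<And>i. i < n \<Longrightarrow> s l $ i = 0" for l
    using assms by (simp add: vanishes_below_def)
  note 1 = fps_mult_nth_lowest[OF s, where f = p]
  show "vanishes_below n (\<lambda>l. p * s l)" "vanishes_below n (\<lambda>l. s l * p)"
    by (simp_all add: vanishes_below_def 1(1,3))
  show "(p * s l) $ n = p $ 0 * s l $ n" "(s l * p) $ n = s l $ n * p $ 0"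
    by (rule 1(2), assumption, rule 1(4), assumption)
qed

text \<open>\<open>lam c\<close> differs from the identity by terms with a factor 1/u, hence acts
  trivially in lowest order. Its injectivity follows, and with it the possibility of dividing by u -
  x + c.\<close>

lemma vanishes_below_lam:
  assumes "vanishes_below n s"
  shows "vanishes_below n (lam c s)" "lam c s l $ n = s l $ n"
proof -
  have s: "s l $ i = 0" if "i < n" for l i
    using assms that by (simp add: vanishes_below_def)
  show "lam c s l $ n = s l $ n"
    using fps_mult_nth_lowest(2)[where n = n and g = "s l" and f = "1 + cfps c * fps_X"]
    by (cases n) (auto simp: lam_def s)
  have "lam c s l $ i = 0" if "i < n" for l i
    using fps_mult_nth_lowest(1)[where n = n and g = "s l" and i = i and f = "1 + cfps c * fps_X"] that
    by (cases i) (auto simp: lam_def s)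
  then show "vanishes_below n (lam c s)"
    by (simp add: vanishes_below_def)
qed

lemma vanishes_below_lams:
  assumes "vanishes_below n s"
  shows "vanishes_below n (lams cs s)" "lams cs s l $ n = s l $ n"
proof -
  have "vanishes_below n (lams cs s) \<and> (\<forall>l. lams cs s l $ n = s l $ n)"
    by (induction cs) (simp_all add: assms vanishes_below_lam)
  then show "vanishes_below n (lams cs s)" "lams cs s l $ n = s l $ n"
    by auto
qed

lemma lam_inject:
  assumes "lam c s = lam c t"
  shows "s = t"
proof
  fix l
  have 0: "lam c (\<lambda>l. s l - t l) l = 0" for l
    by (simp add: lam_diff assms)
  have "s l - t l = 0"
  proof (rule vanishes_below_induct[of "\<lambda>l. s l - t l"])
    fix n l assume "vanishes_below n (\<lambda>l. s l - t l)"
    from vanishes_below_lam(2)[OF this, of c l] show "(s l - t l) $ n = 0"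
      by (simp add: 0)
  qed
  then show "s l = t l" by simp
qed

text \<open>Under u -> u + c the factor (u - x + a)/u becomes (u - x + a + c)/(u + c), and 1 + c/u =
  (u + c)/u restores the normalisation.\<close>

lemma shift_lam:
  "(1 + cfps c * fps_X) * shift c (lam a s l) = lam (a + c) (\<lambda>l. shift c (s l)) l"
proof -
  let ?x = "1 + cfps c * fps_X" and ?y = "shift c fps_X"
  have y: "?x * (?y * f) = fps_X * f" for f :: "'a fps"
    using shift_X[of c] by (metis mult.assoc)
  have "?x * shift c (lam a s l) =
      ?x * shift c (s l) + cfps a * (?x * (?y * shift c (s l))) - ?x * (?y * shift c (s (Suc l)))"
    by (simp add: lam_def shift.hom_simps distrib_left distrib_right right_diff_distrib mult.assoc
        cfps_left_commute[of "cfps c" a] cfps_left_commute[of fps_X])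
  then show ?thesis
    unfolding y by (simp add: lam_def cfps.hom_simps algebra_simps)
qed

text \<open>Vanishing for all \<open>l\<close> means that p(u) e(x) equals e(x) p(u) times the
  product of u - x + b over \<open>B\<close> divided by the product of u - x + a over
  \<open>A\<close>. The denominators are cleared and the statement is read off on the modes
  \<open>e l\<close>, so no function of x has to be formed.\<close>

definition defect ::
  "'a :: complex_algebra_1 fps \<Rightarrow> complex list \<Rightarrow> complex list \<Rightarrow> (nat \<Rightarrow> 'a) \<Rightarrow> nat \<Rightarrow> 'a fps" where
  "defect p A B e l = p * lams A (const_seq e) l - lams B (const_seq e) l * p"

abbreviation twisted ::
  "'a :: complex_algebra_1 fps \<Rightarrow> complex list \<Rightarrow> complex list \<Rightarrow> (nat \<Rightarrow> 'a) \<Rightarrow> bool" where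
  "twisted p A B e \<equiv> defect p A B e = (\<lambda>l. 0)"

text \<open>A Leibniz rule: the middle term, with \<open>p\<close> on the left, \<open>q\<close> on
  the right and the factors of \<open>A\<close> and \<open>D\<close> in between, is subtracted and
  added.\<close>

lemma defect_mult:
  "defect (p * q) (A @ C) (B @ D) e l =
     p * lams A (defect q C D e) l + lams D (defect p A B e) l * q"
proof -
  let ?e = "const_seq e"
  have "lams A (defect q C D e) = (\<lambda>l. q * lams A (lams C ?e) l - lams A (lams D ?e) l * q)"
    by (simp add: defect_def[abs_def] lams_mult_left lams_mult_right lams_diff)
  moreover have "lams D (defect p A B e) = (\<lambda>l. p * lams D (lams A ?e) l - lams D (lams B ?e) l * p)"
    by (simp add: defect_def[abs_def] lams_mult_left lams_mult_right lams_diff)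
  moreover have "lams A (lams D ?e) = lams D (lams A ?e)" "lams D (lams B ?e) = lams B (lams D ?e)"
    by (simp_all add: lams_mset[of "A @ D" "D @ A"] lams_mset[of "D @ B" "B @ D"] flip: lams_append)
  ultimately show ?thesis
    by (simp add: defect_def lams_append algebra_simps)
qed

lemma vanishes_below_defect_mult:
  assumes "p $ 0 = 1" "q $ 0 = 1"
    and "vanishes_below n (defect p A B e)" "vanishes_below n (defect q C D e)"
  shows "vanishes_below n (defect (p * q) (A @ C) (B @ D) e)"
    and "defect (p * q) (A @ C) (B @ D) e l $ n = defect q C D e l $ n + defect p A B e l $ n"
proof -
  note 1 = vanishes_below_lams[OF assms(4), where cs = A]
    and 2 = vanishes_below_lams[OF assms(3), where cs = D]
  show "vanishes_below n (defect (p * q) (A @ C) (B @ D) e)"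
    using vanishes_below_mult(1)[OF 1(1), of p] vanishes_below_mult(2)[OF 2(1), of q]
    by (simp add: vanishes_below_def defect_mult)
  show "defect (p * q) (A @ C) (B @ D) e l $ n = defect q C D e l $ n + defect p A B e l $ n"
    using vanishes_below_mult(3)[OF 1(1), of p l] vanishes_below_mult(4)[OF 2(1), of l q] assms(1,2)
    by (simp add: defect_mult 1(2) 2(2))
qed

lemma shift_lams:
  "(1 + cfps c * fps_X) ^ length A * shift c (lams A s l) =
     lams (map (\<lambda>a. a + c) A) (\<lambda>l. shift c (s l)) l"
proof (induction A arbitrary: l)
  case (Cons a A)
  let ?x = "1 + cfps c * fps_X"
  have "?x ^ length (a # A) * shift c (lams (a # A) s l) =
      ?x ^ length A * (?x * shift c (lam a (lams A s) l))"
    by (simp only: lams_Cons list.size power_Suc2 add_0_right add_Suc_right mult.assoc)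
  also have "\<dots> = ?x ^ length A * lam (a + c) (\<lambda>l. shift c (lams A s l)) l"
    by (simp add: shift_lam)
  also have "\<dots> = lam (a + c) (\<lambda>l. ?x ^ length A * shift c (lams A s l)) l"
    by (simp add: lam_mult_left)
  finally show ?case by (simp add: Cons)
qed simp

text \<open>Equal lengths make the normalising powers of 1 + c/u on the two sides agree.\<close>

lemma shift_defect:
  assumes "length A = length B"
  shows "(1 + cfps c * fps_X) ^ length A * shift c (defect p A B e l) =
    defect (shift c p) (map (\<lambda>a. a + c) A) (map (\<lambda>a. a + c) B) e l"
proof -
  let ?x = "(1 + cfps c * fps_X) ^ length A"
  have c: "?x * (p * f) = p * (?x * f)" for p f :: "'a fps"
  proof -
    have "(1 + cfps c * fps_X) * p = p * (1 + cfps c * fps_X)"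
      by (simp only: distrib_left distrib_right mult_1_left mult_1_right mult.assoc
          fps_mult_fps_X_commute[of p] cfps_left_commute)
    then have "?x * p = p * ?x" by (rule power_commuting_commutes)
    then show ?thesis by (simp only: mult.assoc[symmetric])
  qed
  have "?x * shift c (defect p A B e l) =
      shift c p * (?x * shift c (lams A (const_seq e) l)) - ?x * shift c (lams B (const_seq e) l) * shift c p"
    by (simp add: defect_def shift.hom_simps right_diff_distrib c[of "shift c p"] mult.assoc)
  then show ?thesis
    using shift_lams[of c A "const_seq e" l] shift_lams[of c B "const_seq e" l] assms
    by (simp add: defect_def const_seq_def[abs_def])
qed

lemma vanishes_below_shift_defect:
  assumes "length A = length B" "vanishes_below n (defect p A B e)"
  shows "vanishes_below n (defect (shift c p) (map (\<lambda>a. a + c) A) (map (\<lambda>a. a + c) B) e)"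
    and "defect (shift c p) (map (\<lambda>a. a + c) A) (map (\<lambda>a. a + c) B) e l $ n = defect p A B e l $ n"
proof -
  let ?x = "(1 + cfps c * fps_X :: 'a fps) ^ length A"
  have x: "?x $ 0 = 1" by (simp add: fps_power_zeroth cfps_def)
  have v: "vanishes_below n (\<lambda>l. shift c (defect p A B e l))"
    using assms(2) shift_nth_lowest(2)[of n "defect p A B e _"] by (auto simp: vanishes_below_def)
  have 0: "shift c (defect p A B e l) $ n = defect p A B e l $ n"
    using assms(2) by (intro shift_nth_lowest(1)) (auto simp: vanishes_below_def)
  show "vanishes_below n (defect (shift c p) (map (\<lambda>a. a + c) A) (map (\<lambda>a. a + c) B) e)"
    using vanishes_below_mult(1)[OF v, of ?x] by (simp add: shift_defect[OF assms(1)])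
  show "defect (shift c p) (map (\<lambda>a. a + c) A) (map (\<lambda>a. a + c) B) e l $ n = defect p A B e l $ n"
    using vanishes_below_mult(3)[OF v, of ?x l] by (simp add: shift_defect[OF assms(1)] x 0)
qed

text \<open>
  Commutators with the coefficients of \<open>h\<close> and \<open>k\<close> determine each other, because
  \<open>h(u+\<kappa>) k(u+\<kappa>) h(u+1) k(u) = 1\<close> can be solved order by order for either of the two series.
\<close>

lemma twisted_sqrt:
  fixes h k :: "'a :: complex_algebra_1 fps"
  assumes eq: "shift c h * shift c k * shift d h * k = 1" and "h $ 0 = 1" "k $ 0 = 1"
    and len: "length A = length B" "length C = length D"
    and ms: "mset (map (\<lambda>a. a + c) A @ map (\<lambda>a. a + c) C @ map (\<lambda>a. a + d) A @ C) =
      mset (map (\<lambda>a. a + c) B @ map (\<lambda>a. a + c) D @ map (\<lambda>a. a + d) B @ D)"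
  shows "twisted h A B e \<longleftrightarrow> twisted k C D e"
proof -
  let ?s = "\<lambda>c. map (\<lambda>a. a + c)"
  \<comment> \<open>The product is 1, so its defect is the difference of two scalar multiples of the
    modes, and \<open>ms\<close> says that these multiples coincide.\<close>
  have 0: "defect (shift c h * shift c k * shift d h * k)
      (((?s c A @ ?s c C) @ ?s d A) @ C) (((?s c B @ ?s c D) @ ?s d B) @ D) e l = 0" for l
    unfolding eq using lams_mset[OF ms, of "const_seq e"] by (simp add: defect_def)
  \<comment> \<open>In lowest order shifts and the other factors act as 1, so the coefficients
    simply add: two copies from \<open>h\<close> and two from \<open>k\<close>. If one defect is
    identically zero, twice the other vanishes.\<close>
  have step: "defect k C D e l $ n + defect h A B e l $ n + defect k C D e l $ n + defect h A B e l $ n = 0"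
    if "vanishes_below n (defect h A B e)" "vanishes_below n (defect k C D e)" for n l
  proof -
    note h = vanishes_below_shift_defect[OF len(1) that(1)]
      and k = vanishes_below_shift_defect[OF len(2) that(2)]
    note 1 = vanishes_below_defect_mult[OF _ _ h(1)[of c] k(1)[of c]]
    note 2 = vanishes_below_defect_mult[OF _ _ 1(1) h(1)[of d]]
    note 3 = vanishes_below_defect_mult[OF _ _ 2(1) that(2)]
    show ?thesis
      using 3(2)[of l] 0[of l] assms(2,3) by (simp add: 2(2) 1(2) h(2) k(2) add_ac del: append_assoc)
  qed
  have two: "x = 0" if "x + x = 0" for x :: 'a
  proof -
    have "x = (1/2) *\<^sub>C (x + x)"
      by (simp add: scaleC_add_right scaleC_one flip: scaleC_add_left)
    with that show ?thesis by simp
  qed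
  show ?thesis
  proof
    assume "twisted h A B e"
    then show "twisted k C D e"
      using step by (intro ext vanishes_below_induct) (auto simp: vanishes_below_def intro: two)
  next
    assume "twisted k C D e"
    then show "twisted h A B e"
      using step by (intro ext vanishes_below_induct) (auto simp: vanishes_below_def intro: two)
  qed
qed

section \<open>The equation a(u) k(u + c) b(u) k(u) = 1\<close>

lemma double_eq_0:
  fixes x :: "'a :: complex_algebra_1"
  assumes "x + x = 0"
  shows "x = 0"
proof -
  have "x = (1/2) *\<^sub>C (x + x)"
    by (simp add: scaleC_add_right scaleC_one flip: scaleC_add_left)
  with assms show ?thesis by simp
qed

text \<open>The difference telescopes into one term with k' - k shifted and one with k' - k
  unshifted; all remaining factors have constant term 1. Each term contributes the lowest
  coefficient of k' - k once.\<close>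

lemma quasi_square_diff_lowest:
  fixes k k' :: "'a :: complex_algebra_1 fps"
  assumes "a $ 0 = 1" "b $ 0 = 1" "k $ 0 = 1" "k' $ 0 = 1" and v: "\<And>i. i < n \<Longrightarrow> (k' - k) $ i = 0"
  shows "(a * shift c k' * b * k' - a * shift c k * b * k) $ n = (k' - k) $ n + (k' - k) $ n"
    and "i < n \<Longrightarrow> (a * shift c k' * b * k' - a * shift c k * b * k) $ i = 0"
proof -
  define d where "d = k' - k"
  have eq: "a * shift c k' * b * k' - a * shift c k * b * k =
      a * (shift c d * (b * k')) + (a * (shift c k * b)) * d"
    by (simp add: d_def shift.hom_simps algebra_simps)
  have d: "d $ i = 0" if "i < n" for i
    using v that by (simp add: d_def)
  note sd = shift_nth_lowest[where c = c and n = n and f = d, OF d]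
  note 1 = fps_mult_nth_lowest[where n = n, OF sd(2), where f = "b * k'"]
  note 2 = fps_mult_nth_lowest[where n = n, OF 1(3), where f = a]
  note 3 = fps_mult_nth_lowest[where n = n, OF d, where f = "a * (shift c k * b)"]
  show "(a * shift c k' * b * k' - a * shift c k * b * k) $ n = (k' - k) $ n + (k' - k) $ n"
    unfolding eq using 2(2) 3(2) 1(4) sd(1) by (simp add: assms flip: d_def)
  show "i < n \<Longrightarrow> (a * shift c k' * b * k' - a * shift c k * b * k) $ i = 0"
    unfolding eq using 2(1) 3(1) by simp
qed

lemma quasi_square_unique:
  fixes k k' :: "'a :: complex_algebra_1 fps"
  assumes "a $ 0 = 1" "b $ 0 = 1" "k $ 0 = 1" "k' $ 0 = 1"
    and eq: "a * shift c k' * b * k' = a * shift c k * b * k"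
  shows "k' = k"
proof -
  have "k' - k = 0"
  proof (rule vanishes_below_induct[of "\<lambda>l :: nat. k' - k"])
    fix n and l :: nat assume "vanishes_below n (\<lambda>l :: nat. k' - k)"
    then have "\<And>i. i < n \<Longrightarrow> (k' - k) $ i = 0" by (auto simp: vanishes_below_def)
    from quasi_square_diff_lowest(1)[OF assms(1-4) this, where c = c]
    have "(k' - k) $ n + (k' - k) $ n = 0" by (simp only: eq) simp
    then show "(k' - k) $ n = 0" by (rule double_eq_0)
  qed
  then show ?thesis by simp
qed

text \<open>The error of the equation in degree \<open>Suc n\<close> is the coefficient itself,
  since 1 has no term there. A change of k in this degree counts twice, hence the subtraction of one
  half of the error.\<close>

primrec quasi_sqrt_approx ::
  "complex \<Rightarrow> 'a :: complex_algebra_1 fps \<Rightarrow> 'a fps \<Rightarrow> nat \<Rightarrow> 'a fps" where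
  "quasi_sqrt_approx c a b 0 = 1"
| "quasi_sqrt_approx c a b (Suc n) = (let k = quasi_sqrt_approx c a b n in
     k - fps_const ((1/2) *\<^sub>C (a * shift c k * b * k) $ Suc n) * fps_X ^ Suc n)"

lemma quasi_sqrt_exists:
  fixes a b :: "'a :: complex_algebra_1 fps"
  assumes ab: "a $ 0 = 1" "b $ 0 = 1"
  obtains k where "k $ 0 = 1" "a * shift c k * b * k = 1"
proof -
  let ?K = "quasi_sqrt_approx c a b" and ?P = "\<lambda>k. a * shift c k * b * k"
  have nth: "?K (Suc n) $ i = (if i = Suc n then ?K n $ i - (1/2) *\<^sub>C ?P (?K n) $ Suc n else ?K n $ i)" for n i
    by (auto simp: Let_def fps_X_power_mult_right_nth simp del: power_Suc)
  have K0: "?K n $ 0 = 1" for n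
    by (induction n) (simp, simp only: nth, simp)
  have low: "?P (?K n) $ i = 1 $ i" if "i \<le> n" for n i
    using that
  proof (induction n arbitrary: i)
    case 0
    then show ?case using ab by simp
  next
    case (Suc n)
    have v: "\<And>i. i < Suc n \<Longrightarrow> (?K (Suc n) - ?K n) $ i = 0"
      by (simp only: fps_sub_nth nth) simp
    note d = quasi_square_diff_lowest[where n = "Suc n", OF ab K0 K0 v, where c = c]
    show ?case
    proof (cases "i = Suc n")
      case True
      let ?x = "?P (?K n) $ Suc n"
      have "(?K (Suc n) - ?K n) $ Suc n + (?K (Suc n) - ?K n) $ Suc n = - ((1/2) *\<^sub>C ?x + (1/2) *\<^sub>C ?x)"
        by (simp only: fps_sub_nth nth) simp
      also have "\<dots> = - ?x"
        by (simp add: scaleC_one flip: scaleC_add_left)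
      finally show ?thesis using d(1) True by (simp del: quasi_sqrt_approx.simps)
    next
      case False
      with Suc d(2)[of i] show ?thesis by (simp del: quasi_sqrt_approx.simps)
    qed
  qed
  \<comment> \<open>The diagonal limit: coefficient \<open>i\<close> no longer changes after
    approximation \<open>i\<close>.\<close>
  define k where "k = Abs_fps (\<lambda>n. ?K n $ n)"
  have stable: "?K (i + m) $ i = ?K i $ i" for i m
    by (induction m) (simp, simp only: add_Suc_right nth, simp)
  have k: "(k - ?K n) $ i = 0" if "i < Suc n" for n i
    using stable[of i "n - i"] that by (simp add: k_def)
  have k0: "k $ 0 = 1" by (simp add: k_def)
  have "?P k $ n = 1 $ n" for n
    using quasi_square_diff_lowest(2)[where n = "Suc n", OF ab K0 k0 k, where i = n and c = c] low[of n n] by simp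
  then have "?P k = 1" by (simp add: fps_eq_iff)
  with k0 show ?thesis by (rule that)
qed

text \<open>In the reading of sequences used for \<open>lam\<close> this is x^l/(u - x). The
  recursion below is (u - x) * 1/(u - x) = 1, and the member \<open>l = 0\<close> is the generating
  function with its index shifted by one.\<close>

definition gen_seq :: "(nat \<Rightarrow> 'a) \<Rightarrow> nat \<Rightarrow> 'a :: ring_1 fps" where
  "gen_seq e l = Abs_fps (case_nat 0 (\<lambda>k. e (l + k)))"

lemma gen_seq_nth [simp]: "gen_seq e l $ 0 = 0" "gen_seq e l $ Suc k = e (l + k)"
  by (simp_all add: gen_seq_def)

lemma gen_seq_rec: "gen_seq e l - fps_X * gen_seq e (Suc l) = fps_X * fps_const (e l)"
proof (rule fps_ext)
  fix n show "(gen_seq e l - fps_X * gen_seq e (Suc l)) $ n = (fps_X * fps_const (e l)) $ n"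
    by (cases n; cases "n - 1") (auto simp: gen_seq_def split: nat.splits)
qed

lemma lam_gen_seq: "lam 0 (gen_seq e) = (\<lambda>l. fps_X * const_seq e l)"
  by (simp add: fun_eq_iff lam_def cfps.h_0 gen_seq_rec const_seq_def)

lemma lam_shift_gen_seq: "lam c (\<lambda>l. shift c (gen_seq e l)) = (\<lambda>l. fps_X * const_seq e l)"
proof
  fix l
  have "lam c (\<lambda>l. shift c (gen_seq e l)) l = (1 + cfps c * fps_X) * shift c (fps_X * const_seq e l)"
    using shift_lam[of c 0 "gen_seq e" l] by (simp add: lam_gen_seq)
  also have "\<dots> = fps_X * const_seq e l"
    by (simp add: shift.h_mult const_seq_def shift_X flip: mult.assoc)
  finally show "lam c (\<lambda>l. shift c (gen_seq e l)) l = fps_X * const_seq e l" .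
qed

lemma twistedD: "twisted p A B e \<Longrightarrow> p * lams A (const_seq e) l = lams B (const_seq e) l * p"
  by (simp add: defect_def fun_eq_iff)

lemma lam_X_mult: "lam c (\<lambda>l. fps_X * s l) = (\<lambda>l. fps_X * lam c s l)"
  by (rule lam_mult_left)

text \<open>Dividing k(u) (u - x + 1) e(x) = (u - x) e(x) k(u) by (u - x)(u - x + 1) gives k(u) e(u)
  = e(u + 1) k(u). The divisions are the injectivity of \<open>lam 1\<close> and
  \<open>lam 0\<close>.\<close>

lemma twisted_gen_seq_left:
  assumes "twisted k [1] [0] e"
  shows "k * gen_seq e l = shift 1 (gen_seq e l) * k"
proof -
  have "lam 1 (lam 0 (\<lambda>l. k * gen_seq e l)) = (\<lambda>l. k * (fps_X * lam 1 (const_seq e) l))"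
    by (simp only: lam_mult_left lam_gen_seq)
  also have "\<dots> = (\<lambda>l. fps_X * lam 0 (const_seq e) l * k)"
    using twistedD[OF assms] by (simp add: fps_X_left_commute[of k] mult.assoc)
  also have "\<dots> = lam 0 (lam 1 (\<lambda>l. shift 1 (gen_seq e l) * k))"
    by (simp only: lam_mult_right lam_shift_gen_seq lam_X_mult)
  finally have "lam 1 (lam 0 (\<lambda>l. k * gen_seq e l)) = lam 1 (lam 0 (\<lambda>l. shift 1 (gen_seq e l) * k))"
    by (simp only: lam_commute[of 0])
  from fun_cong[OF lam_inject[OF lam_inject[OF this]]] show ?thesis .
qed

text \<open>This is {e(u), f(v)} = (h(v) - h(u))/(u - v) at the points u + 1 and u, where the
  denominator equals 1. It is derived from the modes, one generating series at a time.\<close>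

lemma acomm_shift_gen_seq:
  assumes ef: "\<And>k l. e k * f l + f l * e k = h (k + l)"
  shows "shift 1 (gen_seq e 0) * gen_seq f 0 + gen_seq f 0 * shift 1 (gen_seq e 0) =
    gen_seq h 0 - shift 1 (gen_seq h 0)"
proof -
  let ?E = "\<lambda>k. shift 1 (gen_seq e k)" and ?H = "\<lambda>k. shift 1 (gen_seq h k)"
  have G: "?E k * fps_const (f l) + fps_const (f l) * ?E k = ?H (k + l)" for k l
  proof -
    have "lam 1 (\<lambda>k. ?E k * fps_const (f l) + fps_const (f l) * ?E k) =
        (\<lambda>k. fps_X * const_seq e k * fps_const (f l) + fps_const (f l) * (fps_X * const_seq e k))"
      by (simp only: lam_add lam_mult_left lam_mult_right lam_shift_gen_seq)
    also have "\<dots> = (\<lambda>k. fps_X * const_seq h (k + l))"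
      by (simp add: const_seq_def mult.assoc fps_X_left_commute[of "fps_const _"] ef flip: distrib_left)
    also have "\<dots> = lam 1 (\<lambda>k. ?H (k + l))"
    proof
      fix k show "fps_X * const_seq h (k + l) = lam 1 (\<lambda>k. ?H (k + l)) k"
        using fun_cong[OF lam_shift_gen_seq[of 1 h], of "k + l"] by (simp add: lam_def)
    qed
    finally show ?thesis by (rule fun_cong[OF lam_inject])
  qed
  have "lam 0 (\<lambda>l. ?E 0 * gen_seq f l + gen_seq f l * ?E 0) =
      (\<lambda>l. ?E 0 * (fps_X * const_seq f l) + fps_X * const_seq f l * ?E 0)"
    by (simp only: lam_add lam_mult_left lam_mult_right lam_gen_seq)
  also have "\<dots> = (\<lambda>l. fps_X * ?H l)"
    using G[of 0] by (simp add: const_seq_def mult.assoc fps_X_left_commute[of "?E 0"] flip: distrib_left)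
  also have "\<dots> = lam 0 (\<lambda>l. gen_seq h l - ?H l)"
  proof
    fix l show "fps_X * ?H l = lam 0 (\<lambda>l. gen_seq h l - ?H l) l"
      using fun_cong[OF lam_shift_gen_seq[of 1 h], of l]
      by (simp add: lam_diff lam_gen_seq) (simp add: lam_def cfps.hom_simps algebra_simps)
  qed
  finally show ?thesis by (rule fun_cong[OF lam_inject])
qed

section \<open>The opposite ring\<close>

text \<open>Reversing products turns the exchange relations of f with k into those of e with k, so
  one elimination serves for both quadratic relations.\<close>

datatype 'a opp = Opp (unopp: 'a)

instantiation opp :: (ring_1) ring_1
begin
definition "0 = Opp 0"
definition "1 = Opp 1"
definition "x + y = Opp (unopp x + unopp y)"
definition "x - y = Opp (unopp x - unopp y)"
definition "- x = Opp (- unopp x)"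
definition "x * y = Opp (unopp y * unopp x)"
instance
  by standard
    (simp_all add: zero_opp_def one_opp_def plus_opp_def minus_opp_def uminus_opp_def times_opp_def
      algebra_simps)
end

lemma Opp_simps: "Opp x + Opp y = Opp (x + y)" "Opp x - Opp y = Opp (x - y)" "- Opp x = Opp (- x)"
    "Opp x * Opp y = Opp (y * x)" "1 = Opp 1" "0 = Opp 0"
  by (simp_all add: zero_opp_def one_opp_def plus_opp_def minus_opp_def uminus_opp_def times_opp_def)

lemma opp_all: "(\<And>x :: 'a. P (Opp x)) \<Longrightarrow> P y"
  by (cases y) simp

section \<open>Consequences of the exchange relations in an arbitrary ring\<close>

lemma central_left_commute:
  fixes c :: "'r :: ring_1"
  assumes "\<And>x. x * c = c * x"
  shows "x * (c * y) = c * (x * y)"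
  by (metis assms mult.assoc)

text \<open>Here and below, primed letters are values at v, unprimed ones values at u, and
  \<open>c\<close> is 1/(u - v). Eliminating \<open>k * (e * k')\<close> between the two matrix
  entries \<open>A\<close> and \<open>B\<close> leaves the factor 1 - c, which is
  invertible.\<close>

lemma exchange_ke:
  fixes k :: "'r :: ring_1"
  assumes c: "\<And>x. x * c = c * x" and inv: "k1 * k' = 1" "d * (1 - c) = 1"
    and kk: "k * k' = k' * k"
    and A: "k * (k' * e') - k' * (e' * k) = c * (k * (e * k') - k' * (e' * k))"
    and B: "k * (e * k') - k' * (k * e) = c * (k * (k' * e') - k' * (k * e))"
  shows "e' * k = k * (e' + c * (e' - e))"
proof -
  note cl = central_left_commute[OF c]
  have kk': "k * (k' * z) = k' * (k * z)" for z by (metis kk mult.assoc)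
  let ?z = "e' * k - k * (e' + c * (e' - e))"
  have "(1 - c) * (k' * ?z) =
      - (k * (k' * e') - k' * (e' * k) - c * (k * (e * k') - k' * (e' * k)))
      - c * (k * (e * k') - k' * (k * e) - c * (k * (k' * e') - k' * (k * e)))"
    by (simp add: algebra_simps cl[of k] cl[of k'] kk')
  also have "\<dots> = 0" by (simp add: A B)
  finally have 0: "(1 - c) * (k' * ?z) = 0" .
  have "?z = k1 * (d * ((1 - c) * (k' * ?z)))"
    by (simp only: mult.assoc[symmetric] inv mult_1_left mult_1_right)
  then have "?z = 0" unfolding 0 by simp
  then show ?thesis by simp
qed

lemma exchange_kf:
  fixes k :: "'r :: ring_1"
  assumes c: "\<And>x. x * c = c * x" and inv: "k' * k1 = 1" "d * (1 - c) = 1"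
    and kk: "k * k' = k' * k"
    and A: "k * (f' * k') - f' * (k' * k) = c * (k * (f' * k') - k' * (f * k))"
    and B: "f * (k * k') - k' * (f * k) = c * (f * (k * k') - f' * (k' * k))"
  shows "k * f' = (f' + c * (f' - f)) * k"
proof -
  note cl = central_left_commute[OF c]
  have kk': "k * (k' * z) = k' * (k * z)" for z by (metis kk mult.assoc)
  let ?z = "k * f' - (f' + c * (f' - f)) * k"
  have "(1 - c) * (?z * k') =
      (k * (f' * k') - f' * (k' * k) - c * (k * (f' * k') - k' * (f * k)))
      + c * (f * (k * k') - k' * (f * k) - c * (f * (k * k') - f' * (k' * k)))"
    by (simp add: algebra_simps cl[of k] cl[of k'] kk' kk)
  also have "\<dots> = 0" by (simp add: A B)
  finally have 0: "(1 - c) * (?z * k') = 0" .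
  have "?z = d * ((1 - c) * (?z * k')) * k1"
    by (simp only: mult.assoc[symmetric] inv mult_1_left mult_1_right) (simp only: mult.assoc inv mult_1_right)
  then have "?z = 0" unfolding 0 by simp
  then show ?thesis by simp
qed

text \<open>Once all factors k are moved outwards, \<open>S1\<close> and \<open>S1'\<close> involve
  e and f only through the anticommutators \<open>M\<close> and \<open>M'\<close>. Their right sides
  agree, so k M k' = k' M' k, and this is exactly what \<open>S2\<close> needs to give the
  commutation of k with h'.\<close>

lemma exchange_ef:
  fixes k :: "'r :: ring_1"
  assumes c: "\<And>x. x * c = c * x" and inv: "k' * k2' = 1"
    and kk: "k * k' = k' * k"
    and ke: "e' * k = k * (e' + c * (e' - e))" "e * k' = k' * (e - c * (e - e'))"
    and kf: "k * f' = (f' + c * (f' - f)) * k" "k' * f = (f - c * (f - f')) * k'"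
    and S1: "k * (e * (f' * k')) + f' * (k' * (k * e)) =
      c * (k * (h' * k' - f' * (k' * e')) - k' * (h * k - f * (k * e)))"
    and S1': "k' * (e' * (f * k)) + f * (k * (k' * e')) =
      c * (k * (h' * k' - f' * (k' * e')) - k' * (h * k - f * (k * e)))"
    and S2: "k * (h' * k' - f' * (k' * e')) - (h' * k' - f' * (k' * e')) * k =
      c * (k * (e * (f' * k')) - k' * (e' * (f * k)))"
  shows "k * h' = h' * k" "k * ((e * f' + f' * e) * k') = c * (k * (h' * k') - k' * (h * k))"
proof -
  note cl = central_left_commute[OF c]
  have kk': "k * (k' * z) = k' * (k * z)" for z by (metis kk mult.assoc)
  have ke': "e' * (k * z) = k * (e' * z + c * (e' * z - e * z))" "e * (k' * z) = k' * (e * z - c * (e * z - e' * z))" for z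
    using arg_cong[OF ke(1), of "\<lambda>y. y * z"] arg_cong[OF ke(2), of "\<lambda>y. y * z"]
    by (simp_all add: algebra_simps)
  have kf': "k * (f' * z) = f' * (k * z) + c * (f' * (k * z) - f * (k * z))"
    "k' * (f * z) = f * (k' * z) - c * (f * (k' * z) - f' * (k' * z))" for z
    using arg_cong[OF kf(1), of "\<lambda>y. y * z"] arg_cong[OF kf(2), of "\<lambda>y. y * z"]
    by (simp_all add: algebra_simps)
  define M M' where "M = e * f' + f' * e" and "M' = e' * f + f * e'"
  have ef: "e * (f' * z) = M * z - f' * (e * z)" "e' * (f * z) = M' * z - f * (e' * z)" for z
    by (simp_all add: M_def M'_def algebra_simps)
  note rules = cl[of k] cl[of k'] cl[of f] cl[of f'] cl[of h] cl[of h'] c[of f] c[of f'] c[of k] c[of k']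
    kk' kk ke ke' kf kf' ef
  have 1: "k * (M * k') = c * (k * (h' * k') - k' * (h * k))"
    using S1 by (simp add: rules algebra_simps)
  then show "k * ((e * f' + f' * e) * k') = c * (k * (h' * k') - k' * (h * k))"
    by (simp add: M_def)
  have 2: "k' * (M' * k) = c * (k * (h' * k') - k' * (h * k))"
    using S1' by (simp add: rules algebra_simps)
  have "(k * h' - h' * k) * k' = c * (k * (M * k') - k' * (M' * k))"
    using S2 by (simp add: rules algebra_simps)
  also have "\<dots> = 0" by (simp add: 1 2)
  finally have "(k * h' - h' * k) * (k' * k2') = 0" by (simp flip: mult.assoc)
  then show "k * h' = h' * k" by (simp add: inv)
qed

text \<open>\<open>g\<close> is 1/(2(u - v)), \<open>c2\<close> is 1/(u - v - \<kappa>) and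
  \<open>b\<close> its inverse; c b = 1 - c - g encodes \<kappa> = 3/2. The bracket multiplied by
  \<open>c2\<close>, called \<open>K\<close> in the proof, is the trace term of R. It is eliminated
  through c (K + c2 K) = (1 - g) c2 K, and a factor 1 - c is cancelled at the end.\<close>

lemma exchange_ee:
  fixes k :: "'r :: ring_1"
  assumes g: "\<And>x. x * g = g * x" and c: "c = g + g"
    and c2: "\<And>x. x * c2 = c2 * x" and b: "\<And>x. x * b = b * x" "b * c2 = 1" "c * b = 1 - c - g"
    and inv: "k1 * k = 1" "k1' * k' = 1" "d * (1 - c) = 1"
    and kk: "k * k' = k' * k"
    and ke: "e' * k = k * (e' + c * (e' - e))" "e * k' = k' * (e - c * (e - e'))"
    and R22: "k * (e * (k' * e')) + k' * (e' * (k * e)) =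
      c * (k' * (e' * (k * e)) - k * (e * (k' * e'))) -
      c2 * (k * (k' * E') - k * (e * (k' * e')) - k * (E * k'))"
    and R13: "k * (E * k') - k' * (k * E) = c * (k * (k' * E') - k' * (k * E)) +
      c2 * (k * (k' * E') - k * (e * (k' * e')) - k * (E * k'))"
    and E: "E = - (e * e + (e0 * e + e * e0))" "E' = - (e' * e' + (e0 * e' + e' * e0))"
  shows "e * e' + e' * e = g * (e * e' - e' * e) - c * (e0 * (e - e') + (e - e') * e0) -
    g * (c * ((e - e') * (e - e')))"
proof -
  have cc: "x * c = c * x" for x using g by (simp add: c algebra_simps)
  note cl = central_left_commute[OF cc] and gl = central_left_commute[OF g]
    and c2l = central_left_commute[OF c2] and bl = central_left_commute[OF b(1)]
  have kk': "k * (k' * z) = k' * (k * z)" for z by (metis kk mult.assoc)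
  have ke': "e' * (k * z) = k * (e' * z + c * (e' * z - e * z))" "e * (k' * z) = k' * (e * z - c * (e * z - e' * z))" for z
    using arg_cong[OF ke(1), of "\<lambda>y. y * z"] arg_cong[OF ke(2), of "\<lambda>y. y * z"]
    by (simp_all add: algebra_simps)
  define K where "K = k * (k' * E') - k * (e * (k' * e')) - k * (E * k')"
  define B where "B = (1 + c) * (e * e' - c * (e * e' - e' * e')) + (1 - c) * (e' * e + c * (e' * e - e * e))"
  have 1: "k' * (k * B) = - (c2 * K)"
    using R22 by (simp add: B_def flip: K_def)
      (simp add: algebra_simps cl[of k] cl[of k'] kk' kk ke ke')
  have bK: "b * (c2 * K) = K" by (simp add: b(2) flip: mult.assoc)
  have 2: "k' * (k * ((1 - c) * (E' - E) - (e * e' - c * (e * e' - e' * e')))) = K + c2 * K"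
    using R13 by (simp add: K_def algebra_simps cl[of k] cl[of k'] kk' kk ke ke')
  have "c * K = c * (b * (c2 * K))" by (simp only: bK)
  also have "\<dots> = (1 - c - g) * (c2 * K)" by (simp only: b(3) mult.assoc[symmetric])
  finally have "c * (K + c2 * K) = (1 - g) * (c2 * K)"
    by (simp add: algebra_simps)
  then have "k' * (k * (c * ((1 - c) * (E' - E) - (e * e' - c * (e * e' - e' * e'))) + (1 - g) * B)) = 0"
    using arg_cong[OF 2, of "\<lambda>z. c * z"] arg_cong[OF 1, of "\<lambda>z. (1 - g) * z"]
    by (simp add: distrib_left cl[of k] cl[of k'] gl[of k] gl[of k'] left_diff_distrib right_diff_distrib)
  then have "k1 * (k1' * (k' * (k * (c * ((1 - c) * (E' - E) - (e * e' - c * (e * e' - e' * e'))) + (1 - g) * B)))) = 0"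
    by simp
  then have 3: "c * ((1 - c) * (E' - E) - (e * e' - c * (e * e' - e' * e'))) + (1 - g) * B = 0"
    by (simp only: mult.assoc[symmetric] inv mult_1_left)
  let ?z = "e * e' + e' * e - g * (e * e' - e' * e) + c * (e0 * (e - e') + (e - e') * e0) + g * (c * ((e - e') * (e - e')))"
  have "(1 - c) * ?z = c * ((1 - c) * (E' - E) - (e * e' - c * (e * e' - e' * e'))) + (1 - g) * B"
    by (simp add: B_def E c algebra_simps gl[of e] gl[of e'] gl[of e0] g[of e] g[of e'] g[of e0])
  then have "(1 - c) * ?z = 0" by (simp only: 3)
  then have "d * (1 - c) * ?z = 0" by (simp only: mult.assoc) simp
  then have "?z = 0" by (simp only: inv mult_1_left)
  then show ?thesis by (simp add: algebra_simps)
qed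

section \<open>The orbit of the series \<open>k\<close> under the zero modes\<close>

text \<open>The entries of T are written as commutators and anticommutators of k with the zero
  modes, arranged by weight under \<open>h0\<close>. The last two assumptions say that the orbit
  closes at its extreme entries \<open>t13\<close> and \<open>t31\<close>; this is what the cubic
  relations provide.\<close>

locale osp_orbit =
  fixes k e0 f0 h0 t11 t12 t13 t21 t22 t23 t31 t32 :: "'r :: ring_1"
  assumes h0: "h0 = e0 * f0 + f0 * e0"
    and h0_e0: "h0 * e0 = e0 * h0 + e0" and h0_f0: "h0 * f0 = f0 * h0 - f0"
    and h0_k: "h0 * k = k * h0"
    and t23: "t23 = e0 * k - k * e0" and t13: "t13 = - (e0 * t23 + t23 * e0)"
    and t32: "t32 = k * f0 - f0 * k" and t31: "t31 = f0 * t32 + t32 * f0"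
    and t22: "t22 = f0 * t23 + t23 * f0 + k" and t12: "t12 = - (f0 * t13 - t13 * f0) - t23"
    and t21: "t21 = e0 * t31 - t31 * e0 + t32" and t11: "t11 = f0 * t12 + t12 * f0 + t22"
    and e0_t13: "e0 * t13 = t13 * e0" and f0_t31: "f0 * t31 = t31 * f0"
begin

text \<open>Products are kept nested to the right, so each commutation rule is also needed in the
  form where further factors follow.\<close>

lemma assoc_eq: "x * y = z \<Longrightarrow> x * (y * a) = z * (a :: 'r)"
  by (simp flip: mult.assoc)

lemma e0_f0: "e0 * f0 = h0 - f0 * e0"
  by (simp add: h0)

lemmas nf = e0_f0 h0_e0 h0_f0 h0_k
lemmas nf' = nf nf[THEN assoc_eq]

lemma e0_k: "e0 * k = k * e0 + t23"
  by (simp add: t23)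

lemma f0_k: "f0 * k = k * f0 - t32"
  by (simp add: t32)

lemma e0_t23: "e0 * t23 = - (t23 * e0) - t13"
  by (simp add: t13)

lemma f0_t32: "f0 * t32 = t31 - t32 * f0"
  by (simp add: t31)

lemma h0_t23: "h0 * t23 = t23 * h0 + t23"
  by (simp add: t23 algebra_simps nf')

lemma h0_t32: "h0 * t32 = t32 * h0 - t32"
  by (simp add: t32 algebra_simps nf')

lemma h0_t13: "h0 * t13 = t13 * h0 + t13 + t13"
  by (simp add: t13 algebra_simps nf' h0_t23 h0_t23[THEN assoc_eq])

lemma h0_t31: "h0 * t31 = t31 * h0 - t31 - t31"
  by (simp add: t31 algebra_simps nf' h0_t32 h0_t32[THEN assoc_eq])

text \<open>{e0, [k, f0]} and {f0, [e0, k]} differ by [k, h0] = 0, so \<open>t22\<close> is reached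
  from \<open>t32\<close> by e0 as well as from \<open>t23\<close> by f0.\<close>

lemma e0_t32: "e0 * t32 = t22 - k - t32 * e0"
proof -
  have "e0 * t32 + t32 * e0 - (t22 - k) = k * h0 - h0 * k"
    by (simp add: t32 t22 t23 algebra_simps h0)
  then show ?thesis by (simp add: h0_k algebra_simps)
qed

lemma e0_t22: "e0 * t22 = t22 * e0 + t23 - t12"
  by (simp add: t22 t12 algebra_simps nf' h0_t23 e0_t23 e0_t23[THEN assoc_eq] e0_k)

lemma e0_t12: "e0 * t12 = - (t12 * e0) - t13"
  by (simp add: t12 algebra_simps nf' h0_t13 e0_t23 e0_t13 e0_t13[THEN assoc_eq])

lemma f0_t22: "f0 * t22 = t22 * f0 - t32 - t21"
proof -
  have t22': "t22 = e0 * t32 + t32 * e0 + k" by (simp add: e0_t32)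
  have f0_e0: "f0 * e0 = h0 - e0 * f0" by (simp add: h0)
  show ?thesis
    by (simp add: t22' t21 algebra_simps f0_e0 f0_e0[THEN assoc_eq] h0_t32 f0_t32 f0_t32[THEN assoc_eq] f0_k
        h0_f0)
qed

lemma f0_t21: "f0 * t21 = - (t21 * f0) - t31"
proof -
  have f0_e0: "f0 * e0 = h0 - e0 * f0" by (simp add: h0)
  show ?thesis
    by (simp add: t21 algebra_simps f0_e0 f0_e0[THEN assoc_eq] h0_t31 f0_t32 f0_t31 f0_t31[THEN assoc_eq])
qed

lemma t13': "t13 = - (e0 * (e0 * k) - k * (e0 * e0))"
  by (simp add: t13 t23 algebra_simps)

lemma t31': "t31 = - (f0 * (f0 * k) - k * (f0 * f0))"
  by (simp add: t31 t32 algebra_simps)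

lemma t11': "t11 = - (f0 * (f0 * t13) - t13 * (f0 * f0)) + k"
  by (simp add: t11 t12 t22 algebra_simps)

text \<open>\<open>t11 - k\<close> is [f0^2, [e0^2, k]], while the path through \<open>t31\<close>
  gives [e0^2, [f0^2, k]]. The two agree because [e0^2, f0^2] = -h0 commutes with k.\<close>

lemma e0_t21: "e0 * t21 = t22 - t11 - t21 * e0"
proof -
  have 1: "t11 - k = f0 * (f0 * (e0 * (e0 * k) - k * (e0 * e0))) - (e0 * (e0 * k) - k * (e0 * e0)) * (f0 * f0)"
    by (simp add: t11' t13' algebra_simps)
  have "e0 * t21 + t21 * e0 - (t22 - k) = e0 * (e0 * t31) - t31 * (e0 * e0)"
    by (simp add: t21 e0_t32 algebra_simps)
  also have "\<dots> = - (t11 - k)"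
    unfolding 1 t31' by (simp add: algebra_simps nf')
  finally show ?thesis by (simp add: algebra_simps)
qed

lemma t11'': "t11 = t22 - (e0 * t21 + t21 * e0)"
  by (simp add: e0_t21)

lemma e0_t11: "e0 * t11 = t11 * e0 - t12"
  by (simp add: t11' t12 algebra_simps nf' e0_t13 e0_t13[THEN assoc_eq] e0_k)

lemma f0_t11: "f0 * t11 = t11 * f0 - t21"
proof -
  have f0_e0: "f0 * e0 = h0 - e0 * f0" by (simp add: h0)
  have t11: "t11 = - (e0 * (e0 * t31) - t31 * (e0 * e0)) + k"
    by (simp add: t11'' t21 e0_t32 algebra_simps)
  show ?thesis
    unfolding t11
    by (simp add: t21 algebra_simps f0_e0 f0_e0[THEN assoc_eq] f0_t31 f0_t31[THEN assoc_eq] f0_k h0_f0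
        h0_e0 h0_e0[THEN assoc_eq] h0_t31)
qed

lemma f0_t23: "f0 * t23 = t22 - k - t23 * f0"
  by (simp add: t22)

lemma f0_t13: "f0 * t13 = t13 * f0 - t12 - t23"
  by (simp add: t12)

lemma e0_t31: "e0 * t31 = t31 * e0 + t21 - t32"
  by (simp add: t21)

lemma f0_t12: "f0 * t12 = t11 - t22 - t12 * f0"
  by (simp add: t11)

lemmas e0_move = e0_k e0_t11 e0_t12 e0_t13 e0_t21 e0_t22 e0_t23 e0_t31 e0_t32
lemmas f0_move = f0_k f0_t11 f0_t12 f0_t13 f0_t21 f0_t22 f0_t23 f0_t31 f0_t32

end

text \<open>\<open>u\<close> is the spectral parameter as a central element, \<open>g\<close> is 1/2
  and \<open>ht\<close> is h_1 - h_0^2/2. The action of \<open>ht\<close> is assumed on the corners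
  \<open>t13\<close> and \<open>t31\<close>, where it comes from the quadratic relations; on the
  remaining entries it is computed by moving along the orbit.\<close>

locale osp_orbit_level1 = osp_orbit +
  fixes u g e1 f1 h1 ht :: "'r :: ring_1"
  assumes u: "\<And>x. x * u = u * x" and g: "\<And>x. x * g = g * x" "g + g = 1"
    and h1: "e1 * f0 + f0 * e1 = h1" "e0 * f1 + f1 * e0 = h1" and ht: "h1 = ht + g * (h0 * h0)"
    and h0_ht: "h0 * ht = ht * h0"
    and ht_k: "ht * k = k * ht" and ht_e0: "ht * e0 = e0 * ht + e1" and ht_f0: "ht * f0 = f0 * ht - f1"
    and e1_k: "e1 * k = k * e1 + u * t23 - k * e0" and f1_k: "f1 * k = k * f1 - u * t32 + f0 * k"
    and ht_t13: "ht * t13 = t13 * ht + (u + u + 2 + g) * t13 - e0 * t23 + 4 * (e0 * (e0 * k))"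
    and ht_t31: "ht * t31 = t31 * ht - (u + u + 2 + g) * t31 - t32 * f0 + 4 * (k * (f0 * f0))"
begin

lemma ht_t23: "ht * t23 = t23 * ht + (u + 1) * t23 - e0 * k"
  by (simp add: t23 algebra_simps ht_k ht_k[THEN assoc_eq] ht_e0 ht_e0[THEN assoc_eq] e1_k)

lemma ht_t32: "ht * t32 = t32 * ht - (u + 1) * t32 + k * f0"
  by (simp add: t32 algebra_simps ht_k ht_k[THEN assoc_eq] ht_f0 ht_f0[THEN assoc_eq] f1_k)

lemma e1_f0: "e1 * f0 = ht + g * (h0 * h0) - f0 * e1"
  using h1(1) by (simp add: ht algebra_simps)

lemma f1_e0: "f1 * e0 = ht + g * (h0 * h0) - e0 * f1"
  using h1(2) by (simp add: ht algebra_simps)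

lemmas u_left = central_left_commute[OF u] and g_left = central_left_commute[OF g(1)]

lemmas ug = u[of k] u[of e0] u[of f0] u[of e1] u[of f1] u[of t11] u[of t12] u[of t13] u[of t21] u[of t22]
  u[of t23] u[of t31] u[of t32] u_left[of k] u_left[of e0] u_left[of f0] u_left[of e1] u_left[of f1]
  u_left[of t11] u_left[of t12] u_left[of t13] u_left[of t21] u_left[of t22] u_left[of t23] u_left[of t31]
  u_left[of t32] g(1)[of k] g(1)[of e0] g(1)[of f0] g(1)[of e1] g(1)[of f1] g(1)[of h0]
  g(1)[of t11] g(1)[of t12] g(1)[of t13] g(1)[of t21] g(1)[of t22]
  g(1)[of t23] g(1)[of t31] g(1)[of t32] g_left[of k] g_left[of e0] g_left[of f0] g_left[of e1] g_left[of f1]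
  g_left[of h0]
  g_left[of t11] g_left[of t12] g_left[of t13] g_left[of t21] g_left[of t22] g_left[of t23] g_left[of t31]
  g_left[of t32] g(1)[of u] g_left[of u]

lemmas level1_nf = ht_k ht_e0 ht_f0 e1_k f1_k e1_f0 f1_e0 e0_f0 h0_e0 h0_f0 h0_k h0_ht
lemmas level1_nf' = level1_nf level1_nf[THEN assoc_eq]

lemma ht_t22: "ht * t22 = t22 * ht + t23 * f0 - e0 * t32"
  by (simp add: t22 t23 t32 algebra_simps level1_nf' ug)

lemma e1_eq: "e1 = ht * e0 - e0 * ht" and f1_eq: "f1 = f0 * ht - ht * f0"
  by (simp_all add: ht_e0 ht_f0)

text \<open>Since \<open>t13\<close> is -[e0^2, k], only the commutators of f1 with e0^2 and with k
  enter.\<close>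

lemma f1_t13: "f1 * t13 = t13 * f1 - (e1 + g * (h0 * e0 + e0 * h0)) * k + k * (e1 + g * (h0 * e0 + e0 * h0)) -
    e0 * (e0 * (f0 * k - u * t32)) + (f0 * k - u * t32) * (e0 * e0)"
proof -
  have e0_e0: "f1 * (e0 * (e0 * z)) = e0 * (e0 * (f1 * z)) + (e1 + g * (h0 * e0 + e0 * h0)) * z" for z
    by (simp add: algebra_simps f1_e0[THEN assoc_eq] ht_e0[THEN assoc_eq] h0_e0 h0_e0[THEN assoc_eq] ug)
  have e0_e0': "f1 * (e0 * e0) = e0 * (e0 * f1) + (e1 + g * (h0 * e0 + e0 * h0))"
    using e0_e0[of 1] by simp
  show ?thesis
    by (simp add: t13' algebra_simps e0_e0 e0_e0' f1_k f1_k[THEN assoc_eq])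
qed

lemma e1_t31: "e1 * t31 = t31 * e1 + (f1 + g * (h0 * f0 + f0 * h0)) * k - k * (f1 + g * (h0 * f0 + f0 * h0)) -
    f0 * (f0 * (u * t23 - k * e0)) + (u * t23 - k * e0) * (f0 * f0)"
proof -
  have f0_f0: "e1 * (f0 * (f0 * z)) = f0 * (f0 * (e1 * z)) - (f1 + g * (h0 * f0 + f0 * h0)) * z" for z
    by (simp add: algebra_simps e1_f0[THEN assoc_eq] ht_f0[THEN assoc_eq] h0_f0 h0_f0[THEN assoc_eq] ug)
  have f0_f0': "e1 * (f0 * f0) = f0 * (f0 * e1) - (f1 + g * (h0 * f0 + f0 * h0))"
    using f0_f0[of 1] by simp
  show ?thesis
    by (simp add: t31' algebra_simps f0_f0 f0_f0' e1_k e1_k[THEN assoc_eq])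
qed

lemma four_times: "4 * x = x + x + x + (x :: 'r)"
proof -
  have "4 = (1 + 1 + 1 + 1 :: 'r)" by simp
  then show ?thesis by (simp only: distrib_right mult_1_left)
qed

lemma two_times: "2 * x = x + (x :: 'r)"
  by (rule mult_2)

lemma g_double: "g * x + g * x = x"
  using arg_cong[OF g(2), of "\<lambda>z. z * x"] by (simp add: distrib_right)

lemma g_double': "g * x + (g * x + y) = x + y"
  by (simp add: g_double flip: add.assoc)

lemma ht_t12: "ht * t12 = t12 * ht + (u + 1 + g) * t12 + t13 * f0 - e0 * t22 + 4 * (e0 * (e0 * t32))"
  apply (simp add: t12 algebra_simps ht_t13 ht_t13[THEN assoc_eq] ht_t23 f1_t13 ht_f0 ht_f0[THEN assoc_eq] ug
    e0_move e0_move[THEN assoc_eq] f0_t22 f0_t23 f0_t32 f0_k f0_k[THEN assoc_eq] f0_t23[THEN assoc_eq] h0_k h0_k[THEN assoc_eq] h0_e0 h0_f0 h0_t23 h0_t13 e1_k e0_f0 e0_f0[THEN assoc_eq] g_double g_double' four_times two_times)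
  done

lemma ht_t21: "ht * t21 = t21 * ht - (u + 1 + g) * t21 - t22 * f0 + 4 * (t23 * (f0 * f0)) - e0 * t31"
  apply (simp add: t21 algebra_simps ht_t31 ht_t31[THEN assoc_eq] ht_t32 e1_t31 ht_e0 ht_e0[THEN assoc_eq] ug
    f0_move f0_move[THEN assoc_eq] e0_t22 e0_t23 e0_t32 e0_k e0_k[THEN assoc_eq] e0_t32[THEN assoc_eq] h0_k h0_k[THEN assoc_eq] h0_e0 h0_f0 h0_t32 h0_t31 f1_k e0_f0 e0_f0[THEN assoc_eq] g_double g_double' four_times two_times)
  done

lemma ht_ff: "ht * (f0 * (f0 * z)) = f0 * (f0 * (ht * z)) - (f0 * f1 + f1 * f0) * z"
  by (simp add: algebra_simps ht_f0[THEN assoc_eq])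

text \<open>[ht, f0^2] is minus {f0, f1}, and \<open>t31\<close> is -[f0^2, k] with ht commuting
  with k; so this is the assumed action of ht on \<open>t31\<close> in another form.\<close>

lemma J_k: "(f0 * f1 + f1 * f0) * k = k * (f0 * f1 + f1 * f0) - (u + u + 2 + g) * t31 - t32 * f0 + 4 * (k * (f0 * f0))"
proof -
  have "ht * t31 - t31 * ht = (f0 * f1 + f1 * f0) * k - k * (f0 * f1 + f1 * f0)"
    by (simp add: t31' algebra_simps ht_f0 ht_f0[THEN assoc_eq] ht_k ht_k[THEN assoc_eq])
  then show ?thesis by (simp add: ht_t31 algebra_simps)
qed

lemma J_e0: "(f0 * f1 + f1 * f0) * e0 = e0 * (f0 * f1 + f1 * f0) + f1 + f1 + g * (h0 * f0 + f0 * h0)"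
proof -
  have h0_f1: "h0 * f1 = f1 * h0 - f1"
    by (simp add: f1_eq algebra_simps h0_f0 h0_f0[THEN assoc_eq] h0_ht h0_ht[THEN assoc_eq])
  have f0_e0: "f0 * e0 = h0 - e0 * f0" by (simp add: h0)
  show ?thesis
    by (simp add: algebra_simps f1_e0 f1_e0[THEN assoc_eq] f0_e0 f0_e0[THEN assoc_eq] ht_f0 h0_f0 h0_f0[THEN assoc_eq]
      h0_f1 ug)
qed

text \<open>As \<open>t11\<close> is k - [f0^2, t13], the action of ht requires the commutator of J
  = {f0, f1} with \<open>t13\<close>. That one is found from \<open>t13\<close> = -[e0^2, k] and the
  commutators of J with e0 and k.\<close>

lemma ht_t11: "ht * t11 = t11 * ht - t12 * f0 + 4 * (t13 * (f0 * f0)) - e0 * t21 + 4 * (e0 * (e0 * t31))"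
proof -
  define J where "J = f0 * f1 + f1 * f0"
  note Jk = J_k[folded J_def] and Je = J_e0[folded J_def]
  note J_nf = Jk Jk[THEN assoc_eq] Je Je[THEN assoc_eq] f1_e0 f1_e0[THEN assoc_eq] f1_k h0_f0 h0_f0[THEN assoc_eq] h0_k
    h0_k[THEN assoc_eq] h0_e0 h0_e0[THEN assoc_eq] ht_e0 ht_k
  have "J * t13 = - (J * (e0 * (e0 * k)) - J * (k * (e0 * e0)))"
    by (simp add: t13' algebra_simps)
  also have "\<dots> = t13 * J + (u + u + 2 + g) * (k - t11) + 4 * (k * h0) + 4 * (t13 * (f0 * f0)) + k - t22 + t23 * f0 - t12 * f0"
    apply (simp only: J_nf algebra_simps)
    apply (simp add: algebra_simps J_nf ug e0_k e0_k[THEN assoc_eq] e0_t23 e0_t23[THEN assoc_eq] e0_f0 e0_f0[THEN assoc_eq] f0_k f0_k[THEN assoc_eq] f0_t23 f0_t23[THEN assoc_eq]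
      e0_t31 e0_t32 e0_t21 e0_t22 e0_t31[THEN assoc_eq] e0_t32[THEN assoc_eq] e0_t21[THEN assoc_eq] e0_t22[THEN assoc_eq] g_double g_double' four_times two_times)
    done
  finally have J_t13: "J * t13 = t13 * J + (u + u + 2 + g) * (k - t11) + 4 * (k * h0) + 4 * (t13 * (f0 * f0)) + k - t22 + t23 * f0 - t12 * f0" .
  have "ht * t11 - t11 * ht = - (ht * (f0 * (f0 * t13)) - ht * (t13 * (f0 * f0))) + (f0 * (f0 * (t13 * ht)) - t13 * (f0 * (f0 * ht)))"
    by (simp add: t11' algebra_simps ht_k)
  also have "\<dots> = J * t13 - f0 * (f0 * (ht * t13)) + ht * t13 * (f0 * f0) + (f0 * (f0 * (t13 * ht)) - t13 * (f0 * (f0 * ht)))"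
    by (simp add: J_def algebra_simps ht_ff)
  also have "\<dots> = - (t12 * f0) + 4 * (t13 * (f0 * f0)) - e0 * t21 + 4 * (e0 * (e0 * t31))"
    apply (simp add: J_t13 ht_t13 algebra_simps ug f0_move f0_move[THEN assoc_eq] e0_move e0_move[THEN assoc_eq]
      ht_f0 ht_f0[THEN assoc_eq] e0_f0 e0_f0[THEN assoc_eq] h0_f0 h0_f0[THEN assoc_eq] h0_e0 h0_e0[THEN assoc_eq] h0_k h0_k[THEN assoc_eq] g_double g_double' four_times two_times)
    apply (simp add: J_def algebra_simps)
    done
  finally show ?thesis by (simp add: algebra_simps)
qed

end

section \<open>The graded tensor square as a ring\<close>

text \<open>A type of its own makes the graded tensor square an instance of \<open>ring_1\<close>;
  products of R, T_1, T_2 and the symmetry operators can then be treated by ring identities instead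
  of index sums.\<close>

datatype 'a tmat = TM (tm: "'a tens")

lemma tmat_eqI: "(\<And>i j k l. tm X i j k l = tm Y i j k l) \<Longrightarrow> X = Y"
  by (cases X; cases Y) (simp add: fun_eq_iff)

lemma minus_one_power_commute: "x * (- 1) ^ n = (- 1) ^ n * (x :: 'a :: ring_1)"
  by (cases "even n") simp_all

lemma minus_one_power_eq: "even (m + n) \<Longrightarrow> (- 1) ^ m = ((- 1) ^ n :: 'a :: ring_1)"
  by (cases "even m") simp_all

lemma sum_swap_pairs:
  "(\<Sum>a\<in>A. \<Sum>b\<in>B. \<Sum>c\<in>C. \<Sum>d\<in>D. f a b c d) =
    (\<Sum>c\<in>C. \<Sum>d\<in>D. \<Sum>a\<in>A. \<Sum>b\<in>B. f a b c d :: 'b :: comm_monoid_add)"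
proof -
  have "(\<Sum>a\<in>A. \<Sum>b\<in>B. \<Sum>c\<in>C. \<Sum>d\<in>D. f a b c d) = (\<Sum>a\<in>A. \<Sum>c\<in>C. \<Sum>b\<in>B. \<Sum>d\<in>D. f a b c d)"
    by (intro sum.cong refl sum.swap)
  also have "\<dots> = (\<Sum>c\<in>C. \<Sum>a\<in>A. \<Sum>b\<in>B. \<Sum>d\<in>D. f a b c d)"
    by (rule sum.swap)
  also have "\<dots> = (\<Sum>c\<in>C. \<Sum>a\<in>A. \<Sum>d\<in>D. \<Sum>b\<in>B. f a b c d)"
    by (intro sum.cong refl sum.swap)
  also have "\<dots> = (\<Sum>c\<in>C. \<Sum>d\<in>D. \<Sum>a\<in>A. \<Sum>b\<in>B. f a b c d)"
    by (intro sum.cong refl sum.swap)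
  finally show ?thesis .
qed

lemma tens_mult_assoc: "(X \<bullet> Y) \<bullet> Z = X \<bullet> (Y \<bullet> (Z :: 'a :: ring_1 tens))"
proof (intro ext)
  fix i j k l
  let ?s = "\<lambda>k b a j. (- 1) ^ ((grade k + grade b) * (grade a + grade j)) :: 'a"
  \<comment> \<open>The cocycle identity of the sign rule, checked on the parity of the
    exponents.\<close>
  have s: "?s k b a j * ?s k d c a = ?s k d c j * ?s d b a j" for a b c d
    by (simp only: power_add[symmetric], rule minus_one_power_eq) auto
  have "((X \<bullet> Y) \<bullet> Z) i j k l = (\<Sum>a\<in>UNIV. \<Sum>b\<in>UNIV. \<Sum>c\<in>UNIV. \<Sum>d\<in>UNIV.
      (?s k b a j * ?s k d c a) * (X i c k d * (Y c a d b * Z a j b l)))"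
    by (simp add: tens_mult_def sum_distrib_left sum_distrib_right mult.assoc)
  also have "\<dots> = (\<Sum>c\<in>UNIV. \<Sum>d\<in>UNIV. \<Sum>a\<in>UNIV. \<Sum>b\<in>UNIV.
      (?s k d c j * ?s d b a j) * (X i c k d * (Y c a d b * Z a j b l)))"
    unfolding s by (rule sum_swap_pairs)
  also have "\<dots> = (\<Sum>c\<in>UNIV. \<Sum>d\<in>UNIV. \<Sum>a\<in>UNIV. \<Sum>b\<in>UNIV.
      ?s k d c j * X i c k d * (?s d b a j * Y c a d b * Z a j b l))"
  proof (intro sum.cong refl)
    fix a b c d
    show "?s k d c j * ?s d b a j * (X i c k d * (Y c a d b * Z a j b l)) =
        ?s k d c j * X i c k d * (?s d b a j * Y c a d b * Z a j b l)"
      by (simp only: mult.assoc central_left_commute[OF minus_one_power_commute, of "X i c k d"])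
  qed
  also have "\<dots> = (X \<bullet> (Y \<bullet> Z)) i j k l"
    by (simp add: tens_mult_def sum_distrib_left)
  finally show "((X \<bullet> Y) \<bullet> Z) i j k l = (X \<bullet> (Y \<bullet> Z)) i j k l" .
qed

instantiation tmat :: (ring_1) ring_1
begin
definition "0 = TM (\<lambda>i j k l. 0)"
definition "1 = TM (tensor id_mat id_mat)"
definition "X + Y = TM (\<lambda>i j k l. tm X i j k l + tm Y i j k l)"
definition "X - Y = TM (\<lambda>i j k l. tm X i j k l - tm Y i j k l)"
definition "- X = TM (\<lambda>i j k l. - tm X i j k l)"
definition "X * Y = TM (tm X \<bullet> tm Y)"
instance
proof
  fix a b c :: "'a tmat"
  show "(0 :: 'a tmat) \<noteq> 1"
    by (auto simp: zero_tmat_def one_tmat_def fun_eq_iff tensor_def id_mat_def)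
  show "(a + b) * c = a * c + b * c" "a * (b + c) = a * b + a * c"
    by (simp_all add: plus_tmat_def times_tmat_def tens_mult_def fun_eq_iff distrib_left distrib_right sum.distrib)
qed (simp_all add: zero_tmat_def one_tmat_def plus_tmat_def minus_tmat_def uminus_tmat_def times_tmat_def
    tens_mult_assoc tens_mult_id algebra_simps)
end

lemma tm_simps [simp]: "tm 0 i j k l = 0" "tm (X + Y) i j k l = tm X i j k l + tm Y i j k l"
  "tm (X - Y) i j k l = tm X i j k l - tm Y i j k l" "tm (- X) i j k l = - tm X i j k l"
  by (simp_all add: zero_tmat_def plus_tmat_def minus_tmat_def uminus_tmat_def)

lemma tm_mult: "tm (X * Y) i j k l = (\<Sum>a\<in>UNIV. \<Sum>b\<in>UNIV.
    (- 1) ^ ((grade k + grade b) * (grade a + grade j)) * tm X i a k b * tm Y a j b l)"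
  by (simp add: times_tmat_def tens_mult_def)

section \<open>The three-dimensional representation and the orbit as an intertwiner\<close>

definition diag_mat :: "'a \<Rightarrow> 'a \<Rightarrow> 'a \<Rightarrow> 'a :: ring_1 mat3" where
  "diag_mat a b c i j = (if i = j then (case i of I1 \<Rightarrow> a | I2 \<Rightarrow> b | I3 \<Rightarrow> c) else 0)"

abbreviation parity_mat :: "'a :: ring_1 mat3" where "parity_mat \<equiv> diag_mat 1 (- 1) 1"

text \<open>With \<open>lower_mat\<close> these are the matrices of e_0 and f_0 in the vector
  representation; their anticommutator is E_33 - E_11, the matrix of h_0.\<close>

definition raise_mat :: "'a :: ring_1 mat3" where
  "raise_mat i j = - unit_mat I2 I1 i j - unit_mat I3 I2 i j"

definition lower_mat :: "'a :: ring_1 mat3" where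
  "lower_mat i j = unit_mat I1 I2 i j - unit_mat I2 I3 i j"

definition mat_scale :: "'a :: ring_1 \<Rightarrow> 'a mat3 \<Rightarrow> 'a mat3" where
  "mat_scale x A i j = x * A i j"

definition first :: "'a :: ring_1 mat3 \<Rightarrow> 'a tmat" where "first A = TM (tensor A id_mat)"
definition second :: "'a :: ring_1 mat3 \<Rightarrow> 'a tmat" where "second A = TM (tensor id_mat A)"

lemma first_mult: "first A * first B = first (mat_mult A B)"
  apply (rule tmat_eqI)
  subgoal for i j k l by (cases k; cases l) (auto simp: first_def tm_mult tensor_def mat_mult_def id_mat_def UNIV_idx)
  done

lemma second_mult: "second A * second B = second (mat_mult A B)"
  apply (rule tmat_eqI)
  subgoal for i j k l by (cases i; cases j) (auto simp: second_def tm_mult tensor_def mat_mult_def id_mat_def UNIV_idx)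
  done

definition mat_of :: "'a \<Rightarrow> 'a \<Rightarrow> 'a \<Rightarrow> 'a \<Rightarrow> 'a \<Rightarrow> 'a \<Rightarrow> 'a \<Rightarrow> 'a \<Rightarrow> 'a \<Rightarrow> 'a mat3" where
  "mat_of a b c d e f p q r i j =
     (case i of I1 \<Rightarrow> (case j of I1 \<Rightarrow> a | I2 \<Rightarrow> b | I3 \<Rightarrow> c)
      | I2 \<Rightarrow> (case j of I1 \<Rightarrow> d | I2 \<Rightarrow> e | I3 \<Rightarrow> f)
      | I3 \<Rightarrow> (case j of I1 \<Rightarrow> p | I2 \<Rightarrow> q | I3 \<Rightarrow> r))"

lemma mat_of_simps [simp]:
  "mat_of a b c d e f p q r I1 I1 = a" "mat_of a b c d e f p q r I1 I2 = b" "mat_of a b c d e f p q r I1 I3 = c"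
  "mat_of a b c d e f p q r I2 I1 = d" "mat_of a b c d e f p q r I2 I2 = e" "mat_of a b c d e f p q r I2 I3 = f"
  "mat_of a b c d e f p q r I3 I1 = p" "mat_of a b c d e f p q r I3 I2 = q" "mat_of a b c d e f p q r I3 I3 = r"
  by (simp_all add: mat_of_def)

lemma mat3_eqI:
  fixes A B :: "'a mat3"
  assumes "A I1 I1 = B I1 I1" "A I1 I2 = B I1 I2" "A I1 I3 = B I1 I3"
    "A I2 I1 = B I2 I1" "A I2 I2 = B I2 I2" "A I2 I3 = B I2 I3"
    "A I3 I1 = B I3 I1" "A I3 I2 = B I3 I2" "A I3 I3 = B I3 I3"
  shows "A = B"
proof (intro ext)
  fix i j show "A i j = B i j" by (cases i; cases j) (simp_all add: assms)
qed

context osp_orbit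
begin

definition orbit :: "'r mat3" where "orbit = mat_of t11 t12 t13 t21 t22 t23 t31 t32 k"

lemma orbit_raise:
  "mat_mult orbit (mat_of e0 0 0 (- 1) (- e0) 0 0 (- 1) e0) = mat_mult (mat_of e0 0 0 (- 1) (- e0) 0 0 (- 1) e0) orbit"
  by (rule mat3_eqI) (simp_all add: mat_mult_def orbit_def UNIV_idx e0_move algebra_simps)

lemma orbit_lower:
  "mat_mult orbit (mat_of f0 1 0 0 (- f0) (- 1) 0 0 f0) = mat_mult (mat_of f0 1 0 0 (- f0) (- 1) 0 0 f0) orbit"
  by (rule mat3_eqI) (simp_all add: mat_mult_def orbit_def UNIV_idx f0_move algebra_simps)

end

context osp_orbit_level1
begin

text \<open>The two matrices are images of \<open>ht\<close> under opposite coproducts, with one leg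
  in the vector representation at spectral parameter u. This is why f_0 appears on one side and e_0
  on the other, and why the left and right operators differ.\<close>

lemma orbit_level1:
  "mat_mult orbit (mat_of (ht - (u + u + 2 + g)) 0 0 (- f0) (ht - (u + 1)) 0 (4 * (f0 * f0)) f0 ht) =
   mat_mult (mat_of (ht - (u + u + 2 + g)) e0 (- (4 * (e0 * e0))) 0 (ht - (u + 1)) e0 0 0 ht) orbit"
proof -
  have four: "x * (4 * y) = 4 * (x * y)" for x y :: 'r
    by (simp add: four_times algebra_simps)
  show ?thesis
    by (rule mat3_eqI)
      (simp_all add: mat_mult_def orbit_def UNIV_idx algebra_simps ug ht_k ht_t11 ht_t12 ht_t13 ht_t21 ht_t22 ht_t23 ht_t31
        ht_t32 four mult_2 mult_2_right)
qed

end

lemma quadruple: "4 * x = x + x + x + (x :: 'r :: ring_1)"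
proof -
  have "4 = (1 + 1 + 1 + 1 :: 'r)" by simp
  then show ?thesis by (simp only: distrib_right mult_1_left)
qed

lemma quadruple_right: "x * 4 = x + x + x + (x :: 'r :: ring_1)"
proof -
  have "4 = (1 + 1 + 1 + 1 :: 'r)" by simp
  then show ?thesis by (simp only: distrib_left mult_1_right)
qed

text \<open>The part of the coproduct of \<open>h\<^sub>1 - h\<^sub>0\<^sup>2/2\<close> that is not primitive.\<close>

definition twist :: "'r \<Rightarrow> 'r \<Rightarrow> 'r :: ring_1" where
  "twist x y = x * y + 4 * (x * (x * (y * y)))"

text \<open>Anticommuting summands have no cross term in their square, so the quadratic part of
  \<open>twist\<close> is additive too. This lets the mixed terms of a threefold coproduct be
  regrouped.\<close>

lemma twist_add_left:
  assumes "x * x' + x' * x = 0"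
  shows "twist (x + x') y = twist x y + twist x' y"
proof -
  have "x * (x' * z) = - (x' * (x * z))" for z
    using arg_cong[OF assms, of "\<lambda>a. a * z"] by (simp add: distrib_right mult.assoc eq_neg_iff_add_eq_0)
  then show ?thesis by (simp add: twist_def algebra_simps)
qed

lemma twist_add_right:
  assumes "y * y' + y' * y = 0"
  shows "twist x (y + y') = twist x y + twist x y'"
proof -
  have "y * y' = - (y' * y)"
    using assms by (simp add: eq_neg_iff_add_eq_0)
  then show ?thesis by (simp add: twist_def algebra_simps)
qed

lemma commute_twist:
  assumes "t * x = x * t" "t * y = y * t"
  shows "t * twist x y = twist x y * t"
proof -
  have "t * (x * z) = x * (t * z)" "t * (y * z) = y * (t * z)" for z
    using assms by (metis mult.assoc)+
  then show ?thesis by (simp add: twist_def quadruple algebra_simps assms)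
qed

text \<open>The parity matrix in the other leg compensates the sign of the graded product, so that
  operators of one leg commute with \<open>first t\<close> or \<open>second t\<close> of the other
  leg for every matrix \<open>t\<close>. \<open>odd_elem\<close> carries both parity matrices
  because algebra entries commute with matrix units without sign.\<close>

definition raise1 :: "'r :: ring_1 tmat" where "raise1 = TM (tensor raise_mat parity_mat)"
definition raise2 :: "'r :: ring_1 tmat" where "raise2 = TM (tensor parity_mat raise_mat)"
definition lower1 :: "'r :: ring_1 tmat" where "lower1 = TM (tensor lower_mat parity_mat)"
definition lower2 :: "'r :: ring_1 tmat" where "lower2 = TM (tensor parity_mat lower_mat)"
definition odd_elem :: "'r \<Rightarrow> 'r :: ring_1 tmat" where
  "odd_elem x = TM (\<lambda>i j k l. parity_mat i j * parity_mat k l * x)"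
definition even_elem :: "'r \<Rightarrow> 'r :: ring_1 tmat" where
  "even_elem x = TM (\<lambda>i j k l. id_mat i j * id_mat k l * x)"

lemmas tmat_defs = raise1_def raise2_def lower1_def lower2_def odd_elem_def even_elem_def first_def second_def
  tensor_def raise_mat_def lower_mat_def unit_mat_def id_mat_def diag_mat_def

lemma tmat_eqI_cases:
  assumes "\<And>i j k l. i \<in> {I1, I2, I3} \<Longrightarrow> j \<in> {I1, I2, I3} \<Longrightarrow> k \<in> {I1, I2, I3} \<Longrightarrow> l \<in> {I1, I2, I3} \<Longrightarrow>
    tm X i j k l = tm Y i j k l"
  shows "X = Y"
  by (rule tmat_eqI) (metis UNIV_I UNIV_idx assms)

lemma raise_anticommute:
  "raise1 * raise2 + raise2 * raise1 = (0 :: 'r :: ring_1 tmat)"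
  "raise1 * odd_elem x + odd_elem x * raise1 = (0 :: 'r tmat)"
  "raise2 * odd_elem x + odd_elem x * raise2 = (0 :: 'r tmat)"
  by (rule tmat_eqI_cases, auto simp: tm_mult UNIV_idx tmat_defs)+

lemma lower_anticommute:
  "lower1 * lower2 + lower2 * lower1 = (0 :: 'r :: ring_1 tmat)"
  "lower1 * odd_elem x + odd_elem x * lower1 = (0 :: 'r tmat)"
  "lower2 * odd_elem x + odd_elem x * lower2 = (0 :: 'r tmat)"
  by (rule tmat_eqI_cases, auto simp: tm_mult UNIV_idx tmat_defs)+

lemma odd_elem_mult: "odd_elem x * odd_elem y = even_elem (x * y)"
  by (rule tmat_eqI_cases) (auto simp: tm_mult UNIV_idx tmat_defs)

lemma first_commute:
  "first t * raise2 = raise2 * first t" "first t * lower2 = lower2 * first t"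
  "first t * second parity_mat = second parity_mat * first t"
  by (rule tmat_eqI_cases, auto simp: tm_mult UNIV_idx tmat_defs)+

lemma second_commute:
  "second t * raise1 = raise1 * second t" "second t * lower1 = lower1 * second t"
  "second t * first parity_mat = first parity_mat * second t"
  by (rule tmat_eqI_cases, auto simp: tm_mult UNIV_idx tmat_defs)+

lemma raise_split:
  "raise1 + odd_elem e = first (mat_of e 0 0 (- 1) (- e) 0 0 (- 1) e) * second parity_mat"
  "raise2 + odd_elem e = second (mat_of e 0 0 (- 1) (- e) 0 0 (- 1) e) * first parity_mat"
  by (rule tmat_eqI_cases, auto simp: tm_mult UNIV_idx tmat_defs)+

lemma lower_split:
  "lower1 + odd_elem f = first (mat_of f 1 0 0 (- f) (- 1) 0 0 f) * second parity_mat"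
  "lower2 + odd_elem f = second (mat_of f 1 0 0 (- f) (- 1) 0 0 f) * first parity_mat"
  by (rule tmat_eqI_cases, auto simp: tm_mult UNIV_idx tmat_defs)+

lemma first_diag_commute:
  assumes "\<And>x. x * a = a * x" "\<And>x. x * b = b * x" "\<And>x. x * c = c * x"
  shows "second t * first (diag_mat a b c) = first (diag_mat a b c) * second t"
    "first t * second (diag_mat a b c) = second (diag_mat a b c) * first t"
  by (rule tmat_eqI_cases, auto simp: tm_mult UNIV_idx tmat_defs assms)+

lemma twist_alt: "twist x y = x * y + 4 * (x * x * (y * y))"
  by (simp add: twist_def mult.assoc)

lemma raise_squared:
  "raise1 * raise1 = first (unit_mat I3 I1)" "raise2 * raise2 = second (unit_mat I3 I1)"
  by (rule tmat_eqI_cases, auto simp: tm_mult UNIV_idx tmat_defs)+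

lemma lower_squared:
  "lower1 * lower1 = - first (unit_mat I1 I3)" "lower2 * lower2 = - second (unit_mat I1 I3)"
  by (rule tmat_eqI_cases, auto simp: tm_mult UNIV_idx tmat_defs)+

lemma level1_right_split:
  "first (mat_of (z - a) 0 0 (- f) (z - b) 0 (4 * (f * f)) f z) =
    even_elem z - first (diag_mat a b 0) + twist raise1 (odd_elem f)"
  "second (mat_of (z - a) 0 0 (- f) (z - b) 0 (4 * (f * f)) f z) =
    even_elem z - second (diag_mat a b 0) + twist raise2 (odd_elem f)"
  unfolding twist_alt raise_squared odd_elem_mult quadruple
  by (rule tmat_eqI_cases, auto simp: tm_mult UNIV_idx tmat_defs)+

lemma level1_left_split:
  "first (mat_of (z - a) e (- (4 * (e * e))) 0 (z - b) e 0 0 z) =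
    even_elem z - first (diag_mat a b 0) + twist (odd_elem e) lower1"
  "second (mat_of (z - a) e (- (4 * (e * e))) 0 (z - b) e 0 0 z) =
    even_elem z - second (diag_mat a b 0) + twist (odd_elem e) lower2"
  unfolding twist_alt lower_squared odd_elem_mult quadruple
  by (rule tmat_eqI_cases, auto simp: tm_mult UNIV_idx tmat_defs algebra_simps)+

lemma twist_raise_lower:
  "twist raise1 lower2 = (TM (\<lambda>i j k l.
     (unit_mat I3 I2 i j - unit_mat I2 I1 i j) * (unit_mat I1 I2 k l + unit_mat I2 I3 k l)
     - 4 * (unit_mat I3 I1 i j * unit_mat I1 I3 k l)) :: 'r :: ring_1 tmat)"
  "twist raise2 lower1 = (TM (\<lambda>i j k l.
     (unit_mat I1 I2 i j + unit_mat I2 I3 i j) * (unit_mat I2 I1 k l - unit_mat I3 I2 k l)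
     - 4 * (unit_mat I1 I3 i j * unit_mat I3 I1 k l)) :: 'r tmat)"
  unfolding twist_alt lower_squared raise_squared quadruple
  by (rule tmat_eqI_cases, auto simp: tm_mult UNIV_idx tmat_defs algebra_simps)+

text \<open>\<open>c\<close> and \<open>c2\<close> stand for \<open>1/w\<close> and \<open>1/(w - \<kappa>)\<close>.\<close>

definition rmat :: "'r \<Rightarrow> 'r \<Rightarrow> 'r :: ring_1 tmat" where
  "rmat c c2 = TM (\<lambda>i j k l. id_mat i j * id_mat k l - c * P_tens i j k l + c2 * P_t1_tens i j k l)"

lemma P_tens_eq: "P_tens i j k l = ((- 1) ^ grade j * (unit_mat k i j l * id_mat i i) :: 'r :: ring_1)"
  by (cases i; cases j; cases k; cases l) (simp_all add: P_tens_def UNIV_idx tensor_def unit_mat_def id_mat_def)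

lemma P_t1_tens_eq:
  "P_t1_tens i j k l = ((- 1) ^ (grade k + grade i * grade j + grade i) * (J_mat i k * J_mat j l) :: 'r :: ring_1)"
  by (cases i; cases j; cases k; cases l)
    (simp_all add: P_t1_tens_def super_transpose_def UNIV_idx tensor_def unit_mat_def id_mat_def J_mat_def)

context
  fixes c c2 :: "'r :: ring_1"
  assumes c: "\<And>x. x * c = c * x" and c2: "\<And>x. x * c2 = c2 * x"
begin

lemma rmat_raise: "rmat c c2 * (raise1 + raise2) = (raise1 + raise2) * rmat c c2"
  by (rule tmat_eqI_cases)
    (auto simp: tm_mult UNIV_idx tmat_defs rmat_def P_tens_eq P_t1_tens_eq J_mat_def)

lemma rmat_lower: "rmat c c2 * (lower1 + lower2) = (lower1 + lower2) * rmat c c2"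
  by (rule tmat_eqI_cases)
    (auto simp: tm_mult UNIV_idx tmat_defs rmat_def P_tens_eq P_t1_tens_eq J_mat_def)

lemma rmat_elem: "rmat c c2 * odd_elem x = odd_elem x * rmat c c2"
  "rmat c c2 * even_elem x = even_elem x * rmat c c2"
  by (rule tmat_eqI_cases,
    auto simp: tm_mult UNIV_idx tmat_defs rmat_def P_tens_eq P_t1_tens_eq J_mat_def algebra_simps c[of x] c2[of x])+

text \<open>The assumptions say \<open>c\<close> = 1/(u - v) and \<open>c2\<close> = 1/(u - v -
  \<kappa>) with \<kappa> = 1 + g. Commutation with the zero modes holds for any central
  \<open>c\<close> and \<open>c2\<close>; the dependence of R on the spectral parameters enters
  here, where R exchanges the mixed terms of the two opposite coproducts.\<close>

lemma rmat_level1: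
  fixes u v g :: 'r
  assumes u: "c * u = 1 + c * v" "c2 * u = 1 + c2 * v + c2 + c2 * g" and g: "g + g = 1"
    and central: "\<And>x. x * u = u * x" "\<And>x. x * v = v * x" "\<And>x. x * g = g * x"
  defines "a \<equiv> first (diag_mat (u + u + 2 + g) (u + 1) 0) + second (diag_mat (v + v + 2 + g) (v + 1) 0)"
  shows "rmat c c2 * (twist raise1 lower2 - a) = (twist raise2 lower1 - a) * rmat c c2"
proof -
  have gd: "c * (g * 2) = c" "c2 * (g * 2) = c2" "c * g + c * g = c" "c2 * g + c2 * g = c2"
    "c * g + (c * g + x) = c + x" "c2 * g + (c2 * g + x) = c2 + x" "g + (g + x) = 1 + x" for x
    using g by (simp_all add: mult_2_right flip: distrib_left add.assoc)
  note cc = c[of u] c[of v] c[of g] c2[of u] c2[of v] c2[of g]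
  show ?thesis
    unfolding a_def twist_raise_lower quadruple
    apply (rule tmat_eqI_cases)
    apply (auto simp: tm_mult UNIV_idx tmat_defs rmat_def P_tens_eq P_t1_tens_eq J_mat_def algebra_simps cc u gd g
        quadruple_right mult_2 mult_2_right)
    done
qed

end

text \<open>The matrix is \<open>e\<close> times the parity matrix plus \<open>raise_mat\<close>:
  the coproduct of e_0 with one leg in the vector representation.\<close>

definition commutes_raise :: "'r \<Rightarrow> 'r :: ring_1 mat3 \<Rightarrow> bool" where
  "commutes_raise e t \<longleftrightarrow>
    mat_mult t (mat_of e 0 0 (- 1) (- e) 0 0 (- 1) e) = mat_mult (mat_of e 0 0 (- 1) (- e) 0 0 (- 1) e) t"

definition commutes_lower :: "'r \<Rightarrow> 'r :: ring_1 mat3 \<Rightarrow> bool" where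
  "commutes_lower f t \<longleftrightarrow>
    mat_mult t (mat_of f 1 0 0 (- f) (- 1) 0 0 f) = mat_mult (mat_of f 1 0 0 (- f) (- 1) 0 0 f) t"

definition intertwines_level1 :: "'r \<Rightarrow> 'r \<Rightarrow> 'r \<Rightarrow> 'r \<Rightarrow> 'r \<Rightarrow> 'r :: ring_1 mat3 \<Rightarrow> bool" where
  "intertwines_level1 g e f z u t \<longleftrightarrow>
    mat_mult t (mat_of (z - (u + u + 2 + g)) 0 0 (- f) (z - (u + 1)) 0 (4 * (f * f)) f z) =
    mat_mult (mat_of (z - (u + u + 2 + g)) e (- (4 * (e * e))) 0 (z - (u + 1)) e 0 0 z) t"

text \<open>Values of T at two points. Apart from the symmetries the only input is the commutation
  of the corner entries \<open>t33\<close>. The elements u - v - 1 and u - v - 1 - g that must be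
  cancelled are the differences of level one weights met while descending through the
  columns.\<close>

locale level1_pair =
  fixes c c2 u v g e f z :: "'r :: ring_1" and t t' :: "'r mat3"
  assumes c: "\<And>x. x * c = c * x" and c2: "\<And>x. x * c2 = c2 * x"
    and u: "\<And>x. x * u = u * x" and v: "\<And>x. x * v = v * x"
    and g: "\<And>x. x * g = g * x" "g + g = 1"
    and cu: "c * u = 1 + c * v" "c2 * u = 1 + c2 * v + c2 + c2 * g"
    and raise: "commutes_raise e t" "commutes_raise e t'"
    and lower: "commutes_lower f t" "commutes_lower f t'"
    and level1: "intertwines_level1 g e f z u t" "intertwines_level1 g e f z v t'"
    and t33: "t I3 I3 * t' I3 I3 = t' I3 I3 * t I3 I3"
    and cancel: "\<And>x. (u - v - 1) * x = 0 \<Longrightarrow> x = 0" "\<And>x. (u - v - 1 - g) * x = 0 \<Longrightarrow> x = 0"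
begin

definition "a1 = first (diag_mat (u + u + 2 + g) (u + 1) 0)"
definition "a2 = second (diag_mat (v + v + 2 + g) (v + 1) 0)"

lemma diag_central: "x * (u + u + 2 + g) = (u + u + 2 + g) * x" "x * (u + 1) = (u + 1) * x"
    "x * (v + v + 2 + g) = (v + v + 2 + g) * x" "x * (v + 1) = (v + 1) * x" "x * 0 = 0 * x"
  by (simp_all add: algebra_simps u v g mult_2 mult_2_right)

lemma first_raise: "first t * (raise1 + odd_elem e) = (raise1 + odd_elem e) * first t"
  unfolding raise_split using raise(1)
  by (metis (no_types, lifting) commutes_raise_def first_mult first_commute(3) mult.assoc)

lemma second_raise: "second t' * (raise2 + odd_elem e) = (raise2 + odd_elem e) * second t'"
  unfolding raise_split using raise(2)
  by (metis (no_types, lifting) commutes_raise_def second_mult second_commute(3) mult.assoc)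

lemma first_lower: "first t * (lower1 + odd_elem f) = (lower1 + odd_elem f) * first t"
  unfolding lower_split using lower(1)
  by (metis (no_types, lifting) commutes_lower_def first_mult first_commute(3) mult.assoc)

lemma second_lower: "second t' * (lower2 + odd_elem f) = (lower2 + odd_elem f) * second t'"
  unfolding lower_split using lower(2)
  by (metis (no_types, lifting) commutes_lower_def second_mult second_commute(3) mult.assoc)

lemma first_level1:
  "first t * (even_elem z - a1 + twist raise1 (odd_elem f)) = (even_elem z - a1 + twist (odd_elem e) lower1) * first t"
  using level1(1) by (simp only: a1_def level1_right_split[symmetric] level1_left_split[symmetric] first_mult intertwines_level1_def)

lemma second_level1:
  "second t' * (even_elem z - a2 + twist raise2 (odd_elem f)) = (even_elem z - a2 + twist (odd_elem e) lower2) * second t'"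
  using level1(2) by (simp only: a2_def level1_right_split[symmetric] level1_left_split[symmetric] second_mult intertwines_level1_def)

lemma first_a2: "first t * a2 = a2 * first t" and second_a1: "second t' * a1 = a1 * second t'"
  unfolding a1_def a2_def
  by (rule first_diag_commute[OF diag_central(3,4,5)], rule first_diag_commute[OF diag_central(1,2,5)])

text \<open>The level one operator on both legs without its mixed term. The mixed term,
  \<open>twist raise1 lower2\<close> or \<open>twist raise2 lower1\<close>, depends on the order of
  the legs and is the part that R exchanges.\<close>

definition "dright = even_elem z - a1 - a2 + twist raise1 (odd_elem f) + twist raise2 (odd_elem f)"
definition "dleft = even_elem z - a1 - a2 + twist (odd_elem e) lower1 + twist (odd_elem e) lower2"

text \<open>By additivity of \<open>twist\<close>, \<open>second t'\<close> commutes with the terms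
  built from \<open>raise1\<close> and the full lowering operator of leg 2, and
  \<open>first t\<close> with those built from the full raising operator of leg 1 and
  \<open>lower2\<close>. Each factor then meets only its own level one relation.\<close>

lemma product_level1:
  "first t * second t' * (dright + twist raise1 lower2) = (dleft + twist raise1 lower2) * (first t * second t')"
proof -
  have 1: "second t' * (twist raise1 (odd_elem f) + twist raise1 lower2 - a1) =
      (twist raise1 (odd_elem f) + twist raise1 lower2 - a1) * second t'"
    using commute_twist[OF second_commute(1) second_lower]
    by (simp add: twist_add_right[OF lower_anticommute(3)] algebra_simps second_a1)
  have 2: "first t * (twist (odd_elem e) lower2 + twist raise1 lower2 - a2) =
      (twist (odd_elem e) lower2 + twist raise1 lower2 - a2) * first t"
    using commute_twist[OF first_raise first_commute(2)]
    by (simp add: twist_add_left[OF raise_anticommute(2)] algebra_simps first_a2)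
  have "second t' * (dright + twist raise1 lower2) =
      second t' * (even_elem z - a2 + twist raise2 (odd_elem f)) + second t' * (twist raise1 (odd_elem f) + twist raise1 lower2 - a1)"
    by (simp add: dright_def algebra_simps)
  also have "\<dots> = ((twist (odd_elem e) lower2 + twist raise1 lower2 - a2) + (even_elem z - a1 + twist raise1 (odd_elem f))) * second t'"
    unfolding 1 second_level1 by (simp add: algebra_simps)
  finally have 3: "second t' * (dright + twist raise1 lower2) =
      ((twist (odd_elem e) lower2 + twist raise1 lower2 - a2) + (even_elem z - a1 + twist raise1 (odd_elem f))) * second t'" .
  have "first t * second t' * (dright + twist raise1 lower2) =
      (first t * (twist (odd_elem e) lower2 + twist raise1 lower2 - a2) +
       first t * (even_elem z - a1 + twist raise1 (odd_elem f))) * second t'"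
    unfolding mult.assoc[of "first t" "second t'"] mult.assoc[of "second t'" "first t"] 3
    by (simp only: mult.assoc[symmetric] distrib_left[symmetric])
  also have "\<dots> = (dleft + twist raise1 lower2) * (first t * second t')"
    unfolding 2 first_level1 by (simp add: dleft_def algebra_simps)
  finally show ?thesis .
qed

lemma product_level1':
  "second t' * first t * (dright + twist raise2 lower1) = (dleft + twist raise2 lower1) * (second t' * first t)"
proof -
  have 1: "first t * (twist raise2 (odd_elem f) + twist raise2 lower1 - a2) =
      (twist raise2 (odd_elem f) + twist raise2 lower1 - a2) * first t"
    using commute_twist[OF first_commute(1) first_lower]
    by (simp add: twist_add_right[OF lower_anticommute(2)] algebra_simps first_a2)
  have 2: "second t' * (twist (odd_elem e) lower1 + twist raise2 lower1 - a1) =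
      (twist (odd_elem e) lower1 + twist raise2 lower1 - a1) * second t'"
    using commute_twist[OF second_raise second_commute(2)]
    by (simp add: twist_add_left[OF raise_anticommute(3)] algebra_simps second_a1)
  have "first t * (dright + twist raise2 lower1) =
      first t * (even_elem z - a1 + twist raise1 (odd_elem f)) + first t * (twist raise2 (odd_elem f) + twist raise2 lower1 - a2)"
    by (simp add: dright_def algebra_simps)
  also have "\<dots> = ((twist (odd_elem e) lower1 + twist raise2 lower1 - a1) + (even_elem z - a2 + twist raise2 (odd_elem f))) * first t"
    unfolding 1 first_level1 by (simp add: algebra_simps)
  finally have 3: "first t * (dright + twist raise2 lower1) =
      ((twist (odd_elem e) lower1 + twist raise2 lower1 - a1) + (even_elem z - a2 + twist raise2 (odd_elem f))) * first t" .
  have "second t' * first t * (dright + twist raise2 lower1) =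
      (second t' * (twist (odd_elem e) lower1 + twist raise2 lower1 - a1) +
       second t' * (even_elem z - a2 + twist raise2 (odd_elem f))) * first t"
    unfolding mult.assoc[of "first t" "second t'"] mult.assoc[of "second t'" "first t"] 3
    by (simp only: mult.assoc[symmetric] distrib_left[symmetric])
  also have "\<dots> = (dleft + twist raise2 lower1) * (second t' * first t)"
    unfolding 2 second_level1 by (simp add: dleft_def algebra_simps)
  finally show ?thesis .
qed

abbreviation "R \<equiv> rmat c c2"

lemmas rmat_raise' = rmat_raise[OF c c2] and rmat_lower' = rmat_lower[OF c c2]
lemmas rmat_elem' = rmat_elem[OF c c2] and rmat_level1' = rmat_level1[OF c c2 cu g(2) u v g(1), folded a1_def a2_def]

lemma rmat_dright: "R * (dright + twist raise1 lower2) = (dright + twist raise2 lower1) * R"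
proof -
  have "R * (twist raise1 (odd_elem f) + twist raise2 (odd_elem f)) = (twist raise1 (odd_elem f) + twist raise2 (odd_elem f)) * R"
    using commute_twist[OF rmat_raise' rmat_elem'(1)] by (simp add: twist_add_left[OF raise_anticommute(1)])
  then show ?thesis
    using rmat_level1' rmat_elem'(2)[of z] by (simp add: dright_def algebra_simps)
qed

lemma rmat_dleft: "R * (dleft + twist raise1 lower2) = (dleft + twist raise2 lower1) * R"
proof -
  have "R * (twist (odd_elem e) lower1 + twist (odd_elem e) lower2) = (twist (odd_elem e) lower1 + twist (odd_elem e) lower2) * R"
    using commute_twist[OF rmat_elem'(1) rmat_lower'] by (simp add: twist_add_right[OF lower_anticommute(1)])
  then show ?thesis
    using rmat_level1' rmat_elem'(2)[of z] by (simp add: dleft_def algebra_simps)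
qed

text \<open>The defect of the exchange relation. It inherits all three symmetries, so its entries
  satisfy linear relations that force them to vanish one after another.\<close>

definition "W = R * (first t * second t') - second t' * first t * R"

lemma W_level1: "W * (dright + twist raise1 lower2) = (dleft + twist raise2 lower1) * W"
proof -
  have "W * (dright + twist raise1 lower2) =
      R * (first t * second t' * (dright + twist raise1 lower2)) - second t' * first t * (R * (dright + twist raise1 lower2))"
    by (simp add: W_def left_diff_distrib mult.assoc)
  also have "\<dots> = (R * (dleft + twist raise1 lower2)) * (first t * second t') -
      (second t' * first t * (dright + twist raise2 lower1)) * R"
    unfolding product_level1 rmat_dright by (simp only: mult.assoc)
  also have "\<dots> = (dleft + twist raise2 lower1) * W"
    unfolding product_level1' rmat_dleft W_def by (simp only: right_diff_distrib mult.assoc)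
  finally show ?thesis .
qed

lemma commutes_product:
  assumes "R * x = x * R" "first t * x = x * first t" "second t' * x = x * second t'"
  shows "W * x = x * W"
proof -
  have a: "R * (x * y) = x * (R * y)" "first t * (x * y) = x * (first t * y)" "second t' * (x * y) = x * (second t' * y)" for y
    using assms by (metis mult.assoc)+
  show ?thesis by (simp add: W_def algebra_simps assms a)
qed

lemma W_raise: "W * (raise1 + raise2 + odd_elem e) = (raise1 + raise2 + odd_elem e) * W"
proof (rule commutes_product)
  show "R * (raise1 + raise2 + odd_elem e) = (raise1 + raise2 + odd_elem e) * R"
    using rmat_raise' rmat_elem'(1)[of e] by (simp add: algebra_simps)
  show "first t * (raise1 + raise2 + odd_elem e) = (raise1 + raise2 + odd_elem e) * first t"
    using first_raise first_commute(1)[of t] by (simp add: algebra_simps)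
  show "second t' * (raise1 + raise2 + odd_elem e) = (raise1 + raise2 + odd_elem e) * second t'"
    using second_raise second_commute(1)[of t'] by (simp add: algebra_simps)
qed

lemma W_lower: "W * (lower1 + lower2 + odd_elem f) = (lower1 + lower2 + odd_elem f) * W"
proof (rule commutes_product)
  show "R * (lower1 + lower2 + odd_elem f) = (lower1 + lower2 + odd_elem f) * R"
    using rmat_lower' rmat_elem'(1)[of f] by (simp add: algebra_simps)
  show "first t * (lower1 + lower2 + odd_elem f) = (lower1 + lower2 + odd_elem f) * first t"
    using first_lower first_commute(2)[of t] by (simp add: algebra_simps)
  show "second t' * (lower1 + lower2 + odd_elem f) = (lower1 + lower2 + odd_elem f) * second t'"
    using second_lower second_commute(2)[of t'] by (simp add: algebra_simps)
qed

text \<open>At this corner the trace part of R has no entry and the permutation part is diagonal, so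
  the entry is a multiple of the commutator of the two corner entries.\<close>

lemma W_33: "tm W I3 I3 I3 I3 = 0"
  by (simp add: W_def tm_mult UNIV_idx first_def second_def tensor_def id_mat_def rmat_def P_tens_eq P_t1_tens_eq J_mat_def
      unit_mat_def algebra_simps t33 c[of "t I3 I3"] c[of "t' I3 I3"] central_left_commute[OF c])

lemma level1_right_eq:
  "dright + twist raise1 lower2 =
    first (mat_of (z - (u + u + 2 + g)) 0 0 (- f) (z - (u + 1)) 0 (4 * (f * f)) f z) +
    second (mat_of (z - (v + v + 2 + g)) 0 0 (- f) (z - (v + 1)) 0 (4 * (f * f)) f z) - even_elem z +
    twist raise1 lower2"
  by (simp add: level1_right_split dright_def a1_def a2_def)

lemma level1_left_eq:
  "dleft + twist raise2 lower1 =
    first (mat_of (z - (u + u + 2 + g)) e (- (4 * (e * e))) 0 (z - (u + 1)) e 0 0 z) +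
    second (mat_of (z - (v + v + 2 + g)) e (- (4 * (e * e))) 0 (z - (v + 1)) e 0 0 z) - even_elem z +
    twist raise2 lower1"
  by (simp add: level1_left_split dleft_def a1_def a2_def)

lemmas W_raise_at = arg_cong[OF W_raise, of "\<lambda>X. tm X i j k l" for i j k l]
lemmas W_level1_at = arg_cong[OF W_level1, of "\<lambda>X. tm X i j k l" for i j k l,
    unfolded level1_right_eq level1_left_eq, unfolded twist_raise_lower]

text \<open>The raising operator links the two entries up to sign. Two level one relations then give
  the commutator of \<open>z\<close> with the same entry, once with coefficient u and once with v +
  1; subtracting them leaves u - v - 1.\<close>

lemma W_col_33_a: "tm W I2 I3 I3 I3 = 0" "tm W I3 I3 I2 I3 = 0"
proof -
  have b: "tm W I3 I3 I2 I3 = - tm W I2 I3 I3 I3"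
    using W_raise_at[of I3 I3 I3 I3] W_33 by (simp add: tm_mult UNIV_idx tmat_defs)
  have 1: "z * tm W I2 I3 I3 I3 = tm W I2 I3 I3 I3 * z + (u + 1) * tm W I2 I3 I3 I3 - tm W I2 I3 I3 I3"
    using W_level1_at[of I2 I3 I3 I3] W_33 b by (simp add: tm_mult UNIV_idx tmat_defs algebra_simps)
  have 2: "z * tm W I2 I3 I3 I3 = tm W I2 I3 I3 I3 * z + (v + 1) * tm W I2 I3 I3 I3"
    using W_level1_at[of I3 I3 I2 I3] W_33 b by (simp add: tm_mult UNIV_idx tmat_defs algebra_simps)
  have "(u - v - 1) * tm W I2 I3 I3 I3 = 0"
    using 1 unfolding 2 by (simp add: algebra_simps)
  then show "tm W I2 I3 I3 I3 = 0" by (rule cancel(1))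
  with b show "tm W I3 I3 I2 I3 = 0" by simp
qed

end

context level1_pair
begin

lemma W_col_33_b: "tm W I2 I3 I2 I3 = 0" "tm W I1 I3 I3 I3 = 0" "tm W I3 I3 I1 I3 = 0"
proof -
  note 0 = W_33 W_col_33_a
  let ?p = "tm W I2 I3 I2 I3"
  have "- tm W I1 I3 I3 I3 = ?p"
    using W_raise_at[of I2 I3 I3 I3] 0 by (simp add: tm_mult UNIV_idx tmat_defs)
  then have q: "tm W I1 I3 I3 I3 = - ?p" by (metis minus_minus)
  have r: "tm W I3 I3 I1 I3 = ?p"
    using W_raise_at[of I3 I3 I2 I3] 0 by (simp add: tm_mult UNIV_idx tmat_defs)
  have 1: "z * ?p = ?p * z + (u + v + 1) * ?p"
    using W_level1_at[of I2 I3 I2 I3] 0 q r by (simp add: tm_mult UNIV_idx tmat_defs algebra_simps)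
  have 2: "z * ?p = ?p * z + (u + u + 2 + g) * ?p - ?p - ?p - ?p"
    using W_level1_at[of I1 I3 I3 I3] 0 q r by (simp add: tm_mult UNIV_idx tmat_defs algebra_simps quadruple)
  have "(u - v - 1 - g) * ?p = (u + u + 2 + g) * ?p - ?p - ?p - ?p - (u + v + 1) * ?p - (g + g) * ?p + ?p"
    by (simp add: algebra_simps mult_2)
  also have "\<dots> = 0"
    using 1 unfolding 2 by (simp add: algebra_simps g(2))
  finally show "?p = 0" by (rule cancel(2))
  with q r show "tm W I1 I3 I3 I3 = 0" "tm W I3 I3 I1 I3 = 0" by simp_all
qed

lemma W_col_33: "tm W i I3 k I3 = 0"
proof -
  note 0 = W_33 W_col_33_a W_col_33_b
  have 1: "tm W I1 I3 I2 I3 = 0"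
    using W_raise_at[of I1 I3 I3 I3] 0 by (simp add: tm_mult UNIV_idx tmat_defs)
  have 2: "tm W I2 I3 I1 I3 = 0"
    using W_raise_at[of I3 I3 I1 I3] 0 by (simp add: tm_mult UNIV_idx tmat_defs)
  have 3: "tm W I1 I3 I1 I3 = 0"
    using W_raise_at[of I1 I3 I2 I3] 0 1 2 by (simp add: tm_mult UNIV_idx tmat_defs)
  show ?thesis using 0 1 2 3 by (cases i; cases k) simp_all
qed

text \<open>Once a column of \<open>W\<close> vanishes, so does its image under the lowering operator, also after
  multiplication with the level one operator.\<close>

definition "V = W * (dright + twist raise1 lower2)"

lemma column_vanishes: "(\<And>a b. tm X a j b l = 0) \<Longrightarrow> tm (Y * X) i j k l = 0"
  by (simp add: tm_mult)

lemma V_eq: "V = (dleft + twist raise2 lower1) * W"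
  by (simp add: V_def W_level1)

lemma W_column_lower:
  assumes "\<And>a b. tm W a j b l = 0"
  shows "tm (W * (lower1 + lower2 + odd_elem f)) i j k l = 0"
    "tm (V * (lower1 + lower2 + odd_elem f)) i j k l = 0" "tm V i j k l = 0"
  unfolding V_eq mult.assoc W_lower by (intro column_vanishes assms)+

lemma V_at: "tm V i j k l = tm (W * (first (mat_of (z - (u + u + 2 + g)) 0 0 (- f) (z - (u + 1)) 0 (4 * (f * f)) f z) +
    second (mat_of (z - (v + v + 2 + g)) 0 0 (- f) (z - (v + 1)) 0 (4 * (f * f)) f z) - even_elem z +
    twist raise1 lower2)) i j k l"
  by (simp only: V_def level1_right_eq)

lemmas V_entry = V_at[unfolded twist_raise_lower]

lemma W_col_23: "tm W i I2 k I3 = 0" "tm W i I3 k I2 = 0"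
proof -
  \<comment> \<open>\<open>\<epsilon>\<close> is the sign produced by the parity of the row index
    \<open>k\<close>. Lowering the vanishing column yields one relation between two unknown columns;
    applying it to \<open>V\<close> yields the second.\<close>
  have "tm W i I2 k I3 = 0 \<and> tm W i I3 k I2 = 0" if "\<epsilon> = 1 \<and> grade k = 0 \<or> \<epsilon> = -1 \<and> grade k = 1" for \<epsilon> :: 'r
  proof -
    note low = W_column_lower[OF W_col_33, of i k]
    have b: "tm W i I3 k I2 = - \<epsilon> * tm W i I2 k I3"
      using low(1) that W_col_33 by (auto simp: tm_mult UNIV_idx tmat_defs)
    have Vb: "tm V i I3 k I2 = - \<epsilon> * tm V i I2 k I3"
      using low(2) that W_column_lower(3)[OF W_col_33] by (auto simp: tm_mult UNIV_idx tmat_defs)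
    have 1: "tm V i I2 k I3 = tm W i I2 k I3 * (z - (u + 1)) + tm W i I2 k I3"
      using that W_col_33 b by (auto simp: V_entry tm_mult UNIV_idx tmat_defs algebra_simps)
    have 2: "tm V i I3 k I2 = - \<epsilon> * tm W i I2 k I3 * (z - (v + 1))"
      using that W_col_33 b by (auto simp: V_entry tm_mult UNIV_idx tmat_defs algebra_simps)
    have "(u - v - 1) * tm W i I2 k I3 = 0"
      using Vb that unfolding 1 2 by (auto simp: algebra_simps u[of "tm W i I2 k I3"] v[of "tm W i I2 k I3"])
    then have "tm W i I2 k I3 = 0" by (rule cancel(1))
    with b show ?thesis by simp
  qed
  from this[of 1] this[of "- 1"] show "tm W i I2 k I3 = 0" "tm W i I3 k I2 = 0"
    by (cases k; simp)+
qed

lemma W_col_22: "tm W i I2 k I2 = 0" "tm W i I1 k I3 = 0" "tm W i I3 k I1 = 0"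
proof -
  let ?p = "tm W i I2 k I2"
  have "?p = 0 \<and> tm W i I1 k I3 = 0 \<and> tm W i I3 k I1 = 0" if "\<epsilon> = 1 \<and> grade k = 0 \<or> \<epsilon> = -1 \<and> grade k = 1" for \<epsilon> :: 'r
  proof -
    note 0 = W_col_33 W_col_23
    note low = W_column_lower[OF W_col_23(1), of i k] W_column_lower[OF W_col_23(2), of i k]
      W_column_lower(3)[OF W_col_23(1)] W_column_lower(3)[OF W_col_23(2)] W_column_lower(3)[OF W_col_33]
    have q: "tm W i I1 k I3 = - \<epsilon> * ?p" "tm W i I3 k I1 = \<epsilon> * ?p"
      using low that 0 by (auto simp: tm_mult UNIV_idx tmat_defs add_eq_0_iff)
    have Vq: "tm V i I1 k I3 = - \<epsilon> * tm V i I2 k I2"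
      using low that by (auto simp: tm_mult UNIV_idx tmat_defs add_eq_0_iff)
    have 1: "tm V i I2 k I2 = ?p * (z - (u + v + 2)) + ?p"
      using that 0 q by (auto simp: V_entry tm_mult UNIV_idx tmat_defs algebra_simps mult_2_right)
    have 2: "tm V i I1 k I3 = - \<epsilon> * (?p * (z - (u + u + 2 + g)) + ?p + ?p + ?p)"
      using that 0 q by (auto simp: V_entry tm_mult UNIV_idx tmat_defs algebra_simps quadruple)
    have "(u - v - 1 - g) * ?p = (u + u + 2 + g) * ?p - ?p - ?p - ?p - ((u + v + 2) * ?p - ?p) - (g + g) * ?p + ?p"
      by (simp add: algebra_simps mult_2)
    also have "\<dots> = 0"
      using Vq that unfolding 1 2 by (auto simp: algebra_simps u[of ?p] v[of ?p] g(2) g(1)[of ?p] mult_2 mult_2_right)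
    finally have "?p = 0" by (rule cancel(2))
    with q show ?thesis by simp
  qed
  from this[of 1] this[of "- 1"] show "?p = 0" "tm W i I1 k I3 = 0" "tm W i I3 k I1 = 0"
    by (cases k; simp)+
qed

text \<open>From here on the lowering operator leaves a single unknown column at a time, since it
  annihilates index 1; no level one argument is needed.\<close>

lemma W_col_12: "tm W i I1 k I2 = 0" "tm W i I2 k I1 = 0"
proof -
  have "tm W i I1 k I2 = 0 \<and> tm W i I2 k I1 = 0"
    using W_column_lower(1)[OF W_col_22(2), of i k] W_column_lower(1)[OF W_col_22(3), of i k] W_col_33 W_col_23 W_col_22
    by (cases k) (auto simp: tm_mult UNIV_idx tmat_defs)
  then show "tm W i I1 k I2 = 0" "tm W i I2 k I1 = 0" by simp_all
qed

lemma W_col_11: "tm W i I1 k I1 = 0"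
  using W_column_lower(1)[OF W_col_12(1), of i k] W_col_33 W_col_23 W_col_22 W_col_12
  by (cases k) (auto simp: tm_mult UNIV_idx tmat_defs)

theorem exchange_relation: "R * (first t * second t') = second t' * first t * R"
proof -
  have "tm W i j k l = 0" for i j k l
    by (cases j; cases l) (simp_all add: W_col_33 W_col_23 W_col_22 W_col_12 W_col_11)
  then have "W = 0" by (intro tmat_eqI) simp
  then show ?thesis by (simp add: W_def)
qed

end

section \<open>The quadratic relation from the symmetries\<close>

lemma super_transpose_eq:
  "super_transpose A = mat_of (A I3 I3) (- A I2 I3) (- A I1 I3) (A I3 I2) (A I2 I2) (- A I1 I2) (- A I3 I1) (A I2 I1) (A I1 I1)"
  by (rule mat3_eqI) (simp_all add: super_transpose_def UNIV_idx J_mat_def unit_mat_def)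

lemma mat_mult_assoc: "mat_mult (mat_mult A B) C = mat_mult A (mat_mult B C)"
  by (rule mat3_eqI) (simp_all add: mat_mult_def UNIV_idx algebra_simps)

context osp_orbit
begin

lemma transpose_raise: "commutes_raise e0 (super_transpose orbit)"
  unfolding commutes_raise_def
  by (rule mat3_eqI) (simp_all add: mat_mult_def orbit_def super_transpose_eq UNIV_idx e0_move algebra_simps)

lemma transpose_lower: "commutes_lower f0 (super_transpose orbit)"
  unfolding commutes_lower_def
  by (rule mat3_eqI) (simp_all add: mat_mult_def orbit_def super_transpose_eq UNIV_idx f0_move algebra_simps)

end

context osp_orbit_level1
begin

text \<open>Transposition interchanges the two level one operators and moves the spectral parameter
  by \<kappa> = 1 + g. Multiplying the transpose at s + \<kappa> with T at s therefore gives a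
  matrix that commutes with a single operator.\<close>

lemma transpose_level1:
  assumes "u = s + 1 + g"
  shows "mat_mult (super_transpose orbit)
      (mat_of (ht - (s + s + 2 + g)) e0 (- (4 * (e0 * e0))) 0 (ht - (s + 1)) e0 0 0 ht) =
    mat_mult (mat_of (ht - (s + s + 2 + g)) 0 0 (- f0) (ht - (s + 1)) 0 (4 * (f0 * f0)) f0 ht)
      (super_transpose orbit)"
proof -
  have s: "x * s = s * x" for x
    using u[of x] g(1)[of x] by (simp add: assms algebra_simps)
  note ss = s[of k] s[of t11] s[of t12] s[of t13] s[of t21] s[of t22] s[of t23] s[of t31] s[of t32]
  show ?thesis
    by (rule mat3_eqI)
      (simp_all add: mat_mult_def orbit_def super_transpose_eq UNIV_idx algebra_simps ug ss ht_k ht_t11 ht_t12 ht_t13 ht_t21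
        ht_t22 ht_t23 ht_t31 ht_t32 quadruple mult_2 mult_2_right assms e0_move e0_move[THEN assoc_eq] f0_move
        f0_move[THEN assoc_eq] g_double g_double')
qed

end

text \<open>The product commutes with \<open>F\<close> and \<open>D\<close>. As \<open>D\<close> is
  lower triangular, its entries 13 and 23 make the commutator with \<open>z\<close> a nonzero
  multiple of the unknown, which \<open>cancel\<close> excludes. Commuting with \<open>F\<close>
  then spreads the vanishing and equates the diagonal entries, with one more use of \<open>D\<close>
  at entry 32.\<close>

lemma quadratic_relation:
  fixes t t' :: "'r :: ring_1 mat3"
  assumes raise: "commutes_raise e t" "commutes_raise e t'" and lower: "commutes_lower f t" "commutes_lower f t'"
    and level1: "intertwines_level1 g e f z u t"
    and level1': "mat_mult t' (mat_of (z - (u + u + 2 + g)) e (- (4 * (e * e))) 0 (z - (u + 1)) e 0 0 z) =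
      mat_mult (mat_of (z - (u + u + 2 + g)) 0 0 (- f) (z - (u + 1)) 0 (4 * (f * f)) f z) t'"
    and u: "\<And>x. x * u = u * x" and g: "\<And>x. x * g = g * x"
    and cancel: "\<And>x. z * x = x * z + (u + u + 2 + g) * x \<Longrightarrow> x = 0" "\<And>x. z * x = x * z + (u + 1) * x \<Longrightarrow> x = 0"
      "\<And>x. z * x = x * z - u * x \<Longrightarrow> x = 0"
  shows "mat_mult t' t = (\<lambda>i j. if i = j then mat_mult t' t I3 I3 else 0)"
proof -
  define q where "q = mat_mult t' t"
  define F where "F = mat_of f 1 0 0 (- f) (- 1) 0 0 f"
  define D where "D = mat_of (z - (u + u + 2 + g)) 0 0 (- f) (z - (u + 1)) 0 (4 * (f * f)) f z"
  have F: "mat_mult q F = mat_mult F q"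
    using lower unfolding q_def F_def commutes_lower_def by (simp only: mat_mult_assoc) (simp only: mat_mult_assoc[symmetric])
  have D: "mat_mult q D = mat_mult D q"
    using level1 level1' unfolding q_def D_def intertwines_level1_def by (simp only: mat_mult_assoc) (simp only: mat_mult_assoc[symmetric])
  note Fat = fun_cong[OF fun_cong[OF F]] and Dat = fun_cong[OF fun_cong[OF D]]
  have 13: "q I1 I3 = 0"
    by (rule cancel(1)) (use Dat[of I1 I3] in \<open>simp add: mat_mult_def D_def UNIV_idx algebra_simps\<close>)
  have 23: "q I2 I3 = 0"
    by (rule cancel(2)) (use Dat[of I2 I3] 13 in \<open>simp add: mat_mult_def D_def UNIV_idx algebra_simps\<close>)
  have 22: "q I2 I2 = q I3 I3"
    using Fat[of I2 I3] 13 23 by (simp add: mat_mult_def F_def UNIV_idx)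
  have 12: "q I1 I2 = 0"
    using Fat[of I1 I3] 13 23 by (simp add: mat_mult_def F_def UNIV_idx)
  have 11: "q I1 I1 = q I3 I3"
    using Fat[of I1 I2] 13 12 22 by (simp add: mat_mult_def F_def UNIV_idx)
  have 33: "q I3 I3 * f = f * q I3 I3 + q I3 I2"
    using Fat[of I3 I3] 23 by (simp add: mat_mult_def F_def UNIV_idx algebra_simps)
  have 32: "q I3 I2 = 0"
    by (rule cancel(3)) (use Dat[of I3 I2] 12 22 33 in \<open>simp add: mat_mult_def D_def UNIV_idx algebra_simps u[of "q I3 I2"]\<close>)
  have 21: "q I2 I1 = 0"
    using Fat[of I2 I2] 12 22 23 32 33 by (simp add: mat_mult_def F_def UNIV_idx algebra_simps)
  have 31: "q I3 I1 = 0"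
    using Fat[of I3 I2] 12 22 32 21 by (simp add: mat_mult_def F_def UNIV_idx algebra_simps)
  show ?thesis
    unfolding q_def[symmetric] by (rule mat3_eqI) (simp_all add: 11 12 13 21 22 23 31 32)
qed

section \<open>Series in two variables\<close>

lemma (in ring_1_hom) h_numeral: "h (numeral m) = numeral m"
  by (induction m) (simp_all only: numeral.simps h_add h_1)

lemma ring_1_hom_compose:
  assumes "ring_1_hom g" "ring_1_hom h"
  shows "ring_1_hom (\<lambda>x. g (h x))"
proof -
  interpret g: ring_1_hom g by fact
  interpret h: ring_1_hom h by fact
  show ?thesis by unfold_locales (simp_all add: g.hom_simps h.hom_simps)
qed

lemma ring_1_hom_fls_const: "ring_1_hom (fls_const :: 'a :: ring_1 \<Rightarrow> _)"
  by unfold_locales (simp_all add: fls_plus_const)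

lemma ring_1_hom_fps_to_fls: "ring_1_hom (fps_to_fls :: 'a :: ring_1 fps \<Rightarrow> _)"
  by unfold_locales (simp_all add: fls_times_fps_to_fls)

lemma ring_1_hom_at_u: "ring_1_hom (at_u :: 'a :: ring_1 fps \<Rightarrow> _)"
  unfolding at_u_def[abs_def]
  by (rule ring_1_hom_compose[OF ring_1_hom_map_fls[OF ring_1_hom_fls_const] ring_1_hom_fps_to_fls])

lemma ring_1_hom_at_v: "ring_1_hom (at_v :: 'a :: ring_1 fps \<Rightarrow> _)"
  unfolding at_v_def[abs_def]
  by (rule ring_1_hom_compose[OF ring_1_hom_fls_const ring_1_hom_fps_to_fls])

interpretation at_u: ring_1_hom at_u by (rule ring_1_hom_at_u)
interpretation at_v: ring_1_hom at_v by (rule ring_1_hom_at_v)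

definition scalar :: "complex fls fls \<Rightarrow> 'a :: complex_algebra_1 fls fls" where
  "scalar = map_fls (map_fls cemb)"

interpretation scalar: ring_1_hom scalar
  unfolding scalar_def by (intro ring_1_hom_map_fls ring_1_hom_cemb)

lemma smult_uv_eq: "c \<odot> F = scalar c * F"
  by (simp add: smult_uv_def scalar_def cemb_def[abs_def])

lemma map_fls_0: "g 0 = 0 \<Longrightarrow> map_fls g 0 = 0"
  by (rule fls_eqI) (simp add: map_fls_nth)

lemma scalar_nth: "(scalar c $$ m) $$ n = cemb ((c $$ m) $$ n)"
  by (simp add: scalar_def map_fls_nth map_fls_0 cemb.h_0)

text \<open>One convolution per variable: centrality of the coefficients is lifted by reversing the
  range of summation, first in v and then in u.\<close>

lemma scalar_commute: "F * scalar c = scalar c * (F :: 'a :: complex_algebra_1 fls fls)"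
proof -
  have inner: "a * map_fls cemb d = map_fls cemb d * a" for a :: "'a fls" and d
  proof (rule fls_eqI)
    fix n
    let ?N = "min (fls_subdegree a) (fls_subdegree d)"
    have z: "a $$ i = 0" "map_fls cemb d $$ i = (0 :: 'a)" if "i < ?N" for i
      using that by (simp_all add: map_fls_nth cemb.h_0)
    have "(a * map_fls cemb d) $$ n = (\<Sum>i=?N..n - ?N. a $$ i * map_fls cemb d $$ (n - i))"
      by (rule fls_times_nth_below) (use z in auto)
    also have "\<dots> = (\<Sum>i=?N..n - ?N. map_fls cemb d $$ (n - i) * a $$ i)"
      by (simp add: map_fls_nth cemb.h_0 cemb_commute)
    also have "\<dots> = (\<Sum>i=?N..n - ?N. map_fls cemb d $$ i * a $$ (n - i))"
      by (rule sum.reindex_bij_witness[where i = "\<lambda>i. n - i" and j = "\<lambda>i. n - i"]) auto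
    also have "\<dots> = (map_fls cemb d * a) $$ n"
      by (rule fls_times_nth_below[symmetric]) (use z in auto)
    finally show "(a * map_fls cemb d) $$ n = (map_fls cemb d * a) $$ n" .
  qed
  show ?thesis
  proof (rule fls_eqI)
    fix n
    let ?N = "min (fls_subdegree F) (fls_subdegree c)"
    have z: "F $$ i = 0" "scalar c $$ i = (0 :: 'a fls)" if "i < ?N" for i
      using that by (simp_all add: scalar_def map_fls_nth map_fls_0 cemb.h_0)
    have "(F * scalar c) $$ n = (\<Sum>i=?N..n - ?N. F $$ i * scalar c $$ (n - i))"
      by (rule fls_times_nth_below) (use z in auto)
    also have "\<dots> = (\<Sum>i=?N..n - ?N. scalar c $$ (n - i) * F $$ i)"
      by (simp add: scalar_def map_fls_nth map_fls_0 cemb.h_0 inner)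
    also have "\<dots> = (\<Sum>i=?N..n - ?N. scalar c $$ i * F $$ (n - i))"
      by (rule sum.reindex_bij_witness[where i = "\<lambda>i. n - i" and j = "\<lambda>i. n - i"]) auto
    also have "\<dots> = (scalar c * F) $$ n"
      by (rule fls_times_nth_below[symmetric]) (use z in auto)
    finally show "(F * scalar c) $$ n = (scalar c * F) $$ n" .
  qed
qed

lemmas scalar_left_commute = central_left_commute[OF scalar_commute]

lemma scalar_mult_left: "scalar a * (scalar b * F) = scalar (a * b) * F"
  by (simp add: scalar.h_mult mult.assoc)

lemma scalar_cancel:
  assumes "c \<noteq> 0" "scalar c * F = scalar c * G"
  shows "F = G"
proof -
  have "scalar (1 / c) * (scalar c * F) = scalar (1 / c) * (scalar c * G)" by (simp only: assms(2))
  then show ?thesis using assms(1) by (simp add: scalar_mult_left scalar.h_1)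
qed

text \<open>The coefficient of v^(-n) as a Laurent series in 1/u. Because the inner variable is 1/v,
  multiplication by v raises the index by one.\<close>

definition coeff_v :: "int \<Rightarrow> 'a :: zero fls fls \<Rightarrow> 'a fls" where
  "coeff_v n F = map_fls (\<lambda>x. x $$ n) F"

lemma coeff_v_nth [simp]: "coeff_v n F $$ m = (F $$ m) $$ n"
  by (simp add: coeff_v_def map_fls_nth)

lemma coeff_v_eqI: "(\<And>n. coeff_v n F = coeff_v n G) \<Longrightarrow> F = G"
  by (rule fls2_eqI) (metis coeff_v_nth)

lemma coeff_v_simps [simp]:
  fixes F G :: "'a :: ring_1 fls fls"
  shows "coeff_v n (F + G) = coeff_v n F + coeff_v n G" "coeff_v n (F - G) = coeff_v n F - coeff_v n G"
    "coeff_v n (- F) = - coeff_v n F" "coeff_v n 0 = 0"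
  by (auto intro!: fls_eqI)

lemma at_u_nth: "(at_u f $$ m) $$ n = (if n = 0 then fps_to_fls f $$ m else 0)"
  by (simp add: at_u_def map_fls_nth)

lemma at_v_nth: "(at_v f $$ m) $$ n = (if m = 0 then fps_to_fls f $$ n else 0)"
  by (simp add: at_v_def)

lemma coeff_v_at_u_left: "coeff_v n (at_u f * G) = fps_to_fls f * coeff_v n (G :: 'a :: ring_1 fls fls)"
proof (rule fls_eqI)
  fix m
  let ?N = "fls_subdegree G"
  have "(at_u f * G) $$ m = (\<Sum>i=0..m - ?N. at_u f $$ i * G $$ (m - i))"
    by (rule fls_times_nth_below) (auto simp: at_u_def map_fls_nth)
  moreover have "(fps_to_fls f * coeff_v n G) $$ m = (\<Sum>i=0..m - ?N. fps_to_fls f $$ i * coeff_v n G $$ (m - i))"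
    by (rule fls_times_nth_below) auto
  moreover have "(at_u f $$ i * G $$ (m - i)) $$ n = fps_to_fls f $$ i * coeff_v n G $$ (m - i)" for i
    by (simp add: at_u_def map_fls_nth fls_mult_const_nth)
  ultimately show "coeff_v n (at_u f * G) $$ m = (fps_to_fls f * coeff_v n G) $$ m"
    by (simp add: fls_nth_sum)
qed

lemma coeff_v_at_u_right: "coeff_v n (G * at_u f) = coeff_v n (G :: 'a :: ring_1 fls fls) * fps_to_fls f"
proof (rule fls_eqI)
  fix m
  let ?N = "fls_subdegree G"
  have "(G * at_u f) $$ m = (\<Sum>i=?N..m - 0. G $$ i * at_u f $$ (m - i))"
    by (rule fls_times_nth_below) (auto simp: at_u_def map_fls_nth)
  moreover have "(coeff_v n G * fps_to_fls f) $$ m = (\<Sum>i=?N..m - 0. coeff_v n G $$ i * fps_to_fls f $$ (m - i))"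
    by (rule fls_times_nth_below) auto
  moreover have "(G $$ i * at_u f $$ (m - i)) $$ n = coeff_v n G $$ i * fps_to_fls f $$ (m - i)" for i
    by (simp add: at_u_def map_fls_nth fls_mult_const_nth)
  ultimately show "coeff_v n (G * at_u f) $$ m = (coeff_v n G * fps_to_fls f) $$ m"
    by (simp add: fls_nth_sum)
qed

lemma coeff_v_at_v: "coeff_v n (at_v f :: 'a :: ring_1 fls fls) = fls_const (fps_to_fls f $$ n)"
  by (rule fls_eqI) (simp add: at_v_nth)

lemma coeff_v_at_u: "coeff_v n (at_u f :: 'a :: ring_1 fls fls) = (if n = 0 then fps_to_fls f else 0)"
  by (rule fls_eqI) (simp add: at_u_nth)

lemma coeff_v_const_left: "coeff_v n (const_uv a * F) = fls_const a * coeff_v n (F :: 'a :: ring_1 fls fls)"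
  and coeff_v_const_right: "coeff_v n (F * const_uv a) = coeff_v n F * fls_const a"
proof -
  have c: "const_uv a = at_u (fps_const a)"
    by (rule fls2_eqI) (simp add: const_uv_def at_u_nth)
  show "coeff_v n (const_uv a * F) = fls_const a * coeff_v n F" "coeff_v n (F * const_uv a) = coeff_v n F * fls_const a"
    by (simp_all add: c coeff_v_at_u_left coeff_v_at_u_right)
qed

lemma at_u_const: "at_u (fps_const a) = const_uv a"
  and at_v_const: "at_v (fps_const a) = const_uv a"
  by (rule fls2_eqI, simp add: const_uv_def at_u_nth at_v_nth)+

lemma scalar_var_u: "scalar var_u = (fls_X_inv :: 'a :: complex_algebra_1 fls fls)"
  by (rule fls2_eqI) (simp add: scalar_nth var_u_def cemb.hom_simps)

lemma scalar_var_v: "scalar var_v = (fls_const fls_X_inv :: 'a :: complex_algebra_1 fls fls)"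
  by (rule fls2_eqI) (simp add: scalar_nth var_v_def cemb.hom_simps)

lemma coeff_v_var_u: "coeff_v n (scalar var_u * F) = fls_X_inv * coeff_v n (F :: 'a :: complex_algebra_1 fls fls)"
  by (rule fls_eqI) (simp add: scalar_var_u fls_X_inv_times_conv_shift)

lemma coeff_v_var_v: "coeff_v n (scalar var_v * F) = coeff_v (n + 1) (F :: 'a :: complex_algebra_1 fls fls)"
  by (rule fls_eqI) (simp add: scalar_var_v fls_mult_const_nth fls_X_inv_times_conv_shift)

definition cc :: "complex \<Rightarrow> complex fls fls" where "cc a = fls_const (fls_const a)"

interpretation cc: ring_1_hom cc
  unfolding cc_def[abs_def] by (rule ring_1_hom_compose[OF ring_1_hom_fls_const ring_1_hom_fls_const])

lemma scalar_cc: "scalar (cc a) = const_uv (cemb a)"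
  by (rule fls2_eqI) (simp add: scalar_nth cc_def const_uv_def cemb.hom_simps)

lemma kappa_cc: "kappa = cc (3/2)" and half_cc: "1/2 = cc (1/2)"
proof -
  have "2 * cc (3/2) = 3" "2 * cc (1/2) = 1"
    by (simp_all flip: cc.h_numeral cc.h_mult cc.h_1)
  then show "kappa = cc (3/2)" "1/2 = cc (1/2)"
    by (simp_all add: kappa_def field_simps)
qed

section \<open>The defining relations in an arbitrary algebra\<close>

text \<open>Stated for arbitrary series, so that the free algebra, its quotient and the images under
  homomorphisms are covered by one set of pairs. \<open>e $ 1\<close> is the mode e_0, because the
  series starts with 1/u.\<close>

definition drinfeld_relations ::
  "'a :: complex_algebra_1 fps \<Rightarrow> 'a fps \<Rightarrow> 'a fps \<Rightarrow> ('a fls fls \<times> 'a fls fls) set" where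
  "drinfeld_relations e f h =
    (let u = var_u; v = var_v; eu = at_u e; ev = at_v e; fu = at_u f; fv = at_v f; hu = at_u h; hv = at_v h;
         e0 = const_uv (e $ 1); f0 = const_uv (f $ 1)
     in {(comm hu hv, 0),
         (acomm eu fv, (1 / (u - v)) \<odot> (hv - hu)),
         (comm hu ev,
            - (((u - v + kappa - 1) / ((u - v) * (u - v + kappa))) \<odot> comm hu (eu - ev))
            + (1 / (u - v + kappa)) \<odot> (hu * (ev + eu - e0) - (eu - e0) * hu)),
         (comm hu fv,
            ((u - v - kappa + 1) / ((u - v) * (u - v - kappa))) \<odot> comm hu (fu - fv)
            - (1 / (u - v - kappa)) \<odot> (hu * (fv + fu + f0) - (fu + f0) * hu)),
         (acomm eu ev,
            (1 / (2 * (u - v))) \<odot> comm eu ev - (1 / (u - v)) \<odot> acomm e0 (eu - ev)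
            - (1 / (2 * (u - v)^2)) \<odot> (eu - ev)^2),
         (acomm fu fv,
            - ((1 / (2 * (u - v))) \<odot> comm fu fv) - (1 / (u - v)) \<odot> acomm f0 (fu - fv)
            - (1 / (2 * (u - v)^2)) \<odot> (fu - fv)^2),
         (eu^3, eu * acomm eu e0 + comm (e0^2) eu),
         (fu^3, - (fu * acomm fu f0) + comm (f0^2) fu)})"

definition rtt_relations :: "'a :: complex_algebra_1 fps mat3 \<Rightarrow> ('a fls fls \<times> 'a fls fls) set" where
  "rtt_relations L =
    (let L1 = tensor (\<lambda>i j. at_u (L i j)) id_mat;
         L2 = tensor id_mat (\<lambda>i j. at_v (L i j));
         R = R_tens (var_u - var_v);
         Lt = super_transpose (\<lambda>i j. at_u (shift (- kappa) (L i j)))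
     in {((R \<bullet> L1 \<bullet> L2) i j k l, (L2 \<bullet> L1 \<bullet> R) i j k l) | i j k l. True} \<union>
        {(mat_mult Lt (\<lambda>i j. at_u (L i j)) i j, id_mat i j) | i j. True})"

definition holds :: "('b \<times> 'b) set \<Rightarrow> bool" where
  "holds E \<longleftrightarrow> (\<forall>(l, r)\<in>E. l = r)"

lemma image_pairs4:
  "(\<lambda>(l, r). (p l, p r)) ` {(A i j k l, B i j k l) | i j k l. True} =
    {(p (A i j k l), p (B i j k l)) | i j k l. True}"
  by (auto simp: image_iff) blast

lemma image_pairs2:
  "(\<lambda>(l, r). (p l, p r)) ` {(A i j, B i j) | i j. True} = {(p (A i j), p (B i j)) | i j. True}"
  by (auto simp: image_iff) blast

context complex_algebra_hom
begin

definition hom_uv :: "'a fls fls \<Rightarrow> 'b fls fls" where "hom_uv = map_fls (map_fls h)"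

lemma ring_1_hom_hom: "ring_1_hom h" by unfold_locales

sublocale uv: ring_1_hom hom_uv
  unfolding hom_uv_def by (intro ring_1_hom_map_fls ring_1_hom_hom)

sublocale fps: ring_1_hom "map_fps h"
  by (intro ring_1_hom_map_fps ring_1_hom_hom)

lemma hom_uv_nth: "(hom_uv F $$ m) $$ n = h ((F $$ m) $$ n)"
  by (simp add: hom_uv_def map_fls_nth map_fls_0 h_0)

lemma hom_uv_at_u: "hom_uv (at_u f) = at_u (map_fps h f)"
  by (rule fls2_eqI) (simp add: hom_uv_nth at_u_nth h_0)

lemma hom_uv_at_v: "hom_uv (at_v f) = at_v (map_fps h f)"
  by (rule fls2_eqI) (simp add: hom_uv_nth at_v_nth h_0)

lemma hom_uv_const: "hom_uv (const_uv a) = const_uv (h a)"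
  by (rule fls2_eqI) (simp add: hom_uv_nth const_uv_def h_0)

lemma hom_cemb: "h (cemb c) = cemb c"
  by (simp add: cemb_def h_scaleC_1)

lemma hom_uv_scalar: "hom_uv (scalar c) = scalar c"
  by (rule fls2_eqI) (simp add: hom_uv_nth scalar_nth hom_cemb)

lemma hom_uv_smult: "hom_uv (c \<odot> F) = c \<odot> hom_uv F"
  by (simp add: smult_uv_eq uv.h_mult hom_uv_scalar)

lemma map_fps_shift: "map_fps h (shift c f) = shift c (map_fps h f)"
  unfolding shift_def by (rule map_fps_subst) (simp_all add: h_add h_0 h_scaleC)

lemma map_fps_reflect: "map_fps h (reflect f) = reflect (map_fps h f)"
  unfolding reflect_def by (rule map_fps_subst) (simp_all add: h_add h_0 h_scaleC)

lemma hom_drinfeld_relations: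
  "drinfeld_relations (map_fps h e) (map_fps h f) (map_fps h k) =
    (\<lambda>(l, r). (hom_uv l, hom_uv r)) ` drinfeld_relations e f k"
  by (simp add: drinfeld_relations_def Let_def comm_def acomm_def uv.hom_simps hom_uv_at_u hom_uv_at_v
      hom_uv_const hom_uv_smult)

lemma hom_uv_tens_mult:
  "hom_uv ((X \<bullet> Y) i j k l) = ((\<lambda>i j k l. hom_uv (X i j k l)) \<bullet> (\<lambda>i j k l. hom_uv (Y i j k l))) i j k l"
  by (simp add: tens_mult_def uv.hom_simps)

lemma hom_uv_mats: "hom_uv (id_mat i j) = id_mat i j" "hom_uv (unit_mat a b i j) = unit_mat a b i j"
    "hom_uv (J_mat i j) = J_mat i j"
  by (simp_all add: id_mat_def unit_mat_def J_mat_def uv.hom_simps)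

lemma hom_uv_R_tens: "hom_uv (R_tens w i j k l) = R_tens w i j k l"
  by (simp add: R_tens_def uv.hom_simps hom_uv_smult hom_uv_mats tensor_def P_tens_def P_t1_tens_def
      super_transpose_def)

lemma hom_rtt_relations:
  "rtt_relations (\<lambda>i j. map_fps h (L i j)) = (\<lambda>(l, r). (hom_uv l, hom_uv r)) ` rtt_relations L"
proof -
  have "(\<lambda>i j k l. hom_uv (tensor (\<lambda>i j. at_u (L i j)) id_mat i j k l)) =
      tensor (\<lambda>i j. at_u (map_fps h (L i j))) id_mat"
    "(\<lambda>i j k l. hom_uv (tensor id_mat (\<lambda>i j. at_v (L i j)) i j k l)) =
      tensor id_mat (\<lambda>i j. at_v (map_fps h (L i j)))"
    by (simp_all add: tensor_def fun_eq_iff uv.hom_simps hom_uv_mats hom_uv_at_u hom_uv_at_v)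
  note 1 = this
  have 2: "hom_uv (mat_mult (super_transpose (\<lambda>i j. at_u (shift c (L i j)))) (\<lambda>i j. at_u (L i j)) i j) =
      mat_mult (super_transpose (\<lambda>i j. at_u (shift c (map_fps h (L i j))))) (\<lambda>i j. at_u (map_fps h (L i j))) i j" for c i j
    by (simp add: mat_mult_def super_transpose_def uv.hom_simps hom_uv_mats hom_uv_at_u map_fps_shift)
  show ?thesis
    unfolding rtt_relations_def Let_def image_Un image_pairs4 image_pairs2
    by (simp only: hom_uv_tens_mult 1 2 hom_uv_R_tens hom_uv_mats)
qed

end

lemma a_relations_eq:
  "a_relations = drinfeld_relations (e_series free_gen) (f_series free_gen) (h_series free_gen)"
  by (simp add: a_relations_def drinfeld_relations_def Let_def e_series_def f_series_def)

lemma l_relations_eq: "l_relations = rtt_relations (L_series free_gen)"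
  by (simp add: l_relations_def rtt_relations_def Let_def shift_series_eq)

lemma map_fps_series:
  assumes "ring_1_hom h"
  shows "map_fps h (e_series g) = e_series (\<lambda>a. h (g a))" "map_fps h (f_series g) = f_series (\<lambda>a. h (g a))"
    "map_fps h (h_series g) = h_series (\<lambda>a. h (g a))" "map_fps h (L_series g' i j) = L_series (\<lambda>a. h (g' a)) i j"
proof -
  interpret ring_1_hom h by fact
  show "map_fps h (e_series g) = e_series (\<lambda>a. h (g a))" "map_fps h (f_series g) = f_series (\<lambda>a. h (g a))"
    "map_fps h (h_series g) = h_series (\<lambda>a. h (g a))" "map_fps h (L_series g' i j) = L_series (\<lambda>a. h (g' a)) i j"
    by (auto simp: fps_eq_iff e_series_def f_series_def h_series_def L_series_def id_mat_def hom_simps split: nat.split)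
qed

lemma relators_killed:
  assumes "complex_algebra_hom h" "holds ((\<lambda>(l, r). (complex_algebra_hom.hom_uv h l, complex_algebra_hom.hom_uv h r)) ` E)"
    and "r \<in> relators_of E"
  shows "h r = 0"
proof -
  interpret complex_algebra_hom h by fact
  from assms(3) obtain l r' m n where r: "r = (l $$ m) $$ n - (r' $$ m) $$ n" and "(l, r') \<in> E"
    by (auto simp: relators_of_def)
  with assms(2) have "hom_uv l = hom_uv r'" by (auto simp: holds_def)
  then have "(hom_uv l $$ m) $$ n = (hom_uv r' $$ m) $$ n" by simp
  then show ?thesis by (simp add: r h_diff hom_uv_nth)
qed

lemma relations_hold:
  assumes "complex_algebra_hom h" "\<And>r. r \<in> relators_of E \<Longrightarrow> h r = 0"
  shows "holds ((\<lambda>(l, r). (complex_algebra_hom.hom_uv h l, complex_algebra_hom.hom_uv h r)) ` E)"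
proof -
  interpret complex_algebra_hom h by fact
  have "hom_uv l = hom_uv r" if "(l, r) \<in> E" for l r
  proof (rule fls2_eqI)
    fix m n
    have "(l $$ m) $$ n - (r $$ m) $$ n \<in> relators_of E"
      unfolding relators_of_def using that by blast
    from assms(2)[OF this] show "(hom_uv l $$ m) $$ n = (hom_uv r $$ m) $$ n"
      by (simp add: hom_uv_nth h_diff)
  qed
  then show ?thesis by (auto simp: holds_def)
qed

lemma drinfeld_relations_alg_gen:
  "holds (drinfeld_relations (e_series alg_gen) (f_series alg_gen) (h_series alg_gen :: A_plus fps))"
proof -
  interpret complex_algebra_hom "abs_presented :: a_gen free_algebra \<Rightarrow> A_plus"
    by (rule complex_algebra_hom_abs_presented)
  have gen: "alg_gen = (\<lambda>a. abs_presented (free_gen a :: a_gen free_algebra))" by (simp add: fun_eq_iff alg_gen_def)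
  have "drinfeld_relations (e_series alg_gen) (f_series alg_gen) (h_series alg_gen) =
      (\<lambda>(l, r). (hom_uv l, hom_uv r)) ` a_relations"
    unfolding gen by (simp add: a_relations_eq flip: hom_drinfeld_relations map_fps_series(1-3)[OF ring_1_hom_hom])
  moreover have "abs_presented r = 0" if "r \<in> relators_of a_relations" for r :: "a_gen free_algebra"
    using abs_presented_relator[of r] that by (simp add: relators_a_gen_def)
  ultimately show ?thesis
    using relations_hold[OF complex_algebra_hom_axioms, of a_relations] by simp
qed

lemma rtt_relations_alg_gen: "holds (rtt_relations (L_series (alg_gen :: l_gen \<Rightarrow> U_R)))"
proof -
  interpret complex_algebra_hom "abs_presented :: l_gen free_algebra \<Rightarrow> U_R"
    by (rule complex_algebra_hom_abs_presented)
  have gen: "alg_gen = (\<lambda>a. abs_presented (free_gen a :: l_gen free_algebra))" by (simp add: fun_eq_iff alg_gen_def)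
  have "L_series alg_gen = (\<lambda>i j. map_fps abs_presented (L_series free_gen i j))"
    unfolding gen by (simp add: fun_eq_iff map_fps_series(4)[OF ring_1_hom_hom])
  then have "rtt_relations (L_series alg_gen) = (\<lambda>(l, r). (hom_uv l, hom_uv r)) ` l_relations"
    by (simp add: l_relations_eq hom_rtt_relations)
  moreover have "abs_presented r = 0" if "r \<in> relators_of l_relations" for r :: "l_gen free_algebra"
    using abs_presented_relator[of r] that by (simp add: relators_l_gen_def)
  ultimately show ?thesis
    using relations_hold[OF complex_algebra_hom_axioms, of l_relations] by simp
qed

lemma a_relators_killed:
  fixes g :: "a_gen \<Rightarrow> 'a :: complex_algebra_1"
  assumes "holds (drinfeld_relations (e_series g) (f_series g) (h_series g))" "r \<in> relators"
  shows "free_ev g r = 0"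
proof -
  interpret complex_algebra_hom "free_ev g" by (rule complex_algebra_hom_free_ev)
  have "drinfeld_relations (e_series g) (f_series g) (h_series g) = (\<lambda>(l, r). (hom_uv l, hom_uv r)) ` a_relations"
    by (simp add: a_relations_eq map_fps_series[OF ring_1_hom_hom] flip: hom_drinfeld_relations)
  then show ?thesis
    using relators_killed[OF complex_algebra_hom_axioms, of a_relations] assms by (simp add: relators_a_gen_def)
qed

lemma l_relators_killed:
  fixes g :: "l_gen \<Rightarrow> 'a :: complex_algebra_1"
  assumes "holds (rtt_relations (L_series g))" "r \<in> relators"
  shows "free_ev g r = 0"
proof -
  interpret complex_algebra_hom "free_ev g" by (rule complex_algebra_hom_free_ev)
  have "L_series g = (\<lambda>i j. map_fps (free_ev g) (L_series free_gen i j))"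
    by (simp add: fun_eq_iff map_fps_series(4)[OF ring_1_hom_hom])
  then have "rtt_relations (L_series g) = (\<lambda>(l, r). (hom_uv l, hom_uv r)) ` l_relations"
    by (simp add: l_relations_eq hom_rtt_relations)
  then show ?thesis
    using relators_killed[OF complex_algebra_hom_axioms, of l_relations] assms by (simp add: relators_l_gen_def)
qed

section \<open>Coefficients of the relations\<close>

abbreviation wvar :: "complex fls fls" where "wvar \<equiv> var_u - var_v"
abbreviation om :: "'a :: complex_algebra_1 fls fls" where "om \<equiv> scalar wvar"
abbreviation half :: "'a :: complex_algebra_1 fls fls" where "half \<equiv> scalar (cc (1/2))"

lemma wvar_plus_nonzero: "var_u - var_v + cc a \<noteq> 0"
proof
  assume "var_u - var_v + cc a = 0"
  then have "((var_u - var_v + cc a) $$ (- 1)) $$ 0 = 0" by simp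
  then show False by (simp add: var_u_def var_v_def cc_def)
qed

lemma wvar_nonzero: "var_u - var_v \<noteq> 0" "var_u - var_v + kappa \<noteq> 0" "var_u - var_v - kappa \<noteq> 0"
  using wvar_plus_nonzero[of 0] wvar_plus_nonzero[of "3/2"] wvar_plus_nonzero[of "- (3/2)"]
  by (simp_all add: cc.hom_simps kappa_cc)

lemma half_double: "half + half = 1"
  by (simp flip: scalar.h_add cc.h_add add: scalar.h_1 cc.h_1)

lemma half_double': "half * x + half * x = x" "half * x + (half * x + y) = x + y"
  by (simp_all add: half_double flip: distrib_right add.assoc)

lemma half_double'': "y * (half * x) + y * (half * x) = y * x" "y * (half * x) + (y * (half * x) + z) = y * x + z"
proof -
  show 1: "y * (half * x) + y * (half * x) = y * x"
    by (subst distrib_left[symmetric]) (simp only: half_double')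
  show "y * (half * x) + (y * (half * x) + z) = y * x + z"
    by (subst add.assoc[symmetric]) (simp only: 1)
qed

lemma scalar_kappa: "scalar kappa = 1 + half"
proof -
  have k: "kappa = 1 + cc (1/2)" by (simp add: kappa_cc flip: cc.h_1 cc.h_add)
  show ?thesis unfolding k by (simp only: scalar.h_add scalar.h_1)
qed

lemma coeff_v_om: "coeff_v n (om * F) = fls_X_inv * coeff_v n F - coeff_v (n + 1) F"
  by (simp add: scalar.h_diff left_diff_distrib coeff_v_var_u coeff_v_var_v)

lemma coeff_v_half: "coeff_v n (half * F) = fls_const (cemb (1/2)) * coeff_v n F"
  by (simp add: scalar_cc coeff_v_const_left)

lemmas om_commute = scalar_commute[of _ wvar] scalar_left_commute[of _ wvar]
  scalar_commute[of _ "cc (1/2)"] scalar_left_commute[of _ "cc (1/2)"]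

lemma scalar_combination:
  assumes "d * a = p" "d * b = q"
  shows "scalar d * (X - (- (scalar a * Y) + scalar b * Z)) = scalar d * X + scalar p * Y - scalar q * Z"
    "scalar d * (X - (scalar a * Y - scalar b * Z)) = scalar d * X - scalar p * Y + scalar q * Z"
  by (simp_all add: right_diff_distrib distrib_left scalar_mult_left assms)

text \<open>Multiplication by w (w + \<kappa>) produces the factors (w - 1)(w + 1/2) and (w + 1)(w -
  1/2), the origin of the shift lists in \<open>twisted_h_e\<close>. The two remaining terms contain
  v only through the factor w, so they have no negative powers of v.\<close>

lemma comm_h_e_iff:
  fixes h e e' e0 :: "'a :: complex_algebra_1 fls fls"
  shows "comm h e' = - (((wvar + kappa - 1) / (wvar * (wvar + kappa))) \<odot> comm h (e - e'))
      + (1 / (wvar + kappa)) \<odot> (h * (e' + e - e0) - (e - e0) * h) \<longleftrightarrow>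
    (om - 1) * ((om + half) * (h * e')) - (om + 1) * ((om - half) * (e' * h)) + half * comm h e + om * comm h e0 = 0"
    (is "?l = ?r \<longleftrightarrow> ?p = 0")
proof -
  let ?d = "wvar * (wvar + kappa)"
  have d: "?d \<noteq> 0" using wvar_nonzero by simp
  define a b where "a = (wvar + kappa - 1) / ?d" and "b = 1 / (wvar + kappa)"
  have c: "?d * a = wvar + kappa - 1" "?d * b = wvar"
    using wvar_nonzero by (simp_all add: a_def b_def)
  have sd: "scalar ?d = om * (om + (1 + half))" "scalar (wvar + kappa - 1) = om + (1 + half) - 1"
    by (simp_all only: scalar.h_mult scalar.h_add scalar.h_diff[of "wvar + kappa" 1] scalar.h_1 scalar_kappa)
  have "scalar ?d * (?l - ?r) = scalar ?d * comm h e' + scalar (wvar + kappa - 1) * comm h (e - e')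
      - om * (h * (e' + e - e0) - (e - e0) * h)"
    unfolding smult_uv_eq a_def[symmetric] b_def[symmetric] by (rule scalar_combination(1)[OF c])
  also have "\<dots> = ?p"
    unfolding sd
    by (simp add: comm_def algebra_simps
        om_commute[of h] om_commute[of e] om_commute[of e'] scalar_commute[of half wvar] scalar_left_commute[of half wvar] half_double' half_double'')
  finally have "scalar ?d * (?l - ?r) = ?p" .
  moreover have "?l = ?r \<longleftrightarrow> scalar ?d * (?l - ?r) = scalar ?d * 0"
    using scalar_cancel[OF d, of "?l - ?r" 0] by auto
  ultimately show ?thesis by simp
qed

lemma comm_h_f_iff:
  fixes h f f' f0 :: "'a :: complex_algebra_1 fls fls"
  shows "comm h f' = ((wvar - kappa + 1) / (wvar * (wvar - kappa))) \<odot> comm h (f - f')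
      - (1 / (wvar - kappa)) \<odot> (h * (f' + f + f0) - (f + f0) * h) \<longleftrightarrow>
    (om + 1) * ((om - half) * (h * f')) - (om - 1) * ((om + half) * (f' * h)) + half * comm h f + om * comm h f0 = 0"
    (is "?l = ?r \<longleftrightarrow> ?p = 0")
proof -
  let ?d = "wvar * (wvar - kappa)"
  have d: "?d \<noteq> 0" using wvar_nonzero by simp
  define a b where "a = (wvar - kappa + 1) / ?d" and "b = 1 / (wvar - kappa)"
  have c: "?d * a = wvar - kappa + 1" "?d * b = wvar"
    using wvar_nonzero by (simp_all add: a_def b_def)
  have sd: "scalar ?d = om * (om - (1 + half))" "scalar (wvar - kappa + 1) = om - (1 + half) + 1"
    by (simp_all only: scalar.h_mult scalar.h_add scalar.h_diff[of wvar kappa] scalar.h_1 scalar_kappa)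
  have "scalar ?d * (?l - ?r) = scalar ?d * comm h f' - scalar (wvar - kappa + 1) * comm h (f - f')
      + om * (h * (f' + f + f0) - (f + f0) * h)"
    unfolding smult_uv_eq a_def[symmetric] b_def[symmetric] by (rule scalar_combination(2)[OF c])
  also have "\<dots> = ?p"
    unfolding sd
    by (simp add: comm_def algebra_simps
        om_commute[of h] om_commute[of f] om_commute[of f'] scalar_commute[of half wvar] scalar_left_commute[of half wvar] half_double' half_double'')
  finally have "scalar ?d * (?l - ?r) = ?p" .
  moreover have "?l = ?r \<longleftrightarrow> scalar ?d * (?l - ?r) = scalar ?d * 0"
    using scalar_cancel[OF d, of "?l - ?r" 0] by auto
  ultimately show ?thesis by simp
qed

lemma scalar_om_inverse: "om * (scalar (1 / wvar) * F) = F" "scalar (1 / wvar) * (om * F) = F"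
    "om * (scalar (1 / (2 * wvar)) * F) = half * F" "om * (om * (scalar (1 / (2 * wvar\<^sup>2)) * F)) = half * F"
proof -
  have 1: "wvar * (1 / (2 * wvar)) = cc (1/2)" "wvar * (wvar * (1 / (2 * wvar\<^sup>2))) = cc (1/2)"
    using wvar_nonzero by (simp_all add: power2_eq_square flip: half_cc)
  show "om * (scalar (1 / wvar) * F) = F" "scalar (1 / wvar) * (om * F) = F"
    "om * (scalar (1 / (2 * wvar)) * F) = half * F" "om * (om * (scalar (1 / (2 * wvar\<^sup>2)) * F)) = half * F"
    using wvar_nonzero 1 by (simp_all add: scalar_mult_left scalar.h_1)
qed

lemma acomm_e_e:
  fixes e e' e0 :: "'a :: complex_algebra_1 fls fls"
  assumes "acomm e e' = (1 / (2 * wvar)) \<odot> comm e e' - (1 / wvar) \<odot> acomm e0 (e - e') - (1 / (2 * wvar\<^sup>2)) \<odot> (e - e')\<^sup>2"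
  shows "om * (om * acomm e e') = half * (om * comm e e') - om * acomm e0 (e - e') - half * (e - e')\<^sup>2"
  unfolding assms smult_uv_eq
  by (simp only: right_diff_distrib[of "om :: 'a fls fls"] scalar_om_inverse) (simp only: scalar_left_commute[of om "cc (1/2)"])

lemma acomm_f_f:
  fixes e e' e0 :: "'a :: complex_algebra_1 fls fls"
  assumes "acomm e e' = - ((1 / (2 * wvar)) \<odot> comm e e') - (1 / wvar) \<odot> acomm e0 (e - e') - (1 / (2 * wvar\<^sup>2)) \<odot> (e - e')\<^sup>2"
  shows "om * (om * acomm e e') = - (half * (om * comm e e')) - om * acomm e0 (e - e') - half * (e - e')\<^sup>2"
  unfolding assms smult_uv_eq
  by (simp only: right_diff_distrib[of "om :: 'a fls fls"] mult_minus_right scalar_om_inverse) (simp only: scalar_left_commute[of om "cc (1/2)"])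

lemma fps_to_fls_const: "fps_to_fls (fps_const a) = fls_const (a :: 'a :: ring_1)"
  by (rule fls_eqI) simp

interpretation fps_to_fls: ring_1_hom fps_to_fls by (rule ring_1_hom_fps_to_fls)

lemma fls_X_left_commute: "x * (fls_X * y) = fls_X * (x * (y :: 'a :: ring_1 fls))"
  by (metis fls_X_times_comm mult.assoc)

lemma fls_X_X_inv: "fls_X * (fls_X_inv * x) = (x :: 'a :: ring_1 fls)"
  by (simp add: fls_X_times_conv_shift fls_X_inv_times_conv_shift)

lemma fls_cemb_commute: "x * fls_const (cemb a) = fls_const (cemb a) * (x :: 'a :: complex_algebra_1 fls)"
  by (rule fls_eqI) (simp add: fls_mult_const_nth cemb_commute)

lemmas fls_cemb_left_commute = central_left_commute[OF fls_cemb_commute]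

lemma fps_to_fls_lam:
  "fps_to_fls (lam c s l) = fls_X * ((fls_X_inv + fls_const (cemb c)) * fps_to_fls (s l) - fps_to_fls (s (Suc l)))"
  by (simp add: lam_def fps_to_fls.hom_simps cfps_def fps_to_fls_const algebra_simps fls_X_X_inv fls_cemb_left_commute[of fls_X])

lemma gen_seq_fls_nth: "fps_to_fls (gen_seq s 0) $$ (int l + 1) = s l" "fps_to_fls (gen_seq s 0) $$ (1 + int l) = s l"
  "fps_to_fls (gen_seq s 0) $$ (int l + 2) = s (Suc l)" "fps_to_fls (gen_seq s 0) $$ (2 + int l) = s (Suc l)"
  "fps_to_fls (gen_seq s 0) $$ 1 = s 0" "fps_to_fls (gen_seq s 0) $$ 2 = s 1" "fps_to_fls (gen_seq s 0) $$ 0 = 0"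
proof -
  have "nat (int l + 1) = Suc l" "nat (int l + 2) = Suc (Suc l)" by auto
  then show "fps_to_fls (gen_seq s 0) $$ (int l + 1) = s l" "fps_to_fls (gen_seq s 0) $$ (int l + 2) = s (Suc l)"
    by simp_all
  then show "fps_to_fls (gen_seq s 0) $$ (1 + int l) = s l" "fps_to_fls (gen_seq s 0) $$ (2 + int l) = s (Suc l)"
    by (simp_all only: add.commute)
  show "fps_to_fls (gen_seq s 0) $$ 1 = s 0" "fps_to_fls (gen_seq s 0) $$ 2 = s 1" "fps_to_fls (gen_seq s 0) $$ 0 = 0"
    by (simp_all add: numeral_2_eq_2)
qed

lemma at_u_inject: "at_u f = at_u g \<Longrightarrow> f = (g :: 'a :: ring_1 fps)"
  by (drule arg_cong[of _ _ "coeff_v 0"]) (simp add: coeff_v_at_u)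

lemma coeff_v_const: "coeff_v n (const_uv a) = (if n = 0 then fls_const a else (0 :: 'a :: ring_1 fls))"
  by (simp add: coeff_v_at_u fps_to_fls_const flip: at_u_const)

definition om_prod :: "complex list \<Rightarrow> 'a :: complex_algebra_1 fls fls \<Rightarrow> 'a fls fls" where
  "om_prod cs F = foldr (\<lambda>c G. (om + scalar (cc c)) * G) cs F"

text \<open>On coefficients of negative powers of v, multiplication by u - v + c moves the index by
  one exactly as \<open>lam c\<close> does; one power of 1/u per factor accounts for the
  normalisation of \<open>lam\<close>.\<close>

lemma coeff_v_om_prod:
  fixes F :: "'a :: complex_algebra_1 fls fls"
  assumes "\<And>l. coeff_v (int l + 1) F = fps_to_fls (s l)"
  shows "fls_X ^ length cs * coeff_v (int l + 1) (om_prod cs F) = fps_to_fls (lams cs s l)"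
proof (induction cs arbitrary: l)
  case Nil
  then show ?case by (simp add: om_prod_def assms)
next
  case (Cons c cs)
  let ?G = "\<lambda>l. coeff_v (int l + 1) (om_prod cs F)"
  let ?x = "fls_X_inv + fls_const (cemb c) :: 'a fls"
  have p: "x * fls_X ^ n = fls_X ^ n * x" for x :: "'a fls" and n
  proof (induction n)
    case (Suc n)
    then show ?case by (simp only: power_Suc fls_X_left_commute mult.assoc)
  qed simp
  have "coeff_v (int l + 1) (om_prod (c # cs) F) = ?x * ?G l - ?G (Suc l)"
    by (simp add: om_prod_def distrib_right coeff_v_om scalar_cc coeff_v_const_left add.commute add.left_commute)
  moreover have "fls_X ^ length (c # cs) * (?x * a - b) = fls_X * (?x * (fls_X ^ length cs * a) - fls_X ^ length cs * b)" for a b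
    by (simp only: list.size add_Suc_right add_0_right power_Suc right_diff_distrib mult.assoc[symmetric] p[of ?x])
  ultimately have "fls_X ^ length (c # cs) * coeff_v (int l + 1) (om_prod (c # cs) F) =
      fls_X * (?x * (fls_X ^ length cs * ?G l) - fls_X ^ length cs * ?G (Suc l))"
    by (simp only:)
  then show ?case by (simp only: Cons.IH fps_to_fls_lam lams_Cons)
qed

text \<open>Connects the one-variable notion with two-variable relations. It concerns only the
  powers v^(-n) with n > 0, where the modes sit; the finitely many others are treated
  separately.\<close>

lemma twisted_iff_coeff_v:
  fixes h :: "'a :: complex_algebra_1 fps"
  assumes "length A = length B"
  shows "twisted h A B e \<longleftrightarrow> (\<forall>l. coeff_v (int l + 1)
    (om_prod A (at_u h * at_v (gen_seq e 0)) - om_prod B (at_v (gen_seq e 0) * at_u h)) = 0)"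
proof -
  have X: "fls_X ^ n * x = 0 \<longleftrightarrow> x = (0 :: 'a fls)" for n x
  proof (induction n arbitrary: x)
    case (Suc n)
    have "fls_X * y = 0 \<longleftrightarrow> y = (0 :: 'a fls)" for y
    proof
      assume "fls_X * y = 0"
      then have "fls_X_inv * (fls_X * y) = 0" by simp
      then show "y = 0" by (simp add: fls_X_times_conv_shift fls_X_inv_times_conv_shift)
    qed simp
    with Suc show ?case by (simp add: mult.assoc)
  qed simp
  have "fls_X ^ length A * coeff_v (int l + 1)
      (om_prod A (at_u h * at_v (gen_seq e 0)) - om_prod B (at_v (gen_seq e 0) * at_u h)) = fps_to_fls (defect h A B e l)" for l
  proof -
    have 1: "fls_X ^ length A * coeff_v (int l + 1) (om_prod A (at_u h * at_v (gen_seq e 0))) =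
        fps_to_fls (lams A (\<lambda>l. h * const_seq e l) l)"
      by (rule coeff_v_om_prod)
        (simp add: coeff_v_at_u_left coeff_v_at_v gen_seq_fls_nth const_seq_def fps_to_fls_const fps_to_fls.h_mult del: fps_to_fls_nth)
    have 2: "fls_X ^ length B * coeff_v (int l + 1) (om_prod B (at_v (gen_seq e 0) * at_u h)) =
        fps_to_fls (lams B (\<lambda>l. const_seq e l * h) l)"
      by (rule coeff_v_om_prod)
        (simp add: coeff_v_at_u_right coeff_v_at_v gen_seq_fls_nth const_seq_def fps_to_fls_const fps_to_fls.h_mult del: fps_to_fls_nth)
    show ?thesis
      unfolding coeff_v_simps right_diff_distrib 1 2[folded assms] defect_def lams_mult_left lams_mult_right fps_to_fls.h_diff ..
  qed
  then have "defect h A B e l = 0 \<longleftrightarrow> coeff_v (int l + 1)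
      (om_prod A (at_u h * at_v (gen_seq e 0)) - om_prod B (at_v (gen_seq e 0) * at_u h)) = 0" for l
    using X by (metis fps_to_fls_eq_0_iff)
  then show ?thesis by (simp add: fun_eq_iff)
qed

lemma om_prod_simps: "om_prod [] F = F" "om_prod (c # cs) F = (om + scalar (cc c)) * om_prod cs F"
  by (simp_all add: om_prod_def)

lemma scalar_cc_simps: "scalar (cc (- 1)) = (- 1 :: 'a :: complex_algebra_1 fls fls)" "scalar (cc 1) = (1 :: 'a fls fls)"
   "scalar (cc (- (1/2))) = - (half :: 'a fls fls)" "scalar (cc 0) = (0 :: 'a fls fls)"
  by (simp_all only: cc.h_uminus cc.h_1 cc.h_0 scalar.h_uminus scalar.h_1 scalar.h_0)

text \<open>After multiplication by u - v the relation compares neighbouring modes: the coefficient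
  of u^0 starts the recursion at e_0, and the others trade an index of e for one of f.\<close>

lemma acomm_modes:
  fixes e f h :: "nat \<Rightarrow> 'a :: complex_algebra_1"
  assumes 1: "om * acomm (at_u (gen_seq e 0)) (at_v (gen_seq f 0)) = at_v (1 + gen_seq h 0) - at_u (1 + gen_seq h 0)"
  shows "e k * f l + f l * e k = h (k + l)"
proof -
  let ?E = "fps_to_fls (gen_seq e 0)"
  have 2: "fls_X_inv * (?E * fls_const (f l) + fls_const (f l) * ?E) -
      (?E * fls_const (f (Suc l)) + fls_const (f (Suc l)) * ?E) = fls_const (h l)" for l
  proof -
    have "coeff_v (int l + 1) (at_v (1 + gen_seq h 0) - at_u (1 + gen_seq h 0)) = fls_const (h l)"
      by (simp add: coeff_v_at_v coeff_v_at_u gen_seq_fls_nth) (simp add: nat_add_distrib)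
    moreover have "coeff_v (int l + 1) (om * acomm (at_u (gen_seq e 0)) (at_v (gen_seq f 0))) =
        fls_X_inv * (?E * fls_const (f l) + fls_const (f l) * ?E) -
        (?E * fls_const (f (Suc l)) + fls_const (f (Suc l)) * ?E)"
      by (simp only: coeff_v_om acomm_def coeff_v_simps coeff_v_at_u_left coeff_v_at_u_right coeff_v_at_v
          gen_seq_fls_nth add.assoc one_add_one)
    ultimately show ?thesis by (simp only: 1)
  qed
  have nth: "(fls_X_inv * F) $$ n = F $$ (n + 1)" for F :: "'a fls" and n
    by (simp add: fls_X_inv_times_conv_shift)
  have base: "e 0 * f l + f l * e 0 = h l" for l
    using arg_cong[OF 2[of l], of "\<lambda>F. F $$ 0"] by (simp add: nth fls_mult_const_nth)
  have step: "e (Suc k) * f l + f l * e (Suc k) = e k * f (Suc l) + f (Suc l) * e k" for k l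
    using arg_cong[OF 2[of l], of "\<lambda>F. F $$ (int k + 1)"]
    by (simp add: nth fls_mult_const_nth gen_seq_fls_nth del: fps_to_fls_nth)
  show ?thesis
    by (induction k arbitrary: l) (simp_all add: base step)
qed

locale drinfeld_data =
  fixes e f h :: "nat \<Rightarrow> 'a :: complex_algebra_1"
  assumes relations: "holds (drinfeld_relations (gen_seq e 0) (gen_seq f 0) (1 + gen_seq h 0))"
begin

abbreviation "es \<equiv> gen_seq e 0"
abbreviation "fs \<equiv> gen_seq f 0"
abbreviation "hs \<equiv> 1 + gen_seq h 0"

lemma relations':
  "comm (at_u hs) (at_v hs) = 0"
  "acomm (at_u es) (at_v fs) = (1 / wvar) \<odot> (at_v hs - at_u hs)"
  "comm (at_u hs) (at_v es) = - (((wvar + kappa - 1) / (wvar * (wvar + kappa))) \<odot> comm (at_u hs) (at_u es - at_v es))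
            + (1 / (wvar + kappa)) \<odot> (at_u hs * (at_v es + at_u es - const_uv (e 0)) - (at_u es - const_uv (e 0)) * at_u hs)"
  "comm (at_u hs) (at_v fs) = ((wvar - kappa + 1) / (wvar * (wvar - kappa))) \<odot> comm (at_u hs) (at_u fs - at_v fs)
            - (1 / (wvar - kappa)) \<odot> (at_u hs * (at_v fs + at_u fs + const_uv (f 0)) - (at_u fs + const_uv (f 0)) * at_u hs)"
  "acomm (at_u es) (at_v es) = (1 / (2 * wvar)) \<odot> comm (at_u es) (at_v es) -
      (1 / wvar) \<odot> acomm (const_uv (e 0)) (at_u es - at_v es) - (1 / (2 * wvar\<^sup>2)) \<odot> (at_u es - at_v es)\<^sup>2"
  "acomm (at_u fs) (at_v fs) = - ((1 / (2 * wvar)) \<odot> comm (at_u fs) (at_v fs)) -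
      (1 / wvar) \<odot> acomm (const_uv (f 0)) (at_u fs - at_v fs) - (1 / (2 * wvar\<^sup>2)) \<odot> (at_u fs - at_v fs)\<^sup>2"
  "at_u es ^ 3 = at_u es * acomm (at_u es) (const_uv (e 0)) + comm ((const_uv (e 0))\<^sup>2) (at_u es)"
  "at_u fs ^ 3 = - (at_u fs * acomm (at_u fs) (const_uv (f 0))) + comm ((const_uv (f 0))\<^sup>2) (at_u fs)"
  using relations by (simp_all add: holds_def drinfeld_relations_def Let_def gen_seq_def)

lemma ef: "e k * f l + f l * e k = h (k + l)"
  by (rule acomm_modes) (simp only: relations'(2) smult_uv_eq scalar_om_inverse)

text \<open>These are the terms that distinguish the polynomial relation from the pure product form;
  they do not reach the negative powers of v.\<close>

lemma coeff_v_u_only: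
  "coeff_v (int l + 1) (half * comm (at_u p) (at_u q)) = 0" "coeff_v (int l + 1) (om * comm (at_u p) (const_uv a)) = 0"
proof -
  have [simp]: "coeff_v (int l + 1) (comm (at_u p) (at_u q)) = 0" for l and p q :: "'a fps"
    by (simp add: coeff_v_at_u comm_def flip: at_u.h_mult at_u.h_diff)
  have "int l + 1 + 1 = int (Suc l) + 1" by simp
  then show "coeff_v (int l + 1) (half * comm (at_u p) (at_u q)) = 0" "coeff_v (int l + 1) (om * comm (at_u p) (const_uv a)) = 0"
    by (simp_all only: coeff_v_half coeff_v_om flip: at_u_const) (simp_all add: coeff_v_at_u comm_def flip: at_u.h_mult at_u.h_diff)
qed

lemma twisted_h_e: "twisted hs [- 1, 1/2] [1, - (1/2)] e"
proof -
  have "coeff_v (int l + 1) ((om - 1) * ((om + half) * (at_u hs * at_v es)) - (om + 1) * ((om - half) * (at_v es * at_u hs)) +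
      half * comm (at_u hs) (at_u es) + om * comm (at_u hs) (const_uv (e 0))) = 0" for l
    using relations'(3)[unfolded comm_h_e_iff] by (simp only: coeff_v_simps)
  then show ?thesis
    unfolding coeff_v_simps(1) coeff_v_u_only add_0_right
    by (subst twisted_iff_coeff_v) (simp_all add: om_prod_simps scalar_cc_simps)
qed

lemma twisted_h_f: "twisted hs [1, - (1/2)] [- 1, 1/2] f"
proof -
  have "coeff_v (int l + 1) ((om + 1) * ((om - half) * (at_u hs * at_v fs)) - (om - 1) * ((om + half) * (at_v fs * at_u hs)) +
      half * comm (at_u hs) (at_u fs) + om * comm (at_u hs) (const_uv (f 0))) = 0" for l
    using relations'(4)[unfolded comm_h_f_iff] by (simp only: coeff_v_simps)
  then show ?thesis
    unfolding coeff_v_simps(1) coeff_v_u_only add_0_right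
    by (subst twisted_iff_coeff_v) (simp_all add: om_prod_simps scalar_cc_simps)
qed

lemma twisted_h_h: "twisted hs [] [] h"
proof -
  have "coeff_v (int l + 1) (comm (at_u hs) (at_v hs)) = 0" for l
    by (simp only: relations'(1) coeff_v_simps)
  then show ?thesis
    by (subst twisted_iff_coeff_v) (simp_all add: om_prod_simps comm_def at_v.h_add at_v.h_1 distrib_left distrib_right)
qed

lemma coeff_v_0_square: "coeff_v 0 ((at_u p - at_v (gen_seq s 0))\<^sup>2) = fps_to_fls (p * p)"
  by (simp add: power2_eq_square algebra_simps coeff_v_at_u coeff_v_at_u_left coeff_v_at_u_right coeff_v_at_v gen_seq_fls_nth
      flip: at_u.h_mult at_v.h_mult)

text \<open>The v^0 coefficient of the quadratic relation multiplied by (u - v)^2. The terms v e(v)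
  and v^2 e(v) contribute e_0 and e_1, which yields the anticommutator of e_1 with the whole series
  e(u).\<close>

lemma ee: "fls_const (e 1) * fps_to_fls es + fps_to_fls es * fls_const (e 1) =
    fls_X_inv * (fps_to_fls es * fls_const (e 0) + fls_const (e 0) * fps_to_fls es)
    - fls_const (cemb (1/2)) * (fps_to_fls es * fls_const (e 0) - fls_const (e 0) * fps_to_fls es)
    - (fls_const (e 0) * fls_const (e 0) + fls_const (e 0) * fls_const (e 0))
    - fls_const (cemb (1/2)) * (fps_to_fls es * fps_to_fls es)"
  using arg_cong[OF acomm_e_e[OF relations'(5)], of "coeff_v 0"]
  apply (simp only: acomm_def comm_def coeff_v_om coeff_v_half coeff_v_simps coeff_v_0_square)
  apply (simp add: coeff_v_at_u_left coeff_v_at_u_right coeff_v_at_v coeff_v_at_u coeff_v_const_left coeff_v_const_right coeff_v_const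
     gen_seq_fls_nth fps_to_fls.h_mult algebra_simps del: fps_to_fls_nth)
  done

lemma ff: "fls_const (f 1) * fps_to_fls fs + fps_to_fls fs * fls_const (f 1) =
    fls_X_inv * (fps_to_fls fs * fls_const (f 0) + fls_const (f 0) * fps_to_fls fs)
    + fls_const (cemb (1/2)) * (fps_to_fls fs * fls_const (f 0) - fls_const (f 0) * fps_to_fls fs)
    - (fls_const (f 0) * fls_const (f 0) + fls_const (f 0) * fls_const (f 0))
    - fls_const (cemb (1/2)) * (fps_to_fls fs * fps_to_fls fs)"
  using arg_cong[OF acomm_f_f[OF relations'(6)], of "coeff_v 0"]
  apply (simp only: acomm_def comm_def coeff_v_om coeff_v_half coeff_v_simps coeff_v_0_square)
  apply (simp add: coeff_v_at_u_left coeff_v_at_u_right coeff_v_at_v coeff_v_at_u coeff_v_const_left coeff_v_const_right coeff_v_const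
     gen_seq_fls_nth fps_to_fls.h_mult algebra_simps del: fps_to_fls_nth)
  done

lemma cubic_e: "es * es * es = es * (es * fps_const (e 0) + fps_const (e 0) * es) +
    (fps_const (e 0) * fps_const (e 0) * es - es * (fps_const (e 0) * fps_const (e 0)))"
  using relations'(7)
  by (intro at_u_inject) (simp only: at_u.hom_simps at_u_const acomm_def comm_def power2_eq_square power3_eq_cube)

lemma cubic_f: "fs * fs * fs = - (fs * (fs * fps_const (f 0) + fps_const (f 0) * fs)) +
    (fps_const (f 0) * fps_const (f 0) * fs - fs * (fps_const (f 0) * fps_const (f 0)))"
  using relations'(8)
  by (intro at_u_inject) (simp only: at_u.hom_simps at_u_const acomm_def comm_def power2_eq_square power3_eq_cube)

end

section \<open>From the Drinfeld relations to the RTT relations\<close>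

text \<open>Written in an arbitrary ring, so that it can be carried through every homomorphism used
  below: the embeddings at u and v, the reflection, the shift and the constant term.\<close>

definition orbit_mat :: "'r \<Rightarrow> 'r \<Rightarrow> 'r \<Rightarrow> 'r \<Rightarrow> 'r \<Rightarrow> 'r :: ring_1 mat3" where
  "orbit_mat k E F e0 f0 =
    (let t23 = k * E; t32 = F * k; t13 = - (e0 * t23 + t23 * e0); t31 = f0 * t32 + t32 * f0;
       t22 = f0 * t23 + t23 * f0 + k; t12 = - (f0 * t13 - t13 * f0) - t23;
       t21 = e0 * t31 - t31 * e0 + t32; t11 = f0 * t12 + t12 * f0 + t22
     in mat_of t11 t12 t13 t21 t22 t23 t31 t32 k)"

lemma (in ring_1_hom) hom_orbit_mat:
  "h (orbit_mat k E F e0 f0 i j) = orbit_mat (h k) (h E) (h F) (h e0) (h f0) i j"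
  by (cases i; cases j) (simp_all add: orbit_mat_def Let_def hom_simps)

lemma mat_of_eta: "mat_of (M I1 I1) (M I1 I2) (M I1 I3) (M I2 I1) (M I2 I2) (M I2 I3) (M I3 I1) (M I3 I2) (M I3 I3) = M"
  by (rule mat3_eqI) simp_all

text \<open>Everything known at one spectral parameter: \<open>E\<close>, \<open>F\<close> and
  \<open>k\<close> are values of the series and \<open>u\<close> is the parameter. It is
  instantiated at u, at u + \<kappa>, and at -u and -v in the two-variable ring.\<close>

locale orbit_point =
  fixes k E F e0 f0 h0 e1 f1 h1 ht u g :: "'r :: ring_1"
  assumes u: "\<And>x. x * u = u * x" and g: "\<And>x. x * g = g * x" "g + g = 1"
    and h0: "h0 = e0 * f0 + f0 * e0"
    and h0_e0: "h0 * e0 = e0 * h0 + e0" and h0_f0: "h0 * f0 = f0 * h0 - f0"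
    and h0_k: "h0 * k = k * h0" and h0_ht: "h0 * ht = ht * h0"
    and h1: "e1 * f0 + f0 * e1 = h1" "e0 * f1 + f1 * e0 = h1" and ht: "h1 = ht + g * (h0 * h0)"
    and ht_k: "ht * k = k * ht" and ht_e0: "ht * e0 = e0 * ht + e1" and ht_f0: "ht * f0 = f0 * ht - f1"
    and e0_k: "e0 * k = k * e0 + k * E" and k_f0: "k * f0 = f0 * k + F * k"
    and ht_E: "ht * E = E * ht + u * E - e0" and ht_F: "ht * F = F * ht - u * F + f0"
    and ee: "e1 * E + E * e1 = u * (E * e0 + e0 * E) - g * (E * e0 - e0 * E) - (e0 * e0 + e0 * e0) - g * (E * E)"
    and ff: "f1 * F + F * f1 = u * (F * f0 + f0 * F) + g * (F * f0 - f0 * F) - (f0 * f0 + f0 * f0) - g * (F * F)"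
    and cubic_e: "E * (E * E) + E * (e0 * E) + e0 * (E * E) + e0 * (e0 * E) - E * (e0 * e0) = 0"
    and cubic_f: "F * (F * F) + F * (F * f0) + F * (f0 * F) - f0 * (f0 * F) + F * (f0 * f0) = 0"
begin

abbreviation "M \<equiv> orbit_mat k E F e0 f0"

lemma assoc_eq: "x * y = z \<Longrightarrow> x * (y * a) = z * (a :: 'r)"
  by (simp flip: mult.assoc)

lemmas g_left = central_left_commute[OF g(1)] and u_left = central_left_commute[OF u]
lemmas e_rules = e0_k ht_k ht_e0 ht_E
lemmas e_rules' = e_rules e_rules[THEN assoc_eq]
lemmas f_rules = k_f0 ht_k[symmetric] ht_f0 ht_F
lemmas f_rules' = f_rules f_rules[THEN assoc_eq]
lemmas central_rules = u[of k] u[of E] u[of F] u[of e0] u[of f0] u_left[of k] u_left[of E] u_left[of F] u_left[of e0] u_left[of f0]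
  g(1)[of k] g(1)[of E] g(1)[of F] g(1)[of e0] g(1)[of f0] g_left[of k] g_left[of E] g_left[of F] g_left[of e0] g_left[of f0]

lemma g_double: "g * x + g * x = x" "g * x + (g * x + y) = x + y"
  by (simp_all flip: distrib_right add.assoc add: g(2))

lemma four: "4 * x = x + x + x + (x :: 'r)" and two: "2 * x = x + (x :: 'r)"
proof -
  have "4 = (1 + 1 + 1 + 1 :: 'r)" "2 = (1 + 1 :: 'r)" by simp_all
  then show "4 * x = x + x + x + x" "2 * x = x + x" by (simp_all only: distrib_right mult_1_left)
qed

lemma entries: "M I2 I3 = k * E" "M I3 I2 = F * k" "M I3 I3 = k"
  "M I1 I3 = - (k * (E * E + (e0 * E + E * e0)))" "M I3 I1 = (F * F + (f0 * F + F * f0)) * k"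
  by (simp_all add: orbit_mat_def Let_def algebra_simps e0_k e0_k[THEN assoc_eq] k_f0 k_f0[THEN assoc_eq])

text \<open>The commutator is -k times the left side of the conjugated cubic relation.\<close>

lemma e0_t13: "e0 * M I1 I3 = M I1 I3 * e0"
proof -
  have "e0 * M I1 I3 - M I1 I3 * e0 =
      - (k * (E * (E * E) + E * (e0 * E) + e0 * (E * E) + e0 * (e0 * E) - E * (e0 * e0)))"
    unfolding entries by (simp add: algebra_simps e0_k e0_k[THEN assoc_eq])
  then show ?thesis by (simp add: cubic_e)
qed

lemma f0_t31: "f0 * M I3 I1 = M I3 I1 * f0"
proof -
  have "f0 * M I3 I1 - M I3 I1 * f0 =
      - ((F * (F * F) + F * (F * f0) + F * (f0 * F) - f0 * (f0 * F) + F * (f0 * f0)) * k)"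
    unfolding entries by (simp add: algebra_simps k_f0 k_f0[THEN assoc_eq])
  then show ?thesis by (simp add: cubic_f)
qed

lemma e1_E: "e1 * E = u * (E * e0 + e0 * E) - g * (E * e0 - e0 * E) - (e0 * e0 + e0 * e0) - g * (E * E) - E * e1"
  and f1_F: "f1 * F = u * (F * f0 + f0 * F) + g * (F * f0 - f0 * F) - (f0 * f0 + f0 * f0) - g * (F * F) - F * f1"
  by (simp_all add: eq_diff_eq ee ff)

text \<open>The product e1 E arising from [ht, e0] is reordered by the quadratic relation
  \<open>ee\<close>; this is where the quadratic relation of e enters the orbit.\<close>

lemma ht_t13: "ht * M I1 I3 = M I1 I3 * ht + (u + u + 2 + g) * M I1 I3 - e0 * M I2 I3 + 4 * (e0 * (e0 * k))"
  unfolding entries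
  by (simp add: algebra_simps e_rules' e1_E e1_E[THEN assoc_eq] central_rules four two g_double)

lemma ht_t31: "ht * M I3 I1 = M I3 I1 * ht - (u + u + 2 + g) * M I3 I1 - M I3 I2 * f0 + 4 * (k * (f0 * f0))"
  unfolding entries
  by (simp add: algebra_simps f_rules' f1_F f1_F[THEN assoc_eq] central_rules four two g_double)

lemma e1_k: "e1 * k = k * e1 + u * (k * E) - k * e0"
proof -
  have e1: "e1 = ht * e0 - e0 * ht" by (simp add: ht_e0)
  show ?thesis unfolding e1 by (simp add: algebra_simps e0_k e0_k[THEN assoc_eq] ht_k ht_k[THEN assoc_eq] ht_E central_rules)
qed

lemma f1_k: "f1 * k = k * f1 - u * (F * k) + f0 * k"
proof -
  have f1: "f1 = f0 * ht - ht * f0" by (simp add: ht_f0)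
  show ?thesis unfolding f1
    by (simp add: algebra_simps k_f0 k_f0[THEN assoc_eq] ht_k[symmetric] ht_k[symmetric, THEN assoc_eq] ht_F[THEN assoc_eq] central_rules)
qed

sublocale orb: osp_orbit_level1 k e0 f0 h0 "M I1 I1" "M I1 I2" "M I1 I3" "M I2 I1" "M I2 I2" "M I2 I3" "M I3 I1" "M I3 I2"
  u g e1 f1 h1 ht
proof
  show "M I2 I3 = e0 * k - k * e0" "M I3 I2 = k * f0 - f0 * k" by (simp_all add: entries e0_k k_f0)
qed (fact u g h0 h0_e0 h0_f0 h0_k h0_ht h1 ht ht_k ht_e0 ht_f0 e0_t13 f0_t31 ht_t13 ht_t31 e1_k[folded entries(1)] f1_k[folded entries(2)]
  | simp add: orbit_mat_def Let_def)+

lemma orbit_eq: "orb.orbit = M"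
  unfolding orb.orbit_def by (rule trans[OF _ mat_of_eta]) (simp add: entries(3))

lemma raise: "commutes_raise e0 M" and lower: "commutes_lower f0 M" and level1: "intertwines_level1 g e0 f0 ht u M"
  using orb.orbit_raise orb.orbit_lower orb.orbit_level1
  unfolding orbit_eq commutes_raise_def commutes_lower_def intertwines_level1_def by simp_all

lemmas transpose = orb.transpose_raise[unfolded orbit_eq] orb.transpose_lower[unfolded orbit_eq] orb.transpose_level1[unfolded orbit_eq]

lemma t22: "M I2 I2 = k * (E * f0 + f0 * E + 1) - F * (k * E)"
  by (simp add: orbit_mat_def Let_def algebra_simps k_f0[THEN assoc_eq])

end

text \<open>The last two rows and columns of \<open>T\<^sup>t(u + \<kappa>) T(u) = q\<close> factorise \<open>q\<close> through Schur complements.\<close>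

lemma transpose_product_schur:
  fixes s t :: "'r :: ring_1 mat3"
  assumes inv: "t I3 I3 * k' = 1" "k' * t I3 I3 = 1" "s I3 I3 * l' = 1" "l' * s I3 I3 = 1"
    and eq: "mat_mult (super_transpose s) t = (\<lambda>i j. if i = j then q else 0)"
  shows "(s I2 I2 + s I3 I2 * l' * s I2 I3) * (t I2 I2 - t I2 I3 * k' * t I3 I2) = q"
proof -
  let ?y = "t I2 I2 - t I2 I3 * k' * t I3 I2"
  note e = fun_cong[OF fun_cong[OF eq], unfolded mat_mult_def super_transpose_eq UNIV_idx, simplified]
  have s13: "s I1 I3 = (s I3 I3 * t I1 I3 - s I2 I3 * t I2 I3) * k'"
    using arg_cong[OF e[of I1 I3], of "\<lambda>x. x * k'"] by (simp add: algebra_simps inv)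
  have s12: "s I1 I2 = (s I3 I2 * t I1 I3 + s I2 I2 * t I2 I3) * k'"
    using arg_cong[OF e[of I2 I3], of "\<lambda>x. x * k'"] by (simp add: algebra_simps inv)
  have "s I3 I3 * (t I1 I2 - t I1 I3 * k' * t I3 I2) = s I2 I3 * ?y"
    using e[of I1 I2] unfolding s13 by (simp add: algebra_simps)
  then have "l' * (s I3 I3 * (t I1 I2 - t I1 I3 * k' * t I3 I2)) = l' * (s I2 I3 * ?y)" by simp
  then have z: "t I1 I2 - t I1 I3 * k' * t I3 I2 = l' * (s I2 I3 * ?y)"
    by (simp only: mult.assoc[symmetric] inv mult_1_left)
  have "q = s I3 I2 * (t I1 I2 - t I1 I3 * k' * t I3 I2) + s I2 I2 * ?y"
    using e[of I2 I2] unfolding s12 by (simp add: algebra_simps)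
  then show ?thesis unfolding z by (simp add: algebra_simps)
qed

lemma lam_nth: "lam c s l $ 0 = s l $ 0" "lam c s l $ Suc n = s l $ Suc n + cemb c * s l $ n - s (Suc l) $ n"
  by (simp_all add: lam_def cfps_def distrib_right mult.assoc)

lemma fps_commuteI:
  fixes p q :: "'a :: ring_1 fps"
  assumes "\<And>m n. p $ m * q $ n = q $ n * p $ m"
  shows "p * q = q * p"
  unfolding fps_eq_iff fps_mult_nth
  by (subst sum.atLeastAtMost_rev) (auto simp: assms intro!: sum.cong)

lemma twisted_const_iff: "twisted p [] [] s \<longleftrightarrow> (\<forall>n l. p $ n * s l = s l * p $ n)"
  by (auto simp: defect_def const_seq_def fps_eq_iff fun_eq_iff)

text \<open>The zero mode acts on \<open>k\<close> by the generating series of the relation \<open>k (u - x + 1) e = (u - x) e k\<close>.\<close>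

lemma twisted_zero_mode_left:
  assumes "twisted k [1] [0] e"
  shows "const_seq e l * k = k * const_seq e l + k * gen_seq e l"
proof -
  let ?D = "\<lambda>l. const_seq e l * k - k * const_seq e l - k * gen_seq e l"
  have "lam 0 ?D = lam 0 (\<lambda>l. 0)"
  proof
    fix l
    have "lam 0 ?D l = lam 0 (const_seq e) l * k - k * lam 0 (const_seq e) l - k * lam 0 (gen_seq e) l"
      by (simp only: lam_diff lam_mult_left lam_mult_right)
    also have "\<dots> = k * lam 1 (const_seq e) l - k * lam 0 (const_seq e) l - k * (fps_X * const_seq e l)"
      using twistedD[OF assms, of l] by (simp add: lam_gen_seq)
    also have "\<dots> = 0"
      by (simp add: lam_def cfps_def cemb_def scaleC_one algebra_simps)
    finally show "lam 0 ?D l = lam 0 (\<lambda>l. 0) l" by (simp add: lam_def)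
  qed
  from fun_cong[OF lam_inject[OF this], of l] show ?thesis by (simp add: algebra_simps)
qed

lemma twisted_zero_mode_right:
  assumes "twisted k [0] [1] f"
  shows "k * const_seq f l = const_seq f l * k + gen_seq f l * k"
proof -
  let ?D = "\<lambda>l. k * const_seq f l - const_seq f l * k - gen_seq f l * k"
  have "lam 0 ?D = lam 0 (\<lambda>l. 0)"
  proof
    fix l
    have "lam 0 ?D l = k * lam 0 (const_seq f) l - lam 0 (const_seq f) l * k - lam 0 (gen_seq f) l * k"
      by (simp only: lam_diff lam_mult_left lam_mult_right)
    also have "\<dots> = lam 1 (const_seq f) l * k - lam 0 (const_seq f) l * k - fps_X * const_seq f l * k"
      using twistedD[OF assms, of l] by (simp add: lam_gen_seq)
    also have "\<dots> = 0"
      by (simp add: lam_def cfps_def cemb_def scaleC_one algebra_simps)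
    finally show "lam 0 ?D l = lam 0 (\<lambda>l. 0) l" by (simp add: lam_def)
  qed
  from fun_cong[OF lam_inject[OF this], of l] show ?thesis by (simp add: algebra_simps)
qed

lemma cemb_half: "cemb (1/2) + cemb (1/2) = (1 :: 'a :: complex_algebra_1)"
  by (simp flip: scaleC_add_left add: cemb_def scaleC_one)

lemma cemb_half': "cemb (1/2) * x + cemb (1/2) * x = (x :: 'a :: complex_algebra_1)"
  "cemb (1/2) * x + (cemb (1/2) * x + y) = (x + y :: 'a :: complex_algebra_1)"
  by (simp_all add: cemb_half flip: distrib_right add.assoc)

lemma cemb_simps: "cemb 1 = 1" "cemb (- c) = - cemb c" "cemb 0 = 0"
  by (simp_all add: cemb_def scaleC_one) (metis add.right_inverse minus_unique scaleC_add_left scaleC_zero_left)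

section \<open>Low modes and the series k in an algebra with the Drinfeld relations\<close>

lemma twisted_low_coeffs:
  assumes "p $ 0 = 1" "twisted p [a, b] [c, d] e"
  shows "p $ 1 * e l + (cemb a + cemb b) * e l = e l * p $ 1 + (cemb c + cemb d) * e l"
    and "p $ 2 * e l + p $ 1 * ((cemb a + cemb b) * e l - (e (Suc l) + e (Suc l))) +
        cemb a * (cemb b * e l) - (cemb a + cemb b) * e (Suc l) =
      e l * p $ 2 + ((cemb c + cemb d) * e l - (e (Suc l) + e (Suc l))) * p $ 1 +
        cemb c * (cemb d * e l) - (cemb c + cemb d) * e (Suc l)"
proof -
  have "lams [a, b] (\<lambda>l. p * const_seq e l) l = lams [c, d] (\<lambda>l. const_seq e l * p) l"
    using twistedD[OF assms(2), of l] by (simp only: lams_mult_left lams_mult_right)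
  then have eq: "lams [a, b] (\<lambda>l. p * const_seq e l) l $ n = lams [c, d] (\<lambda>l. const_seq e l * p) l $ n" for n
    by simp
  have c: "x * cemb a = cemb a * x" "x * (cemb a * y) = cemb a * (x * y)" for x y :: 'a and a
    by (rule cemb_commute[symmetric], rule cemb_left_commute)
  show "p $ 1 * e l + (cemb a + cemb b) * e l = e l * p $ 1 + (cemb c + cemb d) * e l"
    using eq[of "Suc 0"] assms(1) by (simp add: lam_nth const_seq_def algebra_simps)
  show "p $ 2 * e l + p $ 1 * ((cemb a + cemb b) * e l - (e (Suc l) + e (Suc l))) +
        cemb a * (cemb b * e l) - (cemb a + cemb b) * e (Suc l) =
      e l * p $ 2 + ((cemb c + cemb d) * e l - (e (Suc l) + e (Suc l))) * p $ 1 +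
        cemb c * (cemb d * e l) - (cemb c + cemb d) * e (Suc l)"
    using eq[of "Suc (Suc 0)"] assms(1)
    by (simp add: lam_nth const_seq_def algebra_simps numeral_2_eq_2 c(2)[of "p $ Suc 0"])
qed

locale drinfeld_sqrt = drinfeld_data +
  fixes k :: "'a fps"
  assumes k_0: "k $ 0 = 1" and k: "shift (3/2) hs * shift (3/2) k * shift 1 hs * k = 1"
begin

lemma hs_0: "hs $ 0 = 1"
  by simp

text \<open>The shifts balance: with the lists of h translated by 3/2 and 1 and those of k by 3/2
  and 0, both sides run over 0, 1/2, 1, 3/2, 2, 5/2.\<close>

lemma twisted_k_e: "twisted k [1] [0] e" and twisted_k_f: "twisted k [0] [1] f"
  using twisted_h_e twisted_h_f
  by (auto simp: twisted_sqrt[OF k hs_0 k_0, of "[- 1, 1/2]" "[1, - (1/2)]" "[1]" "[0]"]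
      twisted_sqrt[OF k hs_0 k_0, of "[1, - (1/2)]" "[- 1, 1/2]" "[0]" "[1]"])

lemma commute_k_iff: "twisted hs [] [] s \<longleftrightarrow> twisted k [] [] s"
  using twisted_sqrt[OF k hs_0 k_0, of "[]" "[]" "[]" "[]"] by simp

lemma h_h: "h m * h n = h n * h m"
  using twisted_h_h[unfolded twisted_const_iff, rule_format, of "Suc m" n] by simp

lemma k_h: "k $ m * h n = h n * k $ m"
  using commute_k_iff[THEN iffD1, OF twisted_h_h, unfolded twisted_const_iff] by blast

lemma k_hs: "k $ m * hs $ n = hs $ n * k $ m"
  by (cases n) (simp_all add: k_h)

text \<open>Commutation passes from h to k twice: first the coefficients of h commute with k, then,
  for a fixed coefficient of k, commuting with h implies commuting with k.\<close>

lemma k_k: "k $ m * k $ n = k $ n * k $ m"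
proof -
  have "twisted hs [] [] (\<lambda>_. k $ n)" unfolding twisted_const_iff using k_hs by metis
  from commute_k_iff[THEN iffD1, OF this, unfolded twisted_const_iff] show ?thesis by blast
qed

lemmas cemb_right = cemb_commute[symmetric, where x = "h i" for i] cemb_commute[symmetric, where x = "e i" for i]
  cemb_commute[symmetric, where x = "f i" for i] cemb_left_commute[where x = "h i" for i] cemb_left_commute[where x = "e i" for i]
  cemb_left_commute[where x = "f i" for i]

lemma h0_e: "h 0 * e l = e l * h 0 + e l" and h1_e: "h 1 * e l = e l * h 1 + cemb (1/2) * (h 0 * e l + e l * h 0) + e (Suc l)"
proof -
  note d0 = twisted_low_coeffs[OF hs_0 twisted_h_e, of l] twisted_low_coeffs[OF hs_0 twisted_h_e, of "Suc l"]
  have hs: "hs $ 1 = h 0" "hs $ 2 = h 1" by (simp_all add: numeral_2_eq_2)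
  note d = d0[unfolded hs]
  show 0: "h 0 * e l = e l * h 0 + e l"
    using d(1) by (simp add: cemb_simps algebra_simps cemb_half')
  have 1: "h 0 * e (Suc l) = e (Suc l) * h 0 + e (Suc l)"
    using d(3) by (simp add: cemb_simps algebra_simps cemb_half')
  show "h 1 * e l = e l * h 1 + cemb (1/2) * (h 0 * e l + e l * h 0) + e (Suc l)"
  proof -
    have "h 1 * e l + cemb (1/2) * e l = e l + (e (Suc l) + (e l * h 0 + e l * h 1))"
      using d(2) by (simp add: cemb_simps algebra_simps cemb_half' 0 1 cemb_right)
    then have "h 1 * e l + cemb (1/2) * e l = cemb (1/2) * e l + cemb (1/2) * e l + (e (Suc l) + (e l * h 0 + e l * h 1))"
      by (simp only: cemb_half')
    then have "h 1 * e l = cemb (1/2) * e l + (e (Suc l) + (e l * h 0 + e l * h 1))"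
      by (simp only: add.assoc add.commute[of "h 1 * e l"] add_left_cancel)
    then show ?thesis by (simp add: algebra_simps 0 cemb_right cemb_half')
  qed
qed

lemma h0_f: "h 0 * f l = f l * h 0 - f l" and h1_f: "h 1 * f l = f l * h 1 - cemb (1/2) * (h 0 * f l + f l * h 0) - f (Suc l)"
proof -
  note d0 = twisted_low_coeffs[OF hs_0 twisted_h_f, of l] twisted_low_coeffs[OF hs_0 twisted_h_f, of "Suc l"]
  have hs: "hs $ 1 = h 0" "hs $ 2 = h 1" by (simp_all add: numeral_2_eq_2)
  note d = d0[unfolded hs]
  show 0: "h 0 * f l = f l * h 0 - f l"
    using d(1) by (simp add: cemb_simps algebra_simps cemb_half')
  have 1: "h 0 * f (Suc l) = f (Suc l) * h 0 - f (Suc l)"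
    using d(3) by (simp add: cemb_simps algebra_simps cemb_half')
  show "h 1 * f l = f l * h 1 - cemb (1/2) * (h 0 * f l + f l * h 0) - f (Suc l)"
  proof -
    have "f (Suc l) + (f l * h 0 + (h 1 * f l + cemb (1/2) * f l)) = f l + f l * h 1"
      using d(2) by (simp add: cemb_simps algebra_simps cemb_half' 0 1 cemb_right)
    then have "f (Suc l) + f l * h 0 + h 1 * f l + cemb (1/2) * f l = f l * h 1 + cemb (1/2) * f l + cemb (1/2) * f l"
      by (simp only: add.assoc cemb_half' add.commute[of "f l * h 1"])
    then have "f (Suc l) + f l * h 0 + h 1 * f l = f l * h 1 + cemb (1/2) * f l"
      by (simp only: add_right_cancel)
    then show ?thesis by (simp add: algebra_simps 0 cemb_right cemb_half')
  qed
qed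

text \<open>Subtracting h_0^2/2 removes the anticommutator term from [h_1, e_l]; what remains is the
  pure raising of modes, [ht, e_l] = e_(l+1) and [ht, f_l] = -f_(l+1).\<close>

definition "ht = h 1 - cemb (1/2) * (h 0 * h 0)"

lemma ht_e: "ht * e l = e l * ht + e (Suc l)" and ht_f: "ht * f l = f l * ht - f (Suc l)"
  unfolding ht_def
  by (simp_all add: algebra_simps h1_e[simplified] h1_f[simplified] cemb_right)
    (simp_all add: h0_e h0_f algebra_simps flip: mult.assoc)

end

lemma inverse_series_right:
  assumes "f $ 0 = (1 :: 'a :: ring_1)"
  shows "f * inverse_series f = 1"
  by (rule fps_right_inverse'[of 1 f 1]) (simp_all add: assms)

lemma fls_X_inv_X: "fls_X_inv * (fls_X * x) = (x :: 'a :: ring_1 fls)"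
  by (simp add: fls_X_times_conv_shift fls_X_inv_times_conv_shift)

context drinfeld_sqrt
begin

lemma commutator_ht_e: "fps_X * (fps_const ht * es - es * fps_const ht) = es - fps_X * fps_const (e 0)"
proof (rule fps_ext)
  fix n
  show "(fps_X * (fps_const ht * es - es * fps_const ht)) $ n = (es - fps_X * fps_const (e 0)) $ n"
  proof (cases n)
    case (Suc m)
    then show ?thesis by (cases m) (simp_all add: ht_e)
  qed simp
qed

lemma commutator_ht_f: "fps_X * (fps_const ht * fs - fs * fps_const ht) = fps_X * fps_const (f 0) - fs"
proof (rule fps_ext)
  fix n
  show "(fps_X * (fps_const ht * fs - fs * fps_const ht)) $ n = (fps_X * fps_const (f 0) - fs) $ n"
  proof (cases n)
    case (Suc m)
    then show ?thesis by (cases m) (simp_all add: ht_f)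
  qed simp
qed

lemma fps_to_fls_inject: "fps_to_fls p = fps_to_fls q \<Longrightarrow> p = (q :: 'a fps)"
  by simp

lemma acomm_e1: "fps_X * (fps_const (e 1) * es + es * fps_const (e 1)) =
    es * fps_const (e 0) + fps_const (e 0) * es
    - fps_X * (cfps (1/2) * (es * fps_const (e 0) - fps_const (e 0) * es))
    - fps_X * (fps_const (e 0) * fps_const (e 0) + fps_const (e 0) * fps_const (e 0))
    - fps_X * (cfps (1/2) * (es * es))"
  by (rule fps_to_fls_inject)
    (simp only: fps_to_fls.hom_simps fps_to_fls_const cfps_def fps_X_to_fls ee right_diff_distrib[of fls_X] fls_X_X_inv)

lemma acomm_f1: "fps_X * (fps_const (f 1) * fs + fs * fps_const (f 1)) =
    fs * fps_const (f 0) + fps_const (f 0) * fs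
    + fps_X * (cfps (1/2) * (fs * fps_const (f 0) - fps_const (f 0) * fs))
    - fps_X * (fps_const (f 0) * fps_const (f 0) + fps_const (f 0) * fps_const (f 0))
    - fps_X * (cfps (1/2) * (fs * fs))"
  by (rule fps_to_fls_inject)
    (simp only: fps_to_fls.hom_simps fps_to_fls_const cfps_def fps_X_to_fls ff right_diff_distrib[of fls_X]
      distrib_left[of fls_X] fls_X_X_inv)

text \<open>The orbit needs the relation with k on the left. Since k(u - 1) e(u - 1) = e(u) k(u -
  1), the defining relation for e(u) multiplied by k(u - 1) becomes the stated one for e(u - 1), and
  a shift by 1 restores the argument.\<close>

lemma cubic_e_conjugate: "es * (es * es) + es * (fps_const (e 0) * es) + fps_const (e 0) * (es * es) +
    fps_const (e 0) * (fps_const (e 0) * es) - es * (fps_const (e 0) * fps_const (e 0)) = 0"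
proof -
  let ?c = "fps_const (e 0)"
  define k' E where "k' = shift (- 1) k" and "E = shift (- 1) es"
  have 1: "k' * E = es * k'"
    using arg_cong[OF twisted_gen_seq_left[OF twisted_k_e, of 0], of "shift (- 1)"]
    by (simp add: k'_def E_def shift.h_mult shift_shift shift_0)
  have "?c * k = k * ?c + k * es" using twisted_zero_mode_left[OF twisted_k_e, of 0] by (simp add: const_seq_def)
  from arg_cong[OF this, of "shift (- 1)"] have 2: "?c * k' = k' * ?c + k' * E"
    by (simp add: k'_def E_def shift.hom_simps shift_const)
  have 3: "k' * ?c = ?c * k' - es * k'" using 1 2 by simp
  have a: "x * y = z \<Longrightarrow> x * (y * w) = z * w" for x y z w :: "'a fps" by (simp flip: mult.assoc)
  have "k' * (E * (E * E) + E * (?c * E) + ?c * (E * E) + ?c * (?c * E) - E * (?c * ?c)) =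
      - (es * es * es - (es * (es * ?c + ?c * es) + (?c * ?c * es - es * (?c * ?c)))) * k'"
    by (simp add: algebra_simps 1 3 1[THEN a] 3[THEN a] del: fps_const_mult)
  also have "\<dots> = 0" by (simp add: cubic_e del: fps_const_mult)
  finally have "k' * (E * (E * E) + E * (?c * E) + ?c * (E * E) + ?c * (?c * E) - E * (?c * ?c)) = 0" .
  then have "inverse_series k' * (k' * (E * (E * E) + E * (?c * E) + ?c * (E * E) + ?c * (?c * E) - E * (?c * ?c))) = 0"
    by simp
  moreover have "inverse_series k' * k' = 1"
    by (rule fps_left_inverse) (simp add: k'_def shift_nth_0 k_0)
  ultimately have "E * (E * E) + E * (?c * E) + ?c * (E * E) + ?c * (?c * E) - E * (?c * ?c) = 0"
    by (simp del: fps_const_mult flip: mult.assoc)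
  from arg_cong[OF this, of "shift 1"] show ?thesis
    by (simp add: E_def shift.hom_simps shift_const shift_shift shift_0 del: fps_const_mult)
qed

lemma cubic_f': "fs * (fs * fs) + fs * (fs * fps_const (f 0)) + fs * (fps_const (f 0) * fs) -
    fps_const (f 0) * (fps_const (f 0) * fs) + fs * (fps_const (f 0) * fps_const (f 0)) = 0"
  using cubic_f by (simp add: algebra_simps del: fps_const_mult)

text \<open>One verification for all points: \<open>\<tau>\<close> may be any homomorphism that
  sends 1/u to an element with left inverse \<open>u\<close>. Relations containing u are stored
  multiplied by \<open>fps_X\<close> and are freed from it in the target.\<close>

lemma orbit_point_hom:
  fixes \<tau> :: "'a fps \<Rightarrow> 'r :: ring_1"
  assumes hom: "ring_1_hom \<tau>" and u: "\<And>x. x * u = u * x" "u * \<tau> fps_X = 1"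
    and g: "\<And>x. x * \<tau> (cfps (1/2)) = \<tau> (cfps (1/2)) * x"
  shows "orbit_point (\<tau> k) (\<tau> es) (\<tau> fs) (\<tau> (fps_const (e 0))) (\<tau> (fps_const (f 0))) (\<tau> (fps_const (h 0)))
    (\<tau> (fps_const (e 1))) (\<tau> (fps_const (f 1))) (\<tau> (fps_const (h 1))) (\<tau> (fps_const ht)) u (\<tau> (cfps (1/2)))"
proof -
  interpret t: ring_1_hom \<tau> by fact
  let ?c = "\<lambda>x. \<tau> (fps_const x)"
  have c: "?c x * ?c y = ?c (x * y)" "?c x + ?c y = ?c (x + y)" "?c x - ?c y = ?c (x - y)" for x y
    by (simp_all flip: t.h_mult t.h_add t.h_diff)
  have gc: "\<tau> (cfps (1/2)) = ?c (cemb (1/2))" by (simp add: cfps_def)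
  have uX: "u * (\<tau> fps_X * x) = x" for x by (simp add: u(2) flip: mult.assoc)
  have X: "\<tau> (fps_X * p) = \<tau> q \<Longrightarrow> \<tau> p = u * \<tau> q" for p q by (metis t.h_mult uX)
  show ?thesis
  proof
    show "\<tau> (cfps (1/2)) + \<tau> (cfps (1/2)) = 1"
      by (simp add: cfps_def cemb_half flip: t.h_add) (simp add: t.h_1)
    show "?c (e 0) * \<tau> k = \<tau> k * ?c (e 0) + \<tau> k * \<tau> es"
      using twisted_zero_mode_left[OF twisted_k_e, of 0] by (simp add: const_seq_def flip: t.h_mult t.h_add)
    show "\<tau> k * ?c (f 0) = ?c (f 0) * \<tau> k + \<tau> fs * \<tau> k"
      using twisted_zero_mode_right[OF twisted_k_f, of 0] by (simp add: const_seq_def flip: t.h_mult t.h_add)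
    have hk: "fps_const (h n) * k = k * fps_const (h n)" for n by (simp add: fps_eq_iff k_h)
    show "?c (h 0) * \<tau> k = \<tau> k * ?c (h 0)" by (simp add: hk flip: t.h_mult)
    have "fps_const ht * k = k * fps_const ht"
      by (simp add: fps_eq_iff ht_def algebra_simps k_h) (metis (no_types, lifting) cemb_left_commute k_h mult.assoc)
    then show "?c ht * \<tau> k = \<tau> k * ?c ht" by (simp flip: t.h_mult)
    show "?c ht * \<tau> es = \<tau> es * ?c ht + u * \<tau> es - ?c (e 0)"
      using arg_cong[OF commutator_ht_e, of "\<lambda>p. u * \<tau> p"]
      by (simp only: t.h_mult t.h_diff uX right_diff_distrib[of u]) (simp add: algebra_simps)
    show "?c ht * \<tau> fs = \<tau> fs * ?c ht - u * \<tau> fs + ?c (f 0)"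
      using arg_cong[OF commutator_ht_f, of "\<lambda>p. u * \<tau> p"]
      by (simp only: t.h_mult t.h_diff uX right_diff_distrib[of u]) (simp add: algebra_simps)
    show "?c (e 1) * \<tau> es + \<tau> es * ?c (e 1) = u * (\<tau> es * ?c (e 0) + ?c (e 0) * \<tau> es)
        - \<tau> (cfps (1/2)) * (\<tau> es * ?c (e 0) - ?c (e 0) * \<tau> es) - (?c (e 0) * ?c (e 0) + ?c (e 0) * ?c (e 0))
        - \<tau> (cfps (1/2)) * (\<tau> es * \<tau> es)"
      using arg_cong[OF acomm_e1, of "\<lambda>p. u * \<tau> p"]
      by (simp only: t.h_mult t.h_diff t.h_add uX right_diff_distrib[of u])
    show "?c (f 1) * \<tau> fs + \<tau> fs * ?c (f 1) = u * (\<tau> fs * ?c (f 0) + ?c (f 0) * \<tau> fs)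
        + \<tau> (cfps (1/2)) * (\<tau> fs * ?c (f 0) - ?c (f 0) * \<tau> fs) - (?c (f 0) * ?c (f 0) + ?c (f 0) * ?c (f 0))
        - \<tau> (cfps (1/2)) * (\<tau> fs * \<tau> fs)"
      using arg_cong[OF acomm_f1, of "\<lambda>p. u * \<tau> p"]
      by (simp only: t.h_mult t.h_diff t.h_add uX right_diff_distrib[of u]) (simp only: uX distrib_left[of u])
    show "\<tau> es * (\<tau> es * \<tau> es) + \<tau> es * (?c (e 0) * \<tau> es) + ?c (e 0) * (\<tau> es * \<tau> es) +
        ?c (e 0) * (?c (e 0) * \<tau> es) - \<tau> es * (?c (e 0) * ?c (e 0)) = 0"
      using arg_cong[OF cubic_e_conjugate, of \<tau>] by (simp only: t.h_mult t.h_add t.h_diff t.h_0)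
    show "\<tau> fs * (\<tau> fs * \<tau> fs) + \<tau> fs * (\<tau> fs * ?c (f 0)) + \<tau> fs * (?c (f 0) * \<tau> fs) -
        ?c (f 0) * (?c (f 0) * \<tau> fs) + \<tau> fs * (?c (f 0) * ?c (f 0)) = 0"
      using arg_cong[OF cubic_f', of \<tau>] by (simp only: t.h_mult t.h_add t.h_diff t.h_0)
    show "x * \<tau> (cfps (1/2)) = \<tau> (cfps (1/2)) * x" for x by (rule g)
    have "h 0 * ht = ht * h 0"
      by (simp add: ht_def algebra_simps h_h[of 0 "Suc 0"] cemb_right)
    then show "?c (h 0) * ?c ht = ?c ht * ?c (h 0)" by (simp only: c)
  qed (simp_all only: u g gc c ef h0_e h0_f ht_e ht_f One_nat_def, simp_all add: ht_def ef)
qed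

abbreviation "T \<equiv> orbit_mat k es fs (fps_const (e 0)) (fps_const (f 0))"

text \<open>Only \<open>T I2 I2\<close> needs an argument: {e(u), f_0} + 1 is h(u), and k commutes
  with h.\<close>

lemma T_entries: "T I3 I3 = k" "T I2 I3 = k * es" "T I3 I2 = fs * k" "T I2 I2 = hs * k - fs * (k * es)"
proof -
  interpret p: orbit_point "fps_to_fls k" "fps_to_fls es" "fps_to_fls fs" "fps_to_fls (fps_const (e 0))" "fps_to_fls (fps_const (f 0))"
    "fps_to_fls (fps_const (h 0))" "fps_to_fls (fps_const (e 1))" "fps_to_fls (fps_const (f 1))" "fps_to_fls (fps_const (h 1))"
    "fps_to_fls (fps_const ht)" fls_X_inv "fps_to_fls (cfps (1/2))"
    by (rule orbit_point_hom)
      (simp_all add: fps_to_fls.ring_1_hom_axioms fls_X_inv_times_conv_shift cfps_def fps_to_fls_const fls_cemb_commute fps_X_to_fls)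
  have "es * fps_const (f 0) + fps_const (f 0) * es + 1 = hs"
  proof (rule fps_ext)
    fix n
    show "(es * fps_const (f 0) + fps_const (f 0) * es + 1) $ n = hs $ n"
      by (cases n) (simp_all add: ef)
  qed
  moreover have "k * hs = hs * k" by (intro fps_commuteI k_hs)
  ultimately have "k * (es * fps_const (f 0) + fps_const (f 0) * es + 1) - fs * (k * es) = hs * k - fs * (k * es)"
    by (simp only:)
  then have "fps_to_fls (T I2 I2) = fps_to_fls (hs * k - fs * (k * es))"
    using p.t22 by (simp only: fps_to_fls.hom_orbit_mat) (simp only: fps_to_fls.hom_simps[symmetric])
  then show "T I2 I2 = hs * k - fs * (k * es)" by (rule fps_to_fls_inject)
  show "T I3 I3 = k" "T I2 I3 = k * es" "T I3 I2 = fs * k" by (simp_all add: orbit_mat_def Let_def)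
qed

end

text \<open>Multiplication by u reaches one degree below the order of \<open>x\<close>, while all
  other terms vanish there; so the lowest coefficient of a nonzero \<open>x\<close> would have to be
  zero.\<close>

lemma fls_subdegree_cancel:
  fixes x :: "'a :: complex_algebra_1 fls"
  assumes eq: "fls_const z * x = x * fls_const z + (fls_const (cemb c) * fls_X_inv + fls_const b) * x" and c: "c \<noteq> 0"
  shows "x = 0"
proof (rule ccontr)
  assume x: "x \<noteq> 0"
  let ?d = "fls_subdegree x - 1"
  have 0: "x $$ ?d = 0" by simp
  have "(fls_const (cemb c) * fls_X_inv * x) $$ ?d = cemb c * x $$ (?d + 1)"
    by (simp only: mult.assoc fls_X_inv_times_conv_shift(1)) simp
  then have "cemb c * x $$ (?d + 1) = 0"
    using arg_cong[OF eq, of "\<lambda>y. y $$ ?d"] 0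
    by (simp add: distrib_right fls_mult_const_nth)
  then have "cemb (1 / c) * (cemb c * x $$ (?d + 1)) = 0" by simp
  then have "x $$ (?d + 1) = 0"
    using c by (simp add: scaleC_scaleC scaleC_one flip: scaleC_cemb)
  with x show False by simp
qed

context drinfeld_sqrt
begin

lemma shift_hom: "ring_1_hom (\<lambda>p. fps_to_fls (shift (3/2) p))"
  by (rule ring_1_hom_compose) (rule fps_to_fls.ring_1_hom_axioms, rule shift.ring_1_hom_axioms)

lemma T_transpose: "mat_mult (super_transpose (\<lambda>i j. shift (3/2) (T i j))) T = id_mat"
proof -
  let ?s = "\<lambda>i j. shift (3/2) (T i j)"
  let ?g = "fls_const (cemb (1/2)) :: 'a fls"
  let ?z = "fls_const ht"
  interpret p: orbit_point "fps_to_fls k" "fps_to_fls es" "fps_to_fls fs" "fps_to_fls (fps_const (e 0))" "fps_to_fls (fps_const (f 0))"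
    "fps_to_fls (fps_const (h 0))" "fps_to_fls (fps_const (e 1))" "fps_to_fls (fps_const (f 1))" "fps_to_fls (fps_const (h 1))"
    "fps_to_fls (fps_const ht)" fls_X_inv "fps_to_fls (cfps (1/2))"
    by (rule orbit_point_hom)
      (simp_all add: fps_to_fls.ring_1_hom_axioms fls_X_inv_times_conv_shift cfps_def fps_to_fls_const fls_cemb_commute fps_X_to_fls)
  have half: "?g + ?g = 1" by (simp add: fls_plus_const cemb_half)
  have k32: "cfps (3/2) = 1 + (cfps (1/2) :: 'a fps)"
  proof -
    have "cemb (3/2) = (1 + cemb (1/2) :: 'a)" using cemb.h_add[of 1 "1/2"] by (simp add: cemb.h_1)
    then show ?thesis by (simp add: cfps_def fps_eq_iff)
  qed
  \<comment> \<open>The parameter of the shifted series is u + 3/2, written as u + 1 + 1/2 to match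
    the form \<kappa> = 1 + g in \<open>transpose_level1\<close>.\<close>
  have u': "(fls_X_inv + 1 + ?g) * fps_to_fls (shift (3/2) fps_X) = 1"
  proof -
    have "fps_to_fls ((1 + cfps (3/2) * fps_X) * shift (3/2) fps_X) = (fls_X :: 'a fls)"
      by (simp add: shift_X fps_X_to_fls)
    then have "fls_X_inv * ((1 + (1 + ?g) * fls_X) * fps_to_fls (shift (3/2) fps_X)) = 1"
      unfolding k32
      by (simp add: fps_to_fls.hom_simps fps_X_to_fls cfps_def fps_to_fls_const fls_X_inv_times_conv_shift)
    moreover have "fls_X_inv * ((1 + (1 + ?g) * fls_X) * y) = (fls_X_inv + 1 + ?g) * y" for y :: "'a fls"
      by (simp add: distrib_left distrib_right mult.assoc fls_X_inv_X fls_cemb_left_commute[of fls_X_inv])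
    ultimately show ?thesis by simp
  qed
  interpret s: orbit_point "fps_to_fls (shift (3/2) k)" "fps_to_fls (shift (3/2) es)" "fps_to_fls (shift (3/2) fs)"
    "fps_to_fls (shift (3/2) (fps_const (e 0)))" "fps_to_fls (shift (3/2) (fps_const (f 0)))"
    "fps_to_fls (shift (3/2) (fps_const (h 0)))" "fps_to_fls (shift (3/2) (fps_const (e 1)))" "fps_to_fls (shift (3/2) (fps_const (f 1)))"
    "fps_to_fls (shift (3/2) (fps_const (h 1)))"
    "fps_to_fls (shift (3/2) (fps_const ht))" "fls_X_inv + 1 + ?g" "fps_to_fls (shift (3/2) (cfps (1/2)))"
    using shift_hom
    by (rule orbit_point_hom)
      (simp_all only: u' shift_cfps, simp_all add: distrib_left distrib_right fls_X_inv_times_conv_shift cfps_def fps_to_fls_const fls_cemb_commute)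
  have pM: "p.M = (\<lambda>i j. fps_to_fls (T i j))" by (intro ext) (simp only: fps_to_fls.hom_orbit_mat)
  interpret sh: ring_1_hom "\<lambda>p. fps_to_fls (shift (3/2) p)" by (rule shift_hom)
  have sM: "s.M = (\<lambda>i j. fps_to_fls (?s i j))" by (intro ext) (simp only: sh.hom_orbit_mat)
  have cg: "fps_to_fls (cfps (1/2)) = ?g" "fps_to_fls (shift (3/2) (cfps (1/2))) = ?g"
    by (simp_all add: cfps_def fps_to_fls_const shift_const)
  have Q: "mat_mult (super_transpose (\<lambda>i j. fps_to_fls (?s i j))) (\<lambda>i j. fps_to_fls (T i j)) =
    (\<lambda>i j. if i = j then mat_mult (super_transpose (\<lambda>i j. fps_to_fls (?s i j))) (\<lambda>i j. fps_to_fls (T i j)) I3 I3 else 0)"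
  proof (rule quadratic_relation)
    show "commutes_raise (fls_const (e 0)) (\<lambda>i j. fps_to_fls (T i j))" "commutes_lower (fls_const (f 0)) (\<lambda>i j. fps_to_fls (T i j))"
      "intertwines_level1 ?g (fls_const (e 0)) (fls_const (f 0)) ?z fls_X_inv (\<lambda>i j. fps_to_fls (T i j))"
      using p.raise[unfolded pM] p.lower[unfolded pM] p.level1[unfolded pM] by (simp_all only: cg fps_to_fls_const)
    show "commutes_raise (fls_const (e 0)) (super_transpose (\<lambda>i j. fps_to_fls (?s i j)))"
      "commutes_lower (fls_const (f 0)) (super_transpose (\<lambda>i j. fps_to_fls (?s i j)))"
      using s.transpose(1,2)[unfolded sM] by (simp_all only: cg shift_const fps_to_fls_const)
    show "mat_mult (super_transpose (\<lambda>i j. fps_to_fls (?s i j)))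
      (mat_of (?z - (fls_X_inv + fls_X_inv + 2 + ?g)) (fls_const (e 0)) (- (4 * (fls_const (e 0) * fls_const (e 0)))) 0
        (?z - (fls_X_inv + 1)) (fls_const (e 0)) 0 0 ?z) =
      mat_mult (mat_of (?z - (fls_X_inv + fls_X_inv + 2 + ?g)) 0 0 (- fls_const (f 0)) (?z - (fls_X_inv + 1)) 0
        (4 * (fls_const (f 0) * fls_const (f 0))) (fls_const (f 0)) ?z) (super_transpose (\<lambda>i j. fps_to_fls (?s i j)))"
      using s.transpose(3)[of fls_X_inv, unfolded sM] by (simp only: cg shift_const fps_to_fls_const)
    have 1: "fls_const (cemb 1) = (1 :: 'a fls)" "fls_const (cemb (- 1)) = (- 1 :: 'a fls)" "fls_const (cemb 2) = (2 :: 'a fls)"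
      "fls_const (2 + cemb (1/2)) = (2 + ?g :: 'a fls)"
      by (simp_all add: cemb.h_1 cemb.h_uminus cemb.h_numeral flip: fls_const_numeral fls_plus_const)
    \<comment> \<open>In the three cancellations \<open>c\<close> is the coefficient of u: 2, 1 and
      -1.\<close>
    show "x = 0" if "?z * x = x * ?z + (fls_X_inv + fls_X_inv + 2 + ?g) * x" for x
      using that by (intro fls_subdegree_cancel[where z = ht and c = 2 and b = "2 + cemb (1/2)"]) (simp_all add: 1 algebra_simps mult_2[of "fls_X_inv * x"])
    show "x = 0" if "?z * x = x * ?z + (fls_X_inv + 1) * x" for x
      using that by (intro fls_subdegree_cancel[where z = ht and c = 1 and b = 1]) (simp_all add: 1)
    show "x = 0" if "?z * x = x * ?z - fls_X_inv * x" for x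
      using that by (intro fls_subdegree_cancel[where z = ht and c = "- 1" and b = 0]) (simp_all add: 1)
  qed (simp_all add: fls_X_inv_times_conv_shift fls_cemb_commute)
  have m: "mat_mult (super_transpose (\<lambda>i j. fps_to_fls (?s i j))) (\<lambda>i j. fps_to_fls (T i j)) i j =
      fps_to_fls (mat_mult (super_transpose ?s) T i j)" for i j
    by (cases i; cases j) (simp_all add: mat_mult_def super_transpose_eq UNIV_idx fps_to_fls.hom_simps)
  have Q': "fps_to_fls (mat_mult (super_transpose ?s) T i j) =
      (if i = j then fps_to_fls (mat_mult (super_transpose ?s) T I3 I3) else 0)" for i j
    using fun_cong[OF fun_cong[OF Q], of i j] unfolding m .
  have "fps_to_fls (mat_mult (super_transpose ?s) T i j) =
      fps_to_fls (if i = j then mat_mult (super_transpose ?s) T I3 I3 else 0)" for i j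
    unfolding if_distrib[of fps_to_fls] fps_to_fls.h_0 by (rule Q')
  then have eq: "mat_mult (super_transpose ?s) T i j = (if i = j then mat_mult (super_transpose ?s) T I3 I3 else 0)" for i j
    by (rule fps_to_fls_inject)
  have inv: "k * inverse_series k = 1" "inverse_series k * k = 1"
    "shift (3/2) k * inverse_series (shift (3/2) k) = 1" "inverse_series (shift (3/2) k) * shift (3/2) k = 1"
    by (simp_all add: fps_left_inverse inverse_series_right k_0 shift_nth_0)
  have schur: "(?s I2 I2 + ?s I3 I2 * inverse_series (shift (3/2) k) * ?s I2 I3) * (T I2 I2 - T I2 I3 * inverse_series k * T I3 I2) =
      mat_mult (super_transpose ?s) T I3 I3"
    by (rule transpose_product_schur) (simp_all only: T_entries inv, intro ext, rule eq)
  have c: "inverse_series (shift (3/2) k) * (shift (3/2) k * x) = x" for x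
    by (simp add: inv flip: mult.assoc)
  have "shift (3/2) fs * shift (3/2) k * inverse_series (shift (3/2) k) * (shift (3/2) k * shift (3/2) es) =
      shift (3/2) fs * shift (3/2) k * shift (3/2) es"
    by (simp only: mult.assoc c)
  then have 1: "?s I2 I2 + ?s I3 I2 * inverse_series (shift (3/2) k) * ?s I2 I3 = shift (3/2) hs * shift (3/2) k"
    by (simp add: T_entries shift.hom_simps mult.assoc)
  \<comment> \<open>Conjugation by k translates e by 1, which turns the Schur complement into h(u +
    1) k(u).\<close>
  have "k * es * inverse_series k = shift 1 es"
    by (simp add: twisted_gen_seq_left[OF twisted_k_e, of 0] mult.assoc inv)
  then have "T I2 I2 - T I2 I3 * inverse_series k * T I3 I2 = (hs - (shift 1 es * fs + fs * shift 1 es)) * k"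
    using twisted_gen_seq_left[OF twisted_k_e, of 0] by (simp add: T_entries algebra_simps)
  also have "hs - (shift 1 es * fs + fs * shift 1 es) = shift 1 hs"
    using acomm_shift_gen_seq[of e f h, OF ef] by (simp add: shift.hom_simps)
  finally have q: "mat_mult (super_transpose ?s) T I3 I3 = 1"
    using schur k unfolding 1 by (simp add: mult.assoc)
  show ?thesis by (intro ext, subst eq) (simp only: q id_mat_def)
qed

end

section \<open>Passing back to L(u) = T(-u) and assembling the RTT relations\<close>

lemma reflect_X: "reflect fps_X = (- fps_X :: 'b :: complex_algebra_1 fps)" and reflect_cfps: "reflect (cfps c) = (cfps c :: 'b fps)"
  by (auto simp: fps_eq_iff reflect_nth cfps_def)

lemma reflect_const: "reflect (fps_const x) = fps_const x"
  by (simp add: fps_eq_iff reflect_nth)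

lemma ring_1_hom_at_reflect: "ring_1_hom (\<lambda>p :: 'b :: complex_algebra_1 fps. at_u (reflect p))" "ring_1_hom (\<lambda>p :: 'b fps. at_v (reflect p))"
  by (rule ring_1_hom_compose, rule at_u.ring_1_hom_axioms at_v.ring_1_hom_axioms, rule reflect.ring_1_hom_axioms)+

lemma var_inverse: "scalar var_u * at_u fps_X = (1 :: 'b :: complex_algebra_1 fls fls)" "scalar var_v * at_v fps_X = (1 :: 'b fls fls)"
proof -
  show "scalar var_u * at_u fps_X = (1 :: 'b fls fls)"
  proof -
    have "at_u fps_X = (fls_X :: 'b fls fls)" by (rule fls2_eqI) (auto simp: at_u_nth)
    then show ?thesis by (simp add: scalar_var_u fls_X_inv_times_conv_shift)
  qed
  show "scalar var_v * at_v fps_X = (1 :: 'b fls fls)"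
    by (simp add: scalar_var_v at_v_def fls_X_inv_times_conv_shift)
qed

lemma at_u_at_v_commute:
  fixes p q :: "'b :: ring_1 fps"
  assumes "\<And>m n. p $ m * q $ n = q $ n * p $ m"
  shows "at_u p * at_v q = at_v q * at_u p"
proof (rule coeff_v_eqI)
  fix n
  show "coeff_v n (at_u p * at_v q) = coeff_v n (at_v q * at_u p)"
    by (rule fls_eqI) (auto simp: coeff_v_at_u_left coeff_v_at_u_right coeff_v_at_v assms)
qed

text \<open>\<open>rmat\<close> is adapted to T(u) = L(-u). The R-matrix of the presentation is
  therefore \<open>rmat\<close> with coefficients -1/w and -1/(w + \<kappa>).\<close>

lemma rtt_matrix_form:
  fixes L :: "'b :: complex_algebra_1 fps mat3"
  defines "R \<equiv> rmat (- scalar (1 / wvar)) (- scalar (1 / (wvar + kappa)))"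
  shows "(\<forall>i j k l. (R_tens wvar \<bullet> tensor (\<lambda>i j. at_u (L i j)) id_mat \<bullet> tensor id_mat (\<lambda>i j. at_v (L i j))) i j k l =
      (tensor id_mat (\<lambda>i j. at_v (L i j)) \<bullet> tensor (\<lambda>i j. at_u (L i j)) id_mat \<bullet> R_tens wvar) i j k l) \<longleftrightarrow>
    R * (first (\<lambda>i j. at_u (L i j)) * second (\<lambda>i j. at_v (L i j))) = second (\<lambda>i j. at_v (L i j)) * first (\<lambda>i j. at_u (L i j)) * R"
proof -
  have R: "R_tens wvar = tm R"
    by (intro ext) (simp add: R_def R_tens_def rmat_def smult_uv_eq tensor_def)
  have t: "A * B = TM (tm A \<bullet> tm B)" for A B :: "'b fls fls tmat"
    by (rule tmat_eqI) (simp add: times_tmat_def)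
  show ?thesis
    unfolding R by (simp add: t first_def second_def tens_mult_assoc fun_eq_iff)
qed

context drinfeld_sqrt
begin

text \<open>The two points of \<open>level1_pair\<close> are -u and -v, so the elements to be
  cancelled become -(w + 1) and -(w + 3/2), which are nonzero scalars. The quadratic relation is the
  reflected form of \<open>T_transpose\<close>.\<close>

theorem rtt_orbit: "holds (rtt_relations (\<lambda>i j. reflect (T i j)))"
proof -
  let ?c = "- scalar (1 / wvar) :: 'a fls fls" and ?c2 = "- scalar (1 / (wvar + kappa)) :: 'a fls fls"
  let ?u = "- scalar var_u :: 'a fls fls" and ?v = "- scalar var_v :: 'a fls fls"
  have central: "x * - scalar a = - scalar a * x" for a and x :: "'a fls fls" by (simp add: scalar_commute)
  have g: "at_u (cfps (1/2)) = (half :: 'a fls fls)" "at_v (cfps (1/2)) = (half :: 'a fls fls)"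
    by (simp_all add: cfps_def at_u_const at_v_const scalar_cc)
  have cst: "at_u (reflect (fps_const x)) = const_uv x" "at_v (reflect (fps_const x)) = const_uv x" for x :: 'a
    by (simp_all add: reflect_const at_u_const at_v_const)
  have hp: "half + half = (1 :: 'a fls fls)" by (rule half_double)
  interpret tu: ring_1_hom "\<lambda>p :: 'a fps. at_u (reflect p)" by (rule ring_1_hom_at_reflect)
  interpret tv: ring_1_hom "\<lambda>p :: 'a fps. at_v (reflect p)" by (rule ring_1_hom_at_reflect)
  note pu = orbit_point_hom[OF ring_1_hom_at_reflect(1), of ?u, unfolded reflect_cfps cst g]
  interpret pu: orbit_point "at_u (reflect k)" "at_u (reflect es)" "at_u (reflect fs)" "const_uv (e 0)" "const_uv (f 0)" "const_uv (h 0)"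
    "const_uv (e 1)" "const_uv (f 1)" "const_uv (h 1)" "const_uv ht" ?u half
    by (rule pu) (simp_all add: scalar_commute reflect_X at_u.h_uminus var_inverse)
  note pv = orbit_point_hom[OF ring_1_hom_at_reflect(2), of ?v, unfolded reflect_cfps cst g]
  interpret pv: orbit_point "at_v (reflect k)" "at_v (reflect es)" "at_v (reflect fs)" "const_uv (e 0)" "const_uv (f 0)" "const_uv (h 0)"
    "const_uv (e 1)" "const_uv (f 1)" "const_uv (h 1)" "const_uv ht" ?v half
    by (rule pv) (simp_all add: scalar_commute reflect_X at_v.h_uminus var_inverse)
  have Mu: "pu.M = (\<lambda>i j. at_u (reflect (T i j)))" and Mv: "pv.M = (\<lambda>i j. at_v (reflect (T i j)))"
    by (intro ext, simp only: tu.hom_orbit_mat tv.hom_orbit_mat cst)+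
  interpret l: level1_pair ?c ?c2 ?u ?v half "const_uv (e 0)" "const_uv (f 0)" "const_uv ht" pu.M pv.M
  proof
    show "x * ?c = ?c * x" "x * ?c2 = ?c2 * x" "x * ?u = ?u * x" "x * ?v = ?v * x" "x * half = half * x" for x :: "'a fls fls"
      by (simp_all only: central scalar_commute)
    have "scalar (1 / wvar) * om = (1 :: 'a fls fls)" "scalar (1 / (wvar + kappa)) * (om + scalar kappa) = (1 :: 'a fls fls)"
      using wvar_nonzero by (simp_all add: scalar.h_1 flip: scalar.h_mult scalar.h_add)
    then have 1: "scalar (1 / wvar) * (scalar var_u - scalar var_v) = (1 :: 'a fls fls)"
      "scalar (1 / (wvar + kappa)) * (scalar var_u - scalar var_v + (1 + half)) = (1 :: 'a fls fls)"
      by (simp_all only: scalar_kappa scalar.h_diff)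
    show "?c * ?u = 1 + ?c * ?v" using 1(1) by (simp only: right_diff_distrib minus_mult_minus) (simp add: algebra_simps)
    have "scalar (1 / (wvar + kappa)) * scalar var_u = 1 + scalar (1 / (wvar + kappa)) * scalar var_v -
        scalar (1 / (wvar + kappa)) - scalar (1 / (wvar + kappa)) * (half :: 'a fls fls)"
      using 1(2) by (simp only: right_diff_distrib distrib_left mult_1_right) (simp only: algebra_simps)
    then show "?c2 * ?u = 1 + ?c2 * ?v + ?c2 + ?c2 * half" by simp
    show "pu.M I3 I3 * pv.M I3 I3 = pv.M I3 I3 * pu.M I3 I3"
      unfolding pu.entries pv.entries
    proof (rule at_u_at_v_commute)
      fix m n
      show "reflect k $ m * reflect k $ n = reflect k $ n * reflect k $ m"
        using k_k[of m n] by (cases "even m"; cases "even n") (simp_all add: reflect_nth)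
    qed
    have u1: "?u - ?v - 1 = - scalar (wvar + cc 1)" "?u - ?v - 1 - half = - scalar (wvar + cc (3/2))"
    proof -
      have "cc (3/2) = 1 + cc (1/2)" using cc.h_add[of 1 "1/2"] by (simp add: cc.h_1)
      then show "?u - ?v - 1 = - scalar (wvar + cc 1)" "?u - ?v - 1 - half = - scalar (wvar + cc (3/2))"
        by (simp_all only: scalar.h_add scalar.h_diff cc.h_1 scalar.h_1) simp_all
    qed
    show "x = 0" if "(?u - ?v - 1) * x = 0" for x :: "'a fls fls"
      using that scalar_cancel[OF wvar_plus_nonzero[of 1], of x 0] unfolding u1(1) by simp
    show "x = 0" if "(?u - ?v - 1 - half) * x = 0" for x :: "'a fls fls"
      using that scalar_cancel[OF wvar_plus_nonzero[of "3/2"], of x 0] unfolding u1(2) by simp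
  qed (rule half_double pu.raise pv.raise pu.lower pv.lower pu.level1 pv.level1)+
  have orth: "mat_mult (super_transpose (\<lambda>i j. at_u (shift (- kappa) (reflect (T i j))))) (\<lambda>i j. at_u (reflect (T i j))) i j = id_mat i j" for i j
  proof -
    have 1: "shift (- kappa) (reflect p) = reflect (shift (3/2) p)" for p :: "'a fps"
      using reflect_shift[of "- kappa" p] by (simp add: kappa_def)
    have "mat_mult (super_transpose (\<lambda>i j. at_u (reflect (shift (3/2) (T i j))))) (\<lambda>i j. at_u (reflect (T i j))) i j =
        at_u (reflect (mat_mult (super_transpose (\<lambda>i j. shift (3/2) (T i j))) T i j))"
      by (cases i; cases j) (simp_all add: mat_mult_def super_transpose_eq UNIV_idx tu.hom_simps)
    then show ?thesis by (simp add: 1 T_transpose id_mat_def tu.hom_simps)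
  qed
  have rtt: "(R_tens wvar \<bullet> tensor (\<lambda>i j. at_u (reflect (T i j))) id_mat \<bullet> tensor id_mat (\<lambda>i j. at_v (reflect (T i j)))) i j k l =
      (tensor id_mat (\<lambda>i j. at_v (reflect (T i j))) \<bullet> tensor (\<lambda>i j. at_u (reflect (T i j))) id_mat \<bullet> R_tens wvar) i j k l" for i j k l
    using l.exchange_relation[unfolded Mu Mv, folded rtt_matrix_form] by blast
  have "l = r" if "(l, r) \<in> rtt_relations (\<lambda>i j. reflect (T i j))" for l r
    using that unfolding rtt_relations_def Let_def
    by (elim UnE CollectE exE conjE Pair_inject) (simp_all only: rtt orth)
  then show ?thesis unfolding holds_def by blast
qed

end

section \<open>Entries of the RTT relations\<close>

text \<open>The substitution \<open>u \<mapsto> -u\<close>, \<open>v \<mapsto> -v\<close>.\<close>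

definition flip1 :: "'b :: ring_1 fls \<Rightarrow> 'b fls" where
  "flip1 F = Abs_fls (\<lambda>n. if even n then F $$ n else - F $$ n)"

lemma flip1_nth: "flip1 F $$ n = (if even n then F $$ n else - F $$ n)"
  unfolding flip1_def by (rule nth_Abs_fls_lower_bound[where N = "fls_subdegree F"]) simp

lemma ring_1_hom_flip1: "ring_1_hom (flip1 :: 'b :: ring_1 fls \<Rightarrow> _)"
proof
  show "flip1 1 = (1 :: 'b fls)" by (rule fls_eqI) (simp add: flip1_nth)
  show "flip1 (x + y) = flip1 x + flip1 y" for x y :: "'b fls" by (rule fls_eqI) (simp add: flip1_nth)
  show "flip1 (x * y) = flip1 x * flip1 y" for x y :: "'b fls"
  proof (rule fls_eqI)
    fix n
    have "(flip1 x * flip1 y) $$ n = (\<Sum>i=fls_subdegree x..n - fls_subdegree y. flip1 x $$ i * flip1 y $$ (n - i))"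
      by (rule fls_times_nth_below) (simp_all add: flip1_nth)
    also have "\<dots> = (\<Sum>i=fls_subdegree x..n - fls_subdegree y.
        if even n then x $$ i * y $$ (n - i) else - (x $$ i * y $$ (n - i)))"
      by (rule sum.cong) (auto simp: flip1_nth)
    finally show "flip1 (x * y) $$ n = (flip1 x * flip1 y) $$ n"
      by (cases "even n") (simp_all add: flip1_nth fls_times_nth(2) sum_negf)
  qed
qed

definition flip :: "'b :: ring_1 fls fls \<Rightarrow> 'b fls fls" where
  "flip F = map_fls flip1 (flip1 F)"

interpretation flip: ring_1_hom flip
  unfolding flip_def[abs_def] by (rule ring_1_hom_compose[OF ring_1_hom_map_fls[OF ring_1_hom_flip1] ring_1_hom_flip1])

lemma flip_nth: "(flip F $$ m) $$ n = (if even (m + n) then (F $$ m) $$ n else - (F $$ m) $$ n)"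
proof -
  have "flip1 0 = (0 :: 'a fls)" by (rule fls_eqI) (simp add: flip1_nth)
  then show ?thesis by (auto simp: flip_def map_fls_nth flip1_nth)
qed

lemma flip_at: "flip (at_u f) = at_u (reflect f)" "flip (at_v f) = at_v (reflect f)"
  by (rule fls2_eqI, auto simp: flip_nth at_u_nth at_v_nth reflect_nth even_nat_iff)+

lemma flip_scalar: "flip (scalar c) = scalar (flip c)"
  by (rule fls2_eqI) (simp add: flip_nth scalar_nth cemb.h_uminus)

lemma flip_var: "flip var_u = - var_u" "flip var_v = - var_v"
  by (rule fls2_eqI, auto simp: flip_nth var_u_def var_v_def)+

lemma flip_kappa: "flip kappa = (kappa :: complex fls fls)"
  by (rule fls2_eqI) (simp add: flip_nth kappa_cc cc_def)

lemma flip_inverse: "flip (1 / x) = 1 / flip (x :: complex fls fls)"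
proof (cases "x = 0")
  case False
  then have "flip (x * (1 / x)) = 1" by (simp add: flip.h_1)
  then have "flip x * flip (1 / x) = 1" by (simp only: flip.h_mult)
  then show ?thesis by (metis nonzero_mult_div_cancel_left mult_zero_left zero_neq_one)
qed (simp add: flip.h_0)

definition flip_tmat :: "'b :: ring_1 fls fls tmat \<Rightarrow> 'b fls fls tmat" where
  "flip_tmat X = TM (\<lambda>i j k l. flip (tm X i j k l))"

lemma flip_tmat: "flip_tmat (X * Y) = flip_tmat X * flip_tmat Y"
  "flip_tmat (first A) = first (\<lambda>i j. flip (A i j))" "flip_tmat (second A) = second (\<lambda>i j. flip (A i j))"
  "flip_tmat (rmat a b) = rmat (flip a) (flip b)"
proof -
  show "flip_tmat (X * Y) = flip_tmat X * flip_tmat Y"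
    by (rule tmat_eqI)
      (simp only: flip_tmat_def tm_mult tmat.sel flip.h_sum flip.h_mult flip.h_power flip.h_uminus flip.h_1)
  show "flip_tmat (first A) = first (\<lambda>i j. flip (A i j))"
    by (rule tmat_eqI) (simp add: flip_tmat_def first_def tensor_def id_mat_def flip.h_0)
  show "flip_tmat (second A) = second (\<lambda>i j. flip (A i j))"
    by (rule tmat_eqI) (simp add: flip_tmat_def second_def tensor_def id_mat_def flip.h_0)
  show "flip_tmat (rmat a b) = rmat (flip a) (flip b)"
  proof (rule tmat_eqI)
    fix i j k l
    show "tm (flip_tmat (rmat a b)) i j k l = tm (rmat (flip a) (flip b)) i j k l"
      by (cases i; cases j; cases k; cases l)
        (simp_all add: flip_tmat_def rmat_def P_tens_eq P_t1_tens_eq unit_mat_def J_mat_def id_mat_def flip.hom_simps)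
  qed
qed

lemma tm_even_elem: "tm (even_elem c * X) i j k l = c * tm X i j k l"
  by (cases i; cases k) (simp_all add: tm_mult even_elem_def id_mat_def UNIV_idx)

lemma tm_even_elem_right: "tm (X * even_elem c) i j k l = tm X i j k l * c"
  by (cases j; cases l) (simp_all add: tm_mult even_elem_def id_mat_def UNIV_idx)

lemma rmat_eq: "rmat c c2 = 1 - even_elem c * TM P_tens + even_elem c2 * TM P_t1_tens"
  by (rule tmat_eqI) (simp add: rmat_def tm_even_elem one_tmat_def tensor_def)

text \<open>Separating the identity from the permutation and trace parts shows each entry as a
  supercommutator equal to correction terms with the coefficients \<open>c\<close> and
  \<open>c2\<close>.\<close>

lemma rmat_exchange_entry:
  fixes c c2 :: "'b :: ring_1"
  assumes c: "\<And>x. x * c = c * x" "\<And>x. x * c2 = c2 * x"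
    and eq: "rmat c c2 * (X * Y) = Y * X * rmat c c2"
  shows "tm (X * Y) i j k l - tm (Y * X) i j k l =
    c * (tm (TM P_tens * (X * Y)) i j k l - tm (Y * X * TM P_tens) i j k l) -
    c2 * (tm (TM P_t1_tens * (X * Y)) i j k l - tm (Y * X * TM P_t1_tens) i j k l)"
proof -
  have e: "Z * (even_elem a * W) = even_elem a * (Z * W)" if "\<And>x. x * a = a * x" for a and Z W :: "'b tmat"
  proof -
    have "Z * even_elem a = even_elem a * Z" by (rule tmat_eqI) (simp add: tm_even_elem tm_even_elem_right that)
    then show ?thesis by (simp flip: mult.assoc)
  qed
  have "X * Y - even_elem c * (TM P_tens * (X * Y)) + even_elem c2 * (TM P_t1_tens * (X * Y)) =
      Y * X - even_elem c * (Y * X * TM P_tens) + even_elem c2 * (Y * X * TM P_t1_tens)"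
    using eq unfolding rmat_eq by (simp add: distrib_left distrib_right left_diff_distrib right_diff_distrib mult.assoc e c)
  then have "tm (X * Y - even_elem c * (TM P_tens * (X * Y)) + even_elem c2 * (TM P_t1_tens * (X * Y))) i j k l =
      tm (Y * X - even_elem c * (Y * X * TM P_tens) + even_elem c2 * (Y * X * TM P_t1_tens)) i j k l"
    by (rule arg_cong)
  then show ?thesis by (simp add: tm_even_elem right_diff_distrib) (simp add: algebra_simps)
qed

lemma tm_first_second: "tm (first A * second B) i j k l = A i j * B k l"
  "tm (second B * first A) i j k l = (- 1) ^ ((grade k + grade l) * (grade i + grade j)) * B k l * A i j"
  by (cases i; cases j; cases k; cases l; simp add: tm_mult first_def second_def tensor_def id_mat_def UNIV_idx)+

lemma tm_P_left: "tm (TM P_tens * X) i j k l = (- 1) ^ ((grade k + grade i) * (grade k + grade j) + grade k) * tm X k j i l"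
  by (cases i; cases k) (simp_all add: tm_mult P_tens_eq unit_mat_def id_mat_def UNIV_idx)

lemma tm_P_right: "tm (X * TM P_tens) i j k l = (- 1) ^ ((grade k + grade j) * (grade l + grade j) + grade j) * tm X i l k j"
  by (cases j; cases l; cases k) (simp_all add: tm_mult P_tens_eq unit_mat_def id_mat_def UNIV_idx)

lemmas tm_K = tm_mult[of "TM P_t1_tens"] tm_mult[of _ "TM P_t1_tens"]

text \<open>After multiplication by w (w - \<kappa>) the coefficients of v^1 are compared. Only v^2
  times the 1/v coefficient of \<open>G\<close> and -v times the constant coefficients of
  \<open>A\<close> and \<open>B\<close> reach that power.\<close>

lemma zero_mode:
  fixes G A B :: "'b :: complex_algebra_1 fls fls"
  assumes eq: "G = scalar (1 / wvar) * A - scalar (1 / (wvar - kappa)) * B"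
    and G: "\<And>n. n \<le> 0 \<Longrightarrow> coeff_v n G = 0" and AB: "coeff_v (- 1) A = 0" "coeff_v (- 1) B = 0"
  shows "coeff_v 1 G = coeff_v 0 B - coeff_v 0 A"
proof -
  have "scalar (wvar * (wvar - kappa)) * G = scalar (wvar - kappa) * A - om * B"
    unfolding eq right_diff_distrib[of "scalar _"] scalar_mult_left using wvar_nonzero by simp
  then have "om * ((om - (1 + half)) * G) = (om - (1 + half)) * A - om * B"
    by (simp only: scalar.h_mult scalar.h_diff[of wvar] scalar_kappa mult.assoc)
  from arg_cong[OF this, of "coeff_v (- 1)"] show ?thesis
    by (simp add: coeff_v_om coeff_v_half left_diff_distrib distrib_right right_diff_distrib G AB)
qed

locale rtt_data =
  fixes T :: "'a :: complex_algebra_1 fps mat3"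
  assumes T_0: "T i j $ 0 = (if i = j then 1 else 0)" and rtt: "holds (rtt_relations (\<lambda>i j. reflect (T i j)))"
begin

abbreviation "t \<equiv> \<lambda>i j. at_u (T i j)"
abbreviation "t' \<equiv> \<lambda>i j. at_v (T i j)"
abbreviation "c \<equiv> scalar (1 / wvar) :: 'a fls fls"
abbreviation "c2 \<equiv> scalar (1 / (wvar - kappa)) :: 'a fls fls"

lemma relation: "(l, r) \<in> rtt_relations (\<lambda>i j. reflect (T i j)) \<Longrightarrow> l = r"
  using rtt unfolding holds_def by (metis (mono_tags, lifting) case_prodD)

text \<open>The substitution \<open>flip\<close> carries the relation for L to one for T and turns
  -1/w and -1/(w + \<kappa>) into 1/w and 1/(w - \<kappa>).\<close>

lemma exchange: "rmat c c2 * (first t * second t') = second t' * first t * rmat c c2"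
proof -
  have "\<forall>i j k l. (R_tens wvar \<bullet> tensor (\<lambda>i j. at_u (reflect (T i j))) id_mat \<bullet> tensor id_mat (\<lambda>i j. at_v (reflect (T i j)))) i j k l =
      (tensor id_mat (\<lambda>i j. at_v (reflect (T i j))) \<bullet> tensor (\<lambda>i j. at_u (reflect (T i j))) id_mat \<bullet> R_tens wvar) i j k l"
  proof (intro allI, rule relation)
    fix i j k l
    show "((R_tens wvar \<bullet> tensor (\<lambda>i j. at_u (reflect (T i j))) id_mat \<bullet> tensor id_mat (\<lambda>i j. at_v (reflect (T i j)))) i j k l,
      (tensor id_mat (\<lambda>i j. at_v (reflect (T i j))) \<bullet> tensor (\<lambda>i j. at_u (reflect (T i j))) id_mat \<bullet> R_tens wvar) i j k l)
      \<in> rtt_relations (\<lambda>i j. reflect (T i j))"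
      unfolding rtt_relations_def Let_def
      by (rule UnI1, rule CollectI, (rule exI)+, rule conjI, rule refl, rule TrueI)
  qed
  from arg_cong[OF this[unfolded rtt_matrix_form], of flip_tmat]
  have "rmat (flip (- scalar (1 / wvar))) (flip (- scalar (1 / (wvar + kappa)))) * (first t * second t') =
      second t' * first t * rmat (flip (- scalar (1 / wvar))) (flip (- scalar (1 / (wvar + kappa))))"
    by (simp only: flip_tmat flip_at reflect_reflect)
  moreover have "flip (- scalar (1 / wvar)) = c"
  proof -
    have "- (1 / (var_v - var_u)) = 1 / wvar"
      by (simp flip: divide_minus_right)
    then show ?thesis
      by (simp add: flip.h_uminus flip_scalar flip_inverse flip.h_diff flip_var flip: scalar.h_uminus)
  qed
  moreover have "flip (- scalar (1 / (wvar + kappa))) = c2"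
  proof -
    have "- (1 / (- var_u + var_v + kappa)) = 1 / (wvar - kappa)"
      by (simp flip: divide_minus_right)
    then show ?thesis
      by (simp add: flip.h_uminus flip_scalar flip_inverse flip.h_diff flip.h_add flip_var flip_kappa flip: scalar.h_uminus)
  qed
  ultimately show ?thesis by simp
qed

lemmas entry = rmat_exchange_entry[OF scalar_commute scalar_commute exchange, unfolded tm_P_left tm_P_right]

lemma orth: "mat_mult (super_transpose (\<lambda>i j. shift (3/2) (T i j))) T i j = id_mat i j"
proof -
  interpret tu: ring_1_hom "\<lambda>p :: 'a fps. at_u (reflect p)" by (rule ring_1_hom_at_reflect)
  have 1: "shift (- kappa) (reflect p) = reflect (shift (3/2) p)" for p :: "'a fps"
    using reflect_shift[of "- kappa" p] by (simp add: kappa_def)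
  have "mat_mult (super_transpose (\<lambda>i j. at_u (shift (- kappa) (reflect (T i j))))) (\<lambda>i j. at_u (reflect (T i j))) i j = id_mat i j"
    by (rule relation, unfold rtt_relations_def Let_def, rule UnI2, rule CollectI, (rule exI)+, rule conjI, rule refl, rule TrueI)
  also have "mat_mult (super_transpose (\<lambda>i j. at_u (shift (- kappa) (reflect (T i j))))) (\<lambda>i j. at_u (reflect (T i j))) i j =
        at_u (reflect (mat_mult (super_transpose (\<lambda>i j. shift (3/2) (T i j))) T i j))"
    unfolding 1 by (cases i; cases j) (simp_all add: mat_mult_def super_transpose_eq UNIV_idx tu.hom_simps)
  also have "id_mat i j = at_u (reflect (id_mat i j :: 'a fps))"
    by (simp add: id_mat_def tu.hom_simps)
  finally have "reflect (mat_mult (super_transpose (\<lambda>i j. shift (3/2) (T i j))) T i j) = reflect (id_mat i j)"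
    by (rule at_u_inject)
  then have "reflect (reflect (mat_mult (super_transpose (\<lambda>i j. shift (3/2) (T i j))) T i j)) = reflect (reflect (id_mat i j))"
    by (rule arg_cong)
  then show ?thesis unfolding reflect_reflect .
qed

lemmas entry_simps = tm_first_second tm_K UNIV_idx P_t1_tens_eq J_mat_def unit_mat_def

lemma cancel_1_minus_c: "x = 0" if "(1 - c) * x = 0" for x
proof -
  have "om * (x - c * x) = 0" using that by (simp add: left_diff_distrib)
  then have "scalar (wvar + cc (- 1)) * x = 0"
    by (simp only: right_diff_distrib scalar_om_inverse scalar.h_add[of wvar] scalar_cc_simps distrib_right) simp
  then show ?thesis using scalar_cancel[OF wvar_plus_nonzero[of "- 1"], of x 0] by simp
qed

lemma kk: "t I3 I3 * t' I3 I3 = t' I3 I3 * t I3 I3"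
proof -
  have "(1 - c) * (t I3 I3 * t' I3 I3 - t' I3 I3 * t I3 I3) = 0"
    using entry[of I3 I3 I3 I3] by (simp add: entry_simps) (simp add: algebra_simps)
  then show ?thesis using cancel_1_minus_c by (metis eq_iff_diff_eq_0)
qed

lemma ke:
  "t I3 I3 * t' I2 I3 - t' I2 I3 * t I3 I3 = c * (t I2 I3 * t' I3 I3 - t' I2 I3 * t I3 I3)"
  "t I2 I3 * t' I3 I3 - t' I3 I3 * t I2 I3 = c * (t I3 I3 * t' I2 I3 - t' I3 I3 * t I2 I3)"
  subgoal using entry[of I3 I3 I2 I3] apply (simp add: entry_simps) done
  subgoal using entry[of I2 I3 I3 I3] apply (simp add: entry_simps) done
  done

lemma kf:
  "t I3 I3 * t' I3 I2 - t' I3 I2 * t I3 I3 = c * (t I3 I3 * t' I3 I2 - t' I3 I3 * t I3 I2)"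
  "t I3 I2 * t' I3 I3 - t' I3 I3 * t I3 I2 = c * (t I3 I2 * t' I3 I3 - t' I3 I2 * t I3 I3)"
  subgoal using entry[of I3 I3 I3 I2] apply (simp add: entry_simps) done
  subgoal using entry[of I3 I2 I3 I3] apply (simp add: entry_simps) done
  done

text \<open>The second identity does not appear directly as an entry with this right side: the entry
  has ?y in place of ?x. The four entries combine to ?x - ?y = c^2 (?x - ?y), and w^2 - 1 is
  invertible.\<close>

lemma ef_entries:
  "t I2 I3 * t' I3 I2 + t' I3 I2 * t I2 I3 = c * (t I3 I3 * t' I2 I2 - t' I3 I3 * t I2 I2)"
  "t' I2 I3 * t I3 I2 + t I3 I2 * t' I2 I3 = c * (t I3 I3 * t' I2 I2 - t' I3 I3 * t I2 I2)"
  "t I3 I3 * t' I2 I2 - t' I2 I2 * t I3 I3 = c * (t I2 I3 * t' I3 I2 - t' I2 I3 * t I3 I2)"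
proof -
  let ?x = "t I3 I3 * t' I2 I2 - t' I3 I3 * t I2 I2" and ?y = "t' I2 I2 * t I3 I3 - t I2 I2 * t' I3 I3"
  show a: "t I2 I3 * t' I3 I2 + t' I3 I2 * t I2 I3 = c * ?x"
    using entry[of I2 I3 I3 I2] by (simp add: entry_simps)
  show x: "t I3 I3 * t' I2 I2 - t' I2 I2 * t I3 I3 = c * (t I2 I3 * t' I3 I2 - t' I2 I3 * t I3 I2)"
    using entry[of I3 I3 I2 I2] by (simp add: entry_simps)
  have b: "t' I2 I3 * t I3 I2 + t I3 I2 * t' I2 I3 = c * ?y"
    using entry[of I3 I2 I2 I3] by (simp add: entry_simps add.commute)
  have y: "t I2 I2 * t' I3 I3 - t' I3 I3 * t I2 I2 = c * (t' I3 I2 * t I2 I3 - t I3 I2 * t' I2 I3)"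
    using entry[of I2 I2 I3 I3] by (simp add: entry_simps)
  have "?x - ?y = (t I3 I3 * t' I2 I2 - t' I2 I2 * t I3 I3) + (t I2 I2 * t' I3 I3 - t' I3 I3 * t I2 I2)"
    by simp
  also have "\<dots> = c * ((t I2 I3 * t' I3 I2 + t' I3 I2 * t I2 I3) - (t' I2 I3 * t I3 I2 + t I3 I2 * t' I2 I3))"
    unfolding x y by (simp add: algebra_simps)
  also have "\<dots> = c * (c * (?x - ?y))"
    unfolding a b by (simp add: right_diff_distrib)
  finally have "om * (om * (?x - ?y)) = om * (om * (c * (c * (?x - ?y))))" by (rule arg_cong)
  then have "om * (om * (?x - ?y)) - (?x - ?y) = 0"
    by (simp only: scalar_om_inverse) simp
  moreover have "scalar ((wvar + cc 1) * (wvar + cc (- 1))) * F = om * (om * F) - F" for F :: "'a fls fls"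
    unfolding scalar.h_mult mult.assoc scalar.h_add[of wvar] scalar_cc_simps
    by (simp add: distrib_left distrib_right left_diff_distrib right_diff_distrib del: scalar.h_diff)
  ultimately have "scalar ((wvar + cc 1) * (wvar + cc (- 1))) * (?x - ?y) = 0" by simp
  then have "?x - ?y = 0"
    using scalar_cancel[of "(wvar + cc 1) * (wvar + cc (- 1))" "?x - ?y" 0] wvar_plus_nonzero by simp
  then have "?x = ?y" by (rule right_minus_eq[THEN iffD1])
  then show "t' I2 I3 * t I3 I2 + t I3 I2 * t' I2 I3 = c * ?x" unfolding b by (rule arg_cong[OF sym])
qed

lemma ee_entries:
  "t I2 I3 * t' I2 I3 + t' I2 I3 * t I2 I3 = c * (t' I2 I3 * t I2 I3 - t I2 I3 * t' I2 I3) -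
    c2 * (t I3 I3 * t' I1 I3 - t I2 I3 * t' I2 I3 - t I1 I3 * t' I3 I3)"
  "t I1 I3 * t' I3 I3 - t' I3 I3 * t I1 I3 = c * (t I3 I3 * t' I1 I3 - t' I3 I3 * t I1 I3) +
    c2 * (t I3 I3 * t' I1 I3 - t I2 I3 * t' I2 I3 - t I1 I3 * t' I3 I3)"
  subgoal using entry[of I2 I3 I2 I3] apply (simp add: entry_simps) apply (simp add: algebra_simps)? done
  subgoal using entry[of I1 I3 I3 I3] apply (simp add: entry_simps) apply (simp add: algebra_simps)? done
  done

lemma ff_entries:
  "t I3 I2 * t' I3 I2 + t' I3 I2 * t I3 I2 = c * (t I3 I2 * t' I3 I2 - t' I3 I2 * t I3 I2) -
    c2 * (t' I3 I3 * t I3 I1 - t' I3 I2 * t I3 I2 - t' I3 I1 * t I3 I3)"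
  "t I3 I1 * t' I3 I3 - t' I3 I3 * t I3 I1 = c * (t I3 I1 * t' I3 I3 - t' I3 I1 * t I3 I3) +
    c2 * (t' I3 I3 * t I3 I1 - t' I3 I2 * t I3 I2 - t' I3 I1 * t I3 I3)"
  subgoal using entry[of I3 I2 I3 I2] apply (simp add: entry_simps) apply (simp add: algebra_simps)? done
  subgoal using entry[of I3 I1 I3 I3] apply (simp add: entry_simps) apply (simp add: algebra_simps)? done
  done

lemma coeff_v_products:
  fixes p q :: "'a fps"
  shows "coeff_v 0 (at_u p * at_v q) = fps_to_fls p * fls_const (q $ 0)" "coeff_v 0 (at_v q * at_u p) = fls_const (q $ 0) * fps_to_fls p"
  "coeff_v 1 (at_u p * at_v q) = fps_to_fls p * fls_const (q $ 1)" "coeff_v 1 (at_v q * at_u p) = fls_const (q $ 1) * fps_to_fls p"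
  "n < 0 \<Longrightarrow> coeff_v n (at_u p * at_v q) = 0" "n < 0 \<Longrightarrow> coeff_v n (at_v q * at_u p) = 0"
  "q $ 0 = 0 \<Longrightarrow> n \<le> 0 \<Longrightarrow> coeff_v n (at_u p * at_v q) = 0" "q $ 0 = 0 \<Longrightarrow> n \<le> 0 \<Longrightarrow> coeff_v n (at_v q * at_u p) = 0"
  by (simp_all add: coeff_v_at_u_left coeff_v_at_u_right coeff_v_at_v)

abbreviation "z \<equiv> \<lambda>i j. fls_const (T i j $ 1)"
abbreviation "s \<equiv> \<lambda>i j. fps_to_fls (T i j)"

lemmas zero_entry = zero_mode[OF entry]

text \<open>At order 1/v the factor taken at v reduces to a zero mode, so these entries describe the
  action of e_0 and f_0 on T. The last two close the orbit and become the cubic relations.\<close>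

lemma zero_modes:
  "s I3 I3 * z I2 I3 - z I2 I3 * s I3 I3 = - s I2 I3"
  "s I3 I3 * z I3 I2 - z I3 I2 * s I3 I3 = s I3 I2"
  "s I2 I3 * z I2 I3 + z I2 I3 * s I2 I3 = - s I1 I3"
  "s I3 I2 * z I3 I2 + z I3 I2 * s I3 I2 = s I3 I1"
  "s I2 I3 * z I3 I2 + z I3 I2 * s I2 I3 = s I2 I2 - s I3 I3"
  "s I1 I3 * z I3 I2 - z I3 I2 * s I1 I3 = s I1 I2 + s I2 I3"
  "s I3 I1 * z I2 I3 - z I2 I3 * s I3 I1 = s I3 I2 - s I2 I1"
  "s I1 I2 * z I3 I2 + z I3 I2 * s I1 I2 = s I1 I1 - s I2 I2"
  "s I1 I3 * z I2 I3 - z I2 I3 * s I1 I3 = 0"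
  "s I3 I1 * z I3 I2 - z I3 I2 * s I3 I1 = 0"
  subgoal using zero_entry[of I3 I3 I2 I3] by (simp add: entry_simps coeff_v_products T_0)
  subgoal using zero_entry[of I3 I3 I3 I2] by (simp add: entry_simps coeff_v_products T_0)
  subgoal using zero_entry[of I2 I3 I2 I3] by (simp add: entry_simps coeff_v_products T_0)
  subgoal using zero_entry[of I3 I2 I3 I2] by (simp add: entry_simps coeff_v_products T_0)
  subgoal using zero_entry[of I2 I3 I3 I2] by (simp add: entry_simps coeff_v_products T_0)
  subgoal using zero_entry[of I1 I3 I3 I2] by (simp add: entry_simps coeff_v_products T_0)
  subgoal using zero_entry[of I3 I1 I2 I3] by (simp add: entry_simps coeff_v_products T_0)
  subgoal using zero_entry[of I1 I2 I3 I2] by (simp add: entry_simps coeff_v_products T_0)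
  subgoal using zero_entry[of I1 I3 I2 I3] by (simp add: entry_simps coeff_v_products T_0)
  subgoal using zero_entry[of I3 I1 I3 I2] by (simp add: entry_simps coeff_v_products T_0)
  done

end

section \<open>From the RTT relations to the Drinfeld relations\<close>

text \<open>Division of the twisted relation by u - x, by the injectivity of \<open>lam 0\<close>;
  the result holds for the series x^l/(u - x).\<close>

lemma twisted_gen_seq_2:
  assumes "twisted h [a, b] [c, d] e"
  shows "lam a (lam b (\<lambda>l. h * gen_seq e l)) l = lam c (lam d (\<lambda>l. gen_seq e l * h)) l"
proof -
  have "lam 0 (lam a (lam b (\<lambda>l. h * gen_seq e l))) = lam 0 (lam c (lam d (\<lambda>l. gen_seq e l * h)))"
  proof
    fix l
    have "lam 0 (lam a (lam b (\<lambda>l. h * gen_seq e l))) l = lam a (lam b (lam 0 (\<lambda>l. h * gen_seq e l))) l"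
      by (simp only: lam_commute[of 0])
    also have "\<dots> = lam a (lam b (\<lambda>l. fps_X * (h * const_seq e l))) l"
      by (simp only: lam_mult_left lam_gen_seq fps_X_left_commute)
    also have "\<dots> = fps_X * (h * lams [a, b] (const_seq e) l)"
      by (simp only: lam_mult_left lams_Cons lams_Nil)
    also have "h * lams [a, b] (const_seq e) l = lams [c, d] (const_seq e) l * h" by (rule twistedD[OF assms])
    also have "fps_X * (lams [c, d] (const_seq e) l * h) = lam c (lam d (\<lambda>l. fps_X * (const_seq e l * h))) l"
      by (simp only: lam_mult_left lam_mult_right lams_Cons lams_Nil)
    also have "\<dots> = lam c (lam d (lam 0 (\<lambda>l. gen_seq e l * h))) l"
      by (simp only: lam_mult_right lam_gen_seq mult.assoc)
    also have "\<dots> = lam 0 (lam c (lam d (\<lambda>l. gen_seq e l * h))) l"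
      by (simp only: lam_commute[of _ 0])
    finally show "lam 0 (lam a (lam b (\<lambda>l. h * gen_seq e l))) l = lam 0 (lam c (lam d (\<lambda>l. gen_seq e l * h))) l" .
  qed
  then have "lam a (lam b (\<lambda>l. h * gen_seq e l)) = lam c (lam d (\<lambda>l. gen_seq e l * h))" by (rule lam_inject)
  then show ?thesis by simp
qed

lemma diff_eq_flip:
  fixes a :: "'r :: ring"
  assumes "a - b = c * (p - q)"
  shows "b - a = - c * (p - q)" "a - b = - c * (q - p)" "b - a = c * (q - p)"
proof -
  have "b - a = - (a - b)" by simp
  then show "b - a = - c * (p - q)" by (simp only: assms mult_minus_left)
  then show "a - b = - c * (q - p)" "b - a = c * (q - p)" using assms by (simp_all add: algebra_simps)
qed

lemma coefficients_commute:
  fixes p q :: "'a :: ring_1 fps"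
  assumes "at_u p * at_v q = at_v q * at_u p"
  shows "p $ m * q $ n = q $ n * p $ m"
proof -
  have "coeff_v (int n) (at_u p * at_v q) $$ int m = coeff_v (int n) (at_v q * at_u p) $$ int m"
    by (simp only: assms)
  then show ?thesis by (simp only: coeff_v_at_u_left coeff_v_at_u_right coeff_v_at_v) simp
qed

context rtt_data
begin

text \<open>These are the Gauss coordinates of the block of \<open>T\<close> with indices 2 and 3,
  up to the sign that goes with the odd entries.\<close>

definition "k = T I3 I3"
definition "es = inverse_series k * T I2 I3"
definition "fs = T I3 I2 * inverse_series k"
definition "hs = T I2 I2 * inverse_series k + fs * T I2 I3 * inverse_series k"

definition "e l = es $ Suc l"
definition "f l = fs $ Suc l"
definition "h l = hs $ Suc l"

lemma k_0: "k $ 0 = 1"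
  by (simp add: k_def T_0)

lemma inv: "k * inverse_series k = 1" "inverse_series k * k = 1"
  by (simp_all add: inverse_series_right fps_left_inverse k_0)

lemma inv_left: "k * (inverse_series k * x) = x" "inverse_series k * (k * x) = x"
  by (simp_all add: inv flip: mult.assoc)

lemma T_eqs: "T I3 I3 = k" "T I2 I3 = k * es" "T I3 I2 = fs * k" "T I2 I2 = hs * k - fs * (k * es)"
  by (simp_all add: k_def[symmetric] es_def fs_def hs_def distrib_right mult.assoc inv inv_left)

lemma zero_coeffs: "es $ 0 = 0" "fs $ 0 = 0" "hs $ 0 = 1"
  by (simp_all add: es_def fs_def hs_def T_0)

lemma es_eq: "es = gen_seq e 0" and fs_eq: "fs = gen_seq f 0" and hs_eq: "hs = 1 + gen_seq h 0"
proof -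
  show "es = gen_seq e 0" "fs = gen_seq f 0" "hs = 1 + gen_seq h 0"
    unfolding fps_eq_iff using zero_coeffs
    by (safe, case_tac n; simp add: e_def f_def h_def)+
qed

lemma T_1: "T I2 I3 $ 1 = e 0" "T I3 I2 $ 1 = f 0"
  by (simp_all add: T_eqs e_def f_def k_0 fps_mult_nth_1 zero_coeffs)

abbreviation "ku \<equiv> at_u k"
abbreviation "kv \<equiv> at_v k"
abbreviation "eu \<equiv> at_u es"
abbreviation "ev \<equiv> at_v es"
abbreviation "fu \<equiv> at_u fs"
abbreviation "fv \<equiv> at_v fs"
abbreviation "hu \<equiv> at_u hs"
abbreviation "hv \<equiv> at_v hs"

lemmas at_simps = T_eqs at_u.h_mult at_v.h_mult at_u.h_diff at_v.h_diff mult.assoc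

lemma inv_uv: "at_u (inverse_series k) * ku = 1" "ku * at_u (inverse_series k) = 1"
  "at_v (inverse_series k) * kv = 1" "kv * at_v (inverse_series k) = 1"
  by (simp_all add: inv flip: at_u.h_mult at_v.h_mult)

lemma unit_1_c: "scalar (1 / (1 - 1 / wvar)) * (1 - c) = 1" "scalar (1 / (1 + 1 / wvar)) * (1 - - c) = 1"
proof -
  have n: "1 - 1 / wvar \<noteq> 0" "1 + 1 / wvar \<noteq> 0"
    using wvar_plus_nonzero[of 1] wvar_plus_nonzero[of "- 1"] wvar_nonzero
    by (auto simp: field_simps cc.h_1 cc.h_uminus eq_neg_iff_add_eq_0)
  have m: "1 / x * x = 1" if "x \<noteq> 0" for x :: "complex fls fls" using that by simp
  have "scalar (1 / (1 - 1 / wvar)) * scalar (1 - 1 / wvar) = (1 :: 'a fls fls)"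
    "scalar (1 / (1 + 1 / wvar)) * scalar (1 + 1 / wvar) = (1 :: 'a fls fls)"
    by (simp_all only: scalar.h_mult[symmetric] m[OF n(1)] m[OF n(2)] scalar.h_1)
  then show "scalar (1 / (1 - 1 / wvar)) * (1 - c) = 1" "scalar (1 / (1 + 1 / wvar)) * (1 - - c) = 1"
    by (simp_all only: scalar.h_diff[of 1] scalar.h_add[of 1] scalar.h_1 diff_minus_eq_add)
qed

lemma kk': "ku * kv = kv * ku"
  using kk by (simp only: T_eqs)

text \<open>Adding the two entries gives x - y = c (x - y) for the two sides x and y, and 1 - c can
  be cancelled. This provides the entries with u and v interchanged.\<close>

lemma ke_swap: "t I3 I3 * t' I2 I3 - t' I3 I3 * t I2 I3 = t' I2 I3 * t I3 I3 - t I2 I3 * t' I3 I3"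
  and kf_swap: "t I3 I3 * t' I3 I2 - t' I3 I3 * t I3 I2 = t' I3 I2 * t I3 I3 - t I3 I2 * t' I3 I3"
proof -
  have *: "x = y" if "a - b = c * (r - b)" "r - d' = c * (a - d')" "x = a - d'" "y = b - r" for a b r d' x y :: "'a fls fls"
  proof -
    have "x - y = (a - b) + (r - d')" by (simp add: that(3,4))
    also have "\<dots> = c * (x - y)" unfolding that by (simp add: algebra_simps)
    finally have "(1 - c) * (x - y) = 0" by (simp only: left_diff_distrib mult_1_left) simp
    then show ?thesis by (rule cancel_1_minus_c[THEN right_minus_eq[THEN iffD1]])
  qed
  show "t I3 I3 * t' I2 I3 - t' I3 I3 * t I2 I3 = t' I2 I3 * t I3 I3 - t I2 I3 * t' I3 I3"
    by (rule *[OF ke refl refl])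
  have **: "x = y" if "a - b = c * (a - d')" "r - d' = c * (r - b)" "x = a - d'" "y = b - r" for a b r d' x y :: "'a fls fls"
  proof -
    have "x - y = (a - b) + (r - d')" by (simp add: that(3,4))
    also have "\<dots> = c * (x - y)" unfolding that by (simp add: algebra_simps)
    finally have "(1 - c) * (x - y) = 0" by (simp only: left_diff_distrib mult_1_left) simp
    then show ?thesis by (rule cancel_1_minus_c[THEN right_minus_eq[THEN iffD1]])
  qed
  show "t I3 I3 * t' I3 I2 - t' I3 I3 * t I3 I2 = t' I3 I2 * t I3 I3 - t I3 I2 * t' I3 I3"
    by (rule **[OF kf refl refl])
qed

lemma central_c: "x * c = c * x" "x * - c = - c * x"
  by (simp_all add: scalar_commute)

text \<open>The second formula is the same elimination with the two points exchanged, which replaces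
  c by -c; its hypotheses come from the entries through \<open>ke_swap\<close>.\<close>

lemma ke_exchange: "ev * ku = ku * (ev + c * (ev - eu))" "eu * kv = kv * (eu - c * (eu - ev))"
proof -
  show "ev * ku = ku * (ev + c * (ev - eu))"
    by (rule exchange_ke[OF central_c(1) inv_uv(3) unit_1_c(1) kk'])
      (use ke in \<open>simp_all only: at_simps\<close>)
  have "eu * kv = kv * (eu + - c * (eu - ev))"
  proof (rule exchange_ke[OF central_c(2) inv_uv(1) unit_1_c(2) kk'[symmetric]])
    have "t I2 I3 * t' I3 I3 - t' I3 I3 * t I2 I3 = c * (t' I2 I3 * t I3 I3 - t I2 I3 * t' I3 I3)"
      using ke(2) by (simp only: ke_swap)
    then have "t' I3 I3 * t I2 I3 - t I2 I3 * t' I3 I3 = - c * (t' I2 I3 * t I3 I3 - t I2 I3 * t' I3 I3)"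
      by (rule diff_eq_flip)
    then show "kv * (ku * eu) - ku * (eu * kv) = - c * (kv * (ev * ku) - ku * (eu * kv))"
      by (simp only: at_simps)
    have "t I3 I3 * t' I2 I3 - t' I2 I3 * t I3 I3 = - c * (t I3 I3 * t' I2 I3 - t' I3 I3 * t I2 I3)"
      unfolding ke_swap using ke(1) by (rule diff_eq_flip)
    then have "t' I2 I3 * t I3 I3 - t I3 I3 * t' I2 I3 = - c * (t' I3 I3 * t I2 I3 - t I3 I3 * t' I2 I3)"
      by (rule diff_eq_flip)
    then show "kv * (ev * ku) - ku * (kv * ev) = - c * (kv * (ku * eu) - ku * (kv * ev))"
      by (simp only: at_simps)
  qed
  then show "eu * kv = kv * (eu - c * (eu - ev))" by simp
qed

lemma kf_exchange: "ku * fv = (fv + c * (fv - fu)) * ku" "kv * fu = (fu - c * (fu - fv)) * kv"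
proof -
  show "ku * fv = (fv + c * (fv - fu)) * ku"
    by (rule exchange_kf[OF central_c(1) inv_uv(4) unit_1_c(1) kk'])
      (use kf in \<open>simp_all only: at_simps\<close>)
  have "kv * fu = (fu + - c * (fu - fv)) * kv"
  proof (rule exchange_kf[OF central_c(2) inv_uv(2) unit_1_c(2) kk'[symmetric]])
    have "t I3 I2 * t' I3 I3 - t' I3 I3 * t I3 I2 = - c * (t I3 I3 * t' I3 I2 - t' I3 I3 * t I3 I2)"
      unfolding kf_swap using kf(2) by (rule diff_eq_flip)
    then have "t' I3 I3 * t I3 I2 - t I3 I2 * t' I3 I3 = - c * (t' I3 I3 * t I3 I2 - t I3 I3 * t' I3 I2)"
      by (rule diff_eq_flip)
    then show "kv * (fu * ku) - fu * (ku * kv) = - c * (kv * (fu * ku) - ku * (fv * kv))"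
      by (simp only: at_simps)
    have "t' I3 I2 * t I3 I3 - t I3 I3 * t' I3 I2 = - c * (t' I3 I2 * t I3 I3 - t I3 I2 * t' I3 I3)"
      using kf(1) unfolding kf_swap by (rule diff_eq_flip)
    then show "fv * (kv * ku) - ku * (fv * kv) = - c * (fv * (kv * ku) - fu * (ku * kv))"
      by (simp only: at_simps)
  qed
  then show "kv * fu = (fu - c * (fu - fv)) * kv" by simp
qed

lemma ef_exchange: "ku * hv = hv * ku" "acomm eu fv = c * (hv - hu)"
proof -
  note x = exchange_ef[OF central_c(1) inv_uv(4) kk' ke_exchange kf_exchange, of hv hu,
    OF ef_entries[unfolded at_simps]]
  show kh: "ku * hv = hv * ku" by (rule x(1))
  have c1: "k $ m * hs $ n = hs $ n * k $ m" for m n by (rule coefficients_commute[OF kh])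
  have vu: "kv * hu = hu * kv" by (rule at_u_at_v_commute[symmetric]) (simp only: c1)
  have uu: "ku * hu = hu * ku" unfolding at_u.h_mult[symmetric] by (rule arg_cong[of _ _ at_u], rule fps_commuteI, rule c1)
  have "ku * ((eu * fv + fv * eu) * kv) = ku * (c * (hv - hu) * kv)"
  proof -
    have "kv * (hu * ku) = kv * (ku * hu)" by (simp only: uu)
    also have "\<dots> = (kv * ku) * hu" by (simp only: mult.assoc)
    also have "\<dots> = (ku * kv) * hu" by (simp only: kk')
    also have "\<dots> = ku * (kv * hu)" by (simp only: mult.assoc)
    also have "\<dots> = ku * (hu * kv)" by (simp only: vu)
    finally have "kv * (hu * ku) = ku * (hu * kv)" .
    with x(2) have "ku * ((eu * fv + fv * eu) * kv) = c * (ku * (hv * kv) - ku * (hu * kv))" by simp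
    also have "\<dots> = ku * (c * (hv - hu) * kv)"
      by (simp only: right_diff_distrib[symmetric] left_diff_distrib[symmetric] scalar_left_commute[of ku "1 / wvar"] mult.assoc)
    finally show ?thesis .
  qed
  then have "at_u (inverse_series k) * (ku * ((eu * fv + fv * eu) * kv)) * at_v (inverse_series k) =
      at_u (inverse_series k) * (ku * (c * (hv - hu) * kv)) * at_v (inverse_series k)" by simp
  then have "(at_u (inverse_series k) * ku) * (eu * fv + fv * eu) * (kv * at_v (inverse_series k)) =
      (at_u (inverse_series k) * ku) * (c * (hv - hu)) * (kv * at_v (inverse_series k))" by (simp only: mult.assoc)
  then show "acomm eu fv = c * (hv - hu)" by (simp only: inv_uv acomm_def mult_1_left mult_1_right)
qed

text \<open>Multiplying the exchange relation by u - v leaves the extra term k(u) e(u), which is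
  independent of v and invisible to the modes.\<close>

lemma twisted_k_e: "twisted k [1] [0] e"
proof -
  have "om * (ev * ku) = om * (ku * (ev + c * (ev - eu)))" by (simp only: ke_exchange)
  then have "om * (ev * ku) = om * (ku * ev) + ku * (ev - eu)"
    by (simp only: scalar_left_commute[of ku "1 / wvar"] distrib_left scalar_om_inverse)
  then have 1: "om_prod [1] (ku * ev) - om_prod [0] (ev * ku) = ku * eu"
    by (simp add: om_prod_simps scalar_cc_simps distrib_right right_diff_distrib del: scalar.h_diff)
  have "coeff_v (int l + 1) (ku * eu) = 0" for l by (simp add: coeff_v_at_u flip: at_u.h_mult)
  then show ?thesis by (subst twisted_iff_coeff_v) (simp_all only: list.size es_eq[symmetric] 1 simp_thms)
qed

lemma twisted_k_f: "twisted k [0] [1] f"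
proof -
  have "om * (ku * fv) = om * ((fv + c * (fv - fu)) * ku)" by (simp only: kf_exchange)
  then have "om * (ku * fv) = om * (fv * ku) + (fv - fu) * ku"
    by (simp only: mult.assoc distrib_left distrib_right scalar_om_inverse)
  then have 1: "om_prod [0] (ku * fv) - om_prod [1] (fv * ku) = - (fu * ku)"
    by (simp add: om_prod_simps scalar_cc_simps distrib_right left_diff_distrib del: scalar.h_diff)
  have "coeff_v (int l + 1) (- (fu * ku)) = 0" for l by (simp add: coeff_v_at_u flip: at_u.h_mult)
  then show ?thesis by (subst twisted_iff_coeff_v) (simp_all only: list.size fs_eq[symmetric] 1 simp_thms)
qed

end

lemma fps_to_fls_injectD: "fps_to_fls p = fps_to_fls q \<Longrightarrow> p = (q :: 'a :: ring_1 fps)"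
  by simp

lemma gen_seq_fls_rec: "fps_to_fls (gen_seq e (Suc l)) = fls_X_inv * fps_to_fls (gen_seq e l) - fls_const (e l :: 'a :: ring_1)"
proof -
  have "fls_X_inv * fps_to_fls (gen_seq e l - fps_X * gen_seq e (Suc l)) = fls_X_inv * fps_to_fls (fps_X * fps_const (e l))"
    by (simp only: gen_seq_rec)
  then have "fls_X_inv * fps_to_fls (gen_seq e l) - fps_to_fls (gen_seq e (Suc l)) = fls_const (e l)"
    by (simp only: fps_to_fls.hom_simps fps_X_to_fls fps_to_fls_const right_diff_distrib fls_X_inv_X)
  then show ?thesis by (simp add: algebra_simps)
qed

lemma fls_X_cancel: "fls_X * x = fls_X * y \<Longrightarrow> x = (y :: 'a :: ring_1 fls)"
  by (metis fls_X_inv_X)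

lemma fls_X_inv_left_commute: "x * (fls_X_inv * y) = fls_X_inv * (x * (y :: 'a :: ring_1 fls))"
  by (metis fls_X_inv_times_comm mult.assoc)

text \<open>These say that the quadratic relation between \<open>h(u)\<close> and \<open>e(x)\<close> may be evaluated at \<open>x = u\<close>.\<close>

lemma twisted_diagonal:
  fixes p :: "'a :: complex_algebra_1 fps"
  assumes "twisted p [a, b] [c, d] e"
  defines "P \<equiv> fps_to_fls p" and "E \<equiv> fps_to_fls (gen_seq e 0)" and "z0 \<equiv> fls_const (e 0)" and "z1 \<equiv> fls_const (e 1)"
    and "k \<equiv> \<lambda>a. fls_const (cemb a)"
  shows "(fls_X_inv + k a) * (k b * (P * E) + P * z0) - (k b * (fls_X_inv * (P * E) - P * z0) + P * z1) =
    (fls_X_inv + k c) * (k d * (E * P) + z0 * P) - (k d * (fls_X_inv * (E * P) - z0 * P) + z1 * P)"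
proof -
  have E1: "fps_to_fls (gen_seq e 1) = fls_X_inv * E - z0" and E2: "fps_to_fls (gen_seq e 2) = fls_X_inv * (fls_X_inv * E - z0) - z1"
    using gen_seq_fls_rec[of e 0] gen_seq_fls_rec[of e 1] by (simp_all add: E_def z0_def z1_def numeral_2_eq_2)
  have l: "fps_to_fls (lam a (lam b (\<lambda>l. s l)) 0) = fls_X * (fls_X * ((fls_X_inv + k a) * ((fls_X_inv + k b) * S 0 - S 1) -
      ((fls_X_inv + k b) * S 1 - S 2)))" if "\<And>l. fps_to_fls (s l) = S l" for a b s and S :: "nat \<Rightarrow> 'a fls"
    unfolding fps_to_fls_lam k_def that
    by (simp only: right_diff_distrib[of fls_X, symmetric] fls_X_left_commute[of "_ + _"] numeral_2_eq_2 One_nat_def)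
  have "fps_to_fls (lam a (lam b (\<lambda>l. p * gen_seq e l)) 0) = fps_to_fls (lam c (lam d (\<lambda>l. gen_seq e l * p)) 0)"
    using twisted_gen_seq_2[OF assms(1)] by simp
  then have "fls_X * (fls_X * ((fls_X_inv + k a) * ((fls_X_inv + k b) * (P * fps_to_fls (gen_seq e 0)) - P * fps_to_fls (gen_seq e 1)) -
      ((fls_X_inv + k b) * (P * fps_to_fls (gen_seq e 1)) - P * fps_to_fls (gen_seq e 2)))) =
    fls_X * (fls_X * ((fls_X_inv + k c) * ((fls_X_inv + k d) * (fps_to_fls (gen_seq e 0) * P) - fps_to_fls (gen_seq e 1) * P) -
      ((fls_X_inv + k d) * (fps_to_fls (gen_seq e 1) * P) - fps_to_fls (gen_seq e 2) * P)))"
    by (subst (asm) l[where S = "\<lambda>l. P * fps_to_fls (gen_seq e l)"], simp add: P_def fps_to_fls.h_mult,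
        subst (asm) l[where S = "\<lambda>l. fps_to_fls (gen_seq e l) * P"], simp add: P_def fps_to_fls.h_mult)
  note this[THEN fls_X_cancel, THEN fls_X_cancel, unfolded E1 E2, folded E_def]
  moreover have "(fls_X_inv + k b) * (P * E) - P * (fls_X_inv * E - z0) = k b * (P * E) + P * z0" for b
    by (simp add: algebra_simps fls_X_inv_left_commute[of P])
  moreover have "(fls_X_inv + k b) * (P * (fls_X_inv * E - z0)) - P * (fls_X_inv * (fls_X_inv * E - z0) - z1) =
      k b * (fls_X_inv * (P * E) - P * z0) + P * z1" for b
    by (simp add: algebra_simps fls_X_inv_left_commute[of P])
  moreover have "(fls_X_inv + k d) * (E * P) - (fls_X_inv * E - z0) * P = k d * (E * P) + z0 * P" for d
    by (simp add: algebra_simps)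
  moreover have "(fls_X_inv + k d) * ((fls_X_inv * E - z0) * P) - (fls_X_inv * (fls_X_inv * E - z0) - z1) * P =
      k d * (fls_X_inv * (E * P) - z0 * P) + z1 * P" for d
    by (simp add: algebra_simps)
  ultimately show ?thesis by (simp only:)
qed

lemma coeff_v_u_part:
  fixes p q :: "'a :: complex_algebra_1 fps"
  shows "coeff_v n (half * comm (at_u p) (at_u q)) = (if n = 0 then fls_const (cemb (1/2)) * comm (fps_to_fls p) (fps_to_fls q) else 0)"
    "coeff_v n (comm (at_u p) (const_uv a)) = (if n = 0 then comm (fps_to_fls p) (fls_const a) else 0)"
proof -
  have 1: "coeff_v n (comm (at_u p) (at_u q)) = (if n = 0 then comm (fps_to_fls p) (fps_to_fls q) else 0)" for q
    by (simp add: comm_def coeff_v_at_u_left coeff_v_at_u)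
  show "coeff_v n (half * comm (at_u p) (at_u q)) = (if n = 0 then fls_const (cemb (1/2)) * comm (fps_to_fls p) (fps_to_fls q) else 0)"
    by (simp add: coeff_v_half 1)
  show "coeff_v n (comm (at_u p) (const_uv a)) = (if n = 0 then comm (fps_to_fls p) (fls_const a) else 0)"
    using 1[of "fps_const a"] by (simp add: at_u_const fps_to_fls_const)
qed

text \<open>\<open>twisted\<close> controls only the negative powers of v. The constant coefficient
  is the evaluation at x = u, the coefficient of v cancels against the term with
  \<open>om * comm\<close>, and higher powers do not occur. \<open>\<epsilon>\<close> is 1 for e and
  -1 for f.\<close>

lemma twisted_polynomial:
  fixes p :: "'a :: complex_algebra_1 fps"
  assumes tw: "twisted p [a, b] [c, d] e" and ab: "a * b = - 1/2" "c * d = - 1/2" "a + b - (c + d) = - \<epsilon>" "\<epsilon> = 1 \<or> \<epsilon> = - 1"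
    "a + b = - \<epsilon> / 2" "c + d = \<epsilon> / 2"
  shows "om_prod [a, b] (at_u p * at_v (gen_seq e 0)) - om_prod [c, d] (at_v (gen_seq e 0) * at_u p) +
    half * comm (at_u p) (at_u (gen_seq e 0)) + om * comm (at_u p) (const_uv (e 0)) = 0" (is "?F = 0")
proof (rule coeff_v_eqI)
  fix n :: int
  let ?k = "\<lambda>a. fls_const (cemb a) :: 'a fls"
  let ?P = "fps_to_fls p" and ?e = "\<lambda>n. fls_const (fps_to_fls (gen_seq e 0) $$ n)"
  have op: "coeff_v n (om_prod [a, b] G) = (fls_X_inv + ?k a) * ((fls_X_inv + ?k b) * coeff_v n G - coeff_v (n + 1) G) -
      ((fls_X_inv + ?k b) * coeff_v (n + 1) G - coeff_v (n + 2) G)" for a b n G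
    by (simp add: om_prod_simps distrib_right coeff_v_om scalar_cc coeff_v_const_left algebra_simps)
  have F: "coeff_v n ?F = (fls_X_inv + ?k a) * ((fls_X_inv + ?k b) * (?P * ?e n) - ?P * ?e (n + 1)) -
      ((fls_X_inv + ?k b) * (?P * ?e (n + 1)) - ?P * ?e (n + 2)) -
      ((fls_X_inv + ?k c) * ((fls_X_inv + ?k d) * (?e n * ?P) - ?e (n + 1) * ?P) -
      ((fls_X_inv + ?k d) * (?e (n + 1) * ?P) - ?e (n + 2) * ?P)) +
      (if n = 0 then ?k (1/2) * comm ?P (fps_to_fls (gen_seq e 0)) else 0) +
      (fls_X_inv * (if n = 0 then comm ?P (fls_const (e 0)) else 0) - (if n + 1 = 0 then comm ?P (fls_const (e 0)) else 0))"
    by (simp only: coeff_v_simps op coeff_v_om coeff_v_u_part coeff_v_at_u_left coeff_v_at_u_right coeff_v_at_v)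
  consider "n > 0" | "n = 0" | "n = - 1" | "n < - 1" by linarith
  then show "coeff_v n ?F = coeff_v n 0"
  proof cases
    case 1
    then obtain l where l: "n = int l + 1" by (metis add.commute zero_less_imp_eq_int Suc_pred of_nat_Suc)
    have "coeff_v n (om_prod [a, b] (at_u p * at_v (gen_seq e 0)) - om_prod [c, d] (at_v (gen_seq e 0) * at_u p)) = 0"
      using tw by (subst (asm) twisted_iff_coeff_v) (simp_all add: l)
    with 1 show ?thesis by (simp add: coeff_v_om coeff_v_u_part)
  next
    \<comment> \<open>For the v^0 coefficient the modes e_0 and e_1 enter through v e(v) and v^2
      e(v); \<open>twisted_diagonal\<close> relates them to the full series at u.\<close>
    case 2
    have k: "?k a * (?k b * x) = ?k (a * b) * x" "?k a * x + ?k b * x = ?k (a + b) * x" for a b and x :: "'a fls"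
      by (simp_all add: cemb.h_mult cemb.h_add flip: mult.assoc distrib_right fls_plus_const)
    have D: "(fls_X_inv + ?k a) * (?k b * (?P * E) + ?P * z0) - (?k b * (fls_X_inv * (?P * E) - ?P * z0) + ?P * z1) =
      ?k (a * b) * (?P * E) + fls_X_inv * (?P * z0) + ?k (a + b) * (?P * z0) - ?P * z1" for E z0 z1 a b
      unfolding k(1,2)[symmetric] by (simp add: algebra_simps fls_cemb_left_commute[of fls_X_inv])
    have D': "(fls_X_inv + ?k c) * (?k d * (E * ?P) + z0 * ?P) - (?k d * (fls_X_inv * (E * ?P) - z0 * ?P) + z1 * ?P) =
      ?k (c * d) * (E * ?P) + fls_X_inv * (z0 * ?P) + ?k (c + d) * (z0 * ?P) - z1 * ?P" for E z0 z1 c d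
      unfolding k(1,2)[symmetric] by (simp add: algebra_simps fls_cemb_left_commute[of fls_X_inv])
    have m: "?k (- x) = - ?k x" for x by (simp add: cemb.h_uminus)
    note t = twisted_diagonal[OF tw, unfolded D D' ab, simplified m minus_divide_left[symmetric]]
    have zero: "?e 0 = 0" "?e 1 = fls_const (e 0)" "?e 2 = fls_const (e 1)" by (simp_all add: gen_seq_fls_nth del: fps_to_fls_nth)
    have G: "(fls_X_inv + ?k a) * ((fls_X_inv + ?k b) * (x * 0) - x0) - ((fls_X_inv + ?k b) * x0 - x1) =
      x1 - (fls_X_inv * x0 + fls_X_inv * x0) - ?k (a + b) * x0" for a b and x x0 x1 :: "'a fls"
      unfolding k(2)[symmetric] by (simp add: algebra_simps)
    have G': "(fls_X_inv + ?k a) * ((fls_X_inv + ?k b) * (0 * x) - x0) - ((fls_X_inv + ?k b) * x0 - x1) =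
      x1 - (fls_X_inv * x0 + fls_X_inv * x0) - ?k (a + b) * x0" for a b and x x0 x1 :: "'a fls"
      unfolding k(2)[symmetric] by (simp add: algebra_simps)
    note F' = F[unfolded 2 add_0 zero G G' ab if_P[OF refl]]
    have "coeff_v 0 ?F = 0"
      unfolding F' using t by (simp add: comm_def algebra_simps m minus_divide_left[symmetric])
    then show ?thesis using 2 by (simp del: coeff_v_simps(1-3))
  next
    case 3
    have zero: "?e (- 1) = 0" "?e 0 = 0" "?e 1 = fls_const (e 0)"
      by simp_all
    have n: "(- 1 :: int) + 1 = 0" "(- 1 :: int) + 2 = 1" "(- 1 :: int) \<noteq> 0" by simp_all
    have "coeff_v (- 1) ?F = 0"
      unfolding F[unfolded 3 n zero] by (simp add: comm_def algebra_simps)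
    then show ?thesis using 3 by (simp del: coeff_v_simps(1-3))
  next
    case 4
    then have "?e n = 0" "?e (n + 1) = 0" "?e (n + 2) = 0" by auto
    then show ?thesis unfolding F using 4 by simp
  qed
qed

context rtt_data
begin

lemma ef: "e m * f l + f l * e m = h (m + l)"
  by (rule acomm_modes)
    (simp only: es_eq[symmetric] fs_eq[symmetric] hs_eq[symmetric] ef_exchange(2) scalar_om_inverse)

lemma k_hs: "k $ m * hs $ n = hs $ n * k $ m"
  by (rule coefficients_commute[OF ef_exchange(1)])

lemma square_root: "shift (3/2) hs * shift (3/2) k * shift 1 hs * k = 1"
proof -
  let ?s = "\<lambda>i j. shift (3/2) (T i j)"
  have inv_s: "shift (3/2) k * inverse_series (shift (3/2) k) = 1" "inverse_series (shift (3/2) k) * shift (3/2) k = 1"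
    by (simp_all add: inverse_series_right fps_left_inverse shift_nth_0 k_0)
  have schur: "(?s I2 I2 + ?s I3 I2 * inverse_series (shift (3/2) k) * ?s I2 I3) * (T I2 I2 - T I2 I3 * inverse_series k * T I3 I2) = 1"
    by (rule transpose_product_schur) (simp_all only: T_eqs inv inv_s, intro ext, simp only: orth id_mat_def)
  have c: "inverse_series (shift (3/2) k) * (shift (3/2) k * x) = x" for x
    by (simp add: inv_s flip: mult.assoc)
  have "shift (3/2) fs * shift (3/2) k * inverse_series (shift (3/2) k) * (shift (3/2) k * shift (3/2) es) =
      shift (3/2) fs * shift (3/2) k * shift (3/2) es"
    by (simp only: mult.assoc c)
  then have 1: "?s I2 I2 + ?s I3 I2 * inverse_series (shift (3/2) k) * ?s I2 I3 = shift (3/2) hs * shift (3/2) k"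
    by (simp add: T_eqs shift.hom_simps mult.assoc)
  have ke: "k * es = shift 1 es * k"
    using twisted_gen_seq_left[OF twisted_k_e, of 0] by (simp only: es_eq[symmetric])
  have "k * es * inverse_series k = shift 1 es" by (simp add: ke mult.assoc inv)
  then have "T I2 I2 - T I2 I3 * inverse_series k * T I3 I2 = (hs - (shift 1 es * fs + fs * shift 1 es)) * k"
    by (simp add: T_eqs algebra_simps ke)
  also have "hs - (shift 1 es * fs + fs * shift 1 es) = shift 1 hs"
    using acomm_shift_gen_seq[of e f h, OF ef] by (simp add: shift.hom_simps hs_eq es_eq[symmetric] fs_eq[symmetric])
  finally show ?thesis using schur unfolding 1 by (simp only: mult.assoc)
qed

lemmas sqrt = twisted_sqrt[OF square_root zero_coeffs(3) k_0]

lemma twisted_h_e: "twisted hs [- 1, 1/2] [1, - (1/2)] e" and twisted_h_f: "twisted hs [1, - (1/2)] [- 1, 1/2] f"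
  using twisted_k_e twisted_k_f
  by (auto simp: sqrt[of "[- 1, 1/2]" "[1, - (1/2)]" "[1]" "[0]"] sqrt[of "[1, - (1/2)]" "[- 1, 1/2]" "[0]" "[1]"])

lemma h_h: "comm hu hv = 0"
proof -
  have "twisted k [] [] (\<lambda>_. hs $ n)" for n
    unfolding twisted_const_iff using k_hs by blast
  then have "twisted hs [] [] (\<lambda>_. hs $ n)" for n
    using sqrt[of "[]" "[]" "[]" "[]"] by simp
  then have "hs $ m * hs $ n = hs $ n * hs $ m" for m n unfolding twisted_const_iff by blast
  then have "hu * hv = hv * hu" by (rule at_u_at_v_commute)
  then show ?thesis by (simp add: comm_def)
qed

lemma h_e: "comm hu ev = - (((wvar + kappa - 1) / (wvar * (wvar + kappa))) \<odot> comm hu (eu - ev))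
      + (1 / (wvar + kappa)) \<odot> (hu * (ev + eu - const_uv (e 0)) - (eu - const_uv (e 0)) * hu)"
  unfolding comm_h_e_iff
  using twisted_polynomial[OF twisted_h_e, of 1] unfolding es_eq[symmetric] om_prod_simps scalar_cc_simps
  by simp

lemma h_f: "comm hu fv = ((wvar - kappa + 1) / (wvar * (wvar - kappa))) \<odot> comm hu (fu - fv)
      - (1 / (wvar - kappa)) \<odot> (hu * (fv + fu + const_uv (f 0)) - (fu + const_uv (f 0)) * hu)"
  unfolding comm_h_f_iff
  using twisted_polynomial[OF twisted_h_f, of "- 1"] unfolding fs_eq[symmetric] om_prod_simps scalar_cc_simps
  by simp

lemma zero_modes_fps:
  "k * fps_const (e 0) - fps_const (e 0) * k = - T I2 I3"
  "k * fps_const (f 0) - fps_const (f 0) * k = T I3 I2"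
  "T I2 I3 * fps_const (e 0) + fps_const (e 0) * T I2 I3 = - T I1 I3"
  "T I3 I2 * fps_const (f 0) + fps_const (f 0) * T I3 I2 = T I3 I1"
  "T I2 I3 * fps_const (f 0) + fps_const (f 0) * T I2 I3 = T I2 I2 - k"
  "T I1 I3 * fps_const (f 0) - fps_const (f 0) * T I1 I3 = T I1 I2 + T I2 I3"
  "T I3 I1 * fps_const (e 0) - fps_const (e 0) * T I3 I1 = T I3 I2 - T I2 I1"
  "T I1 I2 * fps_const (f 0) + fps_const (f 0) * T I1 I2 = T I1 I1 - T I2 I2"
  "T I1 I3 * fps_const (e 0) - fps_const (e 0) * T I1 I3 = 0"
  "T I3 I1 * fps_const (f 0) - fps_const (f 0) * T I3 I1 = 0"
  by (rule fps_to_fls_injectD, use zero_modes in \<open>simp only: k_def fps_to_fls.hom_simps fps_to_fls_const T_1\<close>)+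

text \<open>All generators of the RTT algebra are thereby expressed through k, e and f, so that the
  two constructions of T can be compared entry by entry.\<close>

lemma T_orbit: "T i j = orbit_mat k es fs (fps_const (e 0)) (fps_const (f 0)) i j"
proof -
  note z = zero_modes_fps
  have 13: "T I1 I3 = - (fps_const (e 0) * T I2 I3 + T I2 I3 * fps_const (e 0))" by (simp only: z(3)[unfolded add.commute[of "T I2 I3 * _"]] minus_minus)
  have 31: "T I3 I1 = fps_const (f 0) * T I3 I2 + T I3 I2 * fps_const (f 0)" using z(4) by (simp add: algebra_simps)
  have 22: "T I2 I2 = fps_const (f 0) * T I2 I3 + T I2 I3 * fps_const (f 0) + k" using z(5) by (simp add: algebra_simps)
  have 12: "T I1 I2 = - (fps_const (f 0) * T I1 I3 - T I1 I3 * fps_const (f 0)) - T I2 I3"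
    using z(6) by (simp add: algebra_simps)
  have 21: "T I2 I1 = fps_const (e 0) * T I3 I1 - T I3 I1 * fps_const (e 0) + T I3 I2"
    using z(7) by (simp add: algebra_simps)
  have 11: "T I1 I1 = fps_const (f 0) * T I1 I2 + T I1 I2 * fps_const (f 0) + T I2 I2"
    using z(8) by (simp add: algebra_simps)
  show ?thesis
    by (cases i; cases j)
      (simp_all only: orbit_mat_def Let_def mat_of_simps 11 21 12 22 31 13 T_eqs(1-3))
qed

lemma e0_k: "fps_const (e 0) * k = k * fps_const (e 0) + k * es"
  using zero_modes_fps(1) unfolding T_eqs by (simp add: algebra_simps)

lemma k_f0: "k * fps_const (f 0) = fps_const (f 0) * k + fs * k"
  using zero_modes_fps(2) unfolding T_eqs by (simp add: algebra_simps)

lemma assoc_eq: "x * y = r \<Longrightarrow> x * (y * w) = r * (w :: 'a fps)"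
  by (simp flip: mult.assoc)

lemma T13: "T I1 I3 = k * - (es * es + (fps_const (e 0) * es + es * fps_const (e 0)))"
proof -
  have "T I1 I3 = - (T I2 I3 * fps_const (e 0) + fps_const (e 0) * T I2 I3)"
    by (simp only: zero_modes_fps(3) minus_minus)
  also have "\<dots> = k * - (es * es + (fps_const (e 0) * es + es * fps_const (e 0)))"
    unfolding T_eqs by (simp add: algebra_simps e0_k[THEN assoc_eq])
  finally show ?thesis .
qed

lemma T31: "T I3 I1 = - (- (fs * fs + (fps_const (f 0) * fs + fs * fps_const (f 0))) * k)"
proof -
  have "T I3 I1 = T I3 I2 * fps_const (f 0) + fps_const (f 0) * T I3 I2" by (simp only: zero_modes_fps(4))
  also have "\<dots> = - (- (fs * fs + (fps_const (f 0) * fs + fs * fps_const (f 0))) * k)"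
    unfolding T_eqs by (simp add: algebra_simps k_f0)
  finally show ?thesis .
qed

lemma cubic_f: "fs * fs * fs = - (fs * (fs * fps_const (f 0) + fps_const (f 0) * fs)) +
    (fps_const (f 0) * fps_const (f 0) * fs - fs * (fps_const (f 0) * fps_const (f 0)))" (is "?l = ?r")
proof -
  have "(?l - ?r) * k = 0"
    using zero_modes_fps(10) unfolding T31
    by (simp add: algebra_simps k_f0 k_f0[THEN assoc_eq] del: fps_const_mult)
  then have "(?l - ?r) * k * inverse_series k = 0" by simp
  then show ?thesis by (simp only: mult.assoc inv mult_1_right) simp
qed

text \<open>Closure of the orbit at \<open>T I1 I3\<close> gives the conjugated form; moving k to
  the right replaces e(u) by e(u + 1), and the shift back by 1 gives the relation itself.\<close>

lemma cubic_e: "es * es * es = es * (es * fps_const (e 0) + fps_const (e 0) * es) +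
    (fps_const (e 0) * fps_const (e 0) * es - es * (fps_const (e 0) * fps_const (e 0)))"
proof -
  let ?c = "fps_const (e 0)"
  let ?C = "\<lambda>x. x * x * x - (x * (x * ?c + ?c * x) + (?c * ?c * x - x * (?c * ?c)))"
  have 1: "k * es = shift 1 es * k"
    using twisted_gen_seq_left[OF twisted_k_e, of 0] by (simp only: es_eq[symmetric])
  have 2: "k * ?c = ?c * k - shift 1 es * k" using e0_k 1 by simp
  have "k * (es * (es * es) + es * (?c * es) + ?c * (es * es) + ?c * (?c * es) - es * (?c * ?c)) = 0"
    using zero_modes_fps(9) unfolding T13
    by (simp add: algebra_simps e0_k e0_k[THEN assoc_eq] del: fps_const_mult)
  moreover have "k * (es * (es * es) + es * (?c * es) + ?c * (es * es) + ?c * (?c * es) - es * (?c * ?c)) = - ?C (shift 1 es) * k"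
    by (simp add: algebra_simps 1 2 1[THEN assoc_eq] 2[THEN assoc_eq] del: fps_const_mult)
  ultimately have "- ?C (shift 1 es) * k * inverse_series k = 0" by simp
  then have "?C (shift 1 es) = 0" by (simp only: mult.assoc[of _ k] inv mult_1_right) simp
  then have "shift (- 1) (?C (shift 1 es)) = 0" by (simp only: shift.h_0)
  then have "?C es = 0"
    by (simp only: shift.hom_simps shift_const shift_shift) (simp add: shift_0)
  then show ?thesis by simp
qed

text \<open>The value \<kappa> = 3/2 is used in the form \<kappa>/w = 1/w + 1/(2w), as
  \<open>exchange_ee\<close> requires.\<close>

lemma half_scalars:
  "c = scalar (1 / (2 * wvar)) + scalar (1 / (2 * wvar))"
  "scalar (wvar - kappa) * c2 = 1" "c * scalar (wvar - kappa) = 1 - c - scalar (1 / (2 * wvar))"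
  "scalar (1 / (2 * wvar)) * (c * F) = scalar (1 / (2 * wvar\<^sup>2)) * F"
proof -
  have half: "1 / x = 1 / (2 * x) + 1 / (2 * x)" for x :: "complex fls fls"
    by simp
  have kap: "1 / x * kappa = 1 / x + 1 / (2 * x)" if "x \<noteq> 0" for x :: "complex fls fls"
    using that by (simp add: kappa_def field_simps)
  note 1 = half[of wvar]
  have 2: "(wvar - kappa) * (1 / (wvar - kappa)) = 1"
    using wvar_nonzero by simp
  have w: "1 / x * x = 1" if "x \<noteq> 0" for x :: "complex fls fls"
    using that by simp
  have 3: "1 / wvar * (wvar - kappa) = 1 - 1 / wvar - 1 / (2 * wvar)"
    unfolding right_diff_distrib[of "1 / wvar" wvar] w[OF wvar_nonzero(1)] kap[OF wvar_nonzero(1)] by (rule diff_diff_add[symmetric])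
  have 4: "1 / (2 * wvar) * (1 / wvar) = 1 / (2 * wvar\<^sup>2)"
    by (simp add: power2_eq_square)
  show "c = scalar (1 / (2 * wvar)) + scalar (1 / (2 * wvar))"
    using arg_cong[OF 1, of "scalar :: complex fls fls \<Rightarrow> 'a fls fls"] by (simp only: scalar.h_add)
  show "scalar (wvar - kappa) * c2 = 1"
    using arg_cong[OF 2, of "scalar :: complex fls fls \<Rightarrow> 'a fls fls"] by (simp only: scalar.h_mult scalar.h_1)
  show "c * scalar (wvar - kappa) = 1 - c - scalar (1 / (2 * wvar))"
    using arg_cong[OF 3, of "scalar :: complex fls fls \<Rightarrow> 'a fls fls"]
    by (simp only: scalar.h_mult scalar.h_diff[of 1] scalar.h_diff[of "1 - _"] scalar.h_1)
  show "scalar (1 / (2 * wvar)) * (c * F) = scalar (1 / (2 * wvar\<^sup>2)) * F"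
    by (simp only: scalar_mult_left 4)
qed

lemma at_13_31: "t I1 I3 = ku * - (eu * eu + (const_uv (e 0) * eu + eu * const_uv (e 0)))"
  "t' I1 I3 = kv * - (ev * ev + (const_uv (e 0) * ev + ev * const_uv (e 0)))"
  "t I3 I1 = - (- (fu * fu + (const_uv (f 0) * fu + fu * const_uv (f 0))) * ku)"
  "t' I3 I1 = - (- (fv * fv + (const_uv (f 0) * fv + fv * const_uv (f 0))) * kv)"
  unfolding T13 T31 by (simp_all only: at_u.hom_simps at_v.hom_simps at_u_const at_v_const)

lemma ee: "acomm eu ev = (1 / (2 * wvar)) \<odot> comm eu ev - (1 / wvar) \<odot> acomm (const_uv (e 0)) (eu - ev)
    - (1 / (2 * wvar\<^sup>2)) \<odot> (eu - ev)\<^sup>2"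
proof -
  have "eu * ev + ev * eu = scalar (1 / (2 * wvar)) * (eu * ev - ev * eu) -
      c * (const_uv (e 0) * (eu - ev) + (eu - ev) * const_uv (e 0)) - scalar (1 / (2 * wvar)) * (c * ((eu - ev) * (eu - ev)))"
    by (rule exchange_ee[OF scalar_commute half_scalars(1) scalar_commute scalar_commute half_scalars(2,3)
        inv_uv(1) inv_uv(3) unit_1_c(1) kk' ke_exchange _ _ refl refl])
      (use ee_entries in \<open>simp_all only: at_simps at_13_31\<close>)
  then show ?thesis by (simp only: smult_uv_eq acomm_def comm_def power2_eq_square half_scalars(4))
qed

text \<open>The elimination for e is applied in the opposite ring, where the exchange of k with f
  has the shape of that with e. Scalars are central, so they can be moved back to the left
  afterwards.\<close>

lemma ff: "acomm fu fv = - ((1 / (2 * wvar)) \<odot> comm fu fv) - (1 / wvar) \<odot> acomm (const_uv (f 0)) (fu - fv)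
    - (1 / (2 * wvar\<^sup>2)) \<odot> (fu - fv)\<^sup>2"
proof -
  let ?g = "scalar (1 / (2 * wvar)) :: 'a fls fls" and ?b = "scalar (wvar - kappa) :: 'a fls fls"
  let ?E = "- (fu * fu + (const_uv (f 0) * fu + fu * const_uv (f 0)))" and ?E' = "- (fv * fv + (const_uv (f 0) * fv + fv * const_uv (f 0)))"
  have central: "x * Opp (scalar a) = Opp (scalar a) * x" for a and x :: "'a fls fls opp"
    by (rule opp_all) (simp add: Opp_simps scalar_commute)
  have R1: "t I3 I2 * t' I3 I2 + t' I3 I2 * t I3 I2 = c * (t I3 I2 * t' I3 I2 - t' I3 I2 * t I3 I2) -
      c2 * (?E' * (kv * ku) - t' I3 I2 * t I3 I2 - kv * (?E * ku))"
    unfolding ff_entries(1) T_eqs(1) at_13_31 by (simp only: mult_minus_left mult_minus_right mult.assoc minus_minus add_uminus_conv_diff diff_minus_eq_add) (simp add: algebra_simps)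
  have R2: "kv * (?E * ku) - ?E * (ku * kv) = c * (?E' * (kv * ku) - ?E * (ku * kv)) +
      c2 * (?E' * (kv * ku) - t' I3 I2 * t I3 I2 - kv * (?E * ku))"
    using ff_entries(2) unfolding T_eqs(1) at_13_31
    by (simp only: mult_minus_left mult_minus_right mult.assoc minus_minus add_uminus_conv_diff diff_minus_eq_add) (simp add: algebra_simps)
  have "Opp fu * Opp fv + Opp fv * Opp fu = Opp ?g * (Opp fu * Opp fv - Opp fv * Opp fu) -
      Opp c * (Opp (const_uv (f 0)) * (Opp fu - Opp fv) + (Opp fu - Opp fv) * Opp (const_uv (f 0))) -
      Opp ?g * (Opp c * ((Opp fu - Opp fv) * (Opp fu - Opp fv)))"
  proof (rule exchange_ee[where k = "Opp ku" and k' = "Opp kv" and b = "Opp ?b" and ?c2.0 = "Opp c2" and d = "Opp (scalar (1 / (1 - 1 / wvar)))"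
      and ?k1.0 = "Opp (at_u (inverse_series k))" and k1' = "Opp (at_v (inverse_series k))" and E = "Opp ?E" and E' = "Opp ?E'"])
    show "Opp c = Opp ?g + Opp ?g" by (simp only: Opp_simps half_scalars(1)[symmetric])
    show "Opp ?b * Opp c2 = 1" using half_scalars(2) by (simp only: Opp_simps scalar_commute[of c2])
    show "Opp c * Opp ?b = 1 - Opp c - Opp ?g" using half_scalars(3) by (simp only: Opp_simps scalar_commute[of ?b])
    show "Opp (at_u (inverse_series k)) * Opp ku = 1" "Opp (at_v (inverse_series k)) * Opp kv = 1"
      by (simp_all only: Opp_simps inv_uv)
    show "Opp (scalar (1 / (1 - 1 / wvar))) * (1 - Opp c) = 1"
      using unit_1_c(1) by (simp only: Opp_simps scalar_commute[of "1 - c"])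
    show "Opp ku * Opp kv = Opp kv * Opp ku" by (simp only: Opp_simps kk')
    show "Opp fv * Opp ku = Opp ku * (Opp fv + Opp c * (Opp fv - Opp fu))"
      using kf_exchange(1) by (simp only: Opp_simps scalar_commute[of "fv - fu"])
    show "Opp fu * Opp kv = Opp kv * (Opp fu - Opp c * (Opp fu - Opp fv))"
      using kf_exchange(2) by (simp only: Opp_simps scalar_commute[of "fu - fv"])
    show "Opp ku * (Opp fu * (Opp kv * Opp fv)) + Opp kv * (Opp fv * (Opp ku * Opp fu)) =
      Opp c * (Opp kv * (Opp fv * (Opp ku * Opp fu)) - Opp ku * (Opp fu * (Opp kv * Opp fv))) -
      Opp c2 * (Opp ku * (Opp kv * Opp ?E') - Opp ku * (Opp fu * (Opp kv * Opp fv)) - Opp ku * (Opp ?E * Opp kv))"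
      using R1 by (simp only: Opp_simps scalar_commute[of "_ - _"] at_simps add.commute[of "fv * _"])
    show "Opp ku * (Opp ?E * Opp kv) - Opp kv * (Opp ku * Opp ?E) = Opp c * (Opp ku * (Opp kv * Opp ?E') - Opp kv * (Opp ku * Opp ?E)) +
      Opp c2 * (Opp ku * (Opp kv * Opp ?E') - Opp ku * (Opp fu * (Opp kv * Opp fv)) - Opp ku * (Opp ?E * Opp kv))"
      using R2 by (simp only: Opp_simps scalar_commute[of "_ - _"] at_simps)
    show "Opp ?E = - (Opp fu * Opp fu + (Opp (const_uv (f 0)) * Opp fu + Opp fu * Opp (const_uv (f 0))))"
      "Opp ?E' = - (Opp fv * Opp fv + (Opp (const_uv (f 0)) * Opp fv + Opp fv * Opp (const_uv (f 0))))"
      by (simp_all only: Opp_simps add.commute[of "_ * const_uv (f 0)"])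
  qed (rule central)+
  then have "fv * fu + fu * fv = ?g * (fv * fu - fu * fv) - c * ((fu - fv) * const_uv (f 0) + const_uv (f 0) * (fu - fv)) -
      ?g * (c * ((fu - fv) * (fu - fv)))"
    by (simp only: Opp_simps opp.inject scalar_commute[of "_ - _"] scalar_commute[of "_ + _"] scalar_commute[of "(fu - fv) * (fu - fv)"]
        scalar_commute[of "c * _"])
  then have "fv * fu + fu * fv = ?g * (fv * fu - fu * fv) - c * ((fu - fv) * const_uv (f 0) + const_uv (f 0) * (fu - fv)) -
      scalar (1 / (2 * wvar\<^sup>2)) * ((fu - fv) * (fu - fv))"
    by (simp only: half_scalars(4))
  then show ?thesis
    unfolding smult_uv_eq acomm_def comm_def power2_eq_square
    by (simp only: add.commute[of "fu * fv"] add.commute[of "const_uv (f 0) * _"] mult_minus_right[symmetric] minus_diff_eq)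
qed

theorem drinfeld: "holds (drinfeld_relations es fs hs)"
proof -
  have c3: "eu ^ 3 = eu * acomm eu (const_uv (e 0)) + comm ((const_uv (e 0))\<^sup>2) eu"
    using arg_cong[OF cubic_e, of at_u]
    by (simp only: at_u.hom_simps at_u_const acomm_def comm_def power2_eq_square power3_eq_cube)
  have f3: "fu ^ 3 = - (fu * acomm fu (const_uv (f 0))) + comm ((const_uv (f 0))\<^sup>2) fu"
    using arg_cong[OF cubic_f, of at_u]
    by (simp only: at_u.hom_simps at_u_const acomm_def comm_def power2_eq_square power3_eq_cube)
  have ef': "acomm eu fv = (1 / wvar) \<odot> (hv - hu)" by (simp only: smult_uv_eq ef_exchange(2))
  have 1: "es $ 1 = e 0" "fs $ 1 = f 0" by (simp_all add: e_def f_def)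
  show ?thesis
    unfolding holds_def drinfeld_relations_def Let_def 1
    by (intro ballI, elim insertE emptyE; simp only: prod.case) (rule h_h ef' h_e h_f ee ff c3 f3)+
qed

end

section \<open>Parity\<close>

lemma odd_word_add: "odd_word (v + w) \<longleftrightarrow> odd_word v \<noteq> odd_word w"
  by (auto simp: odd_word_def plus_word_def)

lemma graded_part_add:
  assumes "x \<in> graded_part p" "y \<in> graded_part p"
  shows "x + y \<in> graded_part p"
proof -
  interpret abs: complex_algebra_hom abs_presented by (rule complex_algebra_hom_abs_presented)
  from assms obtain a b where "x = abs_presented a" "y = abs_presented b" "\<forall>w\<in>Poly_Mapping.keys a. odd_word w = p" "\<forall>w\<in>Poly_Mapping.keys b. odd_word w = p"
    unfolding graded_part_def by blast
  then show ?thesis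
    unfolding graded_part_def using keys_add[of a b] by (intro image_eqI[of _ _ "a + b"]) (auto simp: abs.h_add)
qed

lemma graded_part_mult:
  assumes "x \<in> graded_part p" "y \<in> graded_part q"
  shows "x * y \<in> graded_part (p \<noteq> q)"
proof -
  interpret abs: complex_algebra_hom abs_presented by (rule complex_algebra_hom_abs_presented)
  from assms obtain a b where "x = abs_presented a" "y = abs_presented b" "\<forall>w\<in>Poly_Mapping.keys a. odd_word w = p" "\<forall>w\<in>Poly_Mapping.keys b. odd_word w = q"
    unfolding graded_part_def by blast
  then show ?thesis
    unfolding graded_part_def using keys_mult[of a b] by (intro image_eqI[of _ _ "a * b"]) (auto simp: abs.h_mult odd_word_add)
qed

lemma graded_part_0: "0 \<in> graded_part p" and graded_part_scalar: "cemb c \<in> graded_part False"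
  and graded_part_gen: "alg_gen g \<in> graded_part (odd_gen g)"
proof -
  interpret abs: complex_algebra_hom abs_presented by (rule complex_algebra_hom_abs_presented)
  show "0 \<in> graded_part p"
    unfolding graded_part_def by (intro image_eqI[of _ _ 0]) (auto simp: abs.h_0)
  have "cemb c = abs_presented (Poly_Mapping.single 0 c)"
    by (simp add: cemb_def flip: abs.h_scaleC_1) (simp add: scaleC_free_algebra)
  then show "cemb c \<in> graded_part False"
    unfolding graded_part_def by (intro image_eqI[of _ _ "Poly_Mapping.single 0 c"]) (auto simp: odd_word_def zero_word_def)
  show "alg_gen g \<in> graded_part (odd_gen g)"
    unfolding graded_part_def alg_gen_def free_gen_def
    by (intro image_eqI[of _ _ "Poly_Mapping.single (Word [g]) 1"]) (auto simp: odd_word_def)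
qed

lemma graded_part_cemb_mult: "x \<in> graded_part p \<Longrightarrow> cemb c * x \<in> graded_part p"
  using graded_part_mult[OF graded_part_scalar, of x p c] by simp

lemma graded_part_uminus: "x \<in> graded_part p \<Longrightarrow> - x \<in> graded_part p"
  using graded_part_cemb_mult[of x p "- 1"] by (simp add: cemb_simps)

lemma graded_part_diff: "x \<in> graded_part p \<Longrightarrow> y \<in> graded_part p \<Longrightarrow> x - y \<in> graded_part p"
  using graded_part_add[OF _ graded_part_uminus, of x p y] by simp

lemma graded_part_sum: "(\<And>i. i \<in> I \<Longrightarrow> f i \<in> graded_part p) \<Longrightarrow> sum f I \<in> graded_part p"
  by (induction I rule: infinite_finite_induct) (auto intro: graded_part_add graded_part_0)

lemma graded_part_1: "1 \<in> graded_part False"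
  using graded_part_scalar[of 1] by (simp add: cemb_simps)

lemma graded_word_value:
  assumes "\<And>a. g a \<in> graded_part (odd_gen a)"
  shows "word_value g w \<in> graded_part (odd_word w)"
proof (cases w)
  case (Word as)
  have "prod_list (map g as) \<in> graded_part (odd_word (Word as))"
  proof (induction as)
    case Nil
    then show ?case by (simp add: odd_word_def graded_part_1)
  next
    case (Cons a as)
    have "odd_word (Word (a # as)) = (odd_gen a \<noteq> odd_word (Word as))" by (auto simp: odd_word_def)
    then show ?case using graded_part_mult[OF assms Cons.IH] by simp
  qed
  then show ?thesis by (simp add: word_value_def Word)
qed

lemma presented_hom_graded:
  assumes kill: "\<And>r. r \<in> relators \<Longrightarrow> free_ev g r = 0" and g: "\<And>a. g a \<in> graded_part (odd_gen a)"
  shows "presented_hom g ` graded_part p \<subseteq> graded_part p"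
proof
  fix y
  assume "y \<in> presented_hom g ` graded_part p"
  then obtain x where x: "\<forall>w\<in>Poly_Mapping.keys x. odd_word w = p" "y = presented_hom g (abs_presented x)"
    unfolding graded_part_def by blast
  have "free_ev g x \<in> graded_part p"
    unfolding free_ev_def
  proof (rule graded_part_sum)
    fix w
    assume "w \<in> Poly_Mapping.keys x"
    then have "odd_word w = p" using x(1) by blast
    then show "Poly_Mapping.lookup x w *\<^sub>C word_value g w \<in> graded_part p"
      using graded_part_cemb_mult[OF graded_word_value[of g w, OF g]] by (simp add: scaleC_cemb)
  qed
  then show "y \<in> graded_part p" by (simp add: x(2) presented_hom_abs[OF kill])
qed

definition graded_series :: "bool \<Rightarrow> 'g :: superpresentation presented_algebra fps \<Rightarrow> bool" where
  "graded_series p f \<longleftrightarrow> (\<forall>n. f $ n \<in> graded_part p)"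

lemma graded_series_mult: "graded_series p f \<Longrightarrow> graded_series q g \<Longrightarrow> graded_series (p \<noteq> q) (f * g)"
  unfolding graded_series_def fps_mult_nth by (blast intro: graded_part_sum graded_part_mult)

lemma graded_series_mult':
  "graded_series False f \<Longrightarrow> graded_series q g \<Longrightarrow> graded_series q (f * g)"
  "graded_series p f \<Longrightarrow> graded_series False g \<Longrightarrow> graded_series p (f * g)"
  "graded_series True f \<Longrightarrow> graded_series True g \<Longrightarrow> graded_series False (f * g)"
  using graded_series_mult[of False f q g] graded_series_mult[of p f False g] graded_series_mult[of True f True g] by simp_all

lemma graded_series_add: "graded_series p f \<Longrightarrow> graded_series p g \<Longrightarrow> graded_series p (f + g)"
  and graded_series_diff: "graded_series p f \<Longrightarrow> graded_series p g \<Longrightarrow> graded_series p (f - g)"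
  and graded_series_uminus: "graded_series p f \<Longrightarrow> graded_series p (- f)"
  unfolding graded_series_def by (auto intro: graded_part_add graded_part_diff graded_part_uminus)

lemma graded_series_const: "x \<in> graded_part p \<Longrightarrow> graded_series p (fps_const x)"
  unfolding graded_series_def by (auto simp: graded_part_0)

lemma graded_series_subst: "graded_series p f \<Longrightarrow> graded_series p (fps_subst q f)"
  unfolding graded_series_def fps_subst_nth by (blast intro: graded_part_sum graded_part_cemb_mult)

lemma graded_series_shift: "graded_series p f \<Longrightarrow> graded_series p (shift c f)"
  and graded_series_reflect: "graded_series p f \<Longrightarrow> graded_series p (reflect f)"
  unfolding shift_def reflect_def by (rule graded_series_subst, assumption)+

lemma graded_series_inverse:
  assumes k: "graded_series False k" "k $ 0 = 1"
  shows "graded_series False (inverse_series k)"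
  unfolding graded_series_def
proof
  fix n
  show "inverse_series k $ n \<in> graded_part False"
  proof (induction n rule: less_induct)
    case (less n)
    let ?S = "\<Sum>j=Suc 0..n. k $ j * inverse_series k $ (n - j)"
    have "(k * inverse_series k) $ n = inverse_series k $ n + ?S"
      unfolding fps_mult_nth by (subst sum.atLeast_Suc_atMost) (simp_all add: k)
    then have eq: "inverse_series k $ n = (1 :: _ fps) $ n - ?S"
      by (simp add: inverse_series_right[OF k(2)])
    have "?S \<in> graded_part False"
    proof (rule graded_part_sum)
      fix j
      assume "j \<in> {Suc 0..n}"
      then have "inverse_series k $ (n - j) \<in> graded_part False" by (intro less.IH) auto
      moreover have "k $ j \<in> graded_part False" using k(1) by (simp add: graded_series_def)
      ultimately have "k $ j * inverse_series k $ (n - j) \<in> graded_part (False \<noteq> False)" by (intro graded_part_mult)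
      then show "k $ j * inverse_series k $ (n - j) \<in> graded_part False" by (simp only: simp_thms)
    qed
    then show ?case
      unfolding eq by (intro graded_part_diff) (auto simp: graded_part_1 graded_part_0)
  qed
qed

text \<open>Truncating k below degree n keeps only coefficients already known to be even. The degree
  n coefficient of the equation for the truncation is -2 k_n, so k_n is even as well.\<close>

lemma graded_series_square_root:
  assumes "a $ 0 = 1" "b $ 0 = 1" "k $ 0 = 1" "a * shift c k * b * k = 1"
    and ab: "graded_series False a" "graded_series False b"
  shows "graded_series False k"
  unfolding graded_series_def
proof
  fix n
  show "k $ n \<in> graded_part False"
  proof (induction n rule: less_induct)
    case (less n)
    show ?case
    proof (cases "n = 0")
      case False
      let ?k = "fps_cutoff n k"
      have "graded_series False ?k" unfolding graded_series_def using less by (simp add: graded_part_0)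
      then have "graded_series False (a * shift c ?k * b * ?k)"
        using ab by (intro graded_series_mult' graded_series_shift)
      moreover have "(a * shift c ?k * b * ?k - a * shift c k * b * k) $ n = (?k - k) $ n + (?k - k) $ n"
        using False assms(1-3) by (intro quasi_square_diff_lowest(1)) simp_all
      then have "(a * shift c ?k * b * ?k) $ n = - (k $ n) - k $ n"
        using False by (simp add: assms(4))
      ultimately have "- (k $ n) - k $ n \<in> graded_part False"
        unfolding graded_series_def by metis
      from graded_part_uminus[OF this] have "k $ n + k $ n \<in> graded_part False" by simp
      then have "cemb (1/2) * (k $ n + k $ n) \<in> graded_part False"
        by (rule graded_part_cemb_mult)
      then show ?thesis by (simp only: distrib_left cemb_half')
    qed (simp add: assms graded_part_1)
  qed
qed

lemma superalgebra_homI: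
  assumes "complex_algebra_hom \<phi>" "\<And>p. \<phi> ` graded_part p \<subseteq> graded_part p"
  shows "superalgebra_hom \<phi>"
proof -
  interpret complex_algebra_hom \<phi> by fact
  show ?thesis unfolding superalgebra_hom_def using assms(2) by (simp add: linear_hom h_1 h_mult)
qed

lemma superalgebra_homD:
  assumes "superalgebra_hom \<phi>"
  shows "complex_algebra_hom \<phi>"
proof -
  interpret l: Vector_Spaces.linear scaleC scaleC \<phi> using assms unfolding superalgebra_hom_def by blast
  show ?thesis using assms unfolding superalgebra_hom_def by unfold_locales (auto simp: l.add l.scale)
qed

section \<open>The isomorphism\<close>

lemma series_gen_seq: "e_series g = gen_seq (\<lambda>k. g (E_gen k)) 0" "f_series g = gen_seq (\<lambda>k. g (F_gen k)) 0"
    "h_series g = 1 + gen_seq (\<lambda>k. g (H_gen k)) 0"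
  by (auto simp: fps_eq_iff e_series_def f_series_def h_series_def gen_seq_def split: nat.split)

lemma reflect_inverse_series:
  fixes f :: "'a :: complex_algebra_1 fps"
  assumes "f $ 0 = 1"
  shows "reflect (inverse_series f) = inverse_series (reflect f)"
proof -
  have r: "reflect f $ 0 = 1" by (simp add: reflect_nth assms)
  have "reflect (inverse_series f) * reflect f = 1"
    by (simp add: fps_left_inverse assms reflect.h_1 flip: reflect.h_mult)
  then have "reflect (inverse_series f) * reflect f * inverse_series (reflect f) = inverse_series (reflect f)" by simp
  then show ?thesis by (simp only: mult.assoc inverse_series_right[OF r] mult_1_right)
qed

interpretation A: drinfeld_data "\<lambda>k. alg_gen (E_gen k) :: A_plus" "\<lambda>k. alg_gen (F_gen k)" "\<lambda>k. alg_gen (H_gen k)"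
  using drinfeld_relations_alg_gen by unfold_locales (simp only: series_gen_seq)

text \<open>\<open>quasi_sqrt_exists\<close> provides a solution and
  \<open>quasi_square_unique\<close> shows that there is no other, so the choice is
  canonical.\<close>

definition k_A :: "A_plus fps" where
  "k_A = (SOME k. k $ 0 = 1 \<and> shift (3/2) A.hs * shift (3/2) k * shift 1 A.hs * k = 1)"

interpretation A: drinfeld_sqrt "\<lambda>k. alg_gen (E_gen k) :: A_plus" "\<lambda>k. alg_gen (F_gen k)" "\<lambda>k. alg_gen (H_gen k)" k_A
proof
  have "\<exists>k :: A_plus fps. k $ 0 = 1 \<and> shift (3/2) A.hs * shift (3/2) k * shift 1 A.hs * k = 1"
    by (rule quasi_sqrt_exists[of "shift (3/2) A.hs" "shift 1 A.hs" "3/2"]) (auto simp: shift_nth_0)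
  from someI_ex[OF this] show "k_A $ 0 = 1" "shift (3/2) A.hs * shift (3/2) k_A * shift 1 A.hs * k_A = 1"
    unfolding k_A_def by blast+
qed

interpretation U: rtt_data "\<lambda>i j. reflect (L_series alg_gen i j) :: U_R fps"
proof
  show "reflect (L_series alg_gen i j :: U_R fps) $ 0 = (if i = j then 1 else 0)" for i j
    by (simp add: reflect_nth L_series_def id_mat_def)
  show "holds (rtt_relations (\<lambda>i j. reflect (reflect (L_series alg_gen i j :: U_R fps))))"
    using rtt_relations_alg_gen by (simp only: reflect_reflect)
qed

fun a_image :: "a_gen \<Rightarrow> U_R" where
  "a_image (E_gen n) = U.e n" | "a_image (F_gen n) = U.f n" | "a_image (H_gen n) = U.h n"

fun l_image :: "l_gen \<Rightarrow> A_plus" where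
  "l_image (L_gen i j n) = reflect (A.T i j) $ Suc n"

lemma a_image_series: "e_series a_image = U.es" "f_series a_image = U.fs" "h_series a_image = U.hs"
  by (simp_all add: series_gen_seq U.es_eq U.fs_eq U.hs_eq)

lemma A_T_0: "A.T i j $ 0 = id_mat i j"
proof -
  interpret n: ring_1_hom "\<lambda>p :: A_plus fps. p $ 0" by unfold_locales simp_all
  show ?thesis
    unfolding n.hom_orbit_mat
    by (cases i; cases j) (simp_all add: orbit_mat_def Let_def A.k_0 id_mat_def)
qed

lemma l_image_series: "L_series l_image i j = reflect (A.T i j)"
proof (rule fps_ext)
  fix n
  show "L_series l_image i j $ n = reflect (A.T i j) $ n"
    by (cases n) (simp_all add: L_series_def reflect_nth A_T_0)
qed

definition phi :: "A_plus \<Rightarrow> U_R" where "phi = presented_hom a_image"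
definition psi :: "U_R \<Rightarrow> A_plus" where "psi = presented_hom l_image"

lemma a_image_kills: "r \<in> relators \<Longrightarrow> free_ev a_image r = 0"
  using U.drinfeld by (intro a_relators_killed) (simp_all only: a_image_series)

lemma l_image_kills: "r \<in> relators \<Longrightarrow> free_ev l_image r = 0"
proof (rule l_relators_killed)
  have "L_series l_image = (\<lambda>i j. reflect (A.T i j))" by (intro ext l_image_series)
  then show "holds (rtt_relations (L_series l_image))" using A.rtt_orbit by simp
qed

interpretation phi: complex_algebra_hom phi
  unfolding phi_def by (rule complex_algebra_hom_presented_hom[OF a_image_kills])

interpretation psi: complex_algebra_hom psi
  unfolding psi_def by (rule complex_algebra_hom_presented_hom[OF l_image_kills])

lemma phi_gen: "phi (alg_gen a) = a_image a"
  unfolding phi_def by (rule presented_hom_gen[OF a_image_kills])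

lemma psi_gen: "psi (alg_gen a) = l_image a"
  unfolding psi_def by (rule presented_hom_gen[OF l_image_kills])

lemma phi_fps: "ring_1_hom (map_fps phi)"
  by unfold_locales (simp_all add: fps_eq_iff map_fps_nth fps_mult_nth phi.hom_simps)

lemma psi_fps: "ring_1_hom (map_fps psi)"
  by unfold_locales (simp_all add: fps_eq_iff map_fps_nth fps_mult_nth psi.hom_simps)

lemma phi_series: "map_fps phi (e_series alg_gen) = U.es" "map_fps phi (f_series alg_gen) = U.fs"
    "map_fps phi (h_series alg_gen) = U.hs"
  by (simp_all only: map_fps_series[OF phi.ring_1_hom_axioms] phi_gen a_image_series[symmetric])

text \<open>Both series have constant term 1 and solve the same equation with coefficients built
  from h, so uniqueness identifies them. This is how a series absent from the generators of the
  source is carried over.\<close>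

lemma phi_k: "map_fps phi k_A = U.k"
proof (rule quasi_square_unique)
  have "map_fps phi (shift (3/2) A.hs * shift (3/2) k_A * shift 1 A.hs * k_A) = 1"
    by (simp only: A.k ring_1_hom.h_1[OF phi_fps])
  then have "shift (3/2) U.hs * shift (3/2) (map_fps phi k_A) * shift 1 U.hs * map_fps phi k_A = 1"
    by (simp only: ring_1_hom.h_mult[OF phi_fps] phi.map_fps_shift series_gen_seq(3)[symmetric] phi_series)
  then show "shift (3/2) U.hs * shift (3/2) (map_fps phi k_A) * shift 1 U.hs * map_fps phi k_A =
      shift (3/2) U.hs * shift (3/2) U.k * shift 1 U.hs * U.k"
    by (simp only: U.square_root)
qed (simp_all add: shift_nth_0 U.zero_coeffs U.k_0 map_fps_nth A.k_0 phi.h_1)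

lemma phi_T: "map_fps phi (A.T i j) = reflect (L_series alg_gen i j)"
proof -
  have c: "map_fps phi (fps_const x) = fps_const (phi x)" for x
    by (simp add: fps_eq_iff map_fps_nth phi.h_0)
  have "map_fps phi (A.T i j) = orbit_mat U.k U.es U.fs (fps_const (U.e 0)) (fps_const (U.f 0)) i j"
    by (simp only: ring_1_hom.hom_orbit_mat[OF phi_fps] phi_k series_gen_seq(1,2)[of alg_gen, symmetric] phi_series c phi_gen a_image.simps)
  also have "\<dots> = reflect (L_series alg_gen i j)" by (rule U.T_orbit[symmetric])
  finally show ?thesis .
qed

lemma psi_T: "map_fps psi (reflect (L_series alg_gen i j)) = A.T i j"
  by (simp only: psi.map_fps_reflect map_fps_series[OF psi.ring_1_hom_axioms] psi_gen l_image_series reflect_reflect)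

lemma A_cancel: "k_A * x = k_A * y \<Longrightarrow> x = y" "x * k_A = y * k_A \<Longrightarrow> x = y"
proof -
  have i: "inverse_series k_A * k_A = 1" "k_A * inverse_series k_A = 1"
    by (simp_all add: fps_left_inverse inverse_series_right A.k_0)
  show "x = y" if "k_A * x = k_A * y"
  proof -
    have "inverse_series k_A * k_A * x = inverse_series k_A * k_A * y" by (simp only: mult.assoc that)
    then show ?thesis by (simp only: i mult_1_left)
  qed
  show "x = y" if "x * k_A = y * k_A"
  proof -
    have "x * k_A * inverse_series k_A = y * k_A * inverse_series k_A" by (simp only: that)
    then show ?thesis by (simp only: mult.assoc i mult_1_right)
  qed
qed

text \<open>The Gauss coordinates are recovered from the images of the entries with indices 2 and 3
  by cancelling k on the left or right.\<close>

lemma psi_series: "map_fps psi U.es = A.es" "map_fps psi U.fs = A.fs" "map_fps psi U.hs = A.hs"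
proof -
  have k: "map_fps psi U.k = k_A" using psi_T[of I3 I3] by (simp only: U.T_eqs A.T_entries)
  have "k_A * map_fps psi U.es = k_A * A.es"
    using psi_T[of I2 I3] by (simp only: U.T_eqs A.T_entries ring_1_hom.h_mult[OF psi_fps] k)
  then show e: "map_fps psi U.es = A.es" by (rule A_cancel)
  have "map_fps psi U.fs * k_A = A.fs * k_A"
    using psi_T[of I3 I2] by (simp only: U.T_eqs A.T_entries ring_1_hom.h_mult[OF psi_fps] k)
  then show f: "map_fps psi U.fs = A.fs" by (rule A_cancel)
  have "map_fps psi U.hs * k_A - A.fs * (k_A * A.es) = A.hs * k_A - A.fs * (k_A * A.es)"
    using psi_T[of I2 I2] by (simp only: U.T_eqs A.T_entries ring_1_hom.h_mult[OF psi_fps] ring_1_hom.h_diff[OF psi_fps] k e f)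
  then have "map_fps psi U.hs * k_A = A.hs * k_A" by (simp only: diff_eq_eq diff_add_cancel)
  then show "map_fps psi U.hs = A.hs" by (rule A_cancel)
qed

lemma psi_phi: "psi (phi x) = x"
proof -
  have hom: "complex_algebra_hom (\<lambda>x. psi (phi x))"
    by unfold_locales (simp_all add: phi.hom_simps psi.hom_simps phi.h_scaleC psi.h_scaleC)
  have id: "complex_algebra_hom (\<lambda>x :: A_plus. x)" by unfold_locales simp_all
  have "psi (phi (alg_gen a)) = alg_gen a" for a
    using psi_series[THEN arg_cong[of _ _ "\<lambda>f. f $ Suc n" for n]]
    by (cases a) (simp_all add: phi_gen map_fps_nth U.e_def U.f_def U.h_def)
  from fun_cong[OF presented_hom_unique[OF hom id this], of x] show ?thesis .
qed

lemma phi_psi: "phi (psi x) = x"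
proof -
  have hom: "complex_algebra_hom (\<lambda>x. phi (psi x))"
    by unfold_locales (simp_all add: phi.hom_simps psi.hom_simps phi.h_scaleC psi.h_scaleC)
  have id: "complex_algebra_hom (\<lambda>x :: U_R. x)" by unfold_locales simp_all
  have "phi (psi (alg_gen a)) = alg_gen a" for a
  proof (cases a)
    case (L_gen i j n)
    have "map_fps phi (reflect (A.T i j)) = L_series alg_gen i j"
      by (simp only: phi.map_fps_reflect phi_T reflect_reflect)
    then have "map_fps phi (reflect (A.T i j)) $ Suc n = L_series alg_gen i j $ Suc n" by simp
    then show ?thesis by (simp add: L_gen psi_gen map_fps_nth) (simp add: L_series_def)
  qed
  from fun_cong[OF presented_hom_unique[OF hom id this], of x] show ?thesis .
qed

lemma a_image_graded: "a_image a \<in> graded_part (odd_gen a)"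
proof -
  have L: "graded_series (odd (grade i + grade j)) (reflect (L_series alg_gen i j :: U_R fps))" for i j
  proof (rule graded_series_reflect, unfold graded_series_def, rule allI)
    fix n
    show "L_series alg_gen i j $ n \<in> graded_part (odd (grade i + grade j))"
      using graded_part_gen[of "L_gen i j (n - 1)"]
      by (cases n) (auto simp: L_series_def id_mat_def graded_part_0 graded_part_1)
  qed
  have k: "graded_series False U.k" using L[of I3 I3] by (simp add: U.k_def)
  have i: "graded_series False (inverse_series U.k)" by (rule graded_series_inverse[OF k U.k_0])
  have 23: "graded_series True (reflect (L_series alg_gen I2 I3 :: U_R fps))" and 32: "graded_series True (reflect (L_series alg_gen I3 I2 :: U_R fps))"
    and 22: "graded_series False (reflect (L_series alg_gen I2 I2 :: U_R fps))"
    using L[of I2 I3] L[of I3 I2] L[of I2 I2] by simp_all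
  have e: "graded_series True U.es" unfolding U.es_def by (rule graded_series_mult'(1)[OF i 23])
  have f: "graded_series True U.fs" unfolding U.fs_def by (rule graded_series_mult'(2)[OF 32 i])
  have h: "graded_series False U.hs" unfolding U.hs_def
    by (rule graded_series_add[OF graded_series_mult'(1)[OF 22 i] graded_series_mult'(2)[OF graded_series_mult'(3)[OF f 23] i]])
  show ?thesis
    using e f h by (cases a) (simp_all add: graded_series_def U.e_def U.f_def U.h_def)
qed

lemma l_image_graded: "l_image a \<in> graded_part (odd_gen a)"
proof (cases a)
  case (L_gen i j n)
  have e: "graded_series True A.es" and f: "graded_series True A.fs" and h: "graded_series False A.hs"
    unfolding graded_series_def
    using graded_part_gen[of "E_gen _"] graded_part_gen[of "F_gen _"] graded_part_gen[of "H_gen _"]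
    by (auto simp: gen_seq_def graded_part_0 graded_part_1 split: nat.split)
  have k: "graded_series False k_A"
    by (rule graded_series_square_root[OF _ _ A.k_0 A.k]) (simp_all add: shift_nth_0 graded_series_shift h)
  have e0: "graded_series True (fps_const (alg_gen (E_gen 0) :: A_plus))" and f0: "graded_series True (fps_const (alg_gen (F_gen 0) :: A_plus))"
    using graded_part_gen[of "E_gen 0"] graded_part_gen[of "F_gen 0"] by (simp_all add: graded_series_const)
  note m = graded_series_mult' graded_series_add graded_series_diff graded_series_uminus
  have 23: "graded_series True (k_A * A.es)" and 32: "graded_series True (A.fs * k_A)" using e f k by (auto intro: m)
  have 13: "graded_series False (- (fps_const (alg_gen (E_gen 0)) * (k_A * A.es) + k_A * A.es * fps_const (alg_gen (E_gen 0))))" (is "graded_series _ ?t13")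
    by (intro graded_series_uminus graded_series_add graded_series_mult'(3) e0 23)
  have 31: "graded_series False (fps_const (alg_gen (F_gen 0)) * (A.fs * k_A) + A.fs * k_A * fps_const (alg_gen (F_gen 0)))" (is "graded_series _ ?t31")
    by (intro graded_series_add graded_series_mult'(3) f0 32)
  have 22: "graded_series False (fps_const (alg_gen (F_gen 0)) * (k_A * A.es) + k_A * A.es * fps_const (alg_gen (F_gen 0)) + k_A)" (is "graded_series _ ?t22")
    by (intro graded_series_add graded_series_mult'(3) f0 23 k)
  have 12: "graded_series True (- (fps_const (alg_gen (F_gen 0)) * ?t13 - ?t13 * fps_const (alg_gen (F_gen 0))) - k_A * A.es)" (is "graded_series _ ?t12")
    by (intro graded_series_uminus graded_series_diff graded_series_mult'(1)[OF 13] graded_series_mult'(2)[OF _ 13] f0 23)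
  have 21: "graded_series True (fps_const (alg_gen (E_gen 0)) * ?t31 - ?t31 * fps_const (alg_gen (E_gen 0)) + A.fs * k_A)" (is "graded_series _ ?t21")
    by (intro graded_series_add graded_series_diff graded_series_mult'(1)[OF 31] graded_series_mult'(2)[OF _ 31] e0 32)
  have 11: "graded_series False (fps_const (alg_gen (F_gen 0)) * ?t12 + ?t12 * fps_const (alg_gen (F_gen 0)) + ?t22)"
    by (intro graded_series_add graded_series_mult'(3) f0 12 22)
  have "graded_series (odd (grade i + grade j)) (A.T i j)"
    using 11 12 13 21 22 23 31 32 k by (cases i; cases j) (simp_all only: orbit_mat_def Let_def mat_of_simps grade.simps, simp_all)
  then have "graded_series (odd (grade i + grade j)) (reflect (A.T i j))" by (rule graded_series_reflect)
  then show ?thesis by (simp add: L_gen graded_series_def)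
qed

lemma superalgebra_iso_phi: "superalgebra_iso phi"
proof -
  have inv: "inv phi = psi" by (rule inv_unique_comp) (auto simp: fun_eq_iff phi_psi psi_phi)
  have "bij phi" by (rule o_bij[of psi]) (auto simp: fun_eq_iff phi_psi psi_phi)
  moreover have "superalgebra_hom phi"
    by (rule superalgebra_homI[OF phi.complex_algebra_hom_axioms]) (unfold phi_def, rule presented_hom_graded[OF a_image_kills a_image_graded])
  moreover have "superalgebra_hom psi"
    by (rule superalgebra_homI[OF psi.complex_algebra_hom_axioms]) (unfold psi_def, rule presented_hom_graded[OF l_image_kills l_image_graded])
  ultimately show ?thesis unfolding superalgebra_iso_def inv by blast
qed

text \<open>Existence is given by \<open>phi\<close>, whose defining series are the reflections of
  the stated expressions in L. Uniqueness holds because the three series contain every generator and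
  reflection is an involution.\<close>

theorem theorem3p3:
  fixes L :: "U_R fps mat3"
  defines "L \<equiv> L_series alg_gen"
  shows "\<exists>!\<phi> :: A_plus \<Rightarrow> U_R.
    superalgebra_iso \<phi> \<and>
    map_fps \<phi> (reflect_series (e_series alg_gen)) = inverse_series (L I3 I3) * L I2 I3 \<and>
    map_fps \<phi> (reflect_series (f_series alg_gen)) = L I3 I2 * inverse_series (L I3 I3) \<and>
    map_fps \<phi> (reflect_series (h_series alg_gen)) =
      L I2 I2 * inverse_series (L I3 I3) +
      L I3 I2 * inverse_series (L I3 I3) * L I2 I3 * inverse_series (L I3 I3)"
proof -
  have i: "reflect (inverse_series U.k) = inverse_series (L I3 I3)"
    by (simp only: reflect_inverse_series[OF U.k_0]) (simp only: U.k_def reflect_reflect L_def)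
  have es: "reflect U.es = inverse_series (L I3 I3) * L I2 I3"
    and fs: "reflect U.fs = L I3 I2 * inverse_series (L I3 I3)"
    and hs: "reflect U.hs = L I2 I2 * inverse_series (L I3 I3) +
      L I3 I2 * inverse_series (L I3 I3) * L I2 I3 * inverse_series (L I3 I3)"
    by (simp_all only: U.es_def U.fs_def U.hs_def reflect.h_mult reflect.h_add i reflect_reflect) (simp_all only: L_def)
  show ?thesis
    unfolding hs[symmetric] unfolding es[symmetric] fs[symmetric] reflect_series_eq
  proof (rule ex1I[of _ phi], intro conjI)
    show "superalgebra_iso phi" by (rule superalgebra_iso_phi)
    show "map_fps phi (reflect (e_series alg_gen)) = reflect U.es" "map_fps phi (reflect (f_series alg_gen)) = reflect U.fs"
      "map_fps phi (reflect (h_series alg_gen)) = reflect U.hs"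
      by (simp_all only: phi.map_fps_reflect phi_series)
  next
    fix \<phi> :: "A_plus \<Rightarrow> U_R"
    assume \<phi>: "superalgebra_iso \<phi> \<and> map_fps \<phi> (reflect (e_series alg_gen)) = reflect U.es \<and>
      map_fps \<phi> (reflect (f_series alg_gen)) = reflect U.fs \<and> map_fps \<phi> (reflect (h_series alg_gen)) = reflect U.hs"
    then have hom: "complex_algebra_hom \<phi>" unfolding superalgebra_iso_def by (blast intro: superalgebra_homD)
    interpret complex_algebra_hom \<phi> by (rule hom)
    have "map_fps \<phi> (e_series alg_gen) = U.es" "map_fps \<phi> (f_series alg_gen) = U.fs" "map_fps \<phi> (h_series alg_gen) = U.hs"
    proof -
      have "reflect (map_fps \<phi> (reflect (e_series alg_gen))) = reflect (reflect U.es)"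
        "reflect (map_fps \<phi> (reflect (f_series alg_gen))) = reflect (reflect U.fs)"
        "reflect (map_fps \<phi> (reflect (h_series alg_gen))) = reflect (reflect U.hs)"
        using \<phi> by simp_all
      then show "map_fps \<phi> (e_series alg_gen) = U.es" "map_fps \<phi> (f_series alg_gen) = U.fs" "map_fps \<phi> (h_series alg_gen) = U.hs"
        by (simp_all only: map_fps_reflect reflect_reflect)
    qed
    note s = this[THEN arg_cong[of _ _ "\<lambda>f. f $ Suc n" for n]]
    have "\<phi> (alg_gen a) = phi (alg_gen a)" for a
      using s by (cases a) (simp_all add: phi_gen map_fps_nth U.e_def U.f_def U.h_def e_series_def f_series_def h_series_def)
    then show "\<phi> = phi" by (rule presented_hom_unique[OF hom phi.complex_algebra_hom_axioms])
  qed
qed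

end
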